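(* Let $N\geq 1$, $0<\alpha<1$, and let $\Omega\subset\mathbb{R}^N$ be a bounded open set. For every $\varphi\in H^1_0(\Omega)$ there exists a unique global solution $u\in C([0,\infty),H^1_0(\Omega))\cap C^1([0,\infty),H^{-1}(\Omega))$ of the damped nonlinear Schrödinger equation $$i\partial_t u+\Delta u+i\frac{u}{|u|^{\alpha}}=0 \ \text{ in } [0,\infty)\times\Omega,\qquad u=0\ \text{ on } [0,\infty)\times\partial\Omega,\qquad u(0)=\varphi \ \text{ on } \Omega.$$ Moreover, $u$ satisfies the a priori estimate $$\|u\|_{C([0,\infty),H^1_0)}=\sup_{t\geq 0}\|u(t)\|_{H^1_0(\Omega)}\leq \|\varphi\|_{H^1_0(\Omega)}.$$
   Context: Functions are complex valued. $H^1_0(\Omega)$ is the closure of $C_c^\infty(\Omega)$ in $H^1(\Omega)$, with the $H^1$ norm, and $H^{-1}(\Omega)$ is its dual. The Dirichlet Laplacian $\Delta$ is viewed as a bounded operator $H^1_0(\Omega)\to H^{-1}(\Omega)$. The nonlinearity $z\mapsto z/|z|^{\alpha}$ is understood to be $0$ at $z=0$. A solution in the stated class satisfies the equation in $H^{-1}(\Omega)$ for all $t\ge 0$; the boundary condition is encoded by $u(t)\in H^1_0(\Omega)$. *)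

theory Defs
  imports "HOL-Analysis.Analysis"
begin

text \<open>
  Elements of function spaces on \<open>\<Omega>\<close> are represented by functions on the whole space. Only their
  values on \<open>\<Omega>\<close> matter, and equality in the function spaces is equality almost everywhere with
  respect to \<open>lebesgue_on \<Omega>\<close>.
\<close>

primrec Ck :: "nat \<Rightarrow> ('a::euclidean_space \<Rightarrow> complex) \<Rightarrow> bool" where
  "Ck 0 f \<longleftrightarrow> continuous_on UNIV f"
| "Ck (Suc k) f \<longleftrightarrow> (\<forall>x. f differentiable (at x)) \<and>
     (\<forall>b. Ck k (\<lambda>x. frechet_derivative f (at x) b))"

definition test_functions :: "'a::euclidean_space set \<Rightarrow> ('a \<Rightarrow> complex) set" where
  "test_functions \<Omega> = {\<psi>. (\<forall>k. Ck k \<psi>) \<and> compact (closure {x. \<psi> x \<noteq> 0}) \<and>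
     closure {x. \<psi> x \<noteq> 0} \<subseteq> \<Omega>}"

definition L2 :: "'a::euclidean_space set \<Rightarrow> ('a \<Rightarrow> complex) set" where
  "L2 \<Omega> = {u. u \<in> borel_measurable (lebesgue_on \<Omega>) \<and>
     integrable (lebesgue_on \<Omega>) (\<lambda>x. (cmod (u x))\<^sup>2)}"

definition L2_norm :: "'a::euclidean_space set \<Rightarrow> ('a \<Rightarrow> complex) \<Rightarrow> real" where
  "L2_norm \<Omega> u = sqrt (LINT x|lebesgue_on \<Omega>. (cmod (u x))\<^sup>2)"

definition has_weak_deriv ::
  "'a::euclidean_space set \<Rightarrow> 'a \<Rightarrow> ('a \<Rightarrow> complex) \<Rightarrow> ('a \<Rightarrow> complex) \<Rightarrow> bool" where
  "has_weak_deriv \<Omega> b u g \<longleftrightarrow> u \<in> L2 \<Omega> \<and> g \<in> L2 \<Omega> \<and>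
     (\<forall>\<psi>\<in>test_functions \<Omega>.
        (LINT x|lebesgue_on \<Omega>. u x * frechet_derivative \<psi> (at x) b) =
        - (LINT x|lebesgue_on \<Omega>. g x * \<psi> x))"

text \<open>For open \<open>\<Omega>\<close> a weak derivative is unique up to null sets; \<open>weak_deriv\<close> picks a representative.\<close>

definition weak_deriv ::
  "'a::euclidean_space set \<Rightarrow> 'a \<Rightarrow> ('a \<Rightarrow> complex) \<Rightarrow> 'a \<Rightarrow> complex" where
  "weak_deriv \<Omega> b u = (SOME g. has_weak_deriv \<Omega> b u g)"

definition H1 :: "'a::euclidean_space set \<Rightarrow> ('a \<Rightarrow> complex) set" where
  "H1 \<Omega> = {u \<in> L2 \<Omega>. \<forall>b\<in>Basis. \<exists>g. has_weak_deriv \<Omega> b u g}"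

definition H1_norm :: "'a::euclidean_space set \<Rightarrow> ('a \<Rightarrow> complex) \<Rightarrow> real" where
  "H1_norm \<Omega> u =
     sqrt ((L2_norm \<Omega> u)\<^sup>2 + (\<Sum>b\<in>Basis. (L2_norm \<Omega> (weak_deriv \<Omega> b u))\<^sup>2))"

definition H10 :: "'a::euclidean_space set \<Rightarrow> ('a \<Rightarrow> complex) set" where
  "H10 \<Omega> = {u \<in> H1 \<Omega>. \<forall>\<epsilon>>0. \<exists>\<psi>\<in>test_functions \<Omega>. H1_norm \<Omega> (\<lambda>x. u x - \<psi> x) < \<epsilon>}"

text \<open>
  \<open>H\<^sup>-\<^sup>1\<close> consists of the bounded complex-linear functionals on \<open>H10 \<Omega>\<close>; their values outside
  \<open>H10 \<Omega>\<close> are irrelevant. Accordingly the duality pairing extends the bilinear form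
  \<open>\<integral>\<^sub>\<Omega> f v\<close>, as for distributions, and there is no complex conjugation in \<open>Hm1_of\<close> and \<open>laplacian\<close>.
\<close>

definition Hm1 :: "'a::euclidean_space set \<Rightarrow> (('a \<Rightarrow> complex) \<Rightarrow> complex) set" where
  "Hm1 \<Omega> = {F.
     (\<forall>v\<in>H10 \<Omega>. \<forall>w\<in>H10 \<Omega>. F (\<lambda>x. v x + w x) = F v + F w) \<and>
     (\<forall>c. \<forall>v\<in>H10 \<Omega>. F (\<lambda>x. c * v x) = c * F v) \<and>
     (\<exists>C. \<forall>v\<in>H10 \<Omega>. cmod (F v) \<le> C * H1_norm \<Omega> v)}"

definition Hm1_norm :: "'a::euclidean_space set \<Rightarrow> (('a \<Rightarrow> complex) \<Rightarrow> complex) \<Rightarrow> real" where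
  "Hm1_norm \<Omega> F = (SUP v\<in>{v \<in> H10 \<Omega>. H1_norm \<Omega> v \<le> 1}. cmod (F v))"

text \<open>The embedding of \<open>L2 \<Omega>\<close>, hence of \<open>H10 \<Omega>\<close>, into \<open>Hm1 \<Omega>\<close>.\<close>

definition Hm1_of :: "'a::euclidean_space set \<Rightarrow> ('a \<Rightarrow> complex) \<Rightarrow> ('a \<Rightarrow> complex) \<Rightarrow> complex" where
  "Hm1_of \<Omega> f v = (LINT x|lebesgue_on \<Omega>. f x * v x)"

definition laplacian :: "'a::euclidean_space set \<Rightarrow> ('a \<Rightarrow> complex) \<Rightarrow> ('a \<Rightarrow> complex) \<Rightarrow> complex" where
  "laplacian \<Omega> u v =
     - (\<Sum>b\<in>Basis. LINT x|lebesgue_on \<Omega>. weak_deriv \<Omega> b u x * weak_deriv \<Omega> b v x)"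

definition C_H10 :: "'a::euclidean_space set \<Rightarrow> (real \<Rightarrow> 'a \<Rightarrow> complex) \<Rightarrow> bool" where
  "C_H10 \<Omega> u \<longleftrightarrow> (\<forall>t\<ge>0. u t \<in> H10 \<Omega>) \<and>
     (\<forall>t\<ge>0. ((\<lambda>s. H1_norm \<Omega> (\<lambda>x. u s x - u t x)) \<longlongrightarrow> 0) (at t within {0..}))"

definition C_Hm1 ::
  "'a::euclidean_space set \<Rightarrow> (real \<Rightarrow> ('a \<Rightarrow> complex) \<Rightarrow> complex) \<Rightarrow> bool" where
  "C_Hm1 \<Omega> U \<longleftrightarrow> (\<forall>t\<ge>0. U t \<in> Hm1 \<Omega>) \<and>
     (\<forall>t\<ge>0. ((\<lambda>s. Hm1_norm \<Omega> (\<lambda>v. U s v - U t v)) \<longlongrightarrow> 0) (at t within {0..}))"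

text \<open>
  \<open>C1_Hm1 \<Omega> U U'\<close>: the map \<open>U\<close> belongs to \<open>C\<^sup>1([0,\<infinity>), H\<^sup>-\<^sup>1(\<Omega>))\<close> and has derivative \<open>U'\<close>
  (one-sided at \<open>0\<close>).
\<close>

definition C1_Hm1 ::
  "'a::euclidean_space set \<Rightarrow> (real \<Rightarrow> ('a \<Rightarrow> complex) \<Rightarrow> complex) \<Rightarrow>
   (real \<Rightarrow> ('a \<Rightarrow> complex) \<Rightarrow> complex) \<Rightarrow> bool" where
  "C1_Hm1 \<Omega> U U' \<longleftrightarrow> C_Hm1 \<Omega> U \<and> C_Hm1 \<Omega> U' \<and>
     (\<forall>t\<ge>0. ((\<lambda>s. Hm1_norm \<Omega> (\<lambda>v. (U s v - U t v) / of_real (s - t) - U' t v)) \<longlongrightarrow> 0)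
        (at t within {0..}))"

definition damping :: "real \<Rightarrow> complex \<Rightarrow> complex" where
  "damping \<alpha> z = (if z = 0 then 0 else z / of_real (cmod z powr \<alpha>))"

definition global_solution ::
  "'a::euclidean_space set \<Rightarrow> real \<Rightarrow> ('a \<Rightarrow> complex) \<Rightarrow> (real \<Rightarrow> 'a \<Rightarrow> complex) \<Rightarrow> bool" where
  "global_solution \<Omega> \<alpha> \<phi> u \<longleftrightarrow>
     C_H10 \<Omega> u \<and>
     (\<exists>u'. C1_Hm1 \<Omega> (\<lambda>t. Hm1_of \<Omega> (u t)) u' \<and>
        (\<forall>t\<ge>0. \<forall>v\<in>H10 \<Omega>.
           \<i> * u' t v + laplacian \<Omega> (u t) v + \<i> * Hm1_of \<Omega> (\<lambda>x. damping \<alpha> (u t x)) v = 0)) \<and>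
     (AE x in lebesgue_on \<Omega>. u 0 x = \<phi> x)"

end

theory Submission
  imports Defs
begin

text \<open>
  Replace \<open>- \<Delta>\<close> by its Yosida approximations \<open>A\<^sub>\<epsilon> = (1 - J\<^sub>\<epsilon>) / \<epsilon>\<close>, where \<open>J\<^sub>\<epsilon> = (1 - \<epsilon> \<Delta>)\<close>\<open>\<^sup>-\<^sup>1\<close>, and the
  nonlinearity \<open>g\<close> by Lipschitz monotone truncations; the resulting ordinary differential equations in
  \<open>L\<^sup>2\<close> are solved by Picard iteration. Since \<open>J\<^sub>\<epsilon>\<close> is symmetric and sub-Markovian,
  \<open>\<langle>A\<^sub>\<epsilon> u, g(u)\<rangle> \<ge> 0\<close>, so the energy \<open>\<langle>A\<^sub>\<epsilon> u, u\<rangle>\<close> decreases along the approximate flows. With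
  \<open>\<epsilon> = 16\<close>\<open>\<^sup>-\<^sup>n\<close> and initial datum \<open>J\<^sub>\<delta> \<phi>\<close>, \<open>\<delta> = 4\<close>\<open>\<^sup>-\<^sup>n\<close>, the \<open>n\<close>-th approximation satisfies \<open>\<parallel>A\<^sub>\<epsilon> u\<parallel> \<le> K 2\<^sup>n\<close>, and
  monotonicity of \<open>g\<close> then makes consecutive approximations differ by a summable amount in \<open>L\<^sup>2\<close>, locally
  uniformly in time: no compactness is needed. The limit is a weak solution that is bounded in
  \<open>H\<^sub>0\<^sup>1\<close>.

  Strong continuity in \<open>H\<^sub>0\<^sup>1\<close> requires continuity of \<open>\<parallel>\<nabla>u(t)\<parallel>\<close>. The dissipation \<open>\<langle>A\<^sub>\<epsilon> u, g(u)\<rangle>\<close> is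
  comparable, uniformly in \<open>\<epsilon>\<close>, with the energy \<open>\<langle>A\<^sub>\<epsilon> w, w\<rangle>\<close> of \<open>w = u / |u|\<close>\<open>\<^sup>\<alpha>\<^sup>/\<^sup>2\<close>, which increases as \<open>\<epsilon>\<close>
  decreases to \<open>0\<close>; hence the dissipation integrals converge by monotonicity, and the limit of the energy
  identities is continuous in time. Uniqueness follows from the monotonicity of \<open>g\<close>.
\<close>

section \<open>Resolvent and Yosida approximation\<close>

text \<open>The nonlinearity is not Lipschitz at 0, so what can be carried through the limit is its
  monotonicity in L2, and the parameters are tuned to that. For neighbouring levels with parameters
  \<open>e > m\<close>, the Schroedinger part contributes to the derivative of the squared distance
  a multiple of \<open>(e - m) * inner p (I q)\<close>, where \<open>p\<close>, \<open>q\<close> are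
  the two Yosida terms: about 16^-n * 2^n * 2^(n+1), hence of order 4^-n. The truncation error and
  the squared change of the initial datum have the same order, so distances are of order 2^-n.
  Contraction in L2 gives no strong continuity of the gradient. The dissipation is not a quadratic
  form in u and has no evident monotonicity in the Yosida parameter. The half power
  \<open>\<alpha>/2\<close> gives the squared increment of \<open>G\<close> the homogeneity 2 -
  \<alpha> of the product of the increments of u and g(u), and the comparison of the two is already
  true for pairs of complex numbers. Complex scalars enter the abstract part only as a skew isometry
  \<open>I\<close> of a real Hilbert space, since monotonicity concerns real inner products.\<close>

text \<open>By the parallelogram law a minimizing sequence is Cauchy, and at the minimizer no
  multiple of \<open>v\<close> can be added with profit. In \<open>resolvent_exists\<close> this
  plays the part of the Riesz representation theorem.\<close>

lemma closed_subspace_projection: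
  fixes S :: "'a::{real_inner,complete_space} set"
  assumes S: "subspace S" and cl: "closed S"
  obtains p where "p \<in> S" "\<And>v. v \<in> S \<Longrightarrow> inner (x - p) v = 0"
proof -
  have ne: "S \<noteq> {}" using subspace_0[OF S] by auto
  define d where "d = infdist x S"
  have d0: "d \<ge> 0" unfolding d_def by (rule infdist_nonneg)
  have lower: "d \<le> norm (x - y)" if "y \<in> S" for y
    using infdist_le[OF that, of x] by (simp add: d_def dist_norm)
  have "\<exists>y\<in>S. norm (x - y) < d + 1 / real (Suc n)" for n
  proof -
    have "Inf (dist x ` S) < d + 1 / real (Suc n)"
      using ne by (simp add: d_def infdist_notempty)
    then show ?thesis using ne cInf_lessD[of "dist x ` S"] by (auto simp: dist_norm)
  qed
  then obtain y where yS: "\<And>n. y n \<in> S" and yd: "\<And>n. norm (x - y n) < d + 1 / real (Suc n)"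
    by metis
  have para: "(norm (a - b))\<^sup>2 \<le> 2 * (norm (x - a))\<^sup>2 + 2 * (norm (x - b))\<^sup>2 - 4 * d\<^sup>2"
    if "a \<in> S" "b \<in> S" for a b
  proof -
    have "(1/2) *\<^sub>R (a + b) \<in> S" using that S by (simp add: subspace_add subspace_scale)
    then have "d \<le> norm (x - (1/2) *\<^sub>R (a + b))" by (rule lower)
    then have "d\<^sup>2 \<le> (norm (x - (1/2) *\<^sub>R (a + b)))\<^sup>2" using d0 by (simp add: power_mono)
    moreover have "(norm (a - b))\<^sup>2 = 2 * (norm (x - a))\<^sup>2 + 2 * (norm (x - b))\<^sup>2
        - 4 * (norm (x - (1/2) *\<^sub>R (a + b)))\<^sup>2"
      by (simp add: power2_norm_eq_inner inner_diff_left inner_diff_right inner_add_left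
          inner_add_right inner_commute algebra_simps)
    ultimately show ?thesis by simp
  qed
  have bnd: "(norm (a - b))\<^sup>2 \<le> 4 * (2 * d + 1) * (1 / real (Suc N))"
    if "a \<in> S" "b \<in> S" "norm (x - a) < d + 1 / real (Suc N)" "norm (x - b) < d + 1 / real (Suc N)"
    for a b N
  proof -
    define h where "h = 1 / real (Suc N)"
    have h: "0 \<le> h" "h \<le> 1" by (auto simp: h_def)
    have "(norm (x - a))\<^sup>2 \<le> (d + h)\<^sup>2" "(norm (x - b))\<^sup>2 \<le> (d + h)\<^sup>2"
      using that by (auto intro!: power_mono simp: h_def)
    then have "(norm (a - b))\<^sup>2 \<le> 4 * (d + h)\<^sup>2 - 4 * d\<^sup>2" using para[OF that(1,2)] by linarith
    also have "\<dots> = 4 * (2 * d * h + h * h)" by (simp add: power2_eq_square algebra_simps)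
    also have "\<dots> \<le> 4 * (2 * d * h + h)" using h by (simp add: mult_left_le)
    finally show ?thesis by (simp add: h_def algebra_simps add_divide_distrib)
  qed
  have "Cauchy y"
  proof (rule CauchyI)
    fix e :: real assume e: "e > 0"
    obtain N where N: "4 * (2 * d + 1) / e\<^sup>2 < real N"
      using reals_Archimedean2 by blast
    have small: "4 * (2 * d + 1) * (1 / real (Suc N)) < e\<^sup>2"
    proof -
      have "4 * (2 * d + 1) / e\<^sup>2 < real (Suc N)" using N by simp
      then show ?thesis using e by (simp add: field_simps)
    qed
    show "\<exists>M. \<forall>m\<ge>M. \<forall>n\<ge>M. norm (y m - y n) < e"
    proof (intro exI allI impI)
      fix m n assume mn: "N \<le> m" "N \<le> n"
      have le: "norm (x - y k) < d + 1 / real (Suc N)" if "N \<le> k" for k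
      proof -
        have "1 / real (Suc k) \<le> 1 / real (Suc N)" using that by (simp add: frac_le)
        then show ?thesis using yd[of k] by linarith
      qed
      have "(norm (y m - y n))\<^sup>2 < e\<^sup>2"
        using bnd[OF yS yS le[OF mn(1)] le[OF mn(2)]] small by linarith
      then show "norm (y m - y n) < e" using e by (simp add: power_less_imp_less_base)
    qed
  qed
  then obtain p where p: "y \<longlonglongrightarrow> p" using Cauchy_convergent_iff convergent_def by blast
  have pS: "p \<in> S" using cl p yS closed_sequentially by blast
  have "norm (x - p) \<le> d"
  proof (rule LIMSEQ_le)
    show "(\<lambda>n. norm (x - y n)) \<longlonglongrightarrow> norm (x - p)" by (intro tendsto_intros p)
    have "(\<lambda>n. d + 1 / real (Suc n)) \<longlonglongrightarrow> d + 0"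
      by (intro tendsto_intros LIMSEQ_Suc[OF lim_1_over_n])
    then show "(\<lambda>n. d + 1 / real (Suc n)) \<longlonglongrightarrow> d" by simp
    show "\<exists>N. \<forall>n\<ge>N. norm (x - y n) \<le> d + 1 / real (Suc n)" using yd less_imp_le by blast
  qed
  then have pmin: "norm (x - p) \<le> norm (x - v)" if "v \<in> S" for v using lower[OF that] by linarith
  have "inner (x - p) v = 0" if v: "v \<in> S" for v
  proof (rule ccontr)
    assume ne0: "inner (x - p) v \<noteq> 0"
    then have v0: "inner v v > 0" by (metis inner_gt_zero_iff inner_zero_right)
    \<comment> \<open>This \<open>t\<close> minimizes the squared distance to \<open>x\<close> along
      the line \<open>p + t *\<^sub>R v\<close> and lowers it by \<open>t * inner (x - p) v\<close>,
      which is positive unless the inner product vanishes.\<close>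
    define t where "t = inner (x - p) v / inner v v"
    have "p + t *\<^sub>R v \<in> S" using pS v S by (simp add: subspace_add subspace_scale)
    from pmin[OF this] have "(norm (x - p))\<^sup>2 \<le> (norm (x - (p + t *\<^sub>R v)))\<^sup>2"
      by (simp add: power_mono)
    also have "x - (p + t *\<^sub>R v) = (x - p) - t *\<^sub>R v" by simp
    also have "(norm \<dots>)\<^sup>2 = (norm (x - p))\<^sup>2 - 2 * t * inner (x - p) v + t\<^sup>2 * inner v v"
      unfolding power2_norm_eq_inner
      by (simp add: inner_diff_left[of "x - p"] inner_diff_right[of _ "x - p"]
          inner_commute power2_eq_square)
    also have "t\<^sup>2 * inner v v = t * inner (x - p) v" using v0 by (simp add: t_def power2_eq_square)
    finally have "t * inner (x - p) v \<le> 0" by simp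
    moreover have "t * inner (x - p) v > 0" using ne0 v0 by (simp add: t_def power2_eq_square[symmetric] zero_less_power2)
    ultimately show False by simp
  qed
  with pS that show ?thesis by blast
qed

section \<open>Closed forms with a complex structure, and their resolvents\<close>

text \<open>The form is the inner product of gradients; that it is closed is expressed by sequences
  in the graph of \<open>grad\<close>. \<open>I\<close> stands for multiplication by the imaginary
  unit, and \<open>I_grad\<close> makes the form compatible with it. Density of \<open>D\<close> is
  not among the axioms: in the application the ambient space is L2 over the whole space, whereas
  elements of \<open>D\<close> vanish off the domain.\<close>

locale closed_skew_form =
  fixes D :: "'h::{real_inner,banach} set" and grad :: "'h \<Rightarrow> 'k::{real_inner,banach}"
    and I :: "'h \<Rightarrow> 'h"
  assumes D_subspace: "subspace D"
    and grad_add: "\<And>x y. x \<in> D \<Longrightarrow> y \<in> D \<Longrightarrow> grad (x + y) = grad x + grad y"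
    and grad_scaleR: "\<And>c x. x \<in> D \<Longrightarrow> grad (c *\<^sub>R x) = c *\<^sub>R grad x"
    and closed_graph: "\<And>x y z. (\<And>n::nat. x n \<in> D) \<Longrightarrow> x \<longlonglongrightarrow> y \<Longrightarrow> (\<lambda>n. grad (x n)) \<longlonglongrightarrow> z \<Longrightarrow>
       y \<in> D \<and> grad y = z"
    and I_linear: "linear I"
    and I_inner: "\<And>x y. inner (I x) (I y) = inner x y"
    and I_I: "\<And>x. I (I x) = - x"
    and I_D: "\<And>x. x \<in> D \<Longrightarrow> I x \<in> D"
    and I_grad: "\<And>x y. x \<in> D \<Longrightarrow> y \<in> D \<Longrightarrow> inner (grad (I x)) (grad y) = - inner (grad x) (grad (I y))"
begin

lemmas I_add = linear_add[OF I_linear] and I_diff = linear_diff[OF I_linear]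
  and I_scaleR = linear_scale[OF I_linear]

lemma D_0: "0 \<in> D" by (rule subspace_0[OF D_subspace])
lemma D_add: "x \<in> D \<Longrightarrow> y \<in> D \<Longrightarrow> x + y \<in> D" by (rule subspace_add[OF D_subspace])
lemma D_scaleR: "x \<in> D \<Longrightarrow> c *\<^sub>R x \<in> D" by (rule subspace_scale[OF D_subspace])
lemma D_diff: "x \<in> D \<Longrightarrow> y \<in> D \<Longrightarrow> x - y \<in> D" by (rule subspace_diff[OF D_subspace])

lemma grad_0: "grad 0 = 0" using grad_scaleR[OF D_0, of 0] by simp
lemma grad_minus: "x \<in> D \<Longrightarrow> grad (- x) = - grad x" using grad_scaleR[of x "-1"] by simp
lemma grad_diff: "x \<in> D \<Longrightarrow> y \<in> D \<Longrightarrow> grad (x - y) = grad x - grad y"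
  using grad_add[of x "- y"] grad_minus[of y] D_scaleR[of y "-1"] by simp

lemma norm_I: "norm (I x) = norm x" by (simp add: norm_eq_sqrt_inner I_inner)

lemma I_skew: "inner (I x) y = - inner x (I y)"
  using I_inner[of "I x" y] by (simp add: I_I)

lemma I_self: "inner (I x) x = 0" using I_skew[of x x] by (simp add: inner_commute)

lemma I_grad_self: "x \<in> D \<Longrightarrow> inner (grad x) (grad (I x)) = 0"
  using I_grad[of x x] by (simp add: inner_commute)

text \<open>The weak form of w - e * Laplacian w = f.\<close>

definition is_resolvent :: "real \<Rightarrow> 'h \<Rightarrow> 'h \<Rightarrow> bool" where
  "is_resolvent e f w \<longleftrightarrow> w \<in> D \<and> (\<forall>v\<in>D. inner w v + e * inner (grad w) (grad v) = inner f v)"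

text \<open>Project \<open>(f, 0)\<close> orthogonally onto the graph of
  \<open>sqrt e *\<^sub>R grad\<close>: orthogonality of the residual to this graph is the resolvent
  equation. The factor \<open>sqrt e\<close> occurs twice in the inner product and so yields the
  coefficient \<open>e\<close>.\<close>

lemma resolvent_exists:
  assumes e: "e > 0" shows "\<exists>w. is_resolvent e f w"
proof -
  define S where "S = (\<lambda>u. (u, sqrt e *\<^sub>R grad u)) ` D"
  have sub: "subspace S"
    unfolding S_def subspace_def
  proof (intro conjI ballI allI)
    show "0 \<in> (\<lambda>u. (u, sqrt e *\<^sub>R grad u)) ` D"
      using D_0 grad_0 by (auto simp: image_iff zero_prod_def intro!: bexI[of _ 0])
  next
    fix x y assume "x \<in> (\<lambda>u. (u, sqrt e *\<^sub>R grad u)) ` D" "y \<in> (\<lambda>u. (u, sqrt e *\<^sub>R grad u)) ` D"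
    then show "x + y \<in> (\<lambda>u. (u, sqrt e *\<^sub>R grad u)) ` D"
      by (auto simp: image_iff grad_add D_add scaleR_add_right intro!: bexI[of _ "fst x + fst y"])
  next
    fix c x assume "x \<in> (\<lambda>u. (u, sqrt e *\<^sub>R grad u)) ` D"
    then show "c *\<^sub>R x \<in> (\<lambda>u. (u, sqrt e *\<^sub>R grad u)) ` D"
      by (auto simp: image_iff grad_scaleR D_scaleR intro!: bexI[of _ "c *\<^sub>R fst x"])
  qed
  have cl: "closed S"
    unfolding closed_sequential_limits
  proof (intro allI impI, elim conjE)
    fix x l assume xS: "\<forall>n::nat. x n \<in> S" and xl: "x \<longlonglongrightarrow> l"
    have f1: "fst (x n) \<in> D" "snd (x n) = sqrt e *\<^sub>R grad (fst (x n))" for n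
      using xS by (auto simp: S_def image_iff dest!: spec[of _ n])
    have a: "(\<lambda>n. fst (x n)) \<longlonglongrightarrow> fst l" by (intro tendsto_intros xl)
    have "(\<lambda>n. (1 / sqrt e) *\<^sub>R snd (x n)) \<longlonglongrightarrow> (1 / sqrt e) *\<^sub>R snd l" by (intro tendsto_intros xl)
    then have b: "(\<lambda>n. grad (fst (x n))) \<longlonglongrightarrow> (1 / sqrt e) *\<^sub>R snd l" using e by (simp add: f1)
    from closed_graph[OF f1(1) a b] show "l \<in> S"
      using e by (auto simp: S_def image_iff intro!: bexI[of _ "fst l"] prod_eqI)
  qed
  obtain p where p: "p \<in> S" "\<And>v. v \<in> S \<Longrightarrow> inner ((f, 0) - p) v = 0"
    using closed_subspace_projection[OF sub cl, of "(f,0)"] by metis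
  then obtain w where w: "w \<in> D" "p = (w, sqrt e *\<^sub>R grad w)" by (auto simp: S_def)
  have "inner w v + e * inner (grad w) (grad v) = inner f v" if "v \<in> D" for v
  proof -
    have "inner ((f, 0) - p) (v, sqrt e *\<^sub>R grad v) = 0" using p(2) that by (auto simp: S_def)
    then have "inner (f - w) v - (sqrt e * sqrt e) * inner (grad w) (grad v) = 0"
      by (simp add: w)
    then show ?thesis using e by (simp add: inner_diff_left)
  qed
  with w show ?thesis unfolding is_resolvent_def by blast
qed

lemma resolvent_unique:
  assumes e: "e > 0" and "is_resolvent e f w" "is_resolvent e f z" shows "w = z"
proof -
  have d: "w \<in> D" "z \<in> D" using assms by (auto simp: is_resolvent_def)
  then have wz: "w - z \<in> D" by (rule D_diff)
  have "inner (w - z) (w - z) + e * inner (grad (w - z)) (grad (w - z)) = 0"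
    using assms(2,3) wz d unfolding is_resolvent_def
    by (smt (verit, best) grad_diff inner_diff_left right_diff_distrib)
  moreover have "inner (grad (w - z)) (grad (w - z)) \<ge> 0" by simp
  ultimately have "inner (w - z) (w - z) \<le> 0" using e by (smt (verit) mult_nonneg_nonneg)
  then show ?thesis by (metis eq_iff_diff_eq_0 inner_eq_zero_iff inner_ge_zero order_antisym)
qed

definition J :: "real \<Rightarrow> 'h \<Rightarrow> 'h" where "J e f = (SOME w. is_resolvent e f w)"

definition A :: "real \<Rightarrow> 'h \<Rightarrow> 'h" where "A e f = (1 / e) *\<^sub>R (f - J e f)"

definition En :: "real \<Rightarrow> 'h \<Rightarrow> real" where "En e f = inner (A e f) f"

context
  fixes e :: real assumes e: "e > 0"
begin

lemma J_resolvent: "is_resolvent e f (J e f)"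
  unfolding J_def by (rule someI_ex) (rule resolvent_exists[OF e])

lemma J_D: "J e f \<in> D" using J_resolvent by (simp add: is_resolvent_def)

lemma J_eq: "v \<in> D \<Longrightarrow> inner (J e f) v + e * inner (grad (J e f)) (grad v) = inner f v"
  using J_resolvent by (simp add: is_resolvent_def)

lemma J_eqI: "is_resolvent e f w \<Longrightarrow> J e f = w"
  using resolvent_unique[OF e J_resolvent] .

lemma J_add: "J e (f + g) = J e f + J e g"
proof (rule J_eqI, unfold is_resolvent_def, intro conjI ballI)
  show "J e f + J e g \<in> D" by (simp add: D_add J_D)
  fix v assume "v \<in> D"
  then show "inner (J e f + J e g) v + e * inner (grad (J e f + J e g)) (grad v) = inner (f + g) v"
    using J_eq[of v f] J_eq[of v g] by (simp add: grad_add J_D algebra_simps)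
qed

lemma J_scaleR: "J e (c *\<^sub>R f) = c *\<^sub>R J e f"
proof (rule J_eqI, unfold is_resolvent_def, intro conjI ballI)
  show "c *\<^sub>R J e f \<in> D" by (simp add: D_scaleR J_D)
  fix v assume "v \<in> D"
  then show "inner (c *\<^sub>R J e f) v + e * inner (grad (c *\<^sub>R J e f)) (grad v) = inner (c *\<^sub>R f) v"
    using J_eq[of v f, symmetric] by (simp add: grad_scaleR J_D algebra_simps)
qed

lemma J_I: "J e (I f) = I (J e f)"
proof (rule J_eqI, unfold is_resolvent_def, intro conjI ballI)
  show "I (J e f) \<in> D" by (simp add: I_D J_D)
  fix v assume v: "v \<in> D"
  then show "inner (I (J e f)) v + e * inner (grad (I (J e f))) (grad v) = inner (I f) v"
    using J_eq[of "I v" f] by (simp add: I_skew I_grad J_D I_D)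
qed

text \<open>The resolvent equation solved for its gradient term: \<open>A e f\<close> is minus the
  Laplacian of \<open>J e f\<close> in the weak sense.\<close>

lemma A_inner: "v \<in> D \<Longrightarrow> inner (A e f) v = inner (grad (J e f)) (grad v)"
  using J_eq[of v f, symmetric] e by (simp add: A_def inner_diff_left)

lemma J_eq_A: "J e f = f - e *\<^sub>R A e f" using e by (simp add: A_def)

lemma A_add: "A e (f + g) = A e f + A e g" by (simp add: A_def J_add algebra_simps)
lemma A_scaleR: "A e (c *\<^sub>R f) = c *\<^sub>R A e f" by (simp add: A_def J_scaleR algebra_simps)
lemma A_diff: "A e (f - g) = A e f - A e g" using A_add[of f "- g"] A_scaleR[of "-1" g] by simp
lemma A_I: "A e (I f) = I (A e f)" by (simp add: A_def J_I I_scaleR I_diff)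

lemma J_sym: "inner (J e f) g = inner f (J e g)"
  using J_eq[OF J_D, of f g] J_eq[OF J_D, of g f] by (simp add: inner_commute)

lemma A_sym: "inner (A e f) g = inner f (A e g)"
  by (simp add: A_def inner_diff_left inner_diff_right J_sym)

text \<open>Split \<open>f = J e f + e *\<^sub>R A e f\<close> and apply \<open>A_inner\<close> to
  the first part. Both resulting terms are nonnegative, which is where \<open>norm_A_le\<close>,
  \<open>norm_diff_J\<close> and \<open>norm_A_sq_le\<close> come from.\<close>

lemma En_eq: "En e f = (norm (grad (J e f)))\<^sup>2 + e * (norm (A e f))\<^sup>2"
proof -
  have "En e f = inner (A e f) (J e f + e *\<^sub>R A e f)" by (simp add: En_def J_eq_A)
  then show ?thesis by (simp add: inner_add_right A_inner[OF J_D] power2_norm_eq_inner)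
qed

lemma En_nonneg: "En e f \<ge> 0" using e by (simp add: En_eq)

lemma norm_A_le: "norm (A e f) \<le> norm f / e"
proof (cases "A e f = 0")
  case False
  have "e * (norm (A e f))\<^sup>2 \<le> En e f" by (simp add: En_eq)
  also have "\<dots> \<le> norm (A e f) * norm f" unfolding En_def by (rule norm_cauchy_schwarz)
  finally show ?thesis using e False by (simp add: power2_eq_square field_simps)
qed (use e in simp)

lemma bounded_linear_A: "bounded_linear (A e)"
  using norm_A_le by (intro bounded_linear_intro[of _ "1 / e"]) (auto simp: A_add A_scaleR)

lemma norm_J_le: "norm (J e f) \<le> norm f"
proof -
  have "(norm (J e f))\<^sup>2 \<le> inner f (J e f)"
    using J_eq[OF J_D, of f f] e by (simp add: power2_norm_eq_inner)
      (metis add_increasing2 inner_ge_zero less_eq_real_def mult_nonneg_nonneg order_refl)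
  also have "\<dots> \<le> norm f * norm (J e f)" by (rule norm_cauchy_schwarz)
  finally show ?thesis by (cases "J e f = 0") (auto simp: power2_eq_square)
qed

text \<open>On \<open>D\<close> the energy is the inner product of \<open>grad (J e f)\<close> with
  \<open>grad f\<close>, and it dominates the square of the norm of the first factor; Cauchy-Schwarz
  gives both bounds.\<close>

lemma En_le_grad:
  assumes "f \<in> D" shows "En e f \<le> (norm (grad f))\<^sup>2" "norm (grad (J e f)) \<le> norm (grad f)"
proof -
  let ?a = "norm (grad (J e f))" and ?b = "norm (grad f)"
  have 1: "?a\<^sup>2 \<le> En e f" using e by (simp add: En_eq)
  have 2: "En e f \<le> ?a * ?b" unfolding En_def A_inner[OF assms] by (rule norm_cauchy_schwarz)
  from 1 2 have "?a * ?a \<le> ?a * ?b" by (simp add: power2_eq_square)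
  then show 3: "?a \<le> ?b" by (cases "?a = 0") auto
  have "?a * ?b \<le> ?b * ?b" using 3 by (simp add: mult_right_mono)
  then show "En e f \<le> ?b\<^sup>2" using 2 by (simp add: power2_eq_square)
qed

lemma norm_diff_J: "(norm (f - J e f))\<^sup>2 \<le> e * En e f"
proof -
  have "f - J e f = e *\<^sub>R A e f" by (simp add: J_eq_A)
  then have "norm (f - J e f) = e * norm (A e f)" using e by (metis norm_scaleR abs_of_pos)
  then have "(norm (f - J e f))\<^sup>2 = e * (e * (norm (A e f))\<^sup>2)"
    by (simp add: power2_eq_square algebra_simps)
  also have "\<dots> \<le> e * En e f" using e by (simp add: En_eq)
  finally show ?thesis .
qed

text \<open>\<open>A e\<close> is symmetric and commutes with \<open>I\<close>, while
  \<open>I\<close> is skew, so the number equals its own negative. It expresses conservation of mass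
  by the Schroedinger part.\<close>

lemma A_I_self: "inner (A e f) (I f) = 0"
proof -
  have "inner (A e f) (I f) = - inner (I (A e f)) f" by (simp add: I_skew)
  also have "\<dots> = - inner (A e (I f)) f" by (simp add: A_I)
  also have "\<dots> = - inner (A e f) (I f)" by (metis A_sym inner_commute)
  finally show ?thesis by simp
qed

end

section \<open>Comparison of two Yosida parameters\<close>

text \<open>A bilinear resolvent identity: \<open>inner (A e f) (J m g)\<close> and
  \<open>inner (J e f) (A m g)\<close> coincide, both being the inner product of
  \<open>grad (J e f)\<close> and \<open>grad (J m g)\<close>; then \<open>J\<close> is expressed
  through \<open>A\<close>.\<close>

lemma A_A_swap:
  assumes "e > 0" "m > 0"
  shows "(m - e) * inner (A e f) (A m g) = inner (A e f) g - inner f (A m g)"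
proof -
  have "inner (A e f) (J m g) = inner (J e f) (A m g)"
    using A_inner[OF assms(1) J_D[OF assms(2)], of f g] A_inner[OF assms(2) J_D[OF assms(1)], of g f]
    by (simp add: inner_commute)
  then show ?thesis by (simp add: J_eq_A assms inner_diff_left inner_diff_right algebra_simps)
qed

text \<open>The energy for one parameter is later differentiated along a flow with another
  parameter; this identity removes the Schroedinger part there too.\<close>

lemma A_A_I:
  assumes "e > 0" "m > 0" "e \<noteq> m" shows "inner (A e f) (I (A m f)) = 0"
proof -
  have "(m - e) * inner (A e f) (A m (I f)) = inner (A e f) (I f) - inner f (A m (I f))"
    by (rule A_A_swap[OF assms(1,2)])
  also have "inner f (A m (I f)) = 0" using A_I_self[OF assms(2), of f] A_sym[OF assms(2)] by simp
  finally show ?thesis using assms A_I_self[OF assms(1)] A_I by simp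
qed

text \<open>Expanding the square leaves at most \<open>(m + e) * inner (A e f) (A m f)\<close>,
  while the difference of energies is \<open>m - e\<close> times the same inner product. The gap
  \<open>2 * e \<le> m\<close> gives \<open>m + e \<le> 3 * (m - e)\<close>, hence the constant
  3.\<close>

lemma grad_J_diff:
  assumes "0 < e" "2 * e \<le> m"
  shows "(norm (grad (J e f) - grad (J m f)))\<^sup>2 \<le> 3 * (En e f - En m f)"
proof -
  have m: "m > 0" "e > 0" using assms by auto
  let ?p = "A e f" and ?q = "A m f"
  let ?a = "grad (J e f)" and ?b = "grad (J m f)"
  have diff: "(m - e) * inner ?p ?q = En e f - En m f"
    using A_A_swap[OF m(2,1), of f f] by (simp add: En_def inner_commute)
  have aa: "inner ?a ?a = En e f - e * inner ?p ?p"
    using En_eq[OF m(2), of f] by (simp add: power2_norm_eq_inner)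
  have bb: "inner ?b ?b = En m f - m * inner ?q ?q"
    using En_eq[OF m(1), of f] by (simp add: power2_norm_eq_inner)
  have ab: "inner ?a ?b = En e f - m * inner ?p ?q"
    using A_inner[OF m(2) J_D[OF m(1)], of f f]
    by (simp add: J_eq_A m inner_diff_right En_def)
  have pq: "2 * ((m - e) * inner ?p ?q) = 2 * (En e f - En m f)" by (simp add: diff)
  have "(norm (?a - ?b))\<^sup>2 = (m + e) * inner ?p ?q - e * inner ?p ?p - m * inner ?q ?q"
    using aa bb ab pq
    by (simp add: power2_norm_eq_inner inner_diff_left inner_diff_right inner_commute algebra_simps)
  moreover have "0 \<le> e * inner ?p ?p" "0 \<le> m * inner ?q ?q" using m by auto
  ultimately have le: "(norm (?a - ?b))\<^sup>2 \<le> (m + e) * inner ?p ?q" by linarith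
  then have "inner ?p ?q \<ge> 0" using m
    by (smt (verit) zero_le_power2 mult_pos_neg)
  then have "(m + e) * inner ?p ?q \<le> (3 * (m - e)) * inner ?p ?q"
    using assms by (intro mult_right_mono) auto
  with le diff show ?thesis by (simp add: algebra_simps)
qed

lemma En_antimono: assumes "0 < e" "2 * e \<le> m" shows "En m f \<le> En e f"
  using grad_J_diff[OF assms, of f] by (smt (verit) zero_le_power2)

end

section \<open>Picard iteration for dissipative ordinary differential equations\<close>

lemma derivative_bound_imp_diff_le:
  fixes f f' :: "real \<Rightarrow> real"
  assumes ab: "a \<le> b"
    and d: "\<And>t. a \<le> t \<Longrightarrow> t \<le> b \<Longrightarrow> (f has_vector_derivative f' t) (at t within {a..b})"
    and le: "\<And>t. a \<le> t \<Longrightarrow> t \<le> b \<Longrightarrow> f' t \<le> B"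
  shows "f b - f a \<le> B * (b - a)"
proof -
  have 1: "(f' has_integral (f b - f a)) {a..b}"
    by (rule fundamental_theorem_of_calculus[OF ab]) (use d in auto)
  have 2: "((\<lambda>_. B) has_integral (B * (b - a))) {a..b}"
    using has_integral_const_real[of B a b] ab by (simp add: mult.commute)
  show ?thesis by (rule has_integral_le[OF 1 2]) (use le in auto)
qed

lemma lipschitz_imp_continuous_on:
  fixes F :: "'a::real_normed_vector \<Rightarrow> 'b::real_normed_vector"
  assumes "\<And>x y. norm (F x - F y) \<le> L * norm (x - y)"
  shows "continuous_on UNIV F"
proof -
  have "norm (F x - F y) \<le> \<bar>L\<bar> * norm (x - y)" for x y
    using assms[of x y] mult_right_mono[OF abs_ge_self norm_ge_zero, of L "x - y"] by linarith
  then have "\<bar>L\<bar>-lipschitz_on UNIV F"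
    by (intro lipschitz_onI) (auto simp: dist_norm)
  then show ?thesis by (rule lipschitz_on_continuous_on)
qed

lemma continuous_on_nonneg_reals:
  fixes f :: "real \<Rightarrow> 'a::topological_space"
  assumes "\<And>T. T \<ge> 0 \<Longrightarrow> continuous_on {0..T} f"
  shows "continuous_on {0..} f"
  unfolding continuous_on_def
proof
  fix t :: real assume t: "t \<in> {0..}"
  have "(f \<longlongrightarrow> f t) (at t within {0..t+1})"
    using assms[of "t+1"] t by (auto simp: continuous_on_def)
  moreover have "at t within {0..t+1} = at t within {0..}"
    by (rule at_within_nhd[of _ "{..<t+1}"]) auto
  ultimately show "(f \<longlongrightarrow> f t) (at t within {0..})" by simp
qed

lemma integral_exp_bound:
  fixes l :: real assumes "l > 0" "t \<ge> 0"
  shows "(\<lambda>s. exp (l * s)) integrable_on {0..t}" "integral {0..t} (\<lambda>s. exp (l * s)) \<le> exp (l * t) / l"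
proof -
  have "((\<lambda>s. exp (l * s)) has_integral (exp (l * t) / l - exp (l * 0) / l)) {0..t}"
    by (rule fundamental_theorem_of_calculus)
      (use assms in \<open>auto intro!: derivative_eq_intros
        simp flip: has_real_derivative_iff_has_vector_derivative\<close>)
  then show "(\<lambda>s. exp (l * s)) integrable_on {0..t}"
    "integral {0..t} (\<lambda>s. exp (l * s)) \<le> exp (l * t) / l"
    using assms by (auto simp: integrable_on_def integral_unique)
qed

lemma picard_global:
  fixes F :: "'a::banach \<Rightarrow> 'a"
  assumes lip0: "\<And>x y. norm (F x - F y) \<le> L * norm (x - y)"
  obtains u :: "real \<Rightarrow> 'a" where "u 0 = x0"
    "\<And>t. t \<ge> 0 \<Longrightarrow> (u has_vector_derivative F (u t)) (at t within {0..})"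
proof -
  define K where "K = \<bar>L\<bar>"
  have K0: "K \<ge> 0" by (simp add: K_def)
  have lip: "norm (F x - F y) \<le> K * norm (x - y)" for x y
    using lip0[of x y] mult_right_mono[OF abs_ge_self norm_ge_zero, of L "x - y"] unfolding K_def by linarith
  have Fc: "continuous_on UNIV F" by (rule lipschitz_imp_continuous_on[OF lip])
  define l where "l = 2 * K + 1"
  have l: "l \<ge> 1" "l > 0" "2 * K \<le> l" using K0 by (auto simp: l_def)
  define p where "p = rec_nat (\<lambda>t::real. x0) (\<lambda>_ q t. x0 + integral {0..t} (\<lambda>s. F (q s)))"
  have p0: "p 0 = (\<lambda>t. x0)" and pS: "p (Suc n) = (\<lambda>t. x0 + integral {0..t} (\<lambda>s. F (p n s)))" for n
    by (auto simp: p_def)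
  have pc: "continuous_on {0..T} (p n)" for n T
  proof (induction n arbitrary: T)
    case (Suc n)
    have "continuous_on {0..T} (\<lambda>s. F (p n s))"
      by (rule continuous_on_compose2[OF Fc Suc]) auto
    then have "(\<lambda>s. F (p n s)) integrable_on {0..T}" by (rule integrable_continuous_interval)
    then show ?case unfolding pS by (intro continuous_intros indefinite_integral_continuous_1)
  qed (simp add: p0)
  have Fpc: "continuous_on {0..T} (\<lambda>s. F (p n s))" for n T
    by (rule continuous_on_compose2[OF Fc pc]) auto
  have Fpi: "(\<lambda>s. F (p n s)) integrable_on {0..T}" for n T
    by (rule integrable_continuous_interval[OF Fpc])
  define M where "M = norm (F x0)"
  have M0: "M \<ge> 0" by (simp add: M_def)
  have step: "norm (p (Suc n) t - p n t) \<le> M * exp (l * t) * (1/2)^n" if "t \<ge> 0" for n t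
    using that
  proof (induction n arbitrary: t)
    case 0
    have "norm (p (Suc 0) t - p 0 t) = t * M"
      using 0 by (simp add: pS p0 M_def)
    moreover have "t \<le> exp (l * t)"
    proof -
      have "t \<le> l * t" using l 0 by (simp add: mult_le_cancel_right1)
      also have "\<dots> \<le> exp (l * t)" using exp_ge_add_one_self[of "l * t"] by linarith
      finally show ?thesis .
    qed
    ultimately show ?case using M0 by (simp add: mult.commute[of t] mult_left_mono)
  next
    case (Suc n)
    have "p (Suc (Suc n)) t - p (Suc n) t = integral {0..t} (\<lambda>s. F (p (Suc n) s)) - integral {0..t} (\<lambda>s. F (p n s))"
      by (subst (1 2) pS) simp
    also have "\<dots> = integral {0..t} (\<lambda>s. F (p (Suc n) s) - F (p n s))"
      by (rule integral_diff[OF Fpi Fpi, symmetric])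
    finally have eq: "p (Suc (Suc n)) t - p (Suc n) t = integral {0..t} (\<lambda>s. F (p (Suc n) s) - F (p n s))" .
    have "norm (integral {0..t} (\<lambda>s. F (p (Suc n) s) - F (p n s)))
        \<le> integral {0..t} (\<lambda>s. (K * M * (1/2)^n) * exp (l * s))"
    proof (rule integral_norm_bound_integral)
      show "(\<lambda>s. F (p (Suc n) s) - F (p n s)) integrable_on {0..t}"
        by (rule integrable_diff[OF Fpi Fpi])
      show "(\<lambda>s. (K * M * (1/2)^n) * exp (l * s)) integrable_on {0..t}"
        using integral_exp_bound(1)[OF l(2) Suc.prems] by (rule integrable_on_mult_right)
      fix s assume s: "s \<in> {0..t}"
      have "norm (F (p (Suc n) s) - F (p n s)) \<le> K * norm (p (Suc n) s - p n s)" by (rule lip)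
      also have "\<dots> \<le> K * (M * exp (l * s) * (1/2)^n)"
        using Suc.IH[of s] s K0 by (intro mult_left_mono) auto
      finally show "norm (F (p (Suc n) s) - F (p n s)) \<le> (K * M * (1/2)^n) * exp (l * s)"
        by (simp add: mult_ac)
    qed
    also have "\<dots> = (K * M * (1/2)^n) * integral {0..t} (\<lambda>s. exp (l * s))" by simp
    also have "\<dots> \<le> (K * M * (1/2)^n) * (exp (l * t) / l)"
      using integral_exp_bound(2)[OF l(2) Suc.prems] K0 M0 by (intro mult_left_mono) auto
    also have "\<dots> = (K / l) * (M * (1/2)^n * exp (l * t))" by simp
    also have "\<dots> \<le> (1/2) * (M * (1/2)^n * exp (l * t))"
      using l M0 by (intro mult_right_mono) (auto simp: field_simps)
    finally show ?case using eq by (simp add: mult_ac)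
  qed
  have conv: "\<exists>u. uniform_limit {0..T} p u sequentially" if T: "T \<ge> 0" for T
  proof -
    define C where "C = M * exp (l * T)"
    have b: "norm (p (Suc n) t - p n t) \<le> C * (1/2)^n" if t: "t \<in> {0..T}" for t n
    proof -
      have "norm (p (Suc n) t - p n t) \<le> M * exp (l * t) * (1/2)^n" using step t by auto
      also have "\<dots> \<le> M * exp (l * T) * (1/2)^n"
        using t l M0 by (intro mult_right_mono mult_left_mono) auto
      finally show ?thesis by (simp add: C_def)
    qed
    have "uniformly_convergent_on {0..T} (\<lambda>n x. \<Sum>i<n. p (Suc i) x - p i x)"
      by (rule Weierstrass_m_test'[where M="\<lambda>n. C * (1/2)^n"]) (use b in \<open>auto intro!: summable_mult\<close>)
    then obtain s where "uniform_limit {0..T} (\<lambda>n x. \<Sum>i<n. p (Suc i) x - p i x) s sequentially"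
      by (auto simp: uniformly_convergent_on_def)
    moreover have "(\<Sum>i<n. p (Suc i) x - p i x) = p n x - x0" for n x
      using sum_lessThan_telescope[of "\<lambda>i. p i x" n] by (simp add: p0)
    ultimately have "uniform_limit {0..T} (\<lambda>n x. p n x - x0) s sequentially"
      by simp
    then have "uniform_limit {0..T} (\<lambda>n x. (p n x - x0) + x0) (\<lambda>x. s x + x0) sequentially"
      by (intro uniform_limit_intros)
    then show ?thesis by auto
  qed
  \<comment> \<open>The uniform limits come from separate existence statements, one for each
    \<open>T\<close>; the pointwise limit serves all intervals at once.\<close>
  define u where "u t = lim (\<lambda>n. p n t)" for t
  have ul: "uniform_limit {0..T} p u sequentially" if T: "T \<ge> 0" for T
  proof -
    obtain w where w: "uniform_limit {0..T} p w sequentially" using conv[OF T] by blast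
    have "u t = w t" if "t \<in> {0..T}" for t
      using tendsto_uniform_limitI[OF w that] unfolding u_def by (rule limI)
    then show ?thesis using w by (metis uniform_limit_cong')
  qed
  have uc: "continuous_on {0..T} u" if "T \<ge> 0" for T
    by (rule uniform_limit_theorem[OF _ ul[OF that]]) (use pc in auto)
  have Fuc: "continuous_on {0..T} (\<lambda>s. F (u s))" if "T \<ge> 0" for T
    by (rule continuous_on_compose2[OF Fc uc]) (use that in auto)
  have ueq: "u t = x0 + integral {0..t} (\<lambda>s. F (u s))" if t: "t \<ge> 0" for t
  proof -
    have "uniform_limit {0..t} (\<lambda>n s. F (p n s)) (\<lambda>s. F (u s)) sequentially"
    proof (rule uniform_limitI)
      fix e :: real assume e: "e > 0"
      have "\<forall>\<^sub>F n in sequentially. \<forall>s\<in>{0..t}. dist (p n s) (u s) < e / (K + 1)"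
        using ul[OF t] e K0 by (intro uniform_limitD) auto
      then show "\<forall>\<^sub>F n in sequentially. \<forall>s\<in>{0..t}. dist (F (p n s)) (F (u s)) < e"
      proof (eventually_elim, intro ballI)
        fix n s assume h: "\<forall>s\<in>{0..t}. dist (p n s) (u s) < e / (K + 1)" and s: "s \<in> {0..t}"
        have "dist (F (p n s)) (F (u s)) \<le> K * dist (p n s) (u s)" using lip by (simp add: dist_norm)
        also have "\<dots> \<le> K * (e / (K + 1))" using h s K0 by (intro mult_left_mono) (auto intro: less_imp_le)
        also have "\<dots> < e" using e K0 by (simp add: field_simps)
        finally show "dist (F (p n s)) (F (u s)) < e" .
      qed
    qed
    from uniform_limit_integral[OF this Fpc trivial_limit_sequentially]
    obtain P Q where P: "\<And>n. ((\<lambda>s. F (p n s)) has_integral P n) {0..t}"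
      and Q: "((\<lambda>s. F (u s)) has_integral Q) {0..t}" "P \<longlonglongrightarrow> Q" by metis
    have "P = (\<lambda>n. integral {0..t} (\<lambda>s. F (p n s)))" using integral_unique[OF P] by auto
    with Q have "(\<lambda>n. integral {0..t} (\<lambda>s. F (p n s))) \<longlonglongrightarrow> integral {0..t} (\<lambda>s. F (u s))"
      using integral_unique[OF Q(1)] by simp
    then have "(\<lambda>n. p (Suc n) t) \<longlonglongrightarrow> x0 + integral {0..t} (\<lambda>s. F (u s))"
      unfolding pS by (intro tendsto_intros)
    moreover have "(\<lambda>n. p (Suc n) t) \<longlonglongrightarrow> u t"
      using tendsto_uniform_limitI[OF ul[OF t], of t] t by (intro LIMSEQ_Suc) auto
    ultimately show ?thesis by (rule LIMSEQ_unique[symmetric])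
  qed
  show ?thesis
  proof
    show "u 0 = x0" using ueq[of 0] by simp
    fix t :: real assume t: "t \<ge> 0"
    have "((\<lambda>r. integral {0..r} (\<lambda>s. F (u s))) has_vector_derivative F (u t)) (at t within {0..t+1})"
      by (rule integral_has_vector_derivative[OF Fuc]) (use t in auto)
    then have "((\<lambda>r. x0 + integral {0..r} (\<lambda>s. F (u s))) has_vector_derivative F (u t)) (at t within {0..t+1})"
      by (auto intro!: derivative_eq_intros)
    moreover have "at t within {0..t+1} = at t within {0..}"
      by (rule at_within_nhd[of _ "{..<t+1}"]) auto
    ultimately have "((\<lambda>r. x0 + integral {0..r} (\<lambda>s. F (u s))) has_vector_derivative F (u t)) (at t within {0..})"
      by simp
    then show "(u has_vector_derivative F (u t)) (at t within {0..})"
      by (rule has_vector_derivative_transform[rotated 2]) (use t ueq in auto)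
  qed
qed

section \<open>The damped evolution equation for a closed form\<close>

definition ep :: "nat \<Rightarrow> real" where "ep n = (1/16) ^ n"

lemma ep_pos: "ep n > 0" by (simp add: ep_def)

text \<open>Different levels are a factor of at least two apart, as \<open>grad_J_diff\<close>
  demands.\<close>

lemma ep_lt: "n < k \<Longrightarrow> 2 * ep k \<le> ep n"
proof (induction k)
  case (Suc k)
  have "16 * ep (Suc k) = ep k" by (simp add: ep_def)
  moreover have "ep k \<le> ep n" using Suc ep_pos[of k] by (cases "n = k") auto
  ultimately show ?case using ep_pos[of k] by linarith
qed simp

lemma ep_lim: "ep \<longlonglongrightarrow> 0" unfolding ep_def[abs_def] by (rule LIMSEQ_power_zero) simp

context closed_skew_form begin

lemma En_mono_ep: "n \<le> k \<Longrightarrow> En (ep n) x \<le> En (ep k) x"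
  using En_antimono[OF ep_pos ep_lt] by (cases "n = k") auto

text \<open>This replaces weak compactness: the energies increase with the level and are bounded,
  hence converge; \<open>grad_J_diff\<close> turns this into strong convergence of the gradients of
  \<open>J (ep n) x\<close>, and closedness of the graph puts the limit into \<open>D\<close>. That
  the limit of the energies is the full squared gradient follows from the two bounds of
  \<open>En_eq\<close> and \<open>En_le_grad\<close>.\<close>

lemma bounded_energy:
  assumes b: "\<And>n. En (ep n) x \<le> C"
  shows "x \<in> D" "(norm (grad x))\<^sup>2 \<le> C" "(\<lambda>n. J (ep n) x) \<longlonglongrightarrow> x"
    "(\<lambda>n. grad (J (ep n) x)) \<longlonglongrightarrow> grad x" "(\<lambda>n. En (ep n) x) \<longlonglongrightarrow> (norm (grad x))\<^sup>2"
    "En (ep n) x \<le> (norm (grad x))\<^sup>2"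
proof -
  have inc: "incseq (\<lambda>n. En (ep n) x)" using En_mono_ep by (auto simp: incseq_def)
  have bd: "Bseq (\<lambda>n. En (ep n) x)"
    using b En_nonneg[OF ep_pos] by (intro BseqI'[of _ C]) auto
  obtain l where l: "(\<lambda>n. En (ep n) x) \<longlonglongrightarrow> l"
    using Bseq_monoseq_convergent[OF bd] inc by (auto simp: convergent_def incseq_imp_monoseq)
  have lC: "l \<le> C" by (rule LIMSEQ_le_const2[OF l]) (use b in auto)
  have Cau: "Cauchy (\<lambda>n. grad (J (ep n) x))"
  proof (rule CauchyI)
    fix e :: real assume e: "e > 0"
    obtain N where N: "\<And>m n. m \<ge> N \<Longrightarrow> n \<ge> N \<Longrightarrow> norm (En (ep m) x - En (ep n) x) < e\<^sup>2 / 3"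
      using CauchyD[OF LIMSEQ_imp_Cauchy[OF l], of "e\<^sup>2 / 3"] e by auto
    have one: "norm (grad (J (ep k) x) - grad (J (ep n) x)) < e" if "n \<ge> N" "k > n" for n k
    proof -
      have "(norm (grad (J (ep k) x) - grad (J (ep n) x)))\<^sup>2 \<le> 3 * (En (ep k) x - En (ep n) x)"
        by (rule grad_J_diff[OF ep_pos ep_lt[OF that(2)]])
      also have "En (ep k) x - En (ep n) x \<le> \<bar>En (ep k) x - En (ep n) x\<bar>" by (rule abs_ge_self)
      also have "3 * \<bar>En (ep k) x - En (ep n) x\<bar> < e\<^sup>2"
        using N[OF order_trans[OF that(1) less_imp_le[OF that(2)]] that(1)] by simp
      finally show ?thesis using e by (simp add: power_less_imp_less_base)
    qed
    show "\<exists>M. \<forall>m\<ge>M. \<forall>n\<ge>M. norm (grad (J (ep m) x) - grad (J (ep n) x)) < e"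
    proof (intro exI allI impI)
      fix m n assume "N \<le> m" "N \<le> n"
      then show "norm (grad (J (ep m) x) - grad (J (ep n) x)) < e"
        using one[of n m] one[of m n] e by (cases m n rule: linorder_cases) (auto simp: norm_minus_commute)
    qed
  qed
  then obtain z where z: "(\<lambda>n. grad (J (ep n) x)) \<longlonglongrightarrow> z"
    using Cauchy_convergent_iff convergent_def by blast
  show Jx: "(\<lambda>n. J (ep n) x) \<longlonglongrightarrow> x"
  proof (rule metric_LIMSEQ_I)
    fix e :: real assume e: "e > 0"
    have "(\<lambda>n. ep n * C) \<longlonglongrightarrow> 0 * C" by (intro tendsto_intros ep_lim)
    then have "\<forall>\<^sub>F n in sequentially. ep n * C < e\<^sup>2" using e by (intro order_tendstoD(2)) auto
    then obtain N where N: "\<And>n. n \<ge> N \<Longrightarrow> ep n * C < e\<^sup>2" by (auto simp: eventually_sequentially)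
    show "\<exists>no. \<forall>n\<ge>no. dist (J (ep n) x) x < e"
    proof (intro exI allI impI)
      fix n assume n: "N \<le> n"
      have "(norm (x - J (ep n) x))\<^sup>2 \<le> ep n * En (ep n) x" by (rule norm_diff_J[OF ep_pos])
      also have "\<dots> \<le> ep n * C" using b ep_pos[of n] by (intro mult_left_mono) auto
      also have "\<dots> < e\<^sup>2" using N n by auto
      finally show "dist (J (ep n) x) x < e"
        using e by (simp add: power_less_imp_less_base dist_norm norm_minus_commute)
    qed
  qed
  from closed_graph[OF J_D[OF ep_pos] Jx z] have xz: "x \<in> D" "grad x = z" by auto
  then show "x \<in> D" and gl: "(\<lambda>n. grad (J (ep n) x)) \<longlonglongrightarrow> grad x" using z by auto
  have up: "En (ep n) x \<le> (norm (grad x))\<^sup>2" for n by (rule En_le_grad(1)[OF ep_pos xz(1)])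
  then show "En (ep n) x \<le> (norm (grad x))\<^sup>2" .
  have "(norm (grad (J (ep n) x)))\<^sup>2 \<le> En (ep n) x" for n
    using En_eq[OF ep_pos, of n x] ep_pos[of n] by simp
  then have "(norm (grad x))\<^sup>2 \<le> l"
    by (intro LIMSEQ_le[OF tendsto_power[OF tendsto_norm[OF gl]] l]) auto
  moreover have "l \<le> (norm (grad x))\<^sup>2" by (rule LIMSEQ_le_const2[OF l]) (use up in auto)
  ultimately show "(\<lambda>n. En (ep n) x) \<longlonglongrightarrow> (norm (grad x))\<^sup>2" "(norm (grad x))\<^sup>2 \<le> C"
    using l lC by auto
qed

lemmas D_approx = bounded_energy(3-6)[OF En_le_grad(1)[OF ep_pos]]

text \<open>The hypothesis on \<open>y\<close> says that minus the Laplacian of \<open>x\<close> is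
  \<open>y\<close> in L2. Testing with \<open>A e x\<close>, which lies in \<open>D\<close> as well,
  leaves a term of good sign. It serves for the regularized initial data, where \<open>x\<close> is
  a resolvent and \<open>y\<close> a Yosida term.\<close>

lemma norm_A_le_strong:
  assumes e: "e > 0" and x: "x \<in> D" and y: "\<And>v. v \<in> D \<Longrightarrow> inner (grad x) (grad v) = inner y v"
  shows "norm (A e x) \<le> norm y"
proof -
  have AD: "A e x \<in> D" using x J_D[OF e] by (simp add: A_def D_diff D_scaleR)
  have "grad (J e x) = grad x - e *\<^sub>R grad (A e x)"
    using J_eq_A[OF e, of x] AD x by (simp add: grad_diff grad_scaleR D_scaleR)
  then have "inner (A e x) (A e x) = inner y (A e x) - e * inner (grad (A e x)) (grad (A e x))"
    using A_inner[OF e AD, of x] y[OF AD] by (simp add: inner_diff_left)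
  then have "inner (A e x) (A e x) \<le> inner y (A e x)" using e by simp
  also have "\<dots> \<le> norm y * norm (A e x)" by (rule norm_cauchy_schwarz)
  finally show ?thesis by (cases "A e x = 0") (auto simp: power2_norm_eq_inner[symmetric] power2_eq_square)
qed

lemma norm_A_sq_le: assumes "e > 0" "x \<in> D" shows "e * (norm (A e x))\<^sup>2 \<le> (norm (grad x))\<^sup>2"
  using En_eq[OF assms(1), of x] En_le_grad(1)[OF assms] by (smt (verit) zero_le_power2)

end

lemma inner_has_vector_derivative:
  assumes "(x has_vector_derivative x') (at t within S)" "(y has_vector_derivative y') (at t within S)"
  shows "((\<lambda>t. inner (x t) (y t)) has_vector_derivative (inner (x t) y' + inner x' (y t))) (at t within S)"
  by (rule bounded_bilinear.has_vector_derivative[OF bounded_bilinear_inner assms])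

lemma right_difference_quotients:
  fixes f :: "real \<Rightarrow> 'a::real_normed_vector"
  assumes d: "(f has_vector_derivative d) (at t within {0..})" and t: "t \<ge> 0"
  shows "(\<lambda>k. real (Suc k) *\<^sub>R (f (t + 1 / real (Suc k)) - f t)) \<longlonglongrightarrow> d"
proof -
  have 1: "((\<lambda>y. (1 / norm (y - t)) *\<^sub>R (f y - (f t + (y - t) *\<^sub>R d))) \<longlongrightarrow> 0) (at t within {0..})"
    using d unfolding has_vector_derivative_def has_derivative_within by auto
  have "(\<lambda>k. t + 1 / real (Suc k)) \<longlonglongrightarrow> t + 0"
    by (intro tendsto_intros LIMSEQ_Suc[OF lim_1_over_n])
  then have 2: "filterlim (\<lambda>k. t + 1 / real (Suc k)) (at t within {0..}) sequentially"
    using t by (auto simp: filterlim_at intro!: always_eventually)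
  have "(\<lambda>k. real (Suc k) *\<^sub>R (f (t + 1 / real (Suc k)) - f t) - d) \<longlonglongrightarrow> 0"
    using filterlim_compose[OF 1 2] by (simp add: algebra_simps)
  then show ?thesis by (rule LIM_zero_cancel)
qed

text \<open>A substitute for integrating a nonpositive derivative. For weak solutions the squared L2
  norm is not differentiated directly, but its increments over short intervals can be bounded by an
  arbitrarily small multiple of the length.\<close>

lemma small_increments_imp_le:
  fixes f :: "real \<Rightarrow> real"
  assumes T: "T \<ge> 0"
    and h: "\<And>\<eta>. \<eta> > 0 \<Longrightarrow> \<exists>\<delta>>0. \<forall>s t. 0 \<le> s \<longrightarrow> s \<le> t \<longrightarrow> t \<le> T \<longrightarrow> t - s < \<delta> \<longrightarrow> f t - f s \<le> \<eta> * (t - s)"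
  shows "f T \<le> f 0"
proof (rule ccontr)
  assume "\<not> f T \<le> f 0"
  then have gt: "f T - f 0 > 0" by simp
  \<comment> \<open>Dividing by \<open>T + 1\<close> keeps the total \<open>\<eta> * T\<close>
    strictly below the assumed gap and covers \<open>T = 0\<close>.\<close>
  define \<eta> where "\<eta> = (f T - f 0) / (T + 1)"
  have \<eta>: "\<eta> > 0" using gt T by (simp add: \<eta>_def)
  then obtain \<delta> where \<delta>: "\<delta> > 0"
    "\<And>s t. 0 \<le> s \<Longrightarrow> s \<le> t \<Longrightarrow> t \<le> T \<Longrightarrow> t - s < \<delta> \<Longrightarrow> f t - f s \<le> \<eta> * (t - s)"
    using h by blast
  obtain N :: nat where N: "T / \<delta> < real N" using reals_Archimedean2 by blast
  have N0: "real N > 0" using N T \<delta>(1) divide_nonneg_pos[OF T \<delta>(1)] by linarith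
  have TN: "T / real N < \<delta>" using N N0 \<delta> by (simp add: field_simps)
  have "k \<le> N \<Longrightarrow> f (real k * (T / real N)) - f 0 \<le> \<eta> * (real k * (T / real N))" for k
  proof (induction k)
    case (Suc k)
    have st: "real (Suc k) * (T / real N) - real k * (T / real N) = T / real N"
      by (simp add: algebra_simps add_divide_distrib)
    have le: "real (Suc k) * (T / real N) \<le> T"
    proof -
      have "real (Suc k) * (T / real N) \<le> real N * (T / real N)"
        using Suc.prems T by (intro mult_right_mono) auto
      then show ?thesis using N0 by simp
    qed
    have "f (real (Suc k) * (T / real N)) - f (real k * (T / real N)) \<le>
      \<eta> * (real (Suc k) * (T / real N) - real k * (T / real N))"
    proof (rule \<delta>(2))
      show "real k * (T / real N) \<le> real (Suc k) * (T / real N)"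
        using T by (intro mult_right_mono) auto
      show "real (Suc k) * (T / real N) - real k * (T / real N) < \<delta>" using st TN by simp
    qed (use le T in auto)
    also have "\<dots> = \<eta> * (real (Suc k) * (T / real N)) - \<eta> * (real k * (T / real N))"
      by (rule right_diff_distrib)
    finally show ?case using Suc.IH Suc.prems by linarith
  qed simp
  from this[of N] have "f T - f 0 \<le> \<eta> * T" using N0 by simp
  also have "\<dots> < \<eta> * (T + 1)" using \<eta> by simp
  also have "\<dots> = f T - f 0" using T by (simp add: \<eta>_def)
  finally show False by simp
qed

text \<open>\<open>I\<close> is multiplication by the imaginary unit, \<open>g\<close> the nonlinearity with approximations \<open>gn\<close>, and \<open>G\<close> the
  map \<open>u \<mapsto> u / |u|\<close>\<open>\<^sup>\<alpha>\<^sup>/\<^sup>2\<close>, whose form energy is comparable with the dissipation.\<close>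

locale damped_form = closed_skew_form D grad I
  for D :: "'h::{real_inner,banach} set" and grad :: "'h \<Rightarrow> 'k::{real_inner,banach}" and I +
  fixes g G :: "'h \<Rightarrow> 'h" and gn :: "nat \<Rightarrow> 'h \<Rightarrow> 'h" and c cb c1 c2 :: real
  assumes gn_lip: "\<And>n. \<exists>L. \<forall>x y. norm (gn n x - gn n y) \<le> L * norm (x - y)"
    and gn_mono: "\<And>n x y. inner (gn n x - gn n y) (x - y) \<ge> 0"
    and gn_0: "\<And>n. gn n 0 = 0"
    and gn_g: "\<And>n x. norm (gn n x - g x) \<le> c * (1/4)^n"
    and g_cont: "continuous_on UNIV g"
    and G_cont: "continuous_on UNIV G"
    and g_bound: "\<And>x. norm (g x) \<le> cb * (1 + norm x)"
    and markov: "\<And>e n x. e > 0 \<Longrightarrow> inner (A e x) (gn n x) \<ge> 0"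
    and c1: "c1 > 0" and c2: "c2 > 0"
    and lower: "\<And>e x. e > 0 \<Longrightarrow> c1 * En e (G x) \<le> inner (A e x) (g x)"
    and upper: "\<And>e x. e > 0 \<Longrightarrow> inner (A e x) (g x) \<le> c2 * En e (G x)"
begin

lemma c_nonneg: "c \<ge> 0" using order_trans[OF norm_ge_zero gn_g[of 0 0]] by simp
lemma cb_nonneg: "cb \<ge> 0" using order_trans[OF norm_ge_zero g_bound[of 0]] by simp

lemma gn_lim: "(\<lambda>n. gn n x) \<longlonglongrightarrow> g x"
proof (rule LIM_zero_cancel, rule Lim_null_comparison)
  show "\<forall>\<^sub>F n in sequentially. norm (gn n x - g x) \<le> c * (1/4)^n" using gn_g by simp
  have "(\<lambda>n. c * (1/4::real)^n) \<longlonglongrightarrow> c * 0" by (intro tendsto_intros LIMSEQ_power_zero) simp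
  then show "(\<lambda>n. c * (1/4::real)^n) \<longlonglongrightarrow> 0" by simp
qed

lemma g_mono: "inner (g x - g y) (x - y) \<ge> 0"
proof (rule LIMSEQ_le_const)
  show "(\<lambda>n. inner (gn n x - gn n y) (x - y)) \<longlonglongrightarrow> inner (g x - g y) (x - y)"
    by (intro tendsto_intros gn_lim)
qed (use gn_mono in auto)

section \<open>Weak solutions and their uniqueness\<close>

text \<open>The equation reads u' = i Laplacian u - g(u). It is tested with \<open>v\<close> and
  integrated over time; moving the imaginary unit and one gradient to the test vector yields
  \<open>inner (grad (u r)) (grad (I v))\<close> with this sign.\<close>

definition weak_solution :: "(real \<Rightarrow> 'h) \<Rightarrow> bool" where
  "weak_solution u \<longleftrightarrow> (\<forall>t\<ge>0. u t \<in> D) \<and> continuous_on {0..} u \<and> continuous_on {0..} (\<lambda>t. grad (u t)) \<and>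
    (\<forall>v\<in>D. \<forall>s\<ge>0. \<forall>t\<ge>s. inner (u t - u s) v =
       integral {s..t} (\<lambda>r. inner (grad (u r)) (grad (I v)) - inner (g (u r)) v))"

lemma weak_solution_integrable:
  assumes "weak_solution u" "0 \<le> s"
  shows "(\<lambda>r. inner (grad (u r)) w - inner (g (u r)) v) integrable_on {s..t}"
proof -
  have sub: "{s..t} \<subseteq> {0..}" using assms by auto
  have "continuous_on {s..t} u" "continuous_on {s..t} (\<lambda>t. grad (u t))"
    using assms continuous_on_subset[OF _ sub] by (auto simp: weak_solution_def)
  moreover from this have "continuous_on {s..t} (\<lambda>r. g (u r))"
    by (intro continuous_on_compose2[OF g_cont]) auto
  ultimately show ?thesis
    by (intro integrable_continuous_interval continuous_intros)
qed

text \<open>The difference \<open>z\<close> has no time derivative in L2, so its squared norm is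
  treated by increments. The test vector \<open>z t + z s\<close> makes the tested increment equal
  to the increment of the squared norm. On a short interval it is uniformly close, together with its
  gradient, to \<open>2 *\<^sub>R z r\<close>, for which the integrand is nonpositive.\<close>

theorem weak_solution_unique:
  assumes x: "weak_solution x" and y: "weak_solution y" and xy0: "x 0 = y 0" and T: "T \<ge> 0"
  shows "x T = y T"
proof -
  define z where "z t = x t - y t" for t
  have D: "x t \<in> D" "y t \<in> D" "z t \<in> D" if "t \<ge> 0" for t
    using x y that D_diff by (auto simp: weak_solution_def z_def)
  have gz: "grad (z t) = grad (x t) - grad (y t)" if "t \<ge> 0" for t
    using D[OF that] by (simp add: z_def grad_diff)
  have sub: "{0..T} \<subseteq> {0..}" by auto
  have cx: "continuous_on {0..T} x" "continuous_on {0..T} (\<lambda>t. grad (x t))"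
    using x continuous_on_subset[OF _ sub] unfolding weak_solution_def by blast+
  have cy: "continuous_on {0..T} y" "continuous_on {0..T} (\<lambda>t. grad (y t))"
    using y continuous_on_subset[OF _ sub] unfolding weak_solution_def by blast+
  have cz: "continuous_on {0..T} z"
    unfolding z_def by (intro continuous_intros cx cy)
  have "continuous_on {0..T} (\<lambda>t. grad (x t) - grad (y t))"
    by (intro continuous_intros cx cy)
  then have cgz: "continuous_on {0..T} (\<lambda>t. grad (z t))"
    by (rule continuous_on_eq) (use gz in auto)
  have "continuous_on {0..T} (\<lambda>t. g (x t))" "continuous_on {0..T} (\<lambda>t. g (y t))"
    by (rule continuous_on_compose2[OF g_cont cx(1)], simp) (rule continuous_on_compose2[OF g_cont cy(1)], simp)
  then have cg: "continuous_on {0..T} (\<lambda>t. g (x t) - g (y t))" by (intro continuous_intros)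
  obtain K where K: "K > 0" "\<And>t. t \<in> {0..T} \<Longrightarrow> norm (grad (z t)) \<le> K" "\<And>t. t \<in> {0..T} \<Longrightarrow> norm (g (x t) - g (y t)) \<le> K"
  proof -
    have "bounded ((\<lambda>t. grad (z t)) ` {0..T})" "bounded ((\<lambda>t. g (x t) - g (y t)) ` {0..T})"
        using compact_imp_bounded[OF compact_continuous_image[OF cgz]]
        compact_imp_bounded[OF compact_continuous_image[OF cg]] by auto
    then obtain K1 K2 where "\<And>t. t \<in> {0..T} \<Longrightarrow> norm (grad (z t)) \<le> K1"
      "\<And>t. t \<in> {0..T} \<Longrightarrow> norm (g (x t) - g (y t)) \<le> K2" unfolding bounded_iff by blast
    then show ?thesis by (intro that[of "max 1 (max K1 K2)"]) (auto simp: le_max_iff_disj)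
  qed
  have "(norm (z T))\<^sup>2 \<le> (norm (z 0))\<^sup>2"
  proof (rule small_increments_imp_le[OF T])
    fix \<eta> :: real assume \<eta>: "\<eta> > 0"
    \<comment> \<open>Two error terms occur below, each at most
      \<open>K * (2 * \<epsilon>)\<close>.\<close>
    define \<epsilon> where "\<epsilon> = \<eta> / (4 * K)"
    have \<epsilon>: "\<epsilon> > 0" using \<eta> K by (simp add: \<epsilon>_def)
    have "uniformly_continuous_on {0..T} z" "uniformly_continuous_on {0..T} (\<lambda>t. grad (z t))"
      using compact_uniformly_continuous[OF cz] compact_uniformly_continuous[OF cgz] by auto
    then obtain d1 d2 where d: "d1 > 0" "d2 > 0"
      "\<And>s t. s \<in> {0..T} \<Longrightarrow> t \<in> {0..T} \<Longrightarrow> dist s t < d1 \<Longrightarrow> dist (z s) (z t) < \<epsilon>"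
      "\<And>s t. s \<in> {0..T} \<Longrightarrow> t \<in> {0..T} \<Longrightarrow> dist s t < d2 \<Longrightarrow> dist (grad (z s)) (grad (z t)) < \<epsilon>"
      unfolding uniformly_continuous_on_def using \<epsilon> by metis
    show "\<exists>\<delta>>0. \<forall>s t. 0 \<le> s \<longrightarrow> s \<le> t \<longrightarrow> t \<le> T \<longrightarrow> t - s < \<delta> \<longrightarrow> (norm (z t))\<^sup>2 - (norm (z s))\<^sup>2 \<le> \<eta> * (t - s)"
    proof (intro exI[of _ "min d1 d2"] conjI allI impI)
      show "0 < min d1 d2" using d by simp
      fix s t assume st: "0 \<le> s" "s \<le> t" "t \<le> T" "t - s < min d1 d2"
      define v where "v = z t + z s"
      have vD: "v \<in> D" using D(3)[of s] D(3)[of t] st by (simp add: v_def D_add)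
      have "(norm (z t))\<^sup>2 - (norm (z s))\<^sup>2 = inner (x t - x s) v - inner (y t - y s) v"
        by (simp add: power2_norm_eq_inner v_def z_def inner_diff_left inner_diff_right inner_add_right inner_commute)
      also have "\<dots> = integral {s..t} (\<lambda>r. inner (grad (x r)) (grad (I v)) - inner (g (x r)) v) -
          integral {s..t} (\<lambda>r. inner (grad (y r)) (grad (I v)) - inner (g (y r)) v)"
        using x y vD st by (simp add: weak_solution_def)
      also have "\<dots> = integral {s..t} (\<lambda>r. (inner (grad (x r)) (grad (I v)) - inner (g (x r)) v) -
          (inner (grad (y r)) (grad (I v)) - inner (g (y r)) v))"
        by (rule integral_diff[symmetric]; rule weak_solution_integrable; fact)
      also have "\<dots> \<le> integral {s..t} (\<lambda>r. \<eta>)"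
      proof (rule integral_le)
        show "(\<lambda>r. (inner (grad (x r)) (grad (I v)) - inner (g (x r)) v) -
          (inner (grad (y r)) (grad (I v)) - inner (g (y r)) v)) integrable_on {s..t}"
          by (intro integrable_diff weak_solution_integrable x y st)
        show "(\<lambda>r. \<eta>) integrable_on {s..t}" by (rule integrable_const_ivl)
        fix r assume r: "r \<in> {s..t}"
        have rr: "r \<ge> 0" "r \<in> {0..T}" "s \<in> {0..T}" "t \<in> {0..T}" "dist t r < d1" "dist s r < d1" "dist t r < d2" "dist s r < d2"
          using r st by (auto simp: dist_real_def)
        define w where "w = (z t - z r) + (z s - z r)"
        have wD: "w \<in> D" using D(3) rr by (simp add: w_def D_add D_diff)
        \<comment> \<open>The leading part \<open>2 *\<^sub>R z r\<close> drops out of the gradient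
          term by \<open>I_grad_self\<close> and gives the damping term its sign by
          \<open>g_mono\<close>; only the small \<open>w\<close> has to be estimated.\<close>
        have v: "v = 2 *\<^sub>R z r + w" by (simp add: v_def w_def scaleR_2)
        have nw: "norm w \<le> 2 * \<epsilon>"
          using d(3)[OF rr(4,2,5)] d(3)[OF rr(3,2,6)] norm_triangle_ineq[of "z t - z r" "z s - z r"]
          by (simp add: w_def dist_norm)
        have "grad w = (grad (z t) - grad (z r)) + (grad (z s) - grad (z r))"
          using D(3) rr by (simp add: w_def grad_add grad_diff D_diff)
        then have ngw: "norm (grad w) \<le> 2 * \<epsilon>"
          using d(4)[OF rr(4,2,7)] d(4)[OF rr(3,2,8)]
            norm_triangle_ineq[of "grad (z t) - grad (z r)" "grad (z s) - grad (z r)"]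
          by (simp add: dist_norm)
        have "inner (grad (z r)) (grad (I v)) = - inner (grad (I (z r))) (grad v)"
          using I_grad[of "z r" v] D(3)[OF rr(1)] vD by simp
        also have "grad v = 2 *\<^sub>R grad (z r) + grad w"
          unfolding v using D(3)[OF rr(1)] wD by (simp add: grad_add grad_scaleR D_scaleR)
        also have "- inner (grad (I (z r))) (2 *\<^sub>R grad (z r) + grad w) = - inner (grad (I (z r))) (grad w)"
          using I_grad_self[OF D(3)[OF rr(1)]] by (simp add: inner_add_right inner_commute)
        also have "\<dots> \<le> norm (grad (I (z r))) * norm (grad w)"
          using Cauchy_Schwarz_ineq2[of "grad (I (z r))" "grad w"] by linarith
        also have "norm (grad (I (z r))) = norm (grad (z r))"
          using I_grad[of "z r" "I (z r)"] D(3)[OF rr(1)] grad_minus[OF D(3)[OF rr(1)]]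
          by (simp add: I_D I_I norm_eq_sqrt_inner)
        also have "norm (grad (z r)) * norm (grad w) \<le> K * (2 * \<epsilon>)"
          using K rr ngw by (intro mult_mono) auto
        finally have 1: "inner (grad (z r)) (grad (I v)) \<le> K * (2 * \<epsilon>)" .
        have "- inner (g (x r) - g (y r)) v = - 2 * inner (g (x r) - g (y r)) (x r - y r) - inner (g (x r) - g (y r)) w"
          by (simp add: v z_def inner_add_right)
        also have "\<dots> \<le> - inner (g (x r) - g (y r)) w" using g_mono[of "x r" "y r"] by simp
        also have "\<dots> \<le> norm (g (x r) - g (y r)) * norm w"
          using Cauchy_Schwarz_ineq2[of "g (x r) - g (y r)" w] by linarith
        also have "\<dots> \<le> K * (2 * \<epsilon>)" using K rr nw by (intro mult_mono) auto
        finally have 2: "- inner (g (x r) - g (y r)) v \<le> K * (2 * \<epsilon>)" .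
        have "(inner (grad (x r)) (grad (I v)) - inner (g (x r)) v) -
          (inner (grad (y r)) (grad (I v)) - inner (g (y r)) v) =
          inner (grad (z r)) (grad (I v)) - inner (g (x r) - g (y r)) v"
          by (simp add: gz[OF rr(1)] inner_diff_left)
        also have "\<dots> \<le> K * (2 * \<epsilon>) + K * (2 * \<epsilon>)" using 1 2 by linarith
        also have "\<dots> = \<eta>" using K by (simp add: \<epsilon>_def)
        finally show "(inner (grad (x r)) (grad (I v)) - inner (g (x r)) v) -
          (inner (grad (y r)) (grad (I v)) - inner (g (y r)) v) \<le> \<eta>" .
      qed
      also have "\<dots> = \<eta> * (t - s)" using st by simp
      finally show "(norm (z t))\<^sup>2 - (norm (z s))\<^sup>2 \<le> \<eta> * (t - s)" .
    qed
  qed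
  then show ?thesis using xy0 by (simp add: z_def)
qed

section \<open>The approximate flows\<close>

definition Fn :: "nat \<Rightarrow> 'h \<Rightarrow> 'h" where "Fn n x = - I (A (ep n) x) - gn n x"

lemma Fn_lip: "\<exists>L. \<forall>x y. norm (Fn n x - Fn n y) \<le> L * norm (x - y)"
proof -
  obtain L where L: "\<And>x y. norm (gn n x - gn n y) \<le> L * norm (x - y)" using gn_lip by blast
  have "norm (Fn n x - Fn n y) \<le> (1 / ep n + L) * norm (x - y)" for x y
  proof -
    have "Fn n x - Fn n y = - (I (A (ep n) (x - y)) + (gn n x - gn n y))"
      by (simp add: Fn_def A_diff[OF ep_pos] I_diff)
    then have "norm (Fn n x - Fn n y) = norm (I (A (ep n) (x - y)) + (gn n x - gn n y))"
      by (simp only: norm_minus_cancel)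
    also have "\<dots> \<le> norm (A (ep n) (x - y)) + norm (gn n x - gn n y)"
      using norm_triangle_ineq[of "I (A (ep n) (x - y))" "gn n x - gn n y"] by (simp add: norm_I)
    also have "\<dots> \<le> norm (x - y) / ep n + L * norm (x - y)"
      using norm_A_le[OF ep_pos] L by (intro add_mono) auto
    finally show ?thesis by (simp add: algebra_simps)
  qed
  then show ?thesis by blast
qed

text \<open>The Schroedinger part is skew and contributes nothing, so the monotonicity of
  \<open>gn\<close> decides. The contraction of flows, and through it the bound on their speed, rest
  on this inequality.\<close>

lemma Fn_dissipative: "inner (x - y) (Fn n x - Fn n y) \<le> 0"
proof -
  have "inner (x - y) (Fn n x - Fn n y) = - inner (x - y) (I (A (ep n) (x - y))) - inner (gn n x - gn n y) (x - y)"
    by (simp add: Fn_def A_diff[OF ep_pos] I_diff inner_diff_left inner_diff_right inner_commute)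
  also have "inner (x - y) (I (A (ep n) (x - y))) = 0"
    using A_I_self[OF ep_pos, of n "x - y"] I_skew[of "A (ep n) (x - y)" "x - y"] by (simp add: inner_commute)
  finally show ?thesis using gn_mono by simp
qed

lemma Fn_0: "Fn n 0 = 0"
  using A_scaleR[OF ep_pos, of n 0 0] I_scaleR[of 0 0] by (simp add: Fn_def gn_0)

definition flow :: "nat \<Rightarrow> (real \<Rightarrow> 'h) \<Rightarrow> bool" where
  "flow n u \<longleftrightarrow> (\<forall>t\<ge>0. (u has_vector_derivative Fn n (u t)) (at t within {0..}))"

lemma flow_sub: "flow n u \<Longrightarrow> 0 \<le> a \<Longrightarrow> a \<le> t \<Longrightarrow> (u has_vector_derivative Fn n (u t)) (at t within {a..b})"
  unfolding flow_def by (rule has_vector_derivative_within_subset[of _ _ _ "{0..}"]) auto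

lemma flow_continuous: "flow n u \<Longrightarrow> continuous_on {0..} u"
  unfolding flow_def continuous_on_eq_continuous_within
  using has_vector_derivative_continuous by fastforce

lemma flow_contract:
  assumes "flow n x" "flow n y" "t \<ge> 0" shows "norm (x t - y t) \<le> norm (x 0 - y 0)"
proof -
  have "inner (x t - y t) (x t - y t) - inner (x 0 - y 0) (x 0 - y 0) \<le> 0 * (t - 0)"
  proof (rule derivative_bound_imp_diff_le[OF assms(3)])
    fix s assume s: "0 \<le> s" "s \<le> t"
    have "((\<lambda>s. x s - y s) has_vector_derivative (Fn n (x s) - Fn n (y s))) (at s within {0..t})"
      by (intro has_vector_derivative_diff flow_sub assms s) auto
    from inner_has_vector_derivative[OF this this]
    show "((\<lambda>s. inner (x s - y s) (x s - y s)) has_vector_derivative 2 * inner (x s - y s) (Fn n (x s) - Fn n (y s)))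
      (at s within {0..t})" by (simp add: inner_commute)
    show "2 * inner (x s - y s) (Fn n (x s) - Fn n (y s)) \<le> 0" using Fn_dissipative by simp
  qed
  then show ?thesis by (simp add: norm_eq_sqrt_inner)
qed

lemma flow_zero: "flow n (\<lambda>_. 0)" by (simp add: flow_def Fn_0)

lemma flow_norm: "flow n u \<Longrightarrow> t \<ge> 0 \<Longrightarrow> norm (u t) \<le> norm (u 0)"
  using flow_contract[OF _ flow_zero] by fastforce

lemma flow_shift:
  assumes u: "flow n u" and h: "h \<ge> 0" shows "flow n (\<lambda>t. u (t + h))"
  unfolding flow_def
proof (intro allI impI)
  fix t :: real assume t: "t \<ge> 0"
  have "(u has_vector_derivative Fn n (u (t + h))) (at (t + h) within (\<lambda>t. t + h) ` {0..})"
    by (rule has_vector_derivative_within_subset[of _ _ _ "{0..}"]) (use u h t in \<open>auto simp: flow_def\<close>)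
  moreover have "((\<lambda>t. t + h) has_vector_derivative 1) (at t within {0..})"
    by (auto intro!: derivative_eq_intros)
  ultimately have "(u \<circ> (\<lambda>t. t + h) has_vector_derivative 1 *\<^sub>R Fn n (u (t + h))) (at t within {0..})"
    by (intro vector_diff_chain_within)
  then show "((\<lambda>t. u (t + h)) has_vector_derivative Fn n (u (t + h))) (at t within {0..})"
    by (simp add: o_def)
qed

text \<open>A time shift of a flow is again a flow, so by contraction the distance between
  \<open>u (t + h)\<close> and \<open>u t\<close> does not exceed its value at time 0. Dividing by
  \<open>h\<close> gives the bound without a second time derivative, which \<open>gn\<close> could
  not provide.\<close>

lemma flow_speed:
  assumes u: "flow n u" and t: "t \<ge> 0" shows "norm (Fn n (u t)) \<le> norm (Fn n (u 0))"
proof (rule LIMSEQ_le)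
  show "(\<lambda>k. norm (real (Suc k) *\<^sub>R (u (t + 1 / real (Suc k)) - u t))) \<longlonglongrightarrow> norm (Fn n (u t))"
    using u t by (intro tendsto_norm right_difference_quotients) (auto simp: flow_def)
  show "(\<lambda>k. norm (real (Suc k) *\<^sub>R (u (0 + 1 / real (Suc k)) - u 0))) \<longlonglongrightarrow> norm (Fn n (u 0))"
    using u t by (intro tendsto_norm right_difference_quotients) (auto simp: flow_def)
  show "\<exists>N. \<forall>k\<ge>N. norm (real (Suc k) *\<^sub>R (u (t + 1 / real (Suc k)) - u t)) \<le>
      norm (real (Suc k) *\<^sub>R (u (0 + 1 / real (Suc k)) - u 0))"
  proof (intro exI allI impI)
    fix k
    have "norm (u (t + 1 / real (Suc k)) - u t) \<le> norm (u (0 + 1 / real (Suc k)) - u 0)"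
      using flow_contract[OF flow_shift[OF u, of "1 / real (Suc k)"] u t] by simp
    then show "norm (real (Suc k) *\<^sub>R (u (t + 1 / real (Suc k)) - u t)) \<le>
      norm (real (Suc k) *\<^sub>R (u (0 + 1 / real (Suc k)) - u 0))"
      by (simp only: norm_scaleR) (rule mult_left_mono, auto)
  qed
qed

lemma flow_exists: "\<exists>u. flow n u \<and> u 0 = x0"
proof -
  obtain L where "\<And>x y. norm (Fn n x - Fn n y) \<le> L * norm (x - y)" using Fn_lip by blast
  from picard_global[OF this, of x0] show ?thesis unfolding flow_def by metis
qed

lemma gn_bound: "norm (gn n x) \<le> c + cb * (1 + norm x)"
proof -
  have "norm (gn n x) \<le> norm (gn n x - g x) + norm (g x)"
    using norm_triangle_sub[of "gn n x" "g x"] by linarith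
  also have "norm (gn n x - g x) \<le> c"
    using gn_g[of n x] mult_left_le[of "(1/4::real)^n" c] c_nonneg power_le_one[of "1/4::real" n] by linarith
  finally show ?thesis using g_bound[of x] by linarith
qed

end

context closed_skew_form begin

lemma A_continuous: "e > 0 \<Longrightarrow> continuous_on S f \<Longrightarrow> continuous_on S (\<lambda>t. A e (f t))"
  by (rule bounded_linear.continuous_on[OF bounded_linear_A])

lemma A_tendsto: "e > 0 \<Longrightarrow> (f \<longlongrightarrow> l) F \<Longrightarrow> ((\<lambda>t. A e (f t)) \<longlongrightarrow> A e l) F"
  by (rule bounded_linear.tendsto[OF bounded_linear_A])

end

lemma has_integral_inner_vector_derivative:
  fixes x :: "real \<Rightarrow> 'a::real_inner"
  assumes "a \<le> b" "\<And>t. a \<le> t \<Longrightarrow> t \<le> b \<Longrightarrow> (x has_vector_derivative x' t) (at t within {a..b})"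
  shows "((\<lambda>t. inner (x' t) v) has_integral inner (x b - x a) v) {a..b}"
  unfolding inner_diff_left
proof (rule fundamental_theorem_of_calculus[OF assms(1)])
  fix t assume "t \<in> {a..b}"
  then show "((\<lambda>t. inner (x t) v) has_vector_derivative inner (x' t) v) (at t within {a..b})"
    using inner_has_vector_derivative[OF assms(2)[of t] has_vector_derivative_const] by simp
qed

section \<open>Convergence of the approximations\<close>

context damped_form begin

text \<open>Starting from \<open>J (lam n) \<phi>\<close> with \<open>lam n = sqrt (ep n)\<close> keeps \<open>\<parallel>A (ep n) u\<parallel>\<close> of size \<open>2 ^ n\<close> and still
  costs only a geometrically small error in the initial datum.\<close>

definition lam :: "nat \<Rightarrow> real" where "lam n = (1/4) ^ n"

lemma lam_pos: "lam n > 0" by (simp add: lam_def)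

lemma lam_sqrt: "sqrt (lam n) = (1/2)^n"
proof -
  have "lam n = ((1/2)^n)\<^sup>2"
    unfolding lam_def power2_eq_square power_mult_distrib[symmetric] by simp
  then show ?thesis by simp
qed

definition approx :: "'h \<Rightarrow> nat \<Rightarrow> real \<Rightarrow> 'h" where
  "approx \<phi> n = (SOME u. flow n u \<and> u 0 = J (lam n) \<phi>)"

context
  fixes \<phi> assumes phi: "\<phi> \<in> D"
begin

lemma approx_flow: "flow n (approx \<phi> n)" and approx_0: "approx \<phi> n 0 = J (lam n) \<phi>"
  using someI_ex[OF flow_exists, of n "J (lam n) \<phi>"] by (auto simp: approx_def)

lemma approx_norm: "t \<ge> 0 \<Longrightarrow> norm (approx \<phi> n t) \<le> norm \<phi>"
  using flow_norm[OF approx_flow, of t n] norm_J_le[OF lam_pos, of n \<phi>] by (simp add: approx_0)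

text \<open>The gradient term bounds the Yosida term of the initial datum. The bound of the
  nonlinearity enters twice, once at time 0 and once at the time considered.\<close>

definition KK where "KK = norm (grad \<phi>) + 2 * (c + cb * (1 + norm \<phi>))"

lemma gn_approx: "t \<ge> 0 \<Longrightarrow> norm (gn n (approx \<phi> n t)) \<le> c + cb * (1 + norm \<phi>)"
  by (rule order_trans[OF gn_bound]) (use approx_norm cb_nonneg in \<open>auto intro!: mult_left_mono\<close>)

lemma KK_nonneg: "KK \<ge> 0"
  unfolding KK_def using c_nonneg cb_nonneg by simp

text \<open>The Yosida term is read off the equation from speed and nonlinearity, and the speed
  never exceeds its initial value. At time 0 the term is at most the norm of
  \<open>A (lam n) \<phi>\<close>, which is bounded by the norm of \<open>grad \<phi>\<close>
  divided by \<open>sqrt (lam n)\<close>, that is, multiplied by 2^n.\<close>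

lemma norm_A_approx: assumes t: "t \<ge> 0" shows "norm (A (ep n) (approx \<phi> n t)) \<le> KK * 2 ^ n"
proof -
  let ?u = "approx \<phi> n"
  let ?b = "c + cb * (1 + norm \<phi>)"
  have b0: "?b \<ge> 0" using c_nonneg cb_nonneg by simp
  have 1: "norm (A (ep n) (?u 0)) \<le> norm (A (lam n) \<phi>)"
    unfolding approx_0
    by (rule norm_A_le_strong[OF ep_pos J_D[OF lam_pos]]) (use A_inner[OF lam_pos] in auto)
  have "lam n * (norm (A (lam n) \<phi>))\<^sup>2 \<le> (norm (grad \<phi>))\<^sup>2" by (rule norm_A_sq_le[OF lam_pos phi])
  then have "sqrt (lam n * (norm (A (lam n) \<phi>))\<^sup>2) \<le> sqrt ((norm (grad \<phi>))\<^sup>2)" by (rule real_sqrt_le_mono)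
  then have "(1/2)^n * norm (A (lam n) \<phi>) \<le> norm (grad \<phi>)"
    by (simp add: real_sqrt_mult lam_sqrt)
  then have "2^n * ((1/2)^n * norm (A (lam n) \<phi>)) \<le> 2^n * norm (grad \<phi>)" by (intro mult_left_mono) auto
  then have 2: "norm (A (lam n) \<phi>) \<le> norm (grad \<phi>) * 2^n"
    by (simp add: mult.assoc[symmetric] power_mult_distrib[symmetric] mult.commute)
  have "norm (A (ep n) (?u t)) = norm (I (A (ep n) (?u t)))" by (simp add: norm_I)
  also have "I (A (ep n) (?u t)) = - (Fn n (?u t) + gn n (?u t))" by (simp add: Fn_def)
  also have "norm (- (Fn n (?u t) + gn n (?u t))) \<le> norm (Fn n (?u t)) + norm (gn n (?u t))"
    unfolding norm_minus_cancel by (rule norm_triangle_ineq)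
  also have "norm (Fn n (?u t)) \<le> norm (Fn n (?u 0))" by (rule flow_speed[OF approx_flow t])
  also have "norm (Fn n (?u 0)) = norm (I (A (ep n) (?u 0)) + gn n (?u 0))"
    by (metis Fn_def diff_conv_add_uminus minus_add_distrib norm_minus_cancel)
  also have "\<dots> \<le> norm (A (ep n) (?u 0)) + norm (gn n (?u 0))"
    using norm_triangle_ineq[of "I (A (ep n) (?u 0))"] by (simp add: norm_I)
  finally have "norm (A (ep n) (?u t)) \<le> norm (grad \<phi>) * 2^n + 2 * ?b"
    using 1 2 gn_approx[OF t, of n] gn_approx[of 0 n] by simp
  also have "2 * ?b \<le> 2 * ?b * 2^n" using b0 by (simp add: mult_le_cancel_left1)
  finally show ?thesis by (simp add: KK_def algebra_simps)
qed

text \<open>The first summand is twice the Schroedinger error 2 * KK^2, where one of the bounds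
  belongs to level n + 1 and supplies the inner factor 2; the second is twice the truncation error
  \<open>(2 * norm \<phi>) * (2 * c)\<close>.\<close>

definition BB where "BB = 4 * KK\<^sup>2 + 8 * c * norm \<phi>"

lemma BB_nonneg: "BB \<ge> 0" unfolding BB_def using c_nonneg by simp

lemma approx_step:
  assumes t: "t \<ge> 0"
  shows "(norm (approx \<phi> n t - approx \<phi> (Suc n) t))\<^sup>2 \<le> (BB * t + 4 * (norm (grad \<phi>))\<^sup>2) * (1/4)^n"
proof -
  let ?u = "approx \<phi> n" and ?v = "approx \<phi> (Suc n)"
  have "inner (?u t - ?v t) (?u t - ?v t) - inner (?u 0 - ?v 0) (?u 0 - ?v 0) \<le> (BB * (1/4)^n) * (t - 0)"
  proof (rule derivative_bound_imp_diff_le[OF t])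
    fix s assume s: "0 \<le> s" "s \<le> t"
    have "((\<lambda>s. ?u s - ?v s) has_vector_derivative (Fn n (?u s) - Fn (Suc n) (?v s))) (at s within {0..t})"
      by (intro has_vector_derivative_diff flow_sub approx_flow s) auto
    from inner_has_vector_derivative[OF this this]
    show "((\<lambda>s. inner (?u s - ?v s) (?u s - ?v s)) has_vector_derivative
        2 * inner (?u s - ?v s) (Fn n (?u s) - Fn (Suc n) (?v s))) (at s within {0..t})"
      by (simp add: inner_commute)
    define a b where "a = ?u s" and "b = ?v s"
    define p q where "p = A (ep n) a" and "q = A (ep (Suc n)) b"
    define e m where "e = ep n" and "m = ep (Suc n)"
    have e: "e > 0" "m > 0" by (auto simp: e_def m_def ep_pos)
    have ab: "a = J e a + e *\<^sub>R p" "b = J m b + m *\<^sub>R q"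
      using J_eq_A[OF e(1), of a] J_eq_A[OF e(2), of b] by (simp_all add: p_def q_def e_def m_def)
    \<comment> \<open>\<open>p\<close> and \<open>q\<close> are minus the Laplacians of the two
      resolvents, so \<open>p - q\<close> is minus the Laplacian of \<open>w\<close>, and its
      pairing with \<open>I w\<close> vanishes.\<close>
    define w where "w = J e a - J m b"
    have wD: "w \<in> D" by (simp add: w_def D_diff J_D e)
    have abw: "a - b = w + (e *\<^sub>R p - m *\<^sub>R q)" using ab by (simp add: w_def algebra_simps)
    have "inner (p - q) (I w) = inner (grad (J e a)) (grad (I w)) - inner (grad (J m b)) (grad (I w))"
      using A_inner[OF e(1) I_D[OF wD], of a] A_inner[OF e(2) I_D[OF wD], of b]
      by (simp add: p_def q_def e_def m_def inner_diff_left)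
    also have "\<dots> = inner (grad w) (grad (I w))"
      by (simp add: w_def grad_diff J_D e inner_diff_left)
    also have "\<dots> = 0" by (rule I_grad_self[OF wD])
    finally have pqw: "inner (p - q) (I w) = 0" .
    have "inner (a - b) (- I (p - q)) = inner (I (a - b)) (p - q)" by (simp add: I_skew)
    also have "\<dots> = inner (p - q) (I w) + inner (p - q) (I (e *\<^sub>R p - m *\<^sub>R q))"
      by (simp only: abw I_add inner_add_left inner_add_right inner_commute)
    \<comment> \<open>The diagonal terms vanish and the two mixed ones combine because
      \<open>I\<close> is skew. What survives carries the small factor \<open>e - m\<close>, which
      beats the growth of \<open>p\<close> and \<open>q\<close>.\<close>
    also have "\<dots> = (e - m) * inner p (I q)"
    proof -
      have "inner q (I p) = - inner p (I q)" using I_skew[of p q] by (simp add: inner_commute)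
      moreover have "inner p (I p) = 0" "inner q (I q) = 0" using I_self by (simp_all add: inner_commute)
      ultimately show ?thesis unfolding pqw
        by (simp add: I_diff I_scaleR inner_diff_left inner_diff_right algebra_simps)
    qed
    also have "\<dots> \<le> (e - m) * (norm p * norm q)"
    proof (rule mult_left_mono)
      show "inner p (I q) \<le> norm p * norm q"
        using norm_cauchy_schwarz[of p "I q"] by (simp add: norm_I)
      show "0 \<le> e - m" using ep_lt[of n "Suc n"] e by (simp add: e_def m_def)
    qed
    also have "\<dots> \<le> e * ((KK * 2^n) * (KK * 2^Suc n))"
      using norm_A_approx[OF s(1), of n] norm_A_approx[OF s(1), of "Suc n"] e KK_nonneg
      by (intro mult_mono) (auto simp: p_def q_def a_def b_def)
    \<comment> \<open>This product is where the base 16 of \<open>ep\<close> is decided: two factors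
      2^n have to be absorbed and a decay 4^-n must remain.\<close>
    also have "\<dots> = 2 * KK\<^sup>2 * ((1/16)^n * 2^n * 2^n)"
      by (simp add: e_def ep_def power2_eq_square)
    also have "(1/16)^n * 2^n * 2^n = (1/4::real)^n" by (simp add: power_mult_distrib[symmetric])
    finally have 1: "inner (a - b) (- I (p - q)) \<le> 2 * KK\<^sup>2 * (1/4)^n" .
    have nab: "norm (a - b) \<le> 2 * norm \<phi>"
      using norm_triangle_ineq4[of a b] approx_norm[OF s(1), of n] approx_norm[OF s(1), of "Suc n"]
      unfolding a_def b_def by linarith
    have "norm (gn n b - gn (Suc n) b) \<le> c * (1/4)^n + c * (1/4)^Suc n"
      using norm_triangle_ineq4[of "gn n b - g b" "gn (Suc n) b - g b"] gn_g[of n b] gn_g[of "Suc n" b] by simp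
    also have "\<dots> \<le> 2 * c * (1/4)^n" using c_nonneg by (simp add: mult_left_mono)
    finally have gd: "norm (gn n b - gn (Suc n) b) \<le> 2 * c * (1/4)^n" .
    have "inner (a - b) (gn n a - gn (Suc n) b) = inner (gn n a - gn n b) (a - b) + inner (a - b) (gn n b - gn (Suc n) b)"
      by (simp add: inner_diff_left inner_diff_right inner_commute)
    also have "\<dots> \<ge> inner (a - b) (gn n b - gn (Suc n) b)" using gn_mono[of n a b] by simp
    moreover have "\<bar>inner (a - b) (gn n b - gn (Suc n) b)\<bar> \<le> (2 * norm \<phi>) * (2 * c * (1/4)^n)"
      by (rule order_trans[OF Cauchy_Schwarz_ineq2]) (rule mult_mono[OF nab gd], auto)
    ultimately have 2: "- inner (a - b) (gn n a - gn (Suc n) b) \<le> (2 * norm \<phi>) * (2 * c * (1/4)^n)" by linarith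
    have "inner (a - b) (Fn n a - Fn (Suc n) b) = inner (a - b) (- I (p - q)) - inner (a - b) (gn n a - gn (Suc n) b)"
      by (simp add: Fn_def p_def q_def I_diff inner_diff_right algebra_simps)
    also have "\<dots> \<le> 2 * KK\<^sup>2 * (1/4)^n + (2 * norm \<phi>) * (2 * c * (1/4)^n)" using 1 2 by linarith
    finally show "2 * inner (?u s - ?v s) (Fn n (?u s) - Fn (Suc n) (?v s)) \<le> BB * (1/4)^n"
      by (simp add: BB_def a_def b_def algebra_simps)
  qed
  then have 1: "(norm (?u t - ?v t))\<^sup>2 \<le> (norm (?u 0 - ?v 0))\<^sup>2 + (BB * (1/4)^n) * t"
    by (simp add: power2_norm_eq_inner)
  have J: "norm (\<phi> - J (lam k) \<phi>) \<le> norm (grad \<phi>) * (1/2)^k" for k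
  proof -
    have "(norm (\<phi> - J (lam k) \<phi>))\<^sup>2 \<le> lam k * En (lam k) \<phi>" by (rule norm_diff_J[OF lam_pos])
    also have "\<dots> \<le> lam k * (norm (grad \<phi>))\<^sup>2"
      using En_le_grad(1)[OF lam_pos phi] lam_pos[of k] by (intro mult_left_mono) auto
    finally have "sqrt ((norm (\<phi> - J (lam k) \<phi>))\<^sup>2) \<le> sqrt (lam k * (norm (grad \<phi>))\<^sup>2)" by (rule real_sqrt_le_mono)
    then show ?thesis by (simp add: real_sqrt_mult lam_sqrt mult.commute)
  qed
  have "norm (?u 0 - ?v 0) \<le> norm (\<phi> - J (lam n) \<phi>) + norm (\<phi> - J (lam (Suc n)) \<phi>)"
    using norm_triangle_ineq4[of "\<phi> - J (lam (Suc n)) \<phi>" "\<phi> - J (lam n) \<phi>"] by (simp add: approx_0 )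
  also have "\<dots> \<le> norm (grad \<phi>) * (1/2)^n + norm (grad \<phi>) * (1/2)^Suc n" by (intro add_mono J)
  also have "\<dots> \<le> 2 * norm (grad \<phi>) * (1/2)^n" by simp
  finally have "(norm (?u 0 - ?v 0))\<^sup>2 \<le> (2 * norm (grad \<phi>) * (1/2)^n)\<^sup>2" by (intro power_mono) auto
  also have "\<dots> = 4 * (norm (grad \<phi>))\<^sup>2 * (1/4)^n"
  proof -
    have "((1/2::real)^n)\<^sup>2 = (1/4)^n" unfolding power2_eq_square power_mult_distrib[symmetric] by simp
    then show ?thesis by (simp only: power_mult_distrib) simp
  qed
  finally show ?thesis using 1 by (simp add: algebra_simps)
qed

lemma approx_uniform_limit:
  assumes T: "T \<ge> 0" shows "\<exists>u. uniform_limit {0..T} (approx \<phi>) u sequentially"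
proof -
  define C where "C = sqrt (BB * T + 4 * (norm (grad \<phi>))\<^sup>2)"
  have b: "norm (approx \<phi> (Suc n) t - approx \<phi> n t) \<le> C * (1/2)^n" if t: "t \<in> {0..T}" for t n
  proof -
    have "(norm (approx \<phi> n t - approx \<phi> (Suc n) t))\<^sup>2 \<le> (BB * t + 4 * (norm (grad \<phi>))\<^sup>2) * (1/4)^n"
      using t by (intro approx_step) auto
    also have "\<dots> \<le> (BB * T + 4 * (norm (grad \<phi>))\<^sup>2) * lam n"
      unfolding lam_def using t BB_nonneg by (intro mult_right_mono add_mono mult_left_mono) auto
    finally have "sqrt ((norm (approx \<phi> n t - approx \<phi> (Suc n) t))\<^sup>2) \<le> sqrt ((BB * T + 4 * (norm (grad \<phi>))\<^sup>2) * lam n)"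
      by (rule real_sqrt_le_mono)
    then show ?thesis by (simp add: C_def real_sqrt_mult lam_sqrt norm_minus_commute)
  qed
  have "uniformly_convergent_on {0..T} (\<lambda>n x. \<Sum>i<n. approx \<phi> (Suc i) x - approx \<phi> i x)"
    by (rule Weierstrass_m_test'[where M="\<lambda>n. C * (1/2)^n"]) (use b in \<open>auto intro!: summable_mult\<close>)
  then obtain s where "uniform_limit {0..T} (\<lambda>n x. \<Sum>i<n. approx \<phi> (Suc i) x - approx \<phi> i x) s sequentially"
    by (auto simp: uniformly_convergent_on_def)
  moreover have "(\<Sum>i<n. approx \<phi> (Suc i) x - approx \<phi> i x) = approx \<phi> n x - approx \<phi> 0 x" for n x
    using sum_lessThan_telescope[of "\<lambda>i. approx \<phi> i x" n] by simp
  ultimately have "uniform_limit {0..T} (\<lambda>n x. approx \<phi> n x - approx \<phi> 0 x) s sequentially"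
    by simp
  from uniform_limit_add[OF this uniform_limit_const[of "approx \<phi> 0"]]
  show ?thesis by auto
qed

definition sol where "sol t = lim (\<lambda>n. approx \<phi> n t)"

lemma approx_uniform: assumes T: "T \<ge> 0" shows "uniform_limit {0..T} (approx \<phi>) sol sequentially"
proof -
  obtain w where w: "uniform_limit {0..T} (approx \<phi>) w sequentially" using approx_uniform_limit[OF T] by blast
  have "sol t = w t" if "t \<in> {0..T}" for t
    using tendsto_uniform_limitI[OF w that] unfolding sol_def by (rule limI)
  then show ?thesis using w by (metis uniform_limit_cong')
qed

lemma approx_lim: "t \<ge> 0 \<Longrightarrow> (\<lambda>n. approx \<phi> n t) \<longlonglongrightarrow> sol t"
  using tendsto_uniform_limitI[OF approx_uniform, of t t] by auto

lemma approx_continuous: "0 \<le> s \<Longrightarrow> continuous_on {s..t} (approx \<phi> n)"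
  by (rule continuous_on_subset[OF flow_continuous[OF approx_flow]]) auto

lemma sol_continuous: "continuous_on {0..} sol"
proof (rule continuous_on_nonneg_reals)
  fix T :: real assume "T \<ge> 0"
  from uniform_limit_theorem[OF _ approx_uniform[OF this]] show "continuous_on {0..T} sol"
    using approx_continuous by auto
qed

lemma sol_norm: "t \<ge> 0 \<Longrightarrow> norm (sol t) \<le> norm \<phi>"
  by (rule LIMSEQ_le_const2[OF tendsto_norm[OF approx_lim]]) (use approx_norm in auto)

section \<open>Energy identities\<close>

text \<open>The level \<open>m\<close> of the energy is kept separate from the level
  \<open>n\<close> of the flow, so that \<open>n\<close> can tend to infinity while
  \<open>A (ep m)\<close> stays a fixed bounded operator. The Schroedinger part disappears by
  \<open>A_A_I\<close> for different levels and by \<open>I_self\<close> for equal ones.\<close>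

lemma energy_identity_approx:
  assumes st: "0 \<le> s" "s \<le> t"
  shows "((\<lambda>r. 2 * inner (A (ep m) (approx \<phi> n r)) (gn n (approx \<phi> n r))) has_integral
    (En (ep m) (approx \<phi> n s) - En (ep m) (approx \<phi> n t))) {s..t}"
proof -
  let ?u = "approx \<phi> n"
  have "((\<lambda>r. - (2 * inner (A (ep m) (?u r)) (gn n (?u r)))) has_integral (En (ep m) (?u t) - En (ep m) (?u s))) {s..t}"
  proof (rule fundamental_theorem_of_calculus[OF st(2)])
    fix r assume r: "r \<in> {s..t}"
    have d: "(?u has_vector_derivative Fn n (?u r)) (at r within {s..t})"
      using r st by (intro flow_sub approx_flow) auto
    have dA: "((\<lambda>r. A (ep m) (?u r)) has_vector_derivative A (ep m) (Fn n (?u r))) (at r within {s..t})"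
      by (rule bounded_linear.has_vector_derivative[OF bounded_linear_A[OF ep_pos] d])
    have *: "inner (A (ep m) (?u r)) (I (A (ep n) (?u r))) = 0"
    proof (cases "m = n")
      case True then show ?thesis using I_self by (simp add: inner_commute)
    next
      case False
      then have "ep m \<noteq> ep n" using ep_lt[of m n] ep_lt[of n m] ep_pos[of n] ep_pos[of m]
        by (cases m n rule: linorder_cases) auto
      then show ?thesis by (rule A_A_I[OF ep_pos ep_pos])
    qed
    have "inner (A (ep m) (?u r)) (Fn n (?u r)) + inner (A (ep m) (Fn n (?u r))) (?u r)
       = - (2 * inner (A (ep m) (?u r)) (gn n (?u r)))"
    proof -
      have "inner (A (ep m) (Fn n (?u r))) (?u r) = inner (A (ep m) (?u r)) (Fn n (?u r))"
        unfolding A_sym[OF ep_pos, of m "Fn n (?u r)" "?u r"] by (rule inner_commute)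
      moreover have "inner (A (ep m) (?u r)) (Fn n (?u r)) = - inner (A (ep m) (?u r)) (gn n (?u r))"
        using * by (simp add: Fn_def inner_diff_right)
      ultimately show ?thesis by simp
    qed
    with inner_has_vector_derivative[OF dA d]
    show "((\<lambda>r. En (ep m) (?u r)) has_vector_derivative - (2 * inner (A (ep m) (?u r)) (gn n (?u r)))) (at r within {s..t})"
      by (simp add: En_def)
  qed
  from has_integral_neg[OF this] show ?thesis by simp
qed

lemma En_tendsto: "(x \<longlongrightarrow> l) F \<Longrightarrow> ((\<lambda>t. En (ep m) (x t)) \<longlongrightarrow> En (ep m) l) F"
  unfolding En_def by (intro tendsto_intros A_tendsto ep_pos)

text \<open>Energy decreases because of \<open>markov\<close>, and the resolvent regularization of
  the datum does not raise it. The bound is uniform in both levels, so it passes to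
  \<open>sol\<close> and there, through \<open>bounded_energy\<close>, yields membership in
  \<open>D\<close>.\<close>

lemma En_approx_le: assumes t: "t \<ge> 0" shows "En (ep m) (approx \<phi> n t) \<le> (norm (grad \<phi>))\<^sup>2"
proof -
  have "0 \<le> En (ep m) (approx \<phi> n 0) - En (ep m) (approx \<phi> n t)"
    by (rule has_integral_nonneg[OF energy_identity_approx]) (use t markov[OF ep_pos] in auto)
  then have "En (ep m) (approx \<phi> n t) \<le> En (ep m) (J (lam n) \<phi>)" by (simp add: approx_0)
  also have "\<dots> \<le> (norm (grad (J (lam n) \<phi>)))\<^sup>2" by (rule En_le_grad(1)[OF ep_pos J_D[OF lam_pos]])
  also have "\<dots> \<le> (norm (grad \<phi>))\<^sup>2"
    using En_le_grad(2)[OF lam_pos phi] by (intro power_mono) auto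
  finally show ?thesis .
qed

lemma En_sol_le: "t \<ge> 0 \<Longrightarrow> En (ep m) (sol t) \<le> (norm (grad \<phi>))\<^sup>2"
  by (rule LIMSEQ_le_const2[OF En_tendsto[OF approx_lim]]) (use En_approx_le in auto)

lemma gn_approx_lim: assumes t: "t \<ge> 0" shows "(\<lambda>n. gn n (approx \<phi> n t)) \<longlonglongrightarrow> g (sol t)"
proof -
  have "(\<lambda>n. g (approx \<phi> n t)) \<longlonglongrightarrow> g (sol t)"
    using g_cont approx_lim[OF t] by (auto simp: continuous_on_eq_continuous_at continuous_at_sequentially comp_def)
  moreover have "(\<lambda>n. gn n (approx \<phi> n t) - g (approx \<phi> n t)) \<longlonglongrightarrow> 0"
  proof (rule Lim_null_comparison)
    show "\<forall>\<^sub>F n in sequentially. norm (gn n (approx \<phi> n t) - g (approx \<phi> n t)) \<le> c * (1/4)^n" using gn_g by simp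
    have "(\<lambda>n. c * (1/4::real)^n) \<longlonglongrightarrow> c * 0" by (intro tendsto_intros LIMSEQ_power_zero) simp
    then show "(\<lambda>n. c * (1/4::real)^n) \<longlonglongrightarrow> 0" by simp
  qed
  ultimately have "(\<lambda>n. g (approx \<phi> n t) + (gn n (approx \<phi> n t) - g (approx \<phi> n t))) \<longlonglongrightarrow> g (sol t) + 0"
    by (rule tendsto_add)
  then show ?thesis by simp
qed

lemma sol_0: "sol 0 = \<phi>"
proof -
  have "(\<lambda>n. J (lam n) \<phi>) \<longlonglongrightarrow> sol 0" using approx_lim[of 0] by (simp add: approx_0)
  moreover have "(\<lambda>n. J (lam n) \<phi>) \<longlonglongrightarrow> \<phi>"
  proof (rule LIM_zero_cancel, rule Lim_null_comparison)
    show "\<forall>\<^sub>F n in sequentially. norm (J (lam n) \<phi> - \<phi>) \<le> (1/2)^n * norm (grad \<phi>)"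
    proof (intro always_eventually allI)
      fix n
      have "(norm (\<phi> - J (lam n) \<phi>))\<^sup>2 \<le> lam n * En (lam n) \<phi>" by (rule norm_diff_J[OF lam_pos])
      also have "\<dots> \<le> lam n * (norm (grad \<phi>))\<^sup>2"
        using En_le_grad(1)[OF lam_pos phi] lam_pos[of n] by (intro mult_left_mono) auto
      finally have "sqrt ((norm (\<phi> - J (lam n) \<phi>))\<^sup>2) \<le> sqrt (lam n * (norm (grad \<phi>))\<^sup>2)" by (rule real_sqrt_le_mono)
      then show "norm (J (lam n) \<phi> - \<phi>) \<le> (1/2)^n * norm (grad \<phi>)"
        by (simp add: real_sqrt_mult lam_sqrt norm_minus_commute)
    qed
    have "(\<lambda>n. (1/2::real)^n * norm (grad \<phi>)) \<longlonglongrightarrow> 0 * norm (grad \<phi>)"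
      by (intro tendsto_intros LIMSEQ_power_zero) simp
    then show "(\<lambda>n. (1/2::real)^n * norm (grad \<phi>)) \<longlonglongrightarrow> 0" by simp
  qed
  ultimately show ?thesis by (rule LIMSEQ_unique)
qed

text \<open>Dominated convergence in \<open>n\<close> with \<open>m\<close> fixed:
  \<open>A (ep m)\<close> has norm at most \<open>1 / ep m\<close>, which provides a constant
  majorant.\<close>

lemma energy_identity:
  assumes st: "0 \<le> s" "s \<le> t"
  shows "((\<lambda>r. 2 * inner (A (ep m) (sol r)) (g (sol r))) has_integral
    (En (ep m) (sol s) - En (ep m) (sol t))) {s..t}"
proof -
  let ?f = "\<lambda>n r. 2 * inner (A (ep m) (approx \<phi> n r)) (gn n (approx \<phi> n r))"
  let ?h = "2 * ((norm \<phi> / ep m) * (c + cb * (1 + norm \<phi>)))"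
  have fi: "?f n integrable_on {s..t}" for n using energy_identity_approx[OF st] by (auto simp: integrable_on_def)
  have hi: "(\<lambda>_. ?h) integrable_on {s..t}" by (rule integrable_const_ivl)
  have dom: "norm (?f n r) \<le> ?h" if r: "r \<in> {s..t}" for n r
  proof -
      have r0: "r \<ge> 0" using r st by auto
      have "\<bar>inner (A (ep m) (approx \<phi> n r)) (gn n (approx \<phi> n r))\<bar> \<le>
          norm (A (ep m) (approx \<phi> n r)) * norm (gn n (approx \<phi> n r))" by (rule Cauchy_Schwarz_ineq2)
      also have "\<dots> \<le> (norm \<phi> / ep m) * (c + cb * (1 + norm \<phi>))"
      proof (rule mult_mono)
        show "norm (A (ep m) (approx \<phi> n r)) \<le> norm \<phi> / ep m"
          using order_trans[OF norm_A_le[OF ep_pos] divide_right_mono[OF approx_norm[OF r0]]] ep_pos[of m] by simp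
      qed (use gn_approx[OF r0] ep_pos[of m] in auto)
      finally show ?thesis by (simp add: abs_mult)
  qed
  have lim: "(\<lambda>n. ?f n r) \<longlonglongrightarrow> 2 * inner (A (ep m) (sol r)) (g (sol r))" if "r \<in> {s..t}" for r
    using that st by (intro tendsto_mult tendsto_const tendsto_inner A_tendsto ep_pos approx_lim gn_approx_lim) auto
  note dc = dominated_convergence[OF fi hi dom lim]
  have "integral {s..t} (?f n) = En (ep m) (approx \<phi> n s) - En (ep m) (approx \<phi> n t)" for n
    by (rule integral_unique[OF energy_identity_approx[OF st]])
  moreover have "(\<lambda>n. En (ep m) (approx \<phi> n s) - En (ep m) (approx \<phi> n t)) \<longlonglongrightarrow> En (ep m) (sol s) - En (ep m) (sol t)"
    by (intro tendsto_diff En_tendsto approx_lim order_trans[OF st] st)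
  ultimately have "(\<lambda>n. integral {s..t} (?f n)) \<longlonglongrightarrow> En (ep m) (sol s) - En (ep m) (sol t)"
    by presburger
  from LIMSEQ_unique[OF dc(2) this] integrable_integral[OF dc(1)]
  show ?thesis by presburger
qed

end
end

section \<open>The limit equation\<close>

context damped_form begin

context
  fixes \<phi> assumes phi: "\<phi> \<in> D"
begin

lemma sol_D: "t \<ge> 0 \<Longrightarrow> sol \<phi> t \<in> D"
  using bounded_energy(1)[OF En_sol_le[OF phi]] .

lemma sol_grad_le: "t \<ge> 0 \<Longrightarrow> norm (grad (sol \<phi> t)) \<le> norm (grad \<phi>)"
  using bounded_energy(2)[OF En_sol_le[OF phi]] by (simp add: abs_le_square_iff[symmetric])

lemma g_sol_bound: assumes "t \<ge> 0" shows "norm (g (sol \<phi> t)) \<le> cb * (1 + norm \<phi>)"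
  using order_trans[OF g_bound mult_left_mono[OF add_left_mono[OF sol_norm[OF phi assms]] cb_nonneg]] .

text \<open>For a test vector in the range of a resolvent the gradient term can be rewritten as an
  L2 pairing of \<open>J (ep n) (approx \<phi> n r)\<close> with the fixed vector
  \<open>A l (I f)\<close>. Convergence in L2 then suffices to pass to the limit; the gradients of
  the approximations are not known to converge.\<close>

lemma sol_weak_resolvent:
  assumes st: "0 \<le> s" "s \<le> t" and l: "l > 0"
  shows "((\<lambda>r. inner (grad (sol \<phi> r)) (grad (I (J l f))) - inner (g (sol \<phi> r)) (J l f)) has_integral
    inner (sol \<phi> t - sol \<phi> s) (J l f)) {s..t}"
proof -
  let ?u = "approx \<phi>"
  define v where "v = J l f"
  have Iv: "I v = J l (I f)" by (simp add: v_def J_I l)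
  define w where "w = A l (I f)"
  define P where "P n r = inner (J (ep n) (?u n r)) w - inner (gn n (?u n r)) v" for n r
  have rw: "inner (Fn n x) v = inner (J (ep n) x) w - inner (gn n x) v" for n x
  proof -
    have "inner (Fn n x) v = inner (A (ep n) x) (I v) - inner (gn n x) v"
      by (simp add: Fn_def inner_diff_left I_skew)
    also have "inner (A (ep n) x) (I v) = inner (grad (J (ep n) x)) (grad (J l (I f)))"
      unfolding Iv by (rule A_inner[OF ep_pos J_D[OF l]])
    also have "\<dots> = inner w (J (ep n) x)"
      unfolding w_def A_inner[OF l J_D[OF ep_pos]] by (rule inner_commute)
    finally show ?thesis by (simp add: inner_commute)
  qed
  have hI: "(P n has_integral inner (?u n t - ?u n s) v) {s..t}" for n
    using has_integral_inner_vector_derivative[OF st(2) flow_sub[OF approx_flow[OF phi, of n] st(1)], where v=v]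
    unfolding rw P_def[abs_def] by simp
  let ?h = "norm \<phi> * norm w + (c + cb * (1 + norm \<phi>)) * norm v"
  have fi: "P n integrable_on {s..t}" for n using hI by (auto simp: integrable_on_def)
  have hi: "(\<lambda>_. ?h) integrable_on {s..t}" by (rule integrable_const_ivl)
  have dom: "norm (P n r) \<le> ?h" if r: "r \<in> {s..t}" for n r
  proof -
    have r0: "r \<ge> 0" using r st by auto
    have "\<bar>inner (J (ep n) (?u n r)) w\<bar> \<le> norm \<phi> * norm w"
      by (rule order_trans[OF Cauchy_Schwarz_ineq2 mult_right_mono])
        (use order_trans[OF norm_J_le[OF ep_pos] approx_norm[OF phi r0]] in auto)
    moreover have "\<bar>inner (gn n (?u n r)) v\<bar> \<le> (c + cb * (1 + norm \<phi>)) * norm v"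
      by (rule order_trans[OF Cauchy_Schwarz_ineq2 mult_right_mono[OF gn_approx[OF phi r0]]]) auto
    ultimately show ?thesis unfolding P_def real_norm_def by linarith
  qed
  have lim: "(\<lambda>n. P n r) \<longlonglongrightarrow> inner (sol \<phi> r) w - inner (g (sol \<phi> r)) v" if "r \<in> {s..t}" for r
  proof -
    have r0: "r \<ge> 0" using that st by auto
    have "(\<lambda>n. J (ep n) (?u n r)) \<longlonglongrightarrow> sol \<phi> r"
    proof -
      \<comment> \<open>This is the difference between the approximation and its resolvent; the
        growth 2^n of the Yosida term is beaten by 16^-n.\<close>
      have "(\<lambda>n. ep n *\<^sub>R A (ep n) (?u n r)) \<longlonglongrightarrow> 0"
      proof (rule Lim_null_comparison)
        show "\<forall>\<^sub>F n in sequentially. norm (ep n *\<^sub>R A (ep n) (?u n r)) \<le> KK \<phi> * (1/8)^n"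
        proof (intro always_eventually allI)
          fix n
          have "norm (ep n *\<^sub>R A (ep n) (?u n r)) \<le> ep n * (KK \<phi> * 2^n)"
            using norm_A_approx[OF phi r0, of n] ep_pos[of n] by (simp add: mult_left_mono)
          also have "\<dots> = KK \<phi> * ((1/16)^n * 2^n)" by (simp add: ep_def)
          also have "(1/16)^n * 2^n = (1/8::real)^n" by (simp add: power_mult_distrib[symmetric])
          finally show "norm (ep n *\<^sub>R A (ep n) (?u n r)) \<le> KK \<phi> * (1/8)^n" .
        qed
        have "(\<lambda>n. KK \<phi> * (1/8::real)^n) \<longlonglongrightarrow> KK \<phi> * 0" by (intro tendsto_intros LIMSEQ_power_zero) simp
        then show "(\<lambda>n. KK \<phi> * (1/8::real)^n) \<longlonglongrightarrow> 0" by simp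
      qed
      from tendsto_diff[OF approx_lim[OF phi r0] this] show ?thesis by (simp add: J_eq_A[OF ep_pos])
    qed
    then show ?thesis unfolding P_def by (intro tendsto_diff tendsto_inner tendsto_const gn_approx_lim phi r0)
  qed
  note dc = dominated_convergence[OF fi hi dom lim]
  have "(\<lambda>n. inner (?u n t - ?u n s) v) \<longlonglongrightarrow> inner (sol \<phi> t - sol \<phi> s) v"
    by (intro tendsto_diff tendsto_inner tendsto_const approx_lim phi order_trans[OF st] st)
  moreover have "integral {s..t} (P n) = inner (?u n t - ?u n s) v" for n by (rule integral_unique[OF hI])
  ultimately have "(\<lambda>n. integral {s..t} (P n)) \<longlonglongrightarrow> inner (sol \<phi> t - sol \<phi> s) v" by presburger
  from LIMSEQ_unique[OF dc(2) this] integrable_integral[OF dc(1)]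
  have 1: "((\<lambda>r. inner (sol \<phi> r) w - inner (g (sol \<phi> r)) v) has_integral inner (sol \<phi> t - sol \<phi> s) v) {s..t}"
    by presburger
  have "inner (sol \<phi> r) w = inner (grad (sol \<phi> r)) (grad (I v))" if "r \<in> {s..t}" for r
    using A_inner[OF l sol_D[of r], of "I f"] that st unfolding w_def Iv by (simp add: inner_commute)
  then show ?thesis unfolding v_def[symmetric]
    by (intro has_integral_eq[OF _ 1]) auto
qed

text \<open>General test vectors are reached by \<open>J (ep n) v\<close>, which converges to
  \<open>v\<close> together with its gradient; the bound on \<open>grad (sol \<phi> r)\<close> gives
  the majorant.\<close>

lemma sol_weak:
  assumes st: "0 \<le> s" "s \<le> t" and v: "v \<in> D"
  shows "((\<lambda>r. inner (grad (sol \<phi> r)) (grad (I v)) - inner (g (sol \<phi> r)) v) has_integral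
    inner (sol \<phi> t - sol \<phi> s) v) {s..t}"
proof -
  define P where "P n r = inner (grad (sol \<phi> r)) (grad (I (J (ep n) v))) - inner (g (sol \<phi> r)) (J (ep n) v)" for n r
  have hI: "(P n has_integral inner (sol \<phi> t - sol \<phi> s) (J (ep n) v)) {s..t}" for n
    unfolding P_def[abs_def] by (rule sol_weak_resolvent[OF st ep_pos])
  let ?h = "norm (grad \<phi>) * norm (grad (I v)) + (cb * (1 + norm \<phi>)) * norm v"
  have fi: "P n integrable_on {s..t}" for n using hI by (auto simp: integrable_on_def)
  have hi: "(\<lambda>_. ?h) integrable_on {s..t}" by (rule integrable_const_ivl)
  have IJ: "I (J (ep n) v) = J (ep n) (I v)" for n by (simp add: J_I ep_pos)
  have dom: "norm (P n r) \<le> ?h" if r: "r \<in> {s..t}" for n r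
  proof -
    have r0: "r \<ge> 0" using r st by auto
    have "\<bar>inner (grad (sol \<phi> r)) (grad (I (J (ep n) v)))\<bar> \<le> norm (grad \<phi>) * norm (grad (I v))"
      unfolding IJ by (rule order_trans[OF Cauchy_Schwarz_ineq2 mult_mono])
        (use sol_grad_le[OF r0] En_le_grad(2)[OF ep_pos I_D[OF v]] in auto)
    moreover have "\<bar>inner (g (sol \<phi> r)) (J (ep n) v)\<bar> \<le> (cb * (1 + norm \<phi>)) * norm v"
      by (rule order_trans[OF Cauchy_Schwarz_ineq2 mult_mono])
        (use g_sol_bound[OF r0] norm_J_le[OF ep_pos] cb_nonneg in auto)
    ultimately show ?thesis unfolding P_def real_norm_def by linarith
  qed
  have lim: "(\<lambda>n. P n r) \<longlonglongrightarrow> inner (grad (sol \<phi> r)) (grad (I v)) - inner (g (sol \<phi> r)) v" if "r \<in> {s..t}" for r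
    unfolding P_def IJ
    by (intro tendsto_diff tendsto_inner tendsto_const D_approx(1)[OF v] D_approx(2)[OF I_D[OF v]])
  note dc = dominated_convergence[OF fi hi dom lim]
  have "(\<lambda>n. inner (sol \<phi> t - sol \<phi> s) (J (ep n) v)) \<longlonglongrightarrow> inner (sol \<phi> t - sol \<phi> s) v"
    by (intro tendsto_inner tendsto_const D_approx(1)[OF v])
  moreover have "integral {s..t} (P n) = inner (sol \<phi> t - sol \<phi> s) (J (ep n) v)" for n by (rule integral_unique[OF hI])
  ultimately have "(\<lambda>n. integral {s..t} (P n)) \<longlonglongrightarrow> inner (sol \<phi> t - sol \<phi> s) v" by presburger
  from LIMSEQ_unique[OF dc(2) this] integrable_integral[OF dc(1)] show ?thesis by presburger
qed

section \<open>Dissipation and strong continuity of the gradient\<close>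

text \<open>A surrogate for the dissipation. Unlike \<open>inner (A (ep m) u) (g u)\<close>, it is
  the energy of a single vector and therefore increases with \<open>m\<close>.\<close>

definition Q where "Q m r = En (ep m) (G (sol \<phi> r))"

definition R where "R m t = integral {0..t} (Q m)"

lemma Q_continuous: "0 \<le> s \<Longrightarrow> continuous_on {s..t} (Q m)"
proof -
  assume s: "0 \<le> s"
  have "continuous_on {s..t} (sol \<phi>)" by (rule continuous_on_subset[OF sol_continuous[OF phi]]) (use s in auto)
  then have "continuous_on {s..t} (\<lambda>r. G (sol \<phi> r))" by (rule continuous_on_compose2[OF G_cont]) auto
  then show ?thesis unfolding Q_def[abs_def] En_def by (intro continuous_intros A_continuous ep_pos)
qed

lemma Q_integrable: "0 \<le> s \<Longrightarrow> Q m integrable_on {s..t}"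
  by (rule integrable_continuous_interval[OF Q_continuous])

lemma R_diff: assumes "0 \<le> s" "s \<le> t" shows "R m t - R m s = integral {s..t} (Q m)"
  using Henstock_Kurzweil_Integration.integral_combine[OF assms Q_integrable[OF order_refl], of m]
  unfolding R_def by linarith

lemma Q_mono: "m \<le> k \<Longrightarrow> Q m r \<le> Q k r"
  unfolding Q_def by (rule En_mono_ep)

lemma R_increment_mono:
  assumes "0 \<le> s" "s \<le> t" "m \<le> k" shows "R m t - R m s \<le> R k t - R k s"
  unfolding R_diff[OF assms(1,2)] by (rule integral_le) (use Q_integrable assms Q_mono in auto)

lemma R_0: "R m 0 = 0" by (simp add: R_def)

lemma R_mono: "0 \<le> t \<Longrightarrow> m \<le> k \<Longrightarrow> R m t \<le> R k t"
  using R_increment_mono[of 0 t m k] by (simp add: R_0)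

lemma energy_R:
  assumes st: "0 \<le> s" "s \<le> t"
  shows "2 * c1 * (R m t - R m s) \<le> En (ep m) (sol \<phi> s) - En (ep m) (sol \<phi> t)"
    and "En (ep m) (sol \<phi> s) - En (ep m) (sol \<phi> t) \<le> 2 * c2 * (R m t - R m s)"
proof -
  have q: "(Q m has_integral (R m t - R m s)) {s..t}"
    unfolding R_diff[OF st] by (rule integrable_integral[OF Q_integrable[OF st(1)]])
  show "2 * c1 * (R m t - R m s) \<le> En (ep m) (sol \<phi> s) - En (ep m) (sol \<phi> t)"
    by (rule has_integral_le[OF has_integral_mult_right[OF q] energy_identity[OF phi st]])
      (use lower[OF ep_pos] in \<open>simp add: Q_def\<close>)
  show "En (ep m) (sol \<phi> s) - En (ep m) (sol \<phi> t) \<le> 2 * c2 * (R m t - R m s)"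
    by (rule has_integral_le[OF energy_identity[OF phi st] has_integral_mult_right[OF q]])
      (use upper[OF ep_pos] in \<open>simp add: Q_def\<close>)
qed

lemma R_bounded: assumes t: "0 \<le> t" shows "R m t \<le> (norm (grad \<phi>))\<^sup>2 / (2 * c1)"
proof -
  have "2 * c1 * R m t \<le> En (ep m) (sol \<phi> 0) - En (ep m) (sol \<phi> t)"
    using energy_R(1)[OF order_refl t, of m] by (simp add: R_0)
  also have "\<dots> \<le> (norm (grad \<phi>))\<^sup>2"
    using En_sol_le[OF phi order_refl, of m] En_nonneg[OF ep_pos, of m "sol \<phi> t"] by linarith
  finally show ?thesis using c1 by (simp add: field_simps)
qed

definition Rl where "Rl t = lim (\<lambda>m. R m t)"

lemma R_lim: assumes t: "0 \<le> t" shows "(\<lambda>m. R m t) \<longlonglongrightarrow> Rl t"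
proof -
  have inc: "incseq (\<lambda>m. R m t)" using R_mono[OF t] by (auto simp: incseq_def)
  obtain l where "(\<lambda>m. R m t) \<longlonglongrightarrow> l"
    using incseq_convergent[OF inc, of "(norm (grad \<phi>))\<^sup>2 / (2 * c1)"] R_bounded[OF t] by blast
  then show ?thesis unfolding Rl_def by (simp add: limI)
qed

lemma sol_En_lim: "0 \<le> t \<Longrightarrow> (\<lambda>m. En (ep m) (sol \<phi> t)) \<longlonglongrightarrow> (norm (grad (sol \<phi> t)))\<^sup>2"
  using D_approx(3)[OF sol_D] .

text \<open>For \<open>m \<le> k\<close> the difference of \<open>R k\<close> and \<open>R m\<close>
  is nondecreasing in time and vanishes at 0, so its increment over any subinterval is at most its
  value at \<open>T\<close>. This bounds the increments at level \<open>k\<close> by those at the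
  fixed level \<open>m\<close> plus a tail independent of \<open>s\<close> and \<open>t\<close>, as
  in Dini's theorem.\<close>

lemma grad_norm_increment:
  assumes st: "0 \<le> s" "s \<le> t" "t \<le> T"
  shows "(norm (grad (sol \<phi> s)))\<^sup>2 - (norm (grad (sol \<phi> t)))\<^sup>2 \<le> 2 * c2 * ((R m t - R m s) + (Rl T - R m T))"
    and "(norm (grad (sol \<phi> t)))\<^sup>2 \<le> (norm (grad (sol \<phi> s)))\<^sup>2"
proof -
  have t0: "0 \<le> t" "0 \<le> T" using st by auto
  have lim: "(\<lambda>k. En (ep k) (sol \<phi> s) - En (ep k) (sol \<phi> t)) \<longlonglongrightarrow>
      (norm (grad (sol \<phi> s)))\<^sup>2 - (norm (grad (sol \<phi> t)))\<^sup>2"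
    by (intro tendsto_diff sol_En_lim st t0)
  have limR: "(\<lambda>k. 2 * c2 * ((R m t - R m s) + (R k T - R m T))) \<longlonglongrightarrow> 2 * c2 * ((R m t - R m s) + (Rl T - R m T))"
    by (intro tendsto_intros R_lim t0)
  show "(norm (grad (sol \<phi> s)))\<^sup>2 - (norm (grad (sol \<phi> t)))\<^sup>2 \<le> 2 * c2 * ((R m t - R m s) + (Rl T - R m T))"
  proof (rule LIMSEQ_le[OF lim limR], intro exI allI impI)
    fix k assume k: "m \<le> k"
    have "R k t - R k s \<le> (R m t - R m s) + (R k T - R m T)"
      using R_increment_mono[OF order_refl st(1) k] R_increment_mono[OF t0(1) st(3) k] by (simp add: R_0)
    then have "2 * c2 * (R k t - R k s) \<le> 2 * c2 * ((R m t - R m s) + (R k T - R m T))"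
      using c2 by (intro mult_left_mono) auto
    with energy_R(2)[OF st(1,2), of k]
    show "En (ep k) (sol \<phi> s) - En (ep k) (sol \<phi> t) \<le> 2 * c2 * ((R m t - R m s) + (R k T - R m T))" by linarith
  qed
  have "0 \<le> R k t - R k s" for k
    unfolding R_diff[OF st(1,2)] by (rule integral_nonneg) (use Q_integrable st En_nonneg[OF ep_pos] in \<open>auto simp: Q_def\<close>)
  then have "0 \<le> En (ep k) (sol \<phi> s) - En (ep k) (sol \<phi> t)" for k
    using energy_R(1)[OF st(1,2), of k] c1 by (smt (verit, best) mult_nonneg_nonneg)
  with LIMSEQ_le_const[OF lim, of 0] show "(norm (grad (sol \<phi> t)))\<^sup>2 \<le> (norm (grad (sol \<phi> s)))\<^sup>2" by auto
qed

lemma grad_norm_continuous: "continuous_on {0..} (\<lambda>t. (norm (grad (sol \<phi> t)))\<^sup>2)"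
proof (rule continuous_on_nonneg_reals)
  fix T :: real assume T: "T \<ge> 0"
  let ?f = "\<lambda>t. (norm (grad (sol \<phi> t)))\<^sup>2"
  show "continuous_on {0..T} ?f"
    unfolding continuous_on_iff
  proof (intro ballI allI impI)
    fix t e :: real assume t: "t \<in> {0..T}" and e: "e > 0"
    have "(\<lambda>m. Rl T - R m T) \<longlonglongrightarrow> Rl T - Rl T" by (intro tendsto_intros R_lim T)
    then have "\<forall>\<^sub>F m in sequentially. Rl T - R m T < e / (4 * c2)"
      \<comment> \<open>Tail and increment of \<open>R m\<close> are each made smaller than
        \<open>e / (4 * c2)\<close>; multiplied by \<open>2 * c2\<close>, their sum stays below
        \<open>e\<close>.\<close>
      using e c2 by (intro order_tendstoD(2)[where y = "Rl T - Rl T"]) auto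
    then obtain m where m: "Rl T - R m T < e / (4 * c2)" by (auto simp: eventually_sequentially)
    have "continuous_on {0..T} (R m)"
      unfolding R_def[abs_def] by (intro indefinite_integral_continuous_1 Q_integrable order_refl)
    then obtain d where d: "d > 0" "\<And>s. s \<in> {0..T} \<Longrightarrow> dist s t < d \<Longrightarrow> dist (R m s) (R m t) < e / (4 * c2)"
      using t e c2 unfolding continuous_on_iff by (metis divide_pos_pos mult_pos_pos zero_less_numeral)
    show "\<exists>d>0. \<forall>s\<in>{0..T}. dist s t < d \<longrightarrow> dist (?f s) (?f t) < e"
    proof (intro exI conjI ballI impI)
      fix s assume s: "s \<in> {0..T}" "dist s t < d"
      have R: "\<bar>R m s - R m t\<bar> < e / (4 * c2)" using d(2)[OF s] by (simp add: dist_real_def)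
      have key: "\<bar>?f a - ?f b\<bar> < e" if ab: "0 \<le> a" "a \<le> b" "b \<le> T" "R m b - R m a < e / (4 * c2)" for a b
      proof -
        have "?f a - ?f b \<le> 2 * c2 * ((R m b - R m a) + (Rl T - R m T))" by (rule grad_norm_increment(1)[OF ab(1-3)])
        also have "\<dots> < 2 * c2 * (e / (4 * c2) + e / (4 * c2))" using c2 ab(4) m by (intro mult_strict_left_mono) auto
        also have "\<dots> = e" using c2 by (simp add: field_simps)
        finally show ?thesis using grad_norm_increment(2)[OF ab(1-3)] by simp
      qed
      show "dist (?f s) (?f t) < e"
      proof (cases "s \<le> t")
        case True then show ?thesis using key[of s t] R s t by (simp add: dist_real_def)
      next
        case False then show ?thesis using key[of t s] R s t by (simp add: dist_real_def abs_minus_commute)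
      qed
    qed (rule d)
  qed
qed

text \<open>Weak continuity together with continuity of the norm. For weak continuity,
  \<open>grad (sol \<phi> t)\<close> is replaced by the nearby gradient of
  \<open>J (ep m) (sol \<phi> t)\<close>, against which \<open>grad (sol \<phi> s)\<close> pairs
  like an L2 product and is thus continuous in \<open>s\<close>.\<close>

lemma sol_grad_continuous: "continuous_on {0..} (\<lambda>t. grad (sol \<phi> t))"
  unfolding continuous_on_def
proof
  fix t :: real assume "t \<in> {0..}"
  then have t: "t \<ge> 0" by simp
  let ?F = "at t within {0..}"
  let ?f = "\<lambda>t. (norm (grad (sol \<phi> t)))\<^sup>2"
  have fl: "(?f \<longlongrightarrow> ?f t) ?F" using grad_norm_continuous t by (auto simp: continuous_on_def)
  have ul: "(sol \<phi> \<longlongrightarrow> sol \<phi> t) ?F" using sol_continuous[OF phi] t by (auto simp: continuous_on_def)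
  show "((\<lambda>t. grad (sol \<phi> t)) \<longlongrightarrow> grad (sol \<phi> t)) ?F"
    unfolding tendsto_iff
  proof (intro allI impI)
    fix e :: real assume e: "e > 0"
    define C where "C = norm (grad \<phi>) + 1"
    have C: "C > 0" "norm (grad \<phi>) \<le> C" by (auto simp: C_def add_nonneg_pos)
    \<comment> \<open>The replacement is made twice, in the definition of \<open>h\<close> and in
      bounding \<open>h t\<close>; the total error \<open>4 * (C * \<eta>)\<close> is half of the
      squared tolerance.\<close>
    define \<eta> where "\<eta> = e\<^sup>2 / (8 * C)"
    have \<eta>: "\<eta> > 0" using e C by (simp add: \<eta>_def)
    obtain m where m: "norm (grad (J (ep m) (sol \<phi> t)) - grad (sol \<phi> t)) < \<eta>"
      using LIMSEQ_D[OF D_approx(2)[OF sol_D[OF t]] \<eta>] by blast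
    let ?z = "J (ep m) (sol \<phi> t)"
    define h where "h s = ?f s + ?f t - 2 * inner (sol \<phi> s) (A (ep m) (sol \<phi> t)) + 2 * (C * \<eta>)" for s
    have gz: "inner (sol \<phi> s) (A (ep m) (sol \<phi> t)) = inner (grad (sol \<phi> s)) (grad ?z)" if "s \<ge> 0" for s
      using A_inner[OF ep_pos sol_D[OF that], of m "sol \<phi> t"] by (simp add: inner_commute)
    have dev: "\<bar>inner (grad (sol \<phi> s)) (grad ?z - grad (sol \<phi> t))\<bar> \<le> C * \<eta>" if "s \<ge> 0" for s
      by (rule order_trans[OF Cauchy_Schwarz_ineq2 mult_mono])
        (use sol_grad_le[OF that] C m in auto)
    have up: "(norm (grad (sol \<phi> s) - grad (sol \<phi> t)))\<^sup>2 \<le> h s" if s: "s \<ge> 0" for s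
    proof -
      have "(norm (grad (sol \<phi> s) - grad (sol \<phi> t)))\<^sup>2 = ?f s + ?f t - 2 * inner (grad (sol \<phi> s)) (grad (sol \<phi> t))"
        by (simp add: power2_norm_eq_inner inner_diff_left inner_diff_right inner_commute)
      also have "\<dots> \<le> h s" using dev[OF s] gz[OF s] by (simp add: h_def inner_diff_right)
      finally show ?thesis .
    qed
    have "(h \<longlongrightarrow> h t) ?F" unfolding h_def by (intro tendsto_intros fl ul)
    moreover have "h t < e\<^sup>2"
    proof -
      have "h t \<le> 4 * (C * \<eta>)"
        using dev[OF t] gz[OF t] by (simp add: h_def inner_diff_right power2_norm_eq_inner)
      also have "\<dots> < e\<^sup>2" using C e by (simp add: \<eta>_def)
      finally show ?thesis .
    qed
    ultimately have "\<forall>\<^sub>F s in ?F. h s < e\<^sup>2" by (rule order_tendstoD(2))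
    moreover have "\<forall>\<^sub>F s in ?F. s \<ge> 0" by (simp add: eventually_at_filter)
    ultimately show "\<forall>\<^sub>F s in ?F. dist (grad (sol \<phi> s)) (grad (sol \<phi> t)) < e"
    proof eventually_elim
      case (elim s)
      then have "(norm (grad (sol \<phi> s) - grad (sol \<phi> t)))\<^sup>2 < e\<^sup>2" using up[of s] by linarith
      then show ?case using e by (simp add: dist_norm power_less_imp_less_base)
    qed
  qed
qed

end

theorem weak_solution_exists:
  assumes phi: "\<phi> \<in> D"
  obtains u where "weak_solution u" "u 0 = \<phi>"
    "\<And>t. t \<ge> 0 \<Longrightarrow> norm (u t) \<le> norm \<phi>" "\<And>t. t \<ge> 0 \<Longrightarrow> norm (grad (u t)) \<le> norm (grad \<phi>)"
proof
  show "weak_solution (sol \<phi>)"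
    unfolding weak_solution_def
    using sol_D[OF phi] sol_continuous[OF phi] sol_grad_continuous[OF phi] integral_unique[OF sol_weak[OF phi]]
    by auto
qed (use sol_0[OF phi] sol_norm[OF phi] sol_grad_le[OF phi] in auto)

end

section \<open>The Hilbert space of square-integrable functions\<close>

definition sq_integrable :: "'a measure \<Rightarrow> ('a \<Rightarrow> complex) \<Rightarrow> bool" where
  "sq_integrable M f \<longleftrightarrow> f \<in> borel_measurable M \<and> integrable M (\<lambda>x. (cmod (f x))\<^sup>2)"

lemma sq_integrable_measurable [measurable_dest]: "sq_integrable M f \<Longrightarrow> f \<in> borel_measurable M"
  by (simp add: sq_integrable_def)

lemma sq_integrableI_bound:
  assumes "f \<in> borel_measurable M" "integrable M h" "AE x in M. (cmod (f x))\<^sup>2 \<le> h x"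
  shows "sq_integrable M f"
  unfolding sq_integrable_def
proof (intro conjI assms(1) Bochner_Integration.integrable_bound[OF assms(2)])
  show "(\<lambda>x. (cmod (f x))\<^sup>2) \<in> borel_measurable M" using assms(1) by measurable
  show "AE x in M. norm ((cmod (f x))\<^sup>2) \<le> norm (h x)" using assms(3) by eventually_elim auto
qed

lemma sq_integrable_add:
  assumes "sq_integrable M f" "sq_integrable M g" shows "sq_integrable M (\<lambda>x. f x + g x)"
proof (rule sq_integrableI_bound)
  show "(\<lambda>x. f x + g x) \<in> borel_measurable M" using assms by measurable
  show "integrable M (\<lambda>x. 2 * (cmod (f x))\<^sup>2 + 2 * (cmod (g x))\<^sup>2)"
    using assms by (auto simp: sq_integrable_def)
  have "(cmod (a + b))\<^sup>2 \<le> 2 * (cmod a)\<^sup>2 + 2 * (cmod b)\<^sup>2" for a b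
  proof -
    have "(cmod (a + b))\<^sup>2 \<le> (cmod a + cmod b)\<^sup>2" by (intro power_mono norm_triangle_ineq) auto
    also have "\<dots> \<le> 2 * (cmod a)\<^sup>2 + 2 * (cmod b)\<^sup>2"
      using sum_squares_bound[of "cmod a" "cmod b"] by (simp add: power2_sum)
    finally show ?thesis .
  qed
  then show "AE x in M. (cmod (f x + g x))\<^sup>2 \<le> 2 * (cmod (f x))\<^sup>2 + 2 * (cmod (g x))\<^sup>2" by simp
qed

lemma sq_integrable_cmult:
  assumes "sq_integrable M f" shows "sq_integrable M (\<lambda>x. c * f x)"
  using assms by (auto simp: sq_integrable_def norm_mult power_mult_distrib)

lemma sq_integrable_scaleR: "sq_integrable M f \<Longrightarrow> sq_integrable M (\<lambda>x. (c::real) *\<^sub>R f x)"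
  using sq_integrable_cmult[of M f "of_real c"] by (simp add: scaleR_conv_of_real)

lemma sq_integrable_uminus: "sq_integrable M f \<Longrightarrow> sq_integrable M (\<lambda>x. - f x)"
  by (auto simp: sq_integrable_def)

lemma sq_integrable_diff:
  assumes "sq_integrable M f" "sq_integrable M g" shows "sq_integrable M (\<lambda>x. f x - g x)"
  using sq_integrable_add[OF assms(1) sq_integrable_uminus[OF assms(2)]] by simp

lemma sq_integrable_cnj:
  assumes "sq_integrable M f" shows "sq_integrable M (\<lambda>x. cnj (f x))"
proof -
  have "cnj \<in> borel_measurable borel"
    by (intro borel_measurable_continuous_onI continuous_intros)
  from measurable_compose[OF sq_integrable_measurable[OF assms] this] assms show ?thesis
    by (simp add: sq_integrable_def)
qed

lemma sq_integrable_zero [simp]: "sq_integrable M (\<lambda>x. 0)"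
  by (simp add: sq_integrable_def)

lemma sq_integrable_mult:
  assumes "sq_integrable M f" "sq_integrable M g"
  shows "integrable M (\<lambda>x. f x * g x)"
proof (rule Bochner_Integration.integrable_bound)
  show "integrable M (\<lambda>x. (cmod (f x))\<^sup>2 + (cmod (g x))\<^sup>2)" using assms by (auto simp: sq_integrable_def)
  show "(\<lambda>x. f x * g x) \<in> borel_measurable M" using assms by measurable
  have "cmod a * cmod b \<le> (cmod a)\<^sup>2 + (cmod b)\<^sup>2" for a b
    using sum_squares_bound[of "cmod a" "cmod b"] mult_nonneg_nonneg[OF norm_ge_zero norm_ge_zero, of a b]
    by linarith
  then have "norm (f x * g x) \<le> norm ((cmod (f x))\<^sup>2 + (cmod (g x))\<^sup>2)" for x
    unfolding norm_mult real_norm_def by (rule order_trans[OF _ abs_ge_self])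
  then show "AE x in M. norm (f x * g x) \<le> norm ((cmod (f x))\<^sup>2 + (cmod (g x))\<^sup>2)" by simp
qed

lemma inner_complex_Re: "inner a b = Re (a * cnj b)" for a b :: complex
  by (simp add: inner_complex_def)

lemma sq_integrable_inner:
  assumes "sq_integrable M f" "sq_integrable M g"
  shows "integrable M (\<lambda>x. inner (f x) (g x))"
  unfolding inner_complex_Re
  by (intro integrable_Re sq_integrable_mult sq_integrable_cnj assms)

lemma AE_eq_lift2:
  assumes "AE x in M. f x = f' x" "AE x in M. g x = g' x"
  shows "AE x in M. F (f x) (g x) = F (f' x) (g' x)"
  using assms by eventually_elim simp

lemma AE_eq_lift: "AE x in M. f x = f' x \<Longrightarrow> AE x in M. F (f x) = F (f' x)"
  by (erule eventually_mono) simp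

lemma AE_eq_sym: "AE x in M. f x = f' x \<Longrightarrow> AE x in M. f' x = f x"
  by (erule eventually_mono) simp

lemma AE_eq_trans: "AE x in M. f x = g x \<Longrightarrow> AE x in M. g x = h x \<Longrightarrow> AE x in M. f x = h x"
  by (erule (1) eventually_elim2) simp

section \<open>The quotient by equality almost everywhere\<close>

definition sq_rel :: "('a::euclidean_space \<Rightarrow> complex) \<Rightarrow> ('a \<Rightarrow> complex) \<Rightarrow> bool" where
  "sq_rel f g \<longleftrightarrow> sq_integrable lebesgue f \<and> sq_integrable lebesgue g \<and> (AE x in lebesgue. f x = g x)"

\<comment> \<open>The classes live over the whole space because a type, as the type class instances
  require, cannot depend on the domain. The relation is partial: functions that are not square
  integrable have no class.\<close>
quotient_type (overloaded) 'a l2 = "'a::euclidean_space \<Rightarrow> complex" / partial: sq_rel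
proof (rule part_equivpI)
  show "\<exists>x::'a \<Rightarrow> complex. sq_rel x x" by (rule exI[of _ "\<lambda>_. 0"]) (simp add: sq_rel_def)
  show "symp (sq_rel :: ('a \<Rightarrow> complex) \<Rightarrow> _)" by (auto simp: symp_def sq_rel_def intro: AE_eq_sym)
  show "transp (sq_rel :: ('a \<Rightarrow> complex) \<Rightarrow> _)"
  proof (rule transpI)
    fix f g h :: "'a \<Rightarrow> complex" assume "sq_rel f g" "sq_rel g h"
    then show "sq_rel f h" unfolding sq_rel_def using AE_eq_trans[where f=f and g=g and h=h and M=lebesgue] by blast
  qed
qed

lemma sq_rel_lift2:
  fixes f f' g g' :: "'a::euclidean_space \<Rightarrow> complex"
  assumes "sq_rel f f'" "sq_rel g g'"
    "\<And>f g :: 'a \<Rightarrow> complex. sq_integrable lebesgue f \<Longrightarrow> sq_integrable lebesgue g \<Longrightarrow> sq_integrable lebesgue (\<lambda>x. F (f x) (g x))"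
  shows "sq_rel (\<lambda>x. F (f x) (g x)) (\<lambda>x. F (f' x) (g' x))"
  using assms(1,2) assms(3)[of f g] assms(3)[of f' g'] AE_eq_lift2[where f=f and f'=f' and g=g and g'=g' and F=F and M=lebesgue]
  by (simp add: sq_rel_def)

lemma sq_rel_lift:
  fixes f f' :: "'a::euclidean_space \<Rightarrow> complex"
  assumes "sq_rel f f'"
    "\<And>f :: 'a \<Rightarrow> complex. sq_integrable lebesgue f \<Longrightarrow> sq_integrable lebesgue (\<lambda>x. F (f x))"
  shows "sq_rel (\<lambda>x. F (f x)) (\<lambda>x. F (f' x))"
  using assms(1) assms(2)[of f] assms(2)[of f'] AE_eq_lift[where f=f and f'=f' and F=F and M=lebesgue] by (simp add: sq_rel_def)

instantiation l2 :: (euclidean_space) real_vector begin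

lift_definition zero_l2 :: "'a l2" is "\<lambda>x. 0" by (simp add: sq_rel_def)

lift_definition plus_l2 :: "'a l2 \<Rightarrow> 'a l2 \<Rightarrow> 'a l2" is "\<lambda>f g x. f x + g x"
  by (rule sq_rel_lift2[OF _ _ sq_integrable_add])

lift_definition minus_l2 :: "'a l2 \<Rightarrow> 'a l2 \<Rightarrow> 'a l2" is "\<lambda>f g x. f x - g x"
  by (rule sq_rel_lift2[OF _ _ sq_integrable_diff])

lift_definition uminus_l2 :: "'a l2 \<Rightarrow> 'a l2" is "\<lambda>f x. - f x"
  by (rule sq_rel_lift[OF _ sq_integrable_uminus])

lift_definition scaleR_l2 :: "real \<Rightarrow> 'a l2 \<Rightarrow> 'a l2" is "\<lambda>c f x. c *\<^sub>R f x"
  by (rule sq_rel_lift[OF _ sq_integrable_scaleR])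

instance
proof
  fix x y z :: "'a l2" and a b c :: real
  show "x + y + z = x + (y + z)"
    by transfer (auto simp: sq_rel_def add.assoc intro!: sq_integrable_add)
  show "x + y = y + x" by transfer (auto simp: sq_rel_def add.commute intro!: sq_integrable_add)
  show "0 + x = x" by transfer (auto simp: sq_rel_def)
  show "- x + x = 0" by transfer (auto simp: sq_rel_def)
  show "x - y = x + - y" by transfer (auto simp: sq_rel_def intro!: sq_integrable_diff)
  show "a *\<^sub>R (x + y) = a *\<^sub>R x + a *\<^sub>R y"
    by transfer (auto simp: sq_rel_def scaleR_add_right intro!: sq_integrable_add sq_integrable_scaleR)
  show "(a + b) *\<^sub>R x = a *\<^sub>R x + b *\<^sub>R x"
    by transfer (auto simp: sq_rel_def scaleR_add_left intro!: sq_integrable_add sq_integrable_scaleR)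
  show "a *\<^sub>R b *\<^sub>R x = (a * b) *\<^sub>R x" by transfer (auto simp: sq_rel_def intro!: sq_integrable_scaleR)
  show "1 *\<^sub>R x = x" by transfer (auto simp: sq_rel_def)
qed

end

instantiation l2 :: (euclidean_space) real_inner begin

lift_definition inner_l2 :: "'a l2 \<Rightarrow> 'a l2 \<Rightarrow> real" is "\<lambda>f g. LINT x|lebesgue. inner (f x) (g x)"
proof -
  fix f f' g g' :: "'a \<Rightarrow> complex" assume "sq_rel f f'" "sq_rel g g'"
  then show "(LINT x|lebesgue. inner (f x) (g x)) = (LINT x|lebesgue. inner (f' x) (g' x))"
    unfolding sq_rel_def
    using AE_eq_lift2[where f=f and f'=f' and g=g and g'=g' and F=inner and M=lebesgue]
    by (intro integral_cong_AE borel_measurable_integrable sq_integrable_inner) auto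
qed

definition norm_l2 :: "'a l2 \<Rightarrow> real" where "norm_l2 x = sqrt (inner x x)"
definition dist_l2 :: "'a l2 \<Rightarrow> 'a l2 \<Rightarrow> real" where "dist_l2 x y = norm (x - y)"
definition sgn_l2 :: "'a l2 \<Rightarrow> 'a l2" where "sgn_l2 x = x /\<^sub>R norm x"
definition uniformity_l2 :: "('a l2 \<times> 'a l2) filter" where
  "uniformity_l2 = (INF e\<in>{0<..}. principal {(x, y). dist x y < e})"
definition open_l2 :: "'a l2 set \<Rightarrow> bool" where
  "open_l2 U \<longleftrightarrow> (\<forall>x\<in>U. \<forall>\<^sub>F (x', y) in uniformity. x' = x \<longrightarrow> y \<in> U)"

instance
proof
  fix x y z :: "'a l2" and a b c :: real
  show "inner x y = inner y x" by transfer (simp add: inner_commute)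
  show "inner (x + y) z = inner x z + inner y z"
    by transfer (auto simp: sq_rel_def inner_add_left sq_integrable_inner)
  show "inner (c *\<^sub>R x) y = c * inner x y" by transfer simp
  show "0 \<le> inner x x" by transfer simp
  show "(inner x x = 0) = (x = 0)"
    by transfer (auto simp: sq_rel_def sq_integrable_inner integral_nonneg_eq_0_iff_AE)
qed (simp_all add: norm_l2_def dist_l2_def sgn_l2_def uniformity_l2_def open_l2_def)

end

definition cls :: "('a::euclidean_space \<Rightarrow> complex) \<Rightarrow> 'a l2" where "cls = abs_l2"

definition repr :: "'a::euclidean_space l2 \<Rightarrow> 'a \<Rightarrow> complex" where "repr = rep_l2"

lemma cls_repr [simp]: "cls (repr x) = x"
  unfolding cls_def repr_def by (rule Quotient3_abs_rep[OF Quotient3_l2])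

lemma sq_integrable_repr [simp]: "sq_integrable lebesgue (repr x)"
  using Quotient3_rep_reflp[OF Quotient3_l2, of x] by (simp add: repr_def sq_rel_def)

lemma cls_eq_iff:
  assumes "sq_integrable lebesgue f" "sq_integrable lebesgue g"
  shows "cls f = cls g \<longleftrightarrow> (AE x in lebesgue. f x = g x)"
  using Quotient3_rel[OF Quotient3_l2, of f g] assms unfolding cls_def by (auto simp: sq_rel_def)

lemma repr_cls: assumes "sq_integrable lebesgue f" shows "AE x in lebesgue. repr (cls f) x = f x"
  using cls_eq_iff[of "repr (cls f)" f] assms by simp

lemma cls_zero: "cls (\<lambda>x. 0) = 0" unfolding cls_def by (simp add: zero_l2.abs_eq)

context
  fixes f g :: "'a::euclidean_space \<Rightarrow> complex"
  assumes f: "sq_integrable lebesgue f" and g: "sq_integrable lebesgue g"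
begin

private lemma rel: "sq_rel f f" "sq_rel g g" using f g by (auto simp: sq_rel_def)

lemma cls_add: "cls (\<lambda>x. f x + g x) = cls f + cls g"
  using rel unfolding cls_def by (simp add: plus_l2.abs_eq)

lemma cls_diff: "cls (\<lambda>x. f x - g x) = cls f - cls g"
  using rel unfolding cls_def by (simp add: minus_l2.abs_eq)

lemma cls_scaleR: "cls (\<lambda>x. c *\<^sub>R f x) = c *\<^sub>R cls f"
  using rel unfolding cls_def by (simp add: scaleR_l2.abs_eq)

lemma cls_uminus: "cls (\<lambda>x. - f x) = - cls f"
  using rel unfolding cls_def by (simp add: uminus_l2.abs_eq)

lemma inner_cls: "inner (cls f) (cls g) = (LINT x|lebesgue. inner (f x) (g x))"
  using rel unfolding cls_def by (simp add: inner_l2.abs_eq)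

end

lemma norm_cls_sq: "sq_integrable lebesgue f \<Longrightarrow> (norm (cls f))\<^sup>2 = (LINT x|lebesgue. (cmod (f x))\<^sup>2)"
  by (simp add: power2_norm_eq_inner inner_cls)

lemma norm_sq_repr: "(norm x)\<^sup>2 = (LINT t|lebesgue. (cmod (repr x t))\<^sup>2)"
  using norm_cls_sq[OF sq_integrable_repr, of x] by simp

lemma nn_integral_norm_sq:
  assumes "sq_integrable lebesgue f"
  shows "(\<integral>\<^sup>+ x. ennreal ((cmod (f x))\<^sup>2) \<partial>lebesgue) = ennreal ((norm (cls f))\<^sup>2)"
  using assms by (simp add: norm_cls_sq nn_integral_eq_integral sq_integrable_def)

lemma fast_subsequence:
  fixes X :: "nat \<Rightarrow> 'a::real_normed_vector"
  assumes "Cauchy X"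
  obtains r where "strict_mono r" "\<And>n m. n \<le> m \<Longrightarrow> norm (X (r m) - X (r n)) < (1/2)^n"
proof -
  have "\<exists>N. \<forall>m\<ge>N. \<forall>n\<ge>N. norm (X m - X n) < (1/2)^k" for k
    using CauchyD[OF assms, of "(1/2)^k"] by auto
  then obtain N where N: "\<And>k m n. m \<ge> N k \<Longrightarrow> n \<ge> N k \<Longrightarrow> norm (X m - X n) < (1/2)^k" by metis
  define r where "r = rec_nat (N 0) (\<lambda>k p. max (N (Suc k)) (Suc p))"
  have rS: "r (Suc k) = max (N (Suc k)) (Suc (r k))" "r 0 = N 0" for k by (auto simp: r_def)
  have sm: "strict_mono r" by (rule strict_monoI_Suc) (simp add: rS)
  have rN: "N k \<le> r k" for k by (cases k) (auto simp: rS)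
  show ?thesis
  proof (rule that[OF sm])
    fix n m :: nat assume "n \<le> m"
    then have "r n \<le> r m" using sm by (simp add: strict_mono_less_eq)
    then show "norm (X (r m) - X (r n)) < (1/2)^n" using N rN[of n] by simp
  qed
qed

text \<open>The Riesz-Fischer argument: a rapidly converging subsequence converges almost
  everywhere, and Fatou's lemma identifies the pointwise limit as the limit in norm.\<close>

instance l2 :: (euclidean_space) banach
proof
  fix X :: "nat \<Rightarrow> 'a l2" assume X: "Cauchy X"
  obtain r where r: "strict_mono r" "\<And>n m. n \<le> m \<Longrightarrow> norm (X (r m) - X (r n)) < (1/2)^n"
    using fast_subsequence[OF X] by metis
  define f where "f n = repr (X (r n))" for n
  have sf: "sq_integrable lebesgue (f n)" for n by (simp add: f_def)
  have cf: "cls (f n) = X (r n)" for n by (simp add: f_def)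
  have fm [measurable]: "f n \<in> borel_measurable lebesgue" for n using sf by (simp add: sq_integrable_def)
  have nd: "(\<integral>\<^sup>+ x. ennreal ((cmod (f m x - f n x))\<^sup>2) \<partial>lebesgue) \<le> ennreal ((1/4)^n)" if "n \<le> m" for n m
  proof -
    have "(norm (X (r m) - X (r n)))\<^sup>2 \<le> ((1/2)^n)\<^sup>2" using r(2)[OF that] by (intro power_mono) auto
    also have "((1/2::real)^n)\<^sup>2 = (1/4)^n" unfolding power2_eq_square power_mult_distrib[symmetric] by simp
    finally show ?thesis
      using nn_integral_norm_sq[OF sq_integrable_diff[OF sf sf], of m n] by (simp add: cls_diff sf cf ennreal_leI)
  qed
  \<comment> \<open>The weight 2^n is still beaten by the bound 4^-n on the squared norms, so
    \<open>S\<close> has finite integral. Conversely, finiteness of \<open>S x\<close> bounds the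
    n-th increment at \<open>x\<close> by a constant times \<open>sqrt (1/2) ^ n\<close>, which is
    summable.\<close>
  define S where "S x = (\<Sum>n. ennreal (2^n * (cmod (f (Suc n) x - f n x))\<^sup>2))" for x
  have "(\<integral>\<^sup>+ x. S x \<partial>lebesgue) = (\<Sum>n. \<integral>\<^sup>+ x. ennreal (2^n * (cmod (f (Suc n) x - f n x))\<^sup>2) \<partial>lebesgue)"
    unfolding S_def by (rule nn_integral_suminf) measurable
  also have "\<dots> \<le> (\<Sum>n. ennreal ((1/2)^n))"
  proof (rule suminf_le)
    fix n
    have "(\<integral>\<^sup>+ x. ennreal (2^n * (cmod (f (Suc n) x - f n x))\<^sup>2) \<partial>lebesgue)
      = ennreal (2^n) * (\<integral>\<^sup>+ x. ennreal ((cmod (f (Suc n) x - f n x))\<^sup>2) \<partial>lebesgue)"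
      by (subst nn_integral_cmult[symmetric]) (auto simp: ennreal_mult)
    also have "\<dots> \<le> ennreal (2^n) * ennreal ((1/4)^n)" by (intro mult_left_mono nd) auto
    also have "\<dots> = ennreal (2^n * (1/4)^n)" by (simp add: ennreal_mult)
    also have "2^n * (1/4)^n = (1/2::real)^n" by (simp add: power_mult_distrib[symmetric])
    finally show "(\<integral>\<^sup>+ x. ennreal (2^n * (cmod (f (Suc n) x - f n x))\<^sup>2) \<partial>lebesgue) \<le> ennreal ((1/2)^n)" .
  qed auto
  also have "\<dots> = ennreal (\<Sum>n. (1/2)^n)" by (rule suminf_ennreal2) auto
  finally have fin: "(\<integral>\<^sup>+ x. S x \<partial>lebesgue) \<noteq> \<infinity>" by (auto simp: top_unique)
  have Sm: "S \<in> borel_measurable lebesgue" unfolding S_def by measurable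
  have AES: "AE x in lebesgue. S x \<noteq> \<infinity>" by (rule nn_integral_PInf_AE[OF Sm fin])
  have conv: "convergent (\<lambda>n. f n x)" if Sx: "S x \<noteq> \<infinity>" for x
  proof -
    obtain C where C: "S x = ennreal C" "C \<ge> 0" using Sx by (cases "S x") auto
    have b: "norm (f (Suc n) x - f n x) \<le> sqrt C * (sqrt (1/2))^n" for n
    proof -
      define F where "F i = ennreal (2^i * (cmod (f (Suc i) x - f i x))\<^sup>2)" for i
      have "sum F {n} \<le> suminf F" by (rule sum_le_suminf) (auto intro: summableI)
      then have "ennreal (2^n * (cmod (f (Suc n) x - f n x))\<^sup>2) \<le> ennreal C"
        unfolding C(1)[symmetric] S_def F_def[symmetric] by simp
      then have "2^n * (cmod (f (Suc n) x - f n x))\<^sup>2 \<le> C" unfolding ennreal_le_iff[OF C(2)] .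
      then have "(1/2)^n * (2^n * (cmod (f (Suc n) x - f n x))\<^sup>2) \<le> (1/2)^n * C" by (intro mult_left_mono) auto
      moreover have "(1/2)^n * (2^n * (cmod (f (Suc n) x - f n x))\<^sup>2) = (cmod (f (Suc n) x - f n x))\<^sup>2"
        unfolding mult.assoc[symmetric] power_mult_distrib[symmetric] by simp
      ultimately have "(cmod (f (Suc n) x - f n x))\<^sup>2 \<le> C * (1/2)^n" by (simp only: mult.commute)
      then have "cmod (f (Suc n) x - f n x) \<le> sqrt (C * (1/2)^n)" by (rule real_le_rsqrt)
      also have "sqrt (C * (1/2)^n) = sqrt C * sqrt (1/2) ^ n" by (simp only: real_sqrt_mult real_sqrt_power)
      finally show ?thesis .
    qed
    have "sqrt (1/2) < sqrt 1" by (rule real_sqrt_less_mono) simp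
    then have "summable (\<lambda>n. sqrt C * (sqrt (1/2))^n)" by (intro summable_mult summable_geometric) auto
    then have "summable (\<lambda>n. f (Suc n) x - f n x)" by (rule summable_comparison_test'[where N=0]) (use b in auto)
    then have "convergent (\<lambda>n. (\<Sum>i<n. f (Suc i) x - f i x))" by (simp add: summable_iff_convergent)
    then have "convergent (\<lambda>n. f n x - f 0 x)"
      using sum_lessThan_telescope[of "\<lambda>i. f i x"] by simp
    from convergent_add[OF this convergent_const[of "f 0 x"]] show ?thesis by simp
  qed
  define h where "h x = lim (\<lambda>n. f n x)" for x
  have hm [measurable]: "h \<in> borel_measurable lebesgue" unfolding h_def by (rule borel_measurable_lim_metric) measurable
  have hl: "AE x in lebesgue. (\<lambda>n. f n x) \<longlonglongrightarrow> h x"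
    using AES by eventually_elim (use conv in \<open>auto simp: h_def convergent_LIMSEQ_iff\<close>)
  have hd: "(\<integral>\<^sup>+ x. ennreal ((cmod (h x - f n x))\<^sup>2) \<partial>lebesgue) \<le> ennreal ((1/4)^n)" for n
  proof -
    have "(\<integral>\<^sup>+ x. ennreal ((cmod (h x - f n x))\<^sup>2) \<partial>lebesgue) =
        (\<integral>\<^sup>+ x. liminf (\<lambda>m. ennreal ((cmod (f m x - f n x))\<^sup>2)) \<partial>lebesgue)"
    proof (rule nn_integral_cong_AE)
      show "AE x in lebesgue. ennreal ((cmod (h x - f n x))\<^sup>2) = liminf (\<lambda>m. ennreal ((cmod (f m x - f n x))\<^sup>2))"
        using hl
      proof eventually_elim
        case (elim x)
        have "(\<lambda>m. ennreal ((cmod (f m x - f n x))\<^sup>2)) \<longlonglongrightarrow> ennreal ((cmod (h x - f n x))\<^sup>2)"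
          by (intro tendsto_ennrealI tendsto_intros elim)
        from lim_imp_Liminf[OF trivial_limit_sequentially this] show ?case by simp
      qed
    qed
    also have "\<dots> \<le> liminf (\<lambda>m. \<integral>\<^sup>+ x. ennreal ((cmod (f m x - f n x))\<^sup>2) \<partial>lebesgue)"
      by (rule nn_integral_liminf) measurable
    also have "\<dots> \<le> ennreal ((1/4)^n)"
    proof -
      have "\<forall>\<^sub>F m in sequentially. (\<integral>\<^sup>+ x. ennreal ((cmod (f m x - f n x))\<^sup>2) \<partial>lebesgue) \<le> ennreal ((1/4)^n)"
        using nd by (auto simp: eventually_sequentially)
      then have "liminf (\<lambda>m. \<integral>\<^sup>+ x. ennreal ((cmod (f m x - f n x))\<^sup>2) \<partial>lebesgue) \<le> liminf (\<lambda>m::nat. ennreal ((1/4)^n))"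
        by (rule Liminf_mono)
      then show ?thesis by (simp add: Liminf_const)
    qed
    finally show ?thesis .
  qed
  have sd: "sq_integrable lebesgue (\<lambda>x. h x - f n x)" for n
    unfolding sq_integrable_def
  proof (intro conjI integrableI_nonneg)
    show "(\<integral>\<^sup>+ x. ennreal ((cmod (h x - f n x))\<^sup>2) \<partial>lebesgue) < \<infinity>"
      using hd[of n] by (rule order_le_less_trans) simp
  qed (auto, measurable)
  have sh: "sq_integrable lebesgue h" using sq_integrable_add[OF sd[of 0] sf[of 0]] by simp
  have dist: "norm (cls h - X (r n)) \<le> (1/2)^n" for n
  proof -
    have "ennreal ((norm (cls h - X (r n)))\<^sup>2) \<le> ennreal ((1/4)^n)"
      using nn_integral_norm_sq[OF sd, of n] hd[of n] by (simp add: cls_diff sh sf cf)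
    then have "(norm (cls h - X (r n)))\<^sup>2 \<le> (1/4)^n" by (simp add: ennreal_le_iff)
    also have "(1/4::real)^n = ((1/2)^n)\<^sup>2" unfolding power2_eq_square power_mult_distrib[symmetric] by simp
    finally show ?thesis by (rule power2_le_imp_le) simp
  qed
  have "(\<lambda>n. X (r n)) \<longlonglongrightarrow> cls h"
  proof (rule LIM_zero_cancel, rule Lim_null_comparison)
    show "\<forall>\<^sub>F n in sequentially. norm (X (r n) - cls h) \<le> (1/2)^n" using dist by (simp add: norm_minus_commute)
    show "(\<lambda>n. (1/2::real)^n) \<longlonglongrightarrow> 0" by (rule LIMSEQ_power_zero) simp
  qed
  then have "(X \<circ> r) \<longlonglongrightarrow> cls h" by (simp add: comp_def)
  from Cauchy_converges_subseq[OF X r(1) this] show "convergent X" by (auto simp: convergent_def)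
qed

section \<open>Smooth functions and test functions\<close>

lemma Ck_SucI:
  assumes "\<And>x. (f has_derivative f' x) (at x)" "\<And>b. Ck k (\<lambda>x. f' x b)"
  shows "Ck (Suc k) f"
proof -
  have "frechet_derivative f (at x) = f' x" for x
    using frechet_derivative_at[OF assms(1)] by simp
  then show ?thesis using assms by (auto simp: differentiable_def)
qed

lemma Ck_Suc_derivative:
  assumes "Ck (Suc k) f"
  shows "(f has_derivative frechet_derivative f (at x)) (at x)" "Ck k (\<lambda>x. frechet_derivative f (at x) b)"
  using assms by (auto simp: frechet_derivative_works[symmetric])

lemma Ck_Suc_imp: "Ck (Suc k) f \<Longrightarrow> Ck k f"
proof (induction k arbitrary: f)
  case 0
  then show ?case
    by (auto simp: continuous_on_eq_continuous_within intro: differentiable_imp_continuous_within)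
next
  case (Suc k)
  have "\<forall>x. f differentiable at x" "\<forall>b. Ck (Suc k) (\<lambda>x. frechet_derivative f (at x) b)"
    using Suc.prems by auto
  then show ?case using Suc.IH by auto
qed

lemma Ck_const: "Ck k (\<lambda>x. c)"
proof (induction k arbitrary: c)
  case (Suc k)
  show ?case by (rule Ck_SucI[of _ "\<lambda>x h. 0"]) (auto simp: Suc)
qed simp

lemma Ck_add: "Ck k f \<Longrightarrow> Ck k g \<Longrightarrow> Ck k (\<lambda>x. f x + g x)"
proof (induction k arbitrary: f g)
  case 0 then show ?case by (auto intro!: continuous_intros)
next
  case (Suc k)
  show ?case
  proof (rule Ck_SucI)
    show "((\<lambda>x. f x + g x) has_derivative
        (\<lambda>h. frechet_derivative f (at x) h + frechet_derivative g (at x) h)) (at x)" for x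
      by (intro has_derivative_add Ck_Suc_derivative(1)[OF Suc.prems(1)] Ck_Suc_derivative(1)[OF Suc.prems(2)])
    show "Ck k (\<lambda>x. frechet_derivative f (at x) b + frechet_derivative g (at x) b)" for b
      by (intro Suc.IH Ck_Suc_derivative(2)[OF Suc.prems(1)] Ck_Suc_derivative(2)[OF Suc.prems(2)])
  qed
qed

lemma Ck_mult: "Ck k f \<Longrightarrow> Ck k g \<Longrightarrow> Ck k (\<lambda>x. f x * g x)"
proof (induction k arbitrary: f g)
  case 0 then show ?case by (auto intro!: continuous_intros)
next
  case (Suc k)
  show ?case
  proof (rule Ck_SucI)
    show "((\<lambda>x. f x * g x) has_derivative
        (\<lambda>h. f x * frechet_derivative g (at x) h + frechet_derivative f (at x) h * g x)) (at x)" for x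
      by (intro has_derivative_mult Ck_Suc_derivative(1)[OF Suc.prems(1)] Ck_Suc_derivative(1)[OF Suc.prems(2)])
    show "Ck k (\<lambda>x. f x * frechet_derivative g (at x) b + frechet_derivative f (at x) b * g x)" for b
      by (intro Ck_add Suc.IH Ck_Suc_imp[OF Suc.prems(1)] Ck_Suc_imp[OF Suc.prems(2)]
          Ck_Suc_derivative(2)[OF Suc.prems(1)] Ck_Suc_derivative(2)[OF Suc.prems(2)])
  qed
qed

lemma Ck_cnj: "Ck k f \<Longrightarrow> Ck k (\<lambda>x. cnj (f x))"
proof (induction k arbitrary: f)
  case 0 then show ?case by (auto intro!: continuous_intros)
next
  case (Suc k)
  show ?case
  proof (rule Ck_SucI)
    show "((\<lambda>x. cnj (f x)) has_derivative (\<lambda>h. cnj (frechet_derivative f (at x) h))) (at x)" for x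
      by (intro bounded_linear.has_derivative[OF bounded_linear_cnj] Ck_Suc_derivative(1)[OF Suc.prems])
    show "Ck k (\<lambda>x. cnj (frechet_derivative f (at x) b))" for b
      by (intro Suc.IH Ck_Suc_derivative(2)[OF Suc.prems])
  qed
qed

lemma Ck_Re: assumes "Ck k f" shows "Ck k (\<lambda>x. of_real (Re (f x)))"
proof -
  have "of_real (Re z) = (1/2) * (z + cnj z)" for z :: complex by (simp add: complex_add_cnj)
  then show ?thesis using assms by (simp only:) (intro Ck_mult Ck_const Ck_add Ck_cnj)
qed

lemma Ck_coordinate: "Ck k (\<lambda>x. of_real (inner x e))"
proof (cases k)
  case 0 then show ?thesis by (auto intro!: continuous_intros)
next
  case (Suc n)
  show ?thesis unfolding Suc
    by (rule Ck_SucI[of _ "\<lambda>x h. of_real (inner h e)"]) (auto intro!: derivative_eq_intros Ck_const)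
qed

lemma Ck_prod:
  assumes "finite A" "\<And>i. i \<in> A \<Longrightarrow> Ck k (f i)" shows "Ck k (\<lambda>x. \<Prod>i\<in>A. f i x)"
  using assms by (induction A rule: finite_induct) (auto intro!: Ck_const Ck_mult)

text \<open>A smooth real function given together with all its derivatives, so that smoothness of a
  composition follows by induction on the order with the index \<open>n\<close> left
  general.\<close>

definition smooth_chain :: "(nat \<Rightarrow> real \<Rightarrow> real) \<Rightarrow> bool" where
  "smooth_chain H \<longleftrightarrow> (\<forall>n x. (H n has_real_derivative H (Suc n) x) (at x))"

lemma Ck_smooth_chain:
  assumes H: "smooth_chain H" and f: "Ck k f" shows "Ck k (\<lambda>x. of_real (H n (Re (f x))))"
  using f
proof (induction k arbitrary: f n)
  case 0
  have "continuous_on UNIV (H n)"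
    using H by (auto simp: smooth_chain_def intro!: DERIV_continuous_on)
  then have "continuous_on UNIV (\<lambda>x. H n (Re (f x)))"
    by (rule continuous_on_compose2) (use 0 in \<open>auto intro!: continuous_intros\<close>)
  then show ?case by (auto intro!: continuous_intros)
next
  case (Suc k)
  note f' = Ck_Suc_derivative[OF Suc.prems]
  show ?case
  proof (rule Ck_SucI)
    fix x
    have "((\<lambda>x. Re (f x)) has_derivative (\<lambda>h. Re (frechet_derivative f (at x) h))) (at x)"
      by (intro bounded_linear.has_derivative[OF bounded_linear_Re] f')
    moreover have "(H n has_derivative (*) (H (Suc n) (Re (f x)))) (at (Re (f x)))"
      using H by (simp add: smooth_chain_def has_field_derivative_def)
    ultimately have "((\<lambda>x. H n (Re (f x))) has_derivative
        (\<lambda>h. H (Suc n) (Re (f x)) * Re (frechet_derivative f (at x) h))) (at x)"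
      by (rule has_derivative_compose)
    then have "((\<lambda>x. of_real (H n (Re (f x))) :: complex) has_derivative
        (\<lambda>h. of_real (H (Suc n) (Re (f x)) * Re (frechet_derivative f (at x) h)))) (at x)"
      by (rule bounded_linear.has_derivative[OF bounded_linear_of_real])
    then show "((\<lambda>x. of_real (H n (Re (f x))) :: complex) has_derivative
        (\<lambda>h. of_real (H (Suc n) (Re (f x))) * of_real (Re (frechet_derivative f (at x) h)))) (at x)"
      by simp
  next
    show "Ck k (\<lambda>x. of_real (H (Suc n) (Re (f x))) * of_real (Re (frechet_derivative f (at x) b)))" for b
      by (intro Ck_mult Suc.IH Ck_Suc_imp[OF Suc.prems] Ck_Re f')
  qed
qed

lemma smooth_chain_derivative:
  assumes H: "smooth_chain H" and f: "(f has_derivative f') (at x)"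
  shows "((\<lambda>x. of_real (H n (Re (f x))) :: complex) has_derivative
        (\<lambda>h. of_real (H (Suc n) (Re (f x)) * Re (f' h)))) (at x)"
proof -
  have "((\<lambda>x. Re (f x)) has_derivative (\<lambda>h. Re (f' h))) (at x)"
    by (intro bounded_linear.has_derivative[OF bounded_linear_Re] f)
  moreover have "(H n has_derivative (*) (H (Suc n) (Re (f x)))) (at (Re (f x)))"
    using H by (simp add: smooth_chain_def has_field_derivative_def)
  ultimately have "((\<lambda>x. H n (Re (f x))) has_derivative (\<lambda>h. H (Suc n) (Re (f x)) * Re (f' h))) (at x)"
    by (rule has_derivative_compose)
  then show ?thesis by (rule bounded_linear.has_derivative[OF bounded_linear_of_real])
qed

lemma smooth_chain_affine:
  assumes "smooth_chain H" shows "smooth_chain (\<lambda>n x. a * c ^ n * H n (c * x + d))"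
  unfolding smooth_chain_def
proof (intro allI)
  fix n x
  have "(H n has_real_derivative H (Suc n) (c * x + d)) (at (c * x + d))"
    using assms by (simp add: smooth_chain_def)
  moreover have "((\<lambda>x. c * x + d) has_real_derivative c) (at x)" by (auto intro!: derivative_eq_intros)
  ultimately have "((\<lambda>x. H n (c * x + d)) has_real_derivative H (Suc n) (c * x + d) * c) (at x)"
    by (rule DERIV_chain2)
  from DERIV_cmult[OF this, of "a * c ^ n"]
  show "((\<lambda>x. a * c ^ n * H n (c * x + d)) has_real_derivative a * c ^ Suc n * H (Suc n) (c * x + d)) (at x)"
    by (simp add: mult_ac)
qed

section \<open>A smooth monotone cutoff\<close>

text \<open>The class p(1/x) exp(-1/x), extended by 0, is closed under differentiation: p is
  replaced by X^2 (p - p'), and the multiplication by X^2 is the double \<open>pCons 0\<close>. At 0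
  the exponential beats every polynomial in 1/x.\<close>

definition exp_cut :: "real poly \<Rightarrow> real \<Rightarrow> real" where
  "exp_cut p x = (if x > 0 then poly p (1 / x) * exp (- (1 / x)) else 0)"

lemma poly_times_exp_tendsto_0:
  fixes p :: "real poly" shows "((\<lambda>y. poly p y * exp (- y)) \<longlongrightarrow> 0) at_top"
proof -
  have "((\<lambda>y. \<Sum>i\<le>degree p. coeff p i * (y ^ i / exp y)) \<longlongrightarrow> (\<Sum>i\<le>degree p. coeff p i * 0)) at_top"
    by (intro tendsto_intros tendsto_power_div_exp_0)
  moreover have "(\<Sum>i\<le>degree p. coeff p i * (y ^ i / exp y)) = poly p y * exp (- y)" for y
    unfolding poly_altdef sum_distrib_right by (intro sum.cong) (auto simp: exp_minus divide_inverse)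
  ultimately show ?thesis by simp
qed

lemma exp_cut_derivative:
  "(exp_cut p has_real_derivative exp_cut (pCons 0 (pCons 0 (p - pderiv p))) x) (at x)"
proof -
  consider "x > 0" | "x < 0" | "x = 0" by linarith
  then show ?thesis
  proof cases
    case 1
    have "((\<lambda>x. poly p (1 / x) * exp (- (1 / x))) has_real_derivative
      (poly (pderiv p) (1 / x) * (- (1 / x\<^sup>2))) * exp (- (1 / x)) + exp (- (1 / x)) * (1 / x\<^sup>2) * poly p (1 / x)) (at x)"
      using 1 by (auto intro!: derivative_eq_intros DERIV_chain2[OF poly_DERIV] simp: power2_eq_square field_simps)
    moreover have "(poly (pderiv p) (1 / x) * (- (1 / x\<^sup>2))) * exp (- (1 / x)) + exp (- (1 / x)) * (1 / x\<^sup>2) * poly p (1 / x)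
       = exp_cut (pCons 0 (pCons 0 (p - pderiv p))) x"
      using 1 by (simp add: exp_cut_def power2_eq_square algebra_simps)
    ultimately have "((\<lambda>x. poly p (1 / x) * exp (- (1 / x))) has_real_derivative
        exp_cut (pCons 0 (pCons 0 (p - pderiv p))) x) (at x)" by simp
    then show ?thesis
      by (rule has_field_derivative_transform_within_open[of _ _ _ "{0<..}"]) (use 1 in \<open>auto simp: exp_cut_def\<close>)
  next
    case 2
    have "((\<lambda>x. 0) has_real_derivative 0) (at x)" by simp
    then have "(exp_cut p has_real_derivative 0) (at x)"
      by (rule has_field_derivative_transform_within_open[of _ _ _ "{..<0}"]) (use 2 in \<open>auto simp: exp_cut_def\<close>)
    then show ?thesis using 2 by (simp add: exp_cut_def)
  next
    case 3
    have "((\<lambda>h. exp_cut p h / h) \<longlongrightarrow> 0) (at_left 0)"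
      by (rule tendsto_eventually) (auto simp: eventually_at_filter exp_cut_def)
    moreover have "((\<lambda>h. exp_cut p h / h) \<longlongrightarrow> 0) (at_right 0)"
    proof -
      have "((\<lambda>h. poly (pCons 0 p) (inverse h) * exp (- inverse h)) \<longlongrightarrow> 0) (at_right (0::real))"
        by (rule filterlim_compose[OF poly_times_exp_tendsto_0 filterlim_inverse_at_top_right])
      then show ?thesis
        by (rule Lim_transform_eventually) (auto simp: eventually_at_filter exp_cut_def divide_inverse)
    qed
    ultimately have "((\<lambda>h. exp_cut p h / h) \<longlongrightarrow> 0) (at 0)" by (simp add: filterlim_split_at)
    then have "(exp_cut p has_real_derivative 0) (at 0)" by (simp add: DERIV_def exp_cut_def)
    then show ?thesis using 3 by (simp add: exp_cut_def)
  qed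
qed

primrec cut_poly :: "nat \<Rightarrow> real poly" where
  "cut_poly 0 = 1"
| "cut_poly (Suc n) = pCons 0 (pCons 0 (cut_poly n - pderiv (cut_poly n)))"

definition cutoff :: "nat \<Rightarrow> real \<Rightarrow> real" where "cutoff n = exp_cut (cut_poly n)"

lemma cutoff_chain: "smooth_chain cutoff"
  unfolding smooth_chain_def cutoff_def using exp_cut_derivative by simp

lemma cutoff_0: "cutoff 0 x = (if x > 0 then exp (- (1 / x)) else 0)"
  by (simp add: cutoff_def exp_cut_def)

lemma cutoff_0_bounds: "0 \<le> cutoff 0 x" "cutoff 0 x \<le> 1" "cutoff 0 x > 0 \<longleftrightarrow> x > 0"
  "x \<le> 0 \<Longrightarrow> cutoff 0 x = 0"
  by (auto simp: cutoff_0)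

text \<open>The truncation argument needs a function that is nondecreasing and Lipschitz. With y =
  1/x the derivative is y^2 exp(-y), and y/2 is at most exp(y/2).\<close>

lemma cutoff_1_bounds: "0 \<le> cutoff (Suc 0) x" "cutoff (Suc 0) x \<le> 4"
proof -
  show "0 \<le> cutoff (Suc 0) x" by (auto simp: cutoff_def exp_cut_def)
  have "y * y * exp (- y) \<le> 4" if "y > 0" for y :: real
  proof -
    have "y / 2 \<le> exp (y / 2)" using exp_ge_add_one_self[of "y/2"] by linarith
    then have "(y / 2)\<^sup>2 \<le> (exp (y / 2))\<^sup>2" using that by (intro power_mono) auto
    also have "\<dots> = exp y" by (simp add: power2_eq_square mult_exp_exp)
    finally have "y * y \<le> 4 * exp y" by (simp add: power2_eq_square)
    then show ?thesis by (simp add: exp_minus field_simps)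
  qed
  from this[of "1 / x"] show "cutoff (Suc 0) x \<le> 4"
    by (cases "x > 0") (auto simp: cutoff_def exp_cut_def)
qed

lemma cutoff_limit: assumes "y > 0" shows "(\<lambda>n. cutoff 0 (real n * y)) \<longlonglongrightarrow> 1"
proof -
  have "(\<lambda>n. exp (- (inverse (real n) * inverse y))) \<longlonglongrightarrow> exp (- (0 * inverse y))"
    by (intro tendsto_intros lim_inverse_n)
  then have "(\<lambda>n. exp (- (inverse (real n) * inverse y))) \<longlonglongrightarrow> 1" by simp
  then show ?thesis
    by (rule Lim_transform_eventually)
      (use assms in \<open>auto simp: cutoff_0 divide_inverse eventually_sequentially intro!: exI[of _ 1]\<close>)
qed

section \<open>Calculus of test functions\<close>

lemma test_functions_support:
  assumes "\<psi> \<in> test_functions \<Omega>" "\<And>k. Ck k f" "{x. f x \<noteq> 0} \<subseteq> closure {x. \<psi> x \<noteq> 0}"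
  shows "f \<in> test_functions \<Omega>"
proof -
  have sub: "closure {x. f x \<noteq> 0} \<subseteq> closure {x. \<psi> x \<noteq> 0}"
    using assms(3) by (simp add: closure_minimal)
  moreover have "compact (closure {x. f x \<noteq> 0})"
    using sub assms(1) closed_closure compact_Int_closed[of "closure {x. \<psi> x \<noteq> 0}" "closure {x. f x \<noteq> 0}"]
    by (simp add: test_functions_def Int_absorb1)
  ultimately show ?thesis using assms(1,2) by (auto simp: test_functions_def)
qed

lemma test_functions_zeros:
  assumes "\<psi> \<in> test_functions \<Omega>" "\<And>k. Ck k f" "\<And>x. \<psi> x = 0 \<Longrightarrow> f x = 0"
  shows "f \<in> test_functions \<Omega>"
proof (rule test_functions_support[OF assms(1,2)])
  have "{x. f x \<noteq> 0} \<subseteq> {x. \<psi> x \<noteq> 0}" using assms(3) by auto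
  then show "{x. f x \<noteq> 0} \<subseteq> closure {x. \<psi> x \<noteq> 0}" using closure_subset by (rule order_trans)
qed

lemma test_functions_Ck: "\<psi> \<in> test_functions \<Omega> \<Longrightarrow> Ck k \<psi>"
  by (simp add: test_functions_def)

lemma test_functions_mult:
  assumes "\<psi> \<in> test_functions \<Omega>" "\<And>k. Ck k f" shows "(\<lambda>x. f x * \<psi> x) \<in> test_functions \<Omega>"
  by (rule test_functions_zeros[OF assms(1)]) (use assms(2) test_functions_Ck[OF assms(1)] in \<open>auto intro!: Ck_mult\<close>)

lemma test_functions_cmult: "\<psi> \<in> test_functions \<Omega> \<Longrightarrow> (\<lambda>x. c * \<psi> x) \<in> test_functions \<Omega>"
  by (rule test_functions_mult[OF _ Ck_const])

lemma test_functions_cnj: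
  assumes "\<psi> \<in> test_functions \<Omega>" shows "(\<lambda>x. cnj (\<psi> x)) \<in> test_functions \<Omega>"
  by (rule test_functions_zeros[OF assms]) (use test_functions_Ck[OF assms] in \<open>auto intro!: Ck_cnj\<close>)

lemma test_functions_chain:
  assumes "\<psi> \<in> test_functions \<Omega>" "smooth_chain H" "H 0 0 = 0"
  shows "(\<lambda>x. of_real (H 0 (Re (\<psi> x)))) \<in> test_functions \<Omega>"
  by (rule test_functions_zeros[OF assms(1)]) (use assms test_functions_Ck[OF assms(1)] in \<open>auto intro!: Ck_smooth_chain\<close>)

lemma test_functions_add:
  assumes "\<psi> \<in> test_functions \<Omega>" "\<eta> \<in> test_functions \<Omega>"
  shows "(\<lambda>x. \<psi> x + \<eta> x) \<in> test_functions \<Omega>"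
proof -
  let ?C = "closure {x. \<psi> x \<noteq> 0} \<union> closure {x. \<eta> x \<noteq> 0}"
  have C: "compact ?C" "?C \<subseteq> \<Omega>" using assms by (auto simp: test_functions_def)
  have "{x. \<psi> x + \<eta> x \<noteq> 0} \<subseteq> {x. \<psi> x \<noteq> 0} \<union> {x. \<eta> x \<noteq> 0}" by auto
  then have sub: "closure {x. \<psi> x + \<eta> x \<noteq> 0} \<subseteq> ?C"
    using closure_mono by (metis closure_Un)
  moreover have "compact (closure {x. \<psi> x + \<eta> x \<noteq> 0})"
    using sub C(1) compact_Int_closed[of ?C "closure {x. \<psi> x + \<eta> x \<noteq> 0}"] by (simp add: Int_absorb1)
  ultimately show ?thesis using C assms by (auto simp: test_functions_def intro!: Ck_add)
qed

lemma test_functions_zero: "(\<lambda>x. 0) \<in> test_functions \<Omega>"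
  by (simp add: test_functions_def Ck_const)

lemma test_functions_has_derivative:
  assumes "\<psi> \<in> test_functions \<Omega>"
  shows "(\<psi> has_derivative frechet_derivative \<psi> (at x)) (at x)"
  by (rule Ck_Suc_derivative(1)[OF test_functions_Ck[OF assms]])

lemma test_functions_derivative:
  assumes "\<psi> \<in> test_functions \<Omega>"
  shows "(\<lambda>x. frechet_derivative \<psi> (at x) b) \<in> test_functions \<Omega>"
proof (rule test_functions_support[OF assms Ck_Suc_derivative(2)[OF test_functions_Ck[OF assms]]], rule subsetI, rule ccontr)
  fix x assume x: "x \<in> {x. frechet_derivative \<psi> (at x) b \<noteq> 0}" "x \<notin> closure {x. \<psi> x \<noteq> 0}"
  have "((\<lambda>x. 0) has_derivative (\<lambda>h. 0)) (at x)" by simp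
  then have "(\<psi> has_derivative (\<lambda>h. 0)) (at x)"
    by (rule has_derivative_transform_within_open[of _ _ _ _ "- closure {x. \<psi> x \<noteq> 0}"])
      (use x closure_subset[of "{x. \<psi> x \<noteq> 0}"] in auto)
  then have "frechet_derivative \<psi> (at x) = (\<lambda>h. 0)" by (rule frechet_derivative_at[symmetric])
  with x show False by simp
qed

lemma test_functions_continuous: "\<psi> \<in> test_functions \<Omega> \<Longrightarrow> continuous_on UNIV \<psi>"
  using test_functions_Ck[of \<psi> \<Omega> 0] by simp

lemma test_functions_outside: "\<psi> \<in> test_functions \<Omega> \<Longrightarrow> x \<notin> \<Omega> \<Longrightarrow> \<psi> x = 0"
  using closure_subset[of "{x. \<psi> x \<noteq> 0}"] by (auto simp: test_functions_def)

lemma test_functions_bounded: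
  assumes "\<psi> \<in> test_functions \<Omega>" obtains K where "K > 0" "\<And>x. norm (\<psi> x) \<le> K"
proof -
  have "bounded (\<psi> ` closure {x. \<psi> x \<noteq> 0})"
    using assms test_functions_continuous[OF assms]
    by (intro compact_imp_bounded compact_continuous_image)
      (auto simp: test_functions_def intro: continuous_on_subset)
  then obtain K where K: "\<And>x. x \<in> closure {x. \<psi> x \<noteq> 0} \<Longrightarrow> norm (\<psi> x) \<le> K"
    unfolding bounded_iff by blast
  have "norm (\<psi> x) \<le> max K 1" for x
  proof (cases "\<psi> x = 0")
    case False
    then have "x \<in> closure {x. \<psi> x \<noteq> 0}" using closure_subset by fastforce
    then show ?thesis using K by (simp add: le_max_iff_disj)
  qed simp
  then show ?thesis using that[of "max K 1"] by simp
qed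

lemma continuous_compact_support_integrable:
  fixes f :: "'a::euclidean_space \<Rightarrow> 'b::{banach,second_countable_topology}"
  assumes f: "continuous_on UNIV f" and S: "compact S" "\<And>x. x \<notin> S \<Longrightarrow> f x = 0"
  shows "integrable lborel f" "integrable lebesgue f"
proof -
  have "integrable lborel (\<lambda>x. indicator S x *\<^sub>R f x)"
    by (rule borel_integrable_compact[OF S(1) continuous_on_subset[OF f]]) simp
  moreover have "(\<lambda>x. indicator S x *\<^sub>R f x) = f" using S(2) by (auto simp: indicator_def)
  ultimately show 1: "integrable lborel f" by simp
  have "f \<in> borel_measurable lborel" using borel_measurable_continuous_onI[OF f] by simp
  then show "integrable lebesgue f" using 1 by (simp add: integrable_completion)
qed

lemma test_functions_integrable:
  assumes "\<psi> \<in> test_functions \<Omega>" shows "integrable lborel \<psi>" "integrable lebesgue \<psi>"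
    "integrable lebesgue (\<lambda>x. (cmod (\<psi> x))\<^sup>2)"
proof -
  have S: "compact (closure {x. \<psi> x \<noteq> 0})" using assms by (simp add: test_functions_def)
  have z: "\<psi> x = 0" if "x \<notin> closure {x. \<psi> x \<noteq> 0}" for x using that closure_subset[of "{x. \<psi> x \<noteq> 0}"] by auto
  note c = test_functions_continuous[OF assms]
  show "integrable lborel \<psi>" "integrable lebesgue \<psi>"
    using continuous_compact_support_integrable[OF c S z] by auto
  show "integrable lebesgue (\<lambda>x. (cmod (\<psi> x))\<^sup>2)"
  proof (rule continuous_compact_support_integrable(2)[OF _ S])
    show "continuous_on UNIV (\<lambda>x. (cmod (\<psi> x))\<^sup>2)" by (intro continuous_intros c)
    show "(cmod (\<psi> x))\<^sup>2 = 0" if "x \<notin> closure {x. \<psi> x \<noteq> 0}" for x unfolding z[OF that] by simp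
  qed
qed

text \<open>The difference quotients in direction \<open>b\<close> have integral zero by translation
  invariance and converge dominatedly to the derivative. This treats an arbitrary direction without
  iterated integrals.\<close>

lemma test_functions_integral_derivative:
  assumes F: "F \<in> test_functions \<Omega>"
  shows "(LINT x|lebesgue. frechet_derivative F (at x) b) = 0"
proof -
  let ?F' = "\<lambda>x. frechet_derivative F (at x) b"
  have F': "?F' \<in> test_functions \<Omega>" by (rule test_functions_derivative[OF F])
  obtain K where K: "K > 0" "\<And>x. norm (?F' x) \<le> K" using test_functions_bounded[OF F'] by metis
  have cF: "continuous_on UNIV F" by (rule test_functions_continuous[OF F])
  obtain r where r: "closure {x. F x \<noteq> 0} \<subseteq> cball 0 r"
  proof -
    have "bounded (closure {x. F x \<noteq> 0})" using F by (intro compact_imp_bounded) (simp add: test_functions_def)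
    then obtain r where "\<forall>x\<in>closure {x. F x \<noteq> 0}. norm x \<le> r" unfolding bounded_iff by blast
    then show ?thesis using that[of r] by (auto simp: subset_iff)
  qed
  \<comment> \<open>With step sizes \<open>h n \<le> 1\<close>, this ball contains the supports of
    \<open>F\<close> and of all its shifts, so it carries a common majorant.\<close>
  define B where "B = cball (0::'a) (r + norm b)"
  define h where "h n = 1 / real (Suc n)" for n
  have h: "h n > 0" "h n \<le> 1" for n by (auto simp: h_def)
  define Q where "Q n x = (1 / h n) *\<^sub>R (F (x + h n *\<^sub>R b) - F x)" for n x
  have Fm: "F \<in> borel_measurable borel" by (rule borel_measurable_continuous_onI[OF cF])
  have Fsm: "(\<lambda>x. F (x + c)) \<in> borel_measurable borel" for c
    by (intro borel_measurable_continuous_onI continuous_on_compose2[OF cF] continuous_intros) auto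
  have zero: "F x = 0" "F (x + h n *\<^sub>R b) = 0" "?F' x = 0" if "x \<notin> B" for x n
  proof -
    have "norm (h n *\<^sub>R b) \<le> norm b" using h[of n] by (simp add: mult_left_le_one_le)
    then have "norm (x + h n *\<^sub>R b) > r" "norm x > r"
      using that norm_diff_ineq[of x "h n *\<^sub>R b"] norm_ge_zero[of b] unfolding B_def mem_cball_0 by linarith+
    then have "x + h n *\<^sub>R b \<notin> closure {x. F x \<noteq> 0}" "x \<notin> closure {x. F x \<noteq> 0}" using r by auto
    then show "F x = 0" "F (x + h n *\<^sub>R b) = 0" using closure_subset[of "{x. F x \<noteq> 0}"] by auto
    show "?F' x = 0"
    proof -
      have "((\<lambda>x. 0) has_derivative (\<lambda>h. 0)) (at x)" by simp
      then have "(F has_derivative (\<lambda>h. 0)) (at x)"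
        by (rule has_derivative_transform_within_open[of _ _ _ _ "- closure {x. F x \<noteq> 0}"])
          (use \<open>x \<notin> closure {x. F x \<noteq> 0}\<close> closure_subset[of "{x. F x \<noteq> 0}"] in auto)
      from frechet_derivative_at[OF this] show ?thesis by (simp add: fun_eq_iff)
    qed
  qed
  have Qint: "integral\<^sup>L lborel (Q n) = 0" for n
  proof -
    have i1: "integrable lborel F" by (rule test_functions_integrable[OF F])
    have eq: "integral\<^sup>L lborel F = integral\<^sup>L lborel (\<lambda>x. F (h n *\<^sub>R b + x))"
    proof -
      have "integral\<^sup>L lborel F = integral\<^sup>L (distr lborel borel ((+) (h n *\<^sub>R b))) F" by (simp add: lborel_distr_plus)
      also have "\<dots> = integral\<^sup>L lborel (\<lambda>x. F (h n *\<^sub>R b + x))" by (rule integral_distr) (auto simp: Fm)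
      finally show ?thesis .
    qed
    have i2: "integrable lborel (\<lambda>x. F (x + h n *\<^sub>R b))"
      by (rule continuous_compact_support_integrable(1)[of _ B])
        (use zero in \<open>auto simp: B_def intro!: continuous_on_compose2[OF cF] continuous_intros\<close>)
    show ?thesis unfolding Q_def using i1 i2 eq by (simp add: add.commute)
  qed
  have Qlim: "(\<lambda>n. Q n x) \<longlonglongrightarrow> ?F' x" for x
  proof -
    have "((\<lambda>t. x + t *\<^sub>R b) has_derivative (\<lambda>t. t *\<^sub>R b)) (at 0)" by (auto intro!: derivative_eq_intros)
    moreover have "(F has_derivative frechet_derivative F (at x)) (at (x + 0 *\<^sub>R b))"
      using test_functions_has_derivative[OF F] by simp
    ultimately have "((\<lambda>t. F (x + t *\<^sub>R b)) has_derivative (\<lambda>t. frechet_derivative F (at x) (t *\<^sub>R b))) (at 0)"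
      by (rule has_derivative_compose)
    then have "((\<lambda>t. F (x + t *\<^sub>R b)) has_vector_derivative ?F' x) (at 0)"
      using linear_scale[OF has_derivative_linear[OF test_functions_has_derivative[OF F]]]
      by (simp add: has_vector_derivative_def)
    then have "((\<lambda>t. (1 / norm (t - 0)) *\<^sub>R (F (x + t *\<^sub>R b) - (F (x + 0 *\<^sub>R b) + (t - 0) *\<^sub>R ?F' x))) \<longlongrightarrow> 0) (at 0)"
      unfolding has_vector_derivative_def has_derivative_within by auto
    moreover have "filterlim h (at 0) sequentially"
      using h(1) unfolding h_def[abs_def] filterlim_at
      by (auto intro!: LIMSEQ_Suc[OF lim_1_over_n, simplified])
    ultimately have "(\<lambda>n. (1 / norm (h n - 0)) *\<^sub>R (F (x + h n *\<^sub>R b) - (F (x + 0 *\<^sub>R b) + (h n - 0) *\<^sub>R ?F' x))) \<longlonglongrightarrow> 0"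
      by (rule filterlim_compose)
    moreover have "(1 / norm (h n - 0)) *\<^sub>R (F (x + h n *\<^sub>R b) - (F (x + 0 *\<^sub>R b) + (h n - 0) *\<^sub>R ?F' x)) = Q n x - ?F' x" for n
      using h[of n] by (simp add: Q_def algebra_simps)
    ultimately have "(\<lambda>n. Q n x - ?F' x) \<longlonglongrightarrow> 0" by simp
    then show ?thesis by (rule LIM_zero_cancel)
  qed
  have Qb: "norm (Q n x) \<le> K * indicator B x" for n x
  proof (cases "x \<in> B")
    case False then show ?thesis using zero by (simp add: Q_def)
  next
    case True
    have "\<exists>t\<in>{0<..<h n}. norm (F (x + h n *\<^sub>R b) - F (x + 0 *\<^sub>R b)) \<le> norm (frechet_derivative F (at (x + t *\<^sub>R b)) ((h n - 0) *\<^sub>R b))"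
    proof (rule mvt_general[OF h(1)])
      show "continuous_on {0..h n} (\<lambda>t. F (x + t *\<^sub>R b))"
        by (intro continuous_on_compose2[OF cF] continuous_intros) auto
      fix t assume "0 < t" "t < h n"
      have "((\<lambda>t. x + t *\<^sub>R b) has_derivative (\<lambda>t. t *\<^sub>R b)) (at t)" by (auto intro!: derivative_eq_intros)
      then show "((\<lambda>t. F (x + t *\<^sub>R b)) has_derivative (\<lambda>s. frechet_derivative F (at (x + t *\<^sub>R b)) (s *\<^sub>R b))) (at t)"
        by (rule has_derivative_compose[OF _ test_functions_has_derivative[OF F]])
    qed
    then obtain t where t: "norm (F (x + h n *\<^sub>R b) - F x) \<le> norm (frechet_derivative F (at (x + t *\<^sub>R b)) (h n *\<^sub>R b))" by auto
    also have "frechet_derivative F (at (x + t *\<^sub>R b)) (h n *\<^sub>R b) = h n *\<^sub>R ?F' (x + t *\<^sub>R b)"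
      using linear_scale[OF has_derivative_linear[OF test_functions_has_derivative[OF F]]] by simp
    also have "norm \<dots> \<le> h n * K" using K h[of n] by (simp add: mult_left_mono)
    finally have "norm (F (x + h n *\<^sub>R b) - F x) \<le> K * h n" by (simp add: mult.commute)
    then have "norm (Q n x) \<le> K" using h(1)[of n] unfolding Q_def norm_scaleR by (simp add: pos_divide_le_eq)
    then show ?thesis using True by simp
  qed
  have "(\<lambda>n. integral\<^sup>L lborel (Q n)) \<longlonglongrightarrow> integral\<^sup>L lborel ?F'"
  proof (rule integral_dominated_convergence)
    show "?F' \<in> borel_measurable lborel"
      using borel_measurable_continuous_onI[OF test_functions_continuous[OF F']] by simp
    show "Q n \<in> borel_measurable lborel" for n
      unfolding Q_def[abs_def] using Fm Fsm by measurable
    show "integrable lborel (\<lambda>x. K * indicator B x)"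
      by (intro integrable_mult_right integrable_real_indicator) (use emeasure_bounded_finite[of B] in \<open>auto simp: B_def\<close>)
  qed (use Qlim Qb in auto)
  then have "integral\<^sup>L lborel ?F' = 0" unfolding Qint by (simp add: LIMSEQ_const_iff)
  moreover have "?F' \<in> borel_measurable lborel"
    using borel_measurable_continuous_onI[OF test_functions_continuous[OF F']] by simp
  ultimately show ?thesis by (simp add: integral_completion)
qed

lemma test_functions_integration_by_parts:
  assumes \<psi>: "\<psi> \<in> test_functions \<Omega>" and \<eta>: "\<eta> \<in> test_functions \<Omega>"
  shows "(LINT x|lebesgue. \<psi> x * frechet_derivative \<eta> (at x) b) = - (LINT x|lebesgue. frechet_derivative \<psi> (at x) b * \<eta> x)"
proof -
  have i1: "(\<lambda>x. \<psi> x * frechet_derivative \<eta> (at x) b) \<in> test_functions \<Omega>"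
    by (rule test_functions_mult[OF test_functions_derivative[OF \<eta>] test_functions_Ck[OF \<psi>]])
  have i2: "(\<lambda>x. frechet_derivative \<psi> (at x) b * \<eta> x) \<in> test_functions \<Omega>"
    by (rule test_functions_mult[OF \<eta> test_functions_Ck[OF test_functions_derivative[OF \<psi>]]])
  have i3: "(\<lambda>x. \<psi> x * \<eta> x) \<in> test_functions \<Omega>" by (rule test_functions_mult[OF \<eta> test_functions_Ck[OF \<psi>]])
  have "frechet_derivative (\<lambda>x. \<psi> x * \<eta> x) (at x) = (\<lambda>h. \<psi> x * frechet_derivative \<eta> (at x) h + frechet_derivative \<psi> (at x) h * \<eta> x)" for x
    by (rule frechet_derivative_at[symmetric], rule has_derivative_mult[OF test_functions_has_derivative[OF \<psi>] test_functions_has_derivative[OF \<eta>]])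
  with test_functions_integral_derivative[OF i3, of b]
  have "(LINT x|lebesgue. \<psi> x * frechet_derivative \<eta> (at x) b + frechet_derivative \<psi> (at x) b * \<eta> x) = 0" by simp
  then show ?thesis using test_functions_integrable(2)[OF i1] test_functions_integrable(2)[OF i2]
    by (simp add: eq_neg_iff_add_eq_0)
qed

section \<open>The fundamental lemma of the calculus of variations\<close>

text \<open>A product of one-dimensional cutoffs rising from each face of the box. It is supported
  in the closed box and tends to the indicator of the open box as \<open>n\<close> grows.\<close>

definition box_bump :: "'a::euclidean_space \<Rightarrow> 'a \<Rightarrow> nat \<Rightarrow> 'a \<Rightarrow> complex" where
  "box_bump a b n x = (\<Prod>i\<in>Basis. of_real (cutoff 0 (real n * (inner x i - inner a i))) *
     of_real (cutoff 0 (real n * (inner b i - inner x i))))"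

lemma box_bump_test:
  assumes "n > 0" "cbox a b \<subseteq> \<Omega>" shows "box_bump a b n \<in> test_functions \<Omega>"
proof -
  have sm: "smooth_chain (\<lambda>k x. 1 * c ^ k * cutoff k (c * x + d))" for c d
    by (rule smooth_chain_affine[OF cutoff_chain])
  have C: "Ck k (\<lambda>x. of_real (cutoff 0 (c * inner x i + d)))" for k c d and i :: 'a
  proof -
    have "Ck k (\<lambda>x. of_real (1 * c ^ 0 * cutoff 0 (c * Re (of_real (inner x i)) + d)))"
      by (rule Ck_smooth_chain[OF sm Ck_coordinate])
    then show ?thesis by simp
  qed
  have C1: "Ck k (\<lambda>x. of_real (cutoff 0 (real n * (inner x i - inner a i))))" for k i
    using C[of k "real n" i "- real n * inner a i"] by (simp add: right_diff_distrib)
  have C2: "Ck k (\<lambda>x. of_real (cutoff 0 (real n * (inner b i - inner x i))))" for k i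
    using C[of k "- real n" i "real n * inner b i"] by (simp add: right_diff_distrib)
  have Ck: "Ck k (box_bump a b n)" for k
    unfolding box_bump_def[abs_def] by (intro Ck_prod Ck_mult C1 C2) simp
  have "{x. box_bump a b n x \<noteq> 0} \<subseteq> cbox a b"
  proof
    fix x assume "x \<in> {x. box_bump a b n x \<noteq> 0}"
    then have "cutoff 0 (real n * (inner x i - inner a i)) \<noteq> 0 \<and> cutoff 0 (real n * (inner b i - inner x i)) \<noteq> 0"
      if "i \<in> Basis" for i
      using that by (auto simp: box_bump_def)
    then have "real n * (inner x i - inner a i) > 0 \<and> real n * (inner b i - inner x i) > 0"
      if "i \<in> Basis" for i
      using that cutoff_0_bounds(4) not_le by blast
    then show "x \<in> cbox a b" using assms(1) by (auto simp: mem_box zero_less_mult_iff intro: less_imp_le)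
  qed
  then have sub: "closure {x. box_bump a b n x \<noteq> 0} \<subseteq> cbox a b" by (rule closure_minimal[OF _ closed_cbox])
  moreover have "compact (closure {x. box_bump a b n x \<noteq> 0})"
    using sub compact_Int_closed[of "cbox a b" "closure {x. box_bump a b n x \<noteq> 0}"] by (simp add: Int_absorb1)
  ultimately show ?thesis using Ck assms(2) by (auto simp: test_functions_def)
qed

lemma box_bump_bound: "norm (box_bump a b n x) \<le> indicator (cbox a b) x" if n: "n > 0"
proof (cases "x \<in> cbox a b")
  case True
  have "norm (box_bump a b n x) = (\<Prod>i\<in>Basis. cutoff 0 (real n * (inner x i - inner a i)) *
     cutoff 0 (real n * (inner b i - inner x i)))"
    by (simp add: box_bump_def norm_mult cutoff_0_bounds flip: prod_norm)
  also have "\<dots> \<le> 1"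
    by (intro prod_le_1 conjI mult_le_one mult_nonneg_nonneg cutoff_0_bounds)
  finally show ?thesis using True by simp
next
  case False
  then show ?thesis using test_functions_outside[OF box_bump_test[OF n order_refl] False] by simp
qed

lemma box_bump_limit: "(\<lambda>n. box_bump a b n x) \<longlonglongrightarrow> indicator (box a b) x"
proof (cases "x \<in> box a b")
  case True
  have "(\<lambda>n. box_bump a b n x) \<longlonglongrightarrow> (\<Prod>i\<in>(Basis::'a set). of_real 1 * of_real 1)"
    unfolding box_bump_def using True
    by (intro tendsto_prod tendsto_mult tendsto_of_real cutoff_limit) (auto simp: mem_box)
  then show ?thesis using True by simp
next
  case False
  then obtain i where i: "i \<in> Basis" "inner x i - inner a i \<le> 0 \<or> inner b i - inner x i \<le> 0"
    by (auto simp: mem_box not_less)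
  have "box_bump a b n x = 0" for n
  proof -
    have "cutoff 0 (real n * (inner x i - inner a i)) = 0 \<or> cutoff 0 (real n * (inner b i - inner x i)) = 0"
      using i(2) by (auto intro!: cutoff_0_bounds(4) mult_nonneg_nonpos)
    then show ?thesis unfolding box_bump_def using i(1) by (intro prod_zero) auto
  qed
  then show ?thesis using False by simp
qed

lemma sigma_finite_lebesgue: "sigma_finite_measure (lebesgue :: 'a::euclidean_space measure)"
proof
  show "\<exists>A. countable A \<and> A \<subseteq> sets (lebesgue :: 'a measure) \<and> \<Union> A = space lebesgue \<and> (\<forall>a\<in>A. emeasure lebesgue a \<noteq> \<infinity>)"
  proof (intro exI[of _ "range (\<lambda>n::nat. cball (0::'a) (real n))"] conjI ballI)
    have "\<exists>n. norm x \<le> real n" for x :: 'a by (rule real_arch_simple)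
    then show "\<Union> (range (\<lambda>n::nat. cball (0::'a) (real n))) = space lebesgue" by auto
    fix a assume "a \<in> range (\<lambda>n::nat. cball (0::'a) (real n))"
    then obtain n where a: "a = cball (0::'a) (real n)" by auto
    show "emeasure lebesgue a \<noteq> \<infinity>"
      unfolding a using emeasure_bounded_finite[of "cball (0::'a) (real n)"] by auto
  qed auto
qed

text \<open>Open boxes form an intersection-stable generator of the Borel sets, so vanishing
  integrals spread by Dynkin induction; \<open>fz\<close> starts the step for complements. A
  Lebesgue set is an F-sigma set up to a null set, and a function with all set integrals zero
  vanishes almost everywhere.\<close>

lemma box_integrals_zero_imp_AE_zero:
  fixes f :: "'a::euclidean_space \<Rightarrow> complex"
  assumes f: "integrable lebesgue f" and fz: "integral\<^sup>L lebesgue f = 0"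
    and z: "\<And>a b. (LINT x:box a b|lebesgue. f x) = 0"
  shows "AE x in lebesgue. f x = 0"
proof -
  have si: "set_integrable lebesgue A f" if "A \<in> sets lebesgue" for A
    unfolding set_integrable_def by (rule integrable_mult_indicator[OF that f])
  have univ: "(LINT x:UNIV|lebesgue. f x) = 0" using fz by (simp add: set_lebesgue_integral_def)
  let ?G = "range (\<lambda>(a, b). box a b :: 'a set)"
  have borel: "(LINT x:A|lebesgue. f x) = 0" if "A \<in> sets borel" for A
  proof -
    have A: "A \<in> sigma_sets UNIV ?G" using that by (subst (asm) borel_eq_box) simp
    have "Int_stable ?G"
    proof (rule Int_stableI)
      fix S T assume "S \<in> ?G" "T \<in> ?G"
      then obtain a b c d where "S = box a b" "T = box c d" by auto
      then show "S \<inter> T \<in> ?G" by (auto simp: box_Int_box)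
    qed
    moreover have "?G \<subseteq> Pow UNIV" by simp
    ultimately show ?thesis using A
    proof (induction rule: sigma_sets_induct_disjoint)
      case (basic A) then show ?case using z by auto
    next
      case empty then show ?case by (simp add: set_lebesgue_integral_def)
    next
      case (compl A)
      have "A \<in> sets borel" using compl(1) by (subst borel_eq_box) simp
      then have A: "A \<in> sets lebesgue" by simp
      have "(LINT x:A \<union> (UNIV - A)|lebesgue. f x) = (LINT x:A|lebesgue. f x) + (LINT x:(UNIV - A)|lebesgue. f x)"
        by (rule set_integral_Un) (use A in \<open>auto intro!: si\<close>)
      then show ?case using compl(2) univ by simp
    next
      case (union A)
      have A: "A i \<in> sets lebesgue" for i
      proof -
        have "A i \<in> sigma_sets UNIV ?G" using union by auto
        then have "A i \<in> sets borel" by (subst borel_eq_box) simp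
        then show ?thesis by simp
      qed
      have "(LINT x:(\<Union>i. A i)|lebesgue. f x) = (\<Sum>i. (LINT x:(A i)|lebesgue. f x))"
        by (rule lebesgue_integral_countable_add) (use A union in \<open>auto intro!: si simp: disjoint_family_on_def\<close>)
      then show ?case using union by simp
    qed
  qed
  have leb: "(LINT x:A|lebesgue. f x) = 0" if A: "A \<in> sets lebesgue" for A
  proof -
    obtain C T where CT: "fsigma C" "T \<in> null_sets lebesgue" "C \<union> T = A"
      using lebesgue_set_almost_fsigma[OF A] by metis
    have C: "C \<in> sets borel" using CT(1) by (auto elim!: fsigma.cases)
    have "(LINT x:A|lebesgue. f x) = (LINT x:C|lebesgue. f x)"
      unfolding set_lebesgue_integral_def
    proof (rule integral_cong_AE)
      show "(\<lambda>x. indicat_real A x *\<^sub>R f x) \<in> borel_measurable lebesgue"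
        using si[OF A] by (simp add: set_integrable_def)
      show "(\<lambda>x. indicat_real C x *\<^sub>R f x) \<in> borel_measurable lebesgue"
        using si[of C] C by (simp add: set_integrable_def)
      show "AE x in lebesgue. indicat_real A x *\<^sub>R f x = indicat_real C x *\<^sub>R f x"
        using AE_not_in[OF CT(2)] by eventually_elim (use CT(3) in \<open>auto simp: indicator_def\<close>)
    qed
    then show ?thesis using borel[OF C] by simp
  qed
  show ?thesis by (rule sigma_finite_measure.density_zero[OF sigma_finite_lebesgue f leb])
qed

text \<open>Bumps give vanishing integrals over boxes inside \<open>\<Omega>\<close>. As
  \<open>g\<close> need not be integrable over the whole space, each closed box in
  \<open>\<Omega>\<close> is handled on its own by cutting \<open>g\<close> off there; countably
  many such boxes exhaust \<open>\<Omega>\<close>.\<close>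

lemma test_orthogonal_imp_AE_zero:
  fixes g :: "'a::euclidean_space \<Rightarrow> complex"
  assumes \<Omega>: "open \<Omega>" and gm: "g \<in> borel_measurable lebesgue" and g2: "integrable lebesgue (\<lambda>x. (cmod (g x))\<^sup>2)"
    and off: "\<And>x. x \<notin> \<Omega> \<Longrightarrow> g x = 0"
    and z: "\<And>\<psi>. \<psi> \<in> test_functions \<Omega> \<Longrightarrow> (LINT x|lebesgue. g x * \<psi> x) = 0"
  shows "AE x in lebesgue. g x = 0"
proof -
  have li: "integrable lebesgue (\<lambda>x. indicat_real (cbox a b) x * cmod (g x))" for a b
  proof (rule Bochner_Integration.integrable_bound)
    show "integrable lebesgue (\<lambda>x. (cmod (g x))\<^sup>2 + indicat_real (cbox a b) x)"
      by (intro Bochner_Integration.integrable_add g2 integrable_real_indicator)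
        (use emeasure_bounded_finite[OF bounded_cbox[of a b]] in auto)
    show "(\<lambda>x. indicat_real (cbox a b) x * cmod (g x)) \<in> borel_measurable lebesgue"
      by (intro borel_measurable_times borel_measurable_indicator measurable_compose[OF gm borel_measurable_norm]) simp_all
    have "cmod (g x) \<le> (cmod (g x))\<^sup>2 + 1" for x
      using sum_squares_bound[of "cmod (g x)" 1] norm_ge_zero[of "g x"] unfolding power_one by linarith
    then show "AE x in lebesgue. norm (indicat_real (cbox a b) x * cmod (g x)) \<le> norm ((cmod (g x))\<^sup>2 + indicat_real (cbox a b) x)"
      by (auto simp: indicator_def)
  qed
  have im: "(\<lambda>x. indicator (box a b) x * g x) \<in> borel_measurable lebesgue" for a b
    by (intro borel_measurable_times gm borel_measurable_indicator) simp
  have boxint: "(LINT x|lebesgue. indicator (box a b) x * g x) = 0" if ab: "cbox a b \<subseteq> \<Omega>" for a b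
  proof -
    have "(\<lambda>n. LINT x|lebesgue. g x * box_bump a b (Suc n) x) \<longlonglongrightarrow> (LINT x|lebesgue. indicator (box a b) x * g x)"
    proof (rule integral_dominated_convergence[OF im _ li[of a b]])
      show "(\<lambda>x. g x * box_bump a b (Suc n) x) \<in> borel_measurable lebesgue" for n
      proof (intro borel_measurable_times gm)
        show "box_bump a b (Suc n) \<in> borel_measurable lebesgue"
          using test_functions_integrable(2)[OF box_bump_test[OF zero_less_Suc ab]] by simp
      qed
      have "(\<lambda>n. g x * box_bump a b (Suc n) x) \<longlonglongrightarrow> g x * indicator (box a b) x" for x
        by (intro tendsto_intros LIMSEQ_Suc box_bump_limit)
      then show "AE x in lebesgue. (\<lambda>n. g x * box_bump a b (Suc n) x) \<longlonglongrightarrow> indicator (box a b) x * g x"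
        by (simp add: mult.commute)
      have "norm (g x * box_bump a b (Suc n) x) \<le> indicat_real (cbox a b) x * cmod (g x)" for x n
        using mult_right_mono[OF box_bump_bound[of "Suc n" a b x] norm_ge_zero[of "g x"]]
        by (simp add: norm_mult mult.commute)
      then show "AE x in lebesgue. norm (g x * box_bump a b (Suc n) x) \<le> indicat_real (cbox a b) x * cmod (g x)" for n
        by simp
    qed
    then show ?thesis using z[OF box_bump_test[OF zero_less_Suc ab]] by (simp add: LIMSEQ_const_iff)
  qed
  have onbox: "AE x in lebesgue. x \<in> cbox c d \<longrightarrow> g x = 0" if cd: "cbox c d \<subseteq> \<Omega>" for c d
  proof -
    let ?f = "\<lambda>x. indicator (box c d) x * g x"
    have fi: "integrable lebesgue ?f"
      by (rule Bochner_Integration.integrable_bound[OF li[of c d] im])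
        (use box_subset_cbox[of c d] in \<open>auto simp: indicator_def norm_mult\<close>)
    have "AE x in lebesgue. ?f x = 0"
    proof (rule box_integrals_zero_imp_AE_zero[OF fi boxint[OF cd]])
      fix a b
      \<comment> \<open>The cut-off function has to be tested on arbitrary boxes. Their intersection
        with the fixed one is again a box, and its closed version lies in
        \<open>\<Omega>\<close>.\<close>
      define a' where "a' = (\<Sum>i\<in>Basis. max (a\<bullet>i) (c\<bullet>i) *\<^sub>R i)"
      define b' where "b' = (\<Sum>i\<in>Basis. min (b\<bullet>i) (d\<bullet>i) *\<^sub>R i)"
      have I: "box a b \<inter> box c d = box a' b'" by (simp add: a'_def b'_def box_Int_box)
      have "cbox a' b' = cbox a b \<inter> cbox c d" by (simp add: a'_def b'_def Int_interval)
      then have "cbox a' b' \<subseteq> \<Omega>" using cd by auto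
      from boxint[OF this]
      show "(LINT x:box a b|lebesgue. ?f x) = 0"
        unfolding set_lebesgue_integral_def I[symmetric]
        by (simp add: indicator_inter_arith scaleR_conv_of_real mult.assoc of_real_indicator)
    qed
    moreover have "negligible (cbox c d - box c d)" by (rule negligible_frontier_interval)
    then have "AE x in lebesgue. x \<notin> cbox c d - box c d"
      by (intro AE_not_in) (simp add: negligible_iff_null_sets)
    ultimately show ?thesis by eventually_elim (auto simp: indicator_def)
  qed
  obtain \<D> where \<D>: "countable \<D>" "\<D> \<subseteq> Pow \<Omega>" "\<And>X. X \<in> \<D> \<Longrightarrow> \<exists>a b. X = cbox a b" "\<Union>\<D> = \<Omega>"
    using open_countable_Union_open_cbox[OF \<Omega>] by metis
  have "AE x in lebesgue. \<forall>X\<in>\<D>. x \<in> X \<longrightarrow> g x = 0"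
    unfolding AE_ball_countable[OF \<D>(1)]
  proof
    fix X assume X: "X \<in> \<D>"
    then obtain a b where "X = cbox a b" using \<D>(3) by blast
    then show "AE x in lebesgue. x \<in> X \<longrightarrow> g x = 0" using onbox[of a b] X \<D>(2) by auto
  qed
  then show ?thesis by eventually_elim (use \<D>(4) off in blast)
qed

section \<open>The Dirichlet form of a bounded open set\<close>

definition cj :: "'a::euclidean_space l2 \<Rightarrow> 'a l2" where "cj x = cls (\<lambda>t. cnj (repr x t))"
definition Ii :: "'a::euclidean_space l2 \<Rightarrow> 'a l2" where "Ii x = cls (\<lambda>t. \<i> * repr x t)"

lemma cj_cls: assumes "sq_integrable lebesgue f" shows "cj (cls f) = cls (\<lambda>t. cnj (f t))"
  unfolding cj_def
  by (subst cls_eq_iff) (use repr_cls[OF assms] assms in \<open>auto intro!: sq_integrable_cnj elim!: eventually_mono\<close>)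

lemma Ii_cls: assumes "sq_integrable lebesgue f" shows "Ii (cls f) = cls (\<lambda>t. \<i> * f t)"
  unfolding Ii_def
  by (subst cls_eq_iff) (use repr_cls[OF assms] assms in \<open>auto intro!: sq_integrable_cmult elim!: eventually_mono\<close>)

lemma l2_cases: obtains f where "sq_integrable lebesgue f" "x = cls f"
  using that[OF sq_integrable_repr[of x]] by simp

lemma Ii_linear: "linear Ii"
proof (rule linearI)
  fix x y :: "'a l2" and c :: real
  obtain f where f: "sq_integrable lebesgue f" "x = cls f" by (rule l2_cases)
  obtain g where g: "sq_integrable lebesgue g" "y = cls g" by (rule l2_cases)
  have "Ii (x + y) = cls (\<lambda>t. \<i> * f t + \<i> * g t)"
    using f g by (simp add: cls_add[symmetric] Ii_cls sq_integrable_add distrib_left)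
  also have "\<dots> = Ii x + Ii y" using f g by (simp add: cls_add Ii_cls sq_integrable_cmult)
  finally show "Ii (x + y) = Ii x + Ii y" .
  have "Ii (c *\<^sub>R x) = cls (\<lambda>t. c *\<^sub>R (\<i> * f t))"
    using f by (simp add: cls_scaleR[OF f(1) f(1), symmetric] Ii_cls sq_integrable_scaleR)
  also have "\<dots> = c *\<^sub>R Ii x" using f by (simp add: cls_scaleR[of _ f] Ii_cls sq_integrable_cmult)
  finally show "Ii (c *\<^sub>R x) = c *\<^sub>R Ii x" .
qed

lemma Ii_inner: "inner (Ii x) (Ii y) = inner x y"
proof -
  obtain f where f: "sq_integrable lebesgue f" "x = cls f" by (rule l2_cases)
  obtain g where g: "sq_integrable lebesgue g" "y = cls g" by (rule l2_cases)
  show ?thesis using f g by (simp add: Ii_cls inner_cls sq_integrable_cmult inner_complex_def add.commute)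
qed

lemma Ii_Ii: "Ii (Ii x) = - x"
proof -
  obtain f where f: "sq_integrable lebesgue f" "x = cls f" by (rule l2_cases)
  have "Ii (Ii x) = cls (\<lambda>t. \<i> * (\<i> * f t))" using f by (simp add: Ii_cls sq_integrable_cmult)
  also have "(\<lambda>t. \<i> * (\<i> * f t)) = (\<lambda>t. - f t)" by (simp add: mult.assoc[symmetric])
  finally show ?thesis using f by (simp add: cls_uminus[of f f])
qed

lemma cj_linear: "linear cj"
proof (rule linearI)
  fix x y :: "'a l2" and c :: real
  obtain f where f: "sq_integrable lebesgue f" "x = cls f" by (rule l2_cases)
  obtain g where g: "sq_integrable lebesgue g" "y = cls g" by (rule l2_cases)
  have "cj (x + y) = cls (\<lambda>t. cnj (f t) + cnj (g t))"
    using f g by (simp add: cls_add[symmetric] cj_cls sq_integrable_add)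
  also have "\<dots> = cj x + cj y" using f g by (simp add: cls_add cj_cls sq_integrable_cnj)
  finally show "cj (x + y) = cj x + cj y" .
  have "cj (c *\<^sub>R x) = cls (\<lambda>t. c *\<^sub>R (cnj (f t)))"
    using f by (simp add: cls_scaleR[OF f(1) f(1), symmetric] cj_cls sq_integrable_scaleR)
  also have "\<dots> = c *\<^sub>R cj x" using f by (simp add: cls_scaleR[of _ f] cj_cls sq_integrable_cnj)
  finally show "cj (c *\<^sub>R x) = c *\<^sub>R cj x" .
qed

lemma cj_inner: "inner (cj x) (cj y) = inner x y"
proof -
  obtain f where f: "sq_integrable lebesgue f" "x = cls f" by (rule l2_cases)
  obtain g where g: "sq_integrable lebesgue g" "y = cls g" by (rule l2_cases)
  show ?thesis using f g by (simp add: cj_cls inner_cls sq_integrable_cnj inner_complex_def)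
qed

lemma norm_cj: "norm (cj x) = norm x" by (simp add: norm_eq_sqrt_inner cj_inner)

lemma cj_cj: "cj (cj x) = x"
proof -
  obtain f where f: "sq_integrable lebesgue f" "x = cls f" by (rule l2_cases)
  then show ?thesis by (simp add: cj_cls sq_integrable_cnj)
qed

lemma cj_Ii: "cj (Ii x) = - Ii (cj x)"
proof -
  obtain f where f: "sq_integrable lebesgue f" "x = cls f" by (rule l2_cases)
  then have "cj (Ii x) = cls (\<lambda>t. - (\<i> * cnj (f t)))" by (simp add: cj_cls Ii_cls sq_integrable_cmult)
  also have "\<dots> = - Ii (cj x)"
    using f cls_uminus[of "\<lambda>t. \<i> * cnj (f t)" f] by (simp add: cj_cls Ii_cls sq_integrable_cnj sq_integrable_cmult)
  finally show ?thesis .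
qed

lemma bounded_linear_isometry:
  assumes "linear f" "\<And>x. norm (f x) = norm x" shows "bounded_linear f"
  using assms by (intro bounded_linear_intro[of f 1]) (auto simp: linear_add linear_scale)

lemma bounded_linear_cj: "bounded_linear cj"
  by (rule bounded_linear_isometry[OF cj_linear norm_cj])

lemma bounded_linear_Ii: "bounded_linear Ii"
  by (rule bounded_linear_isometry[OF Ii_linear]) (simp add: norm_eq_sqrt_inner Ii_inner)

text \<open>Used to lift real identities to complex ones: the identity for the test function
  multiplied by \<i> supplies the second hypothesis.\<close>

lemma complex_eq_by_Re: "Re z = Re w \<Longrightarrow> Re (\<i> * z) = Re (\<i> * w) \<Longrightarrow> z = w"
  by (simp add: complex_eq_iff)

lemma test_sq_integrable: "\<psi> \<in> test_functions \<Omega> \<Longrightarrow> sq_integrable lebesgue \<psi>"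
  using test_functions_integrable[of \<psi> \<Omega>] by (auto simp: sq_integrable_def)

section \<open>Functions on the domain as classes over the whole space\<close>

locale sobolev_domain =
  fixes \<Omega> :: "(real ^ 'n) set"
  assumes open_dom: "open \<Omega>" and bounded_dom: "bounded \<Omega>"
begin

lemma dom_sets: "\<Omega> \<in> sets lebesgue" using open_dom by simp

definition ext :: "(real ^ 'n \<Rightarrow> 'b::zero) \<Rightarrow> real ^ 'n \<Rightarrow> 'b" where
  "ext f x = (if x \<in> \<Omega> then f x else 0)"

definition emb :: "(real ^ 'n \<Rightarrow> complex) \<Rightarrow> (real ^ 'n) l2" where "emb f = cls (ext f)"

lemma L2_iff: "f \<in> L2 \<Omega> \<longleftrightarrow> sq_integrable lebesgue (ext f)"
proof -
  have "(\<lambda>x. (cmod (ext f x))\<^sup>2) = (\<lambda>x. if x \<in> \<Omega> then (cmod (f x))\<^sup>2 else 0)" by (auto simp: ext_def)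
  moreover have "ext f \<in> borel_measurable lebesgue \<longleftrightarrow> f \<in> borel_measurable (lebesgue_on \<Omega>)"
    unfolding ext_def[abs_def] using borel_measurable_if[OF dom_sets, of f] by simp
  ultimately show ?thesis
    by (simp add: L2_def sq_integrable_def Lebesgue_Measure.integrable_restrict_UNIV[OF dom_sets])
qed

lemma ext_outside: "x \<notin> \<Omega> \<Longrightarrow> ext f x = 0" by (simp add: ext_def)

lemma L2_ext: "f \<in> L2 \<Omega> \<Longrightarrow> sq_integrable lebesgue (ext f)" by (simp add: L2_iff)

lemma ext_mult: "ext (\<lambda>x. f x * g x) = (\<lambda>x. ext f x * (ext g x :: complex))" by (auto simp: ext_def)

lemma integral_ext: "(LINT x|lebesgue_on \<Omega>. f x) = (LINT x|lebesgue. ext (f :: _ \<Rightarrow> 'c::euclidean_space) x)"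
  unfolding ext_def by (rule Lebesgue_Measure.integral_restrict_UNIV[OF dom_sets, symmetric])

lemma L2_norm_emb: assumes "f \<in> L2 \<Omega>" shows "L2_norm \<Omega> f = norm (emb f)"
proof -
  have "ext (\<lambda>x. (cmod (f x))\<^sup>2) = (\<lambda>x. (cmod (ext f x))\<^sup>2)" by (auto simp: ext_def)
  then have "(L2_norm \<Omega> f)\<^sup>2 = (norm (emb f))\<^sup>2"
    using norm_cls_sq[OF L2_ext[OF assms]] by (simp add: L2_norm_def emb_def integral_ext)
  then show ?thesis by (simp add: L2_norm_def)
qed

lemma AE_ext: "(AE x in lebesgue_on \<Omega>. f x = g x) \<longleftrightarrow> (AE x in lebesgue. ext f x = (ext g x :: complex))"
  by (subst AE_restrict_space_iff) (auto simp: dom_sets ext_def elim!: eventually_mono)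

lemma emb_eq_iff:
  assumes "f \<in> L2 \<Omega>" "g \<in> L2 \<Omega>" shows "emb f = emb g \<longleftrightarrow> (AE x in lebesgue_on \<Omega>. f x = g x)"
  unfolding emb_def AE_ext by (rule cls_eq_iff[OF L2_ext[OF assms(1)] L2_ext[OF assms(2)]])

lemma Re_integral_mult:
  assumes "f \<in> L2 \<Omega>" "g \<in> L2 \<Omega>"
  shows "Re (LINT x|lebesgue_on \<Omega>. f x * g x) = inner (emb f) (cj (emb g))"
proof -
  note i = L2_ext[OF assms(1)] L2_ext[OF assms(2)]
  have "Re (LINT x|lebesgue. ext f x * ext g x) = (LINT x|lebesgue. Re (ext f x * ext g x))"
    using integral_Re[OF sq_integrable_mult[OF i]] by (rule sym)
  then show ?thesis
    by (simp add: integral_ext ext_mult emb_def cj_cls i inner_cls sq_integrable_cnj inner_complex_Re)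
qed

lemma ext_add: "ext (\<lambda>x. f x + g x) = (\<lambda>x. ext f x + (ext g x :: complex))"
  and ext_diff: "ext (\<lambda>x. f x - g x) = (\<lambda>x. ext f x - (ext g x :: complex))"
  and ext_cmult: "ext (\<lambda>x. c * f x) = (\<lambda>x. c * (ext f x :: complex))"
  and ext_cnj: "ext (\<lambda>x. cnj (f x)) = (\<lambda>x. cnj (ext f x))"
  by (auto simp: ext_def)

lemma L2_add: "f \<in> L2 \<Omega> \<Longrightarrow> g \<in> L2 \<Omega> \<Longrightarrow> (\<lambda>x. f x + g x) \<in> L2 \<Omega>"
  and L2_diff: "f \<in> L2 \<Omega> \<Longrightarrow> g \<in> L2 \<Omega> \<Longrightarrow> (\<lambda>x. f x - g x) \<in> L2 \<Omega>"
  and L2_cmult: "f \<in> L2 \<Omega> \<Longrightarrow> (\<lambda>x. c * f x) \<in> L2 \<Omega>"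
  by (simp_all add: L2_iff ext_add ext_diff ext_cmult
      sq_integrable_add sq_integrable_diff sq_integrable_cmult)

lemma emb_add: "f \<in> L2 \<Omega> \<Longrightarrow> g \<in> L2 \<Omega> \<Longrightarrow> emb (\<lambda>x. f x + g x) = emb f + emb g"
  and emb_diff: "f \<in> L2 \<Omega> \<Longrightarrow> g \<in> L2 \<Omega> \<Longrightarrow> emb (\<lambda>x. f x - g x) = emb f - emb g"
  and emb_i: "f \<in> L2 \<Omega> \<Longrightarrow> emb (\<lambda>x. \<i> * f x) = Ii (emb f)"
  by (simp_all add: L2_iff emb_def ext_add ext_diff ext_cmult cls_add cls_diff Ii_cls)

lemma test_ext: "\<psi> \<in> test_functions \<Omega> \<Longrightarrow> ext \<psi> = \<psi>"
  using test_functions_outside by (fastforce simp: ext_def)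

lemma test_L2: "\<psi> \<in> test_functions \<Omega> \<Longrightarrow> \<psi> \<in> L2 \<Omega>"
  by (simp add: L2_iff test_ext test_sq_integrable)

lemma test_emb: "\<psi> \<in> test_functions \<Omega> \<Longrightarrow> emb \<psi> = cls \<psi>"
  by (simp add: emb_def test_ext)

definition pd :: "'n \<Rightarrow> (real ^ 'n \<Rightarrow> complex) \<Rightarrow> real ^ 'n \<Rightarrow> complex" where
  "pd i \<psi> x = frechet_derivative \<psi> (at x) (axis i 1)"

lemma pd_test: "\<psi> \<in> test_functions \<Omega> \<Longrightarrow> pd i \<psi> \<in> test_functions \<Omega>"
  unfolding pd_def[abs_def] by (rule test_functions_derivative)

lemma pd_eqI: "(\<psi> has_derivative D) (at x) \<Longrightarrow> pd i \<psi> x = D (axis i 1)"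
  unfolding pd_def using frechet_derivative_at by fastforce

lemma pd_cnj: assumes "\<psi> \<in> test_functions \<Omega>" shows "pd i (\<lambda>x. cnj (\<psi> x)) = (\<lambda>x. cnj (pd i \<psi> x))"
proof
  fix x
  show "pd i (\<lambda>x. cnj (\<psi> x)) x = cnj (pd i \<psi> x)"
    unfolding pd_def[of i \<psi>]
    by (rule pd_eqI, rule bounded_linear.has_derivative[OF bounded_linear_cnj], rule test_functions_has_derivative[OF assms])
qed

lemma pd_cmult: assumes "\<psi> \<in> test_functions \<Omega>" shows "pd i (\<lambda>x. c * \<psi> x) = (\<lambda>x. c * pd i \<psi> x)"
proof
  fix x
  show "pd i (\<lambda>x. c * \<psi> x) x = c * pd i \<psi> x"
    unfolding pd_def[of i \<psi>]
    by (rule pd_eqI, rule bounded_linear.has_derivative[OF bounded_linear_mult_right], rule test_functions_has_derivative[OF assms])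
qed

lemma pd_add: assumes "\<psi> \<in> test_functions \<Omega>" "\<eta> \<in> test_functions \<Omega>"
  shows "pd i (\<lambda>x. \<psi> x + \<eta> x) = (\<lambda>x. pd i \<psi> x + pd i \<eta> x)"
proof
  fix x
  show "pd i (\<lambda>x. \<psi> x + \<eta> x) x = pd i \<psi> x + pd i \<eta> x"
    unfolding pd_def[of i \<psi>] pd_def[of i \<eta>]
    by (rule pd_eqI, rule has_derivative_add[OF test_functions_has_derivative[OF assms(1)] test_functions_has_derivative[OF assms(2)]])
qed

text \<open>The copy of \<open>L\<^sup>2(\<Omega>)\<close> in \<open>L\<^sup>2(\<real>\<^sup>N)\<close>, embedded by extension by zero.\<close>

definition Supp :: "(real ^ 'n) l2 set" where "Supp = {x. emb (repr x) = x}"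

text \<open>The i-th weak derivative in terms of the real inner product. The test functions are
  complex valued and stable under conjugation and multiplication by \<i>, so the real identity
  carries the complex one; see \<open>has_weak_deriv_iff\<close>.\<close>

definition wd :: "'n \<Rightarrow> (real ^ 'n) l2 \<Rightarrow> (real ^ 'n) l2 \<Rightarrow> bool" where
  "wd i x y \<longleftrightarrow> (\<forall>\<eta>\<in>test_functions \<Omega>. inner x (cls (pd i \<eta>)) = - inner y (cls \<eta>))"

lemma sq_integrable_ext: assumes "sq_integrable lebesgue f" shows "sq_integrable lebesgue (ext f)"
proof -
  have "ext f = (\<lambda>x. if x \<in> \<Omega> then f x else 0)" by (auto simp: ext_def)
  then have "ext f \<in> borel_measurable lebesgue"
    using assms dom_sets by (auto simp: sq_integrable_def intro!: measurable_If_set)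
  then show ?thesis
    by (rule sq_integrableI_bound[of _ _ "\<lambda>x. (cmod (f x))\<^sup>2"])
      (use assms in \<open>auto simp: sq_integrable_def ext_def\<close>)
qed

lemma repr_L2: "repr x \<in> L2 \<Omega>" by (simp add: L2_iff sq_integrable_ext)

lemma emb_Supp: assumes "f \<in> L2 \<Omega>" shows "emb f \<in> Supp"
proof -
  note f = L2_ext[OF assms]
  have "cls (ext (repr (emb f))) = cls (ext f)"
    by (subst cls_eq_iff) (use repr_cls[OF f] f in \<open>auto simp: sq_integrable_ext emb_def ext_def elim!: eventually_mono\<close>)
  then show ?thesis by (simp add: Supp_def emb_def)
qed

text \<open>\<open>emb\<close> after \<open>repr\<close> is restriction to \<open>\<Omega>\<close>;
  that it is a contraction makes \<open>Supp\<close> closed.\<close>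

lemma norm_emb_repr_le: "norm (emb (repr x)) \<le> norm x"
proof -
  have "(norm (emb (repr x)))\<^sup>2 \<le> (norm x)\<^sup>2"
    unfolding emb_def norm_cls_sq[OF sq_integrable_ext[OF sq_integrable_repr]] norm_sq_repr[of x]
    by (rule integral_mono) (use sq_integrable_ext[OF sq_integrable_repr] sq_integrable_repr[of x] in \<open>auto simp: sq_integrable_def ext_def\<close>)
  then show ?thesis by (rule power2_le_imp_le) simp
qed

lemma emb_repr_diff: "emb (repr (x - y)) = emb (repr x) - emb (repr y)"
proof -
  have "emb (repr x) - emb (repr y) = cls (ext (\<lambda>t. repr x t - repr y t))"
    unfolding emb_def ext_diff by (rule cls_diff[symmetric]) (simp_all add: sq_integrable_ext)
  also have "\<dots> = emb (repr (x - y))"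
    unfolding emb_def
  proof (subst cls_eq_iff)
    have "AE t in lebesgue. repr (x - y) t = repr x t - repr y t"
      using repr_cls[OF sq_integrable_diff[OF sq_integrable_repr sq_integrable_repr], of x y]
      by (simp add: cls_diff)
    then show "AE t in lebesgue. ext (\<lambda>t. repr x t - repr y t) t = ext (repr (x - y)) t"
      by eventually_elim (simp add: ext_def)
  qed (auto intro!: sq_integrable_ext sq_integrable_diff)
  finally show ?thesis by simp
qed

lemma Supp_closed: assumes "\<And>n. x n \<in> Supp" "x \<longlonglongrightarrow> l" shows "l \<in> Supp"
proof -
  have "(\<lambda>n. emb (repr (x n))) \<longlonglongrightarrow> emb (repr l)"
  proof (rule LIM_zero_cancel, rule Lim_null_comparison)
    show "\<forall>\<^sub>F n in sequentially. norm (emb (repr (x n)) - emb (repr l)) \<le> norm (x n - l)"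
      using norm_emb_repr_le by (simp add: emb_repr_diff[symmetric])
    show "(\<lambda>n. norm (x n - l)) \<longlonglongrightarrow> 0" by (intro tendsto_norm_zero LIM_zero assms)
  qed
  moreover have "(\<lambda>n. emb (repr (x n))) = x" using assms(1) by (simp add: Supp_def fun_eq_iff)
  ultimately show ?thesis using assms(2) LIMSEQ_unique[of x] by (auto simp: Supp_def)
qed

lemma Supp_diff: "x \<in> Supp \<Longrightarrow> y \<in> Supp \<Longrightarrow> x - y \<in> Supp"
  by (simp add: Supp_def emb_repr_diff)

text \<open>Testing with the conjugate of \<open>\<psi>\<close> turns the inner product into the
  real part of the bilinear integral; \<open>\<i> * \<psi>\<close> supplies the imaginary part, and
  the fundamental lemma applies.\<close>

lemma orthogonal_imp_zero:
  assumes y: "y \<in> Supp" and z: "\<And>\<eta>. \<eta> \<in> test_functions \<Omega> \<Longrightarrow> inner y (cls \<eta>) = 0"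
  shows "y = 0"
proof -
  let ?g = "ext (repr y)"
  have g: "sq_integrable lebesgue ?g" by (simp add: sq_integrable_ext)
  have y': "y = cls ?g" using y by (simp add: Supp_def emb_def)
  have Re0: "Re (LINT x|lebesgue. ?g x * \<psi> x) = 0" if \<psi>: "\<psi> \<in> test_functions \<Omega>" for \<psi>
  proof -
    have "inner y (cls (\<lambda>x. cnj (\<psi> x))) = (LINT x|lebesgue. Re (?g x * \<psi> x))"
      by (subst y', subst inner_cls) (use g test_sq_integrable[OF \<psi>] in \<open>auto simp: sq_integrable_cnj inner_complex_Re\<close>)
    then show ?thesis
      unfolding integral_Re[OF sq_integrable_mult[OF g test_sq_integrable[OF \<psi>]], symmetric]
      using z[OF test_functions_cnj[OF \<psi>]] by (rule trans[OF sym])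
  qed
  have "(LINT x|lebesgue. ?g x * \<psi> x) = 0" if \<psi>: "\<psi> \<in> test_functions \<Omega>" for \<psi>
  proof (rule complex_eq_by_Re)
    have "\<i> * (LINT x|lebesgue. ?g x * \<psi> x) = (LINT x|lebesgue. ?g x * (\<i> * \<psi> x))"
      by (simp add: mult.left_commute)
    then show "Re (\<i> * (LINT x|lebesgue. ?g x * \<psi> x)) = Re (\<i> * 0)"
      using Re0[OF test_functions_cmult[OF \<psi>, of \<i>]] by simp
  qed (use Re0[OF \<psi>] in simp)
  then have "AE x in lebesgue. ?g x = 0"
    by (intro test_orthogonal_imp_AE_zero[OF open_dom]) (use g in \<open>auto simp: sq_integrable_def ext_outside\<close>)
  then have "cls ?g = cls (\<lambda>x. 0)" by (subst cls_eq_iff) (use g in auto)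
  then show ?thesis using y' by (simp add: cls_zero)
qed

lemma wd_unique:
  assumes "y \<in> Supp" "z \<in> Supp" "wd i x y" "wd i x z" shows "y = z"
proof -
  have "y - z = 0"
    by (rule orthogonal_imp_zero) (use assms in \<open>auto simp: Supp_diff wd_def inner_diff_left\<close>)
  then show ?thesis by simp
qed

lemma has_weak_deriv_iff:
  assumes u: "u \<in> L2 \<Omega>" and g: "g \<in> L2 \<Omega>"
  shows "has_weak_deriv \<Omega> (axis i 1) u g \<longleftrightarrow> wd i (emb u) (emb g)"
proof -
  have 1: "Re (LINT x|lebesgue_on \<Omega>. u x * pd i \<psi> x) = inner (emb u) (cls (pd i (\<lambda>x. cnj (\<psi> x))))"
    "Re (LINT x|lebesgue_on \<Omega>. g x * \<psi> x) = inner (emb g) (cls (\<lambda>x. cnj (\<psi> x)))"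
    if \<psi>: "\<psi> \<in> test_functions \<Omega>" for \<psi>
    using Re_integral_mult[OF u test_L2[OF pd_test[OF \<psi>]], of i] Re_integral_mult[OF g test_L2[OF \<psi>]]
    by (simp_all add: pd_cnj[OF \<psi>] test_emb[OF \<psi>] test_emb[OF pd_test[OF \<psi>]]
        cj_cls test_sq_integrable[OF \<psi>] test_sq_integrable[OF pd_test[OF \<psi>]])
  show ?thesis
  proof
    assume w: "has_weak_deriv \<Omega> (axis i 1) u g"
    show "wd i (emb u) (emb g)"
      unfolding wd_def
    proof
      fix \<eta> assume \<eta>: "\<eta> \<in> test_functions \<Omega>"
      note c = test_functions_cnj[OF \<eta>]
      have "(LINT x|lebesgue_on \<Omega>. u x * pd i (\<lambda>x. cnj (\<eta> x)) x) = - (LINT x|lebesgue_on \<Omega>. g x * cnj (\<eta> x))"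
        using w c by (simp add: has_weak_deriv_def pd_def)
      then have "Re (LINT x|lebesgue_on \<Omega>. u x * pd i (\<lambda>x. cnj (\<eta> x)) x) = - Re (LINT x|lebesgue_on \<Omega>. g x * cnj (\<eta> x))"
        by simp
      then show "inner (emb u) (cls (pd i \<eta>)) = - inner (emb g) (cls \<eta>)"
        unfolding 1[OF c] by simp
    qed
  next
    assume w: "wd i (emb u) (emb g)"
    have R: "Re (LINT x|lebesgue_on \<Omega>. u x * pd i \<psi> x) = Re (- (LINT x|lebesgue_on \<Omega>. g x * \<psi> x))"
      if \<psi>: "\<psi> \<in> test_functions \<Omega>" for \<psi>
      using w test_functions_cnj[OF \<psi>] by (simp add: 1[OF \<psi>] wd_def)
    have "(LINT x|lebesgue_on \<Omega>. u x * pd i \<psi> x) = - (LINT x|lebesgue_on \<Omega>. g x * \<psi> x)"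
      if \<psi>: "\<psi> \<in> test_functions \<Omega>" for \<psi>
    proof (rule complex_eq_by_Re[OF R[OF \<psi>]])
      have "\<i> * (LINT x|lebesgue_on \<Omega>. u x * pd i \<psi> x) = (LINT x|lebesgue_on \<Omega>. u x * pd i (\<lambda>x. \<i> * \<psi> x) x)"
        by (simp add: pd_cmult[OF \<psi>] mult.left_commute)
      moreover have "\<i> * - (LINT x|lebesgue_on \<Omega>. g x * \<psi> x) = - (LINT x|lebesgue_on \<Omega>. g x * (\<i> * \<psi> x))"
        by (simp add: mult.left_commute)
      ultimately show "Re (\<i> * (LINT x|lebesgue_on \<Omega>. u x * pd i \<psi> x)) = Re (\<i> * - (LINT x|lebesgue_on \<Omega>. g x * \<psi> x))"
        using R[OF test_functions_cmult[OF \<psi>, of \<i>]] by simp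
    qed
    then show "has_weak_deriv \<Omega> (axis i 1) u g" using u g by (simp add: has_weak_deriv_def pd_def)
  qed
qed

section \<open>The closed gradient on the closure of the test functions\<close>

definition gtest :: "(real ^ 'n \<Rightarrow> complex) \<Rightarrow> (real ^ 'n) l2 ^ 'n" where
  "gtest \<psi> = (\<chi> i. cls (pd i \<psi>))"

text \<open>The space H^1_0 with its gradient, built as the closure of the graph over test
  functions. Closedness then holds by construction; what has to be proved is that the closure is
  still the graph of a function, which is \<open>graph_unique\<close>.\<close>

definition graph :: "((real ^ 'n) l2 \<times> ((real ^ 'n) l2 ^ 'n)) set" where
  "graph = closure ((\<lambda>\<psi>. (cls \<psi>, gtest \<psi>)) ` test_functions \<Omega>)"

definition D :: "(real ^ 'n) l2 set" where "D = fst ` graph"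

definition gr :: "(real ^ 'n) l2 \<Rightarrow> (real ^ 'n) l2 ^ 'n" where "gr x = (THE y. (x, y) \<in> graph)"

lemma graph_iff:
  "(x, y) \<in> graph \<longleftrightarrow> (\<exists>\<psi>. (\<forall>n. \<psi> n \<in> test_functions \<Omega>) \<and> (\<lambda>n. cls (\<psi> n)) \<longlonglongrightarrow> x \<and> (\<lambda>n. gtest (\<psi> n)) \<longlonglongrightarrow> y)"
  (is "?L \<longleftrightarrow> ?R")
proof
  assume ?L
  then obtain p where p: "\<And>n. p n \<in> (\<lambda>\<psi>. (cls \<psi>, gtest \<psi>)) ` test_functions \<Omega>" "p \<longlonglongrightarrow> (x, y)"
    unfolding graph_def closure_sequential by blast
  then have "\<forall>n. \<exists>\<psi>. \<psi> \<in> test_functions \<Omega> \<and> p n = (cls \<psi>, gtest \<psi>)" by blast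
  then obtain \<psi> where \<psi>: "\<And>n. \<psi> n \<in> test_functions \<Omega>" "\<And>n. p n = (cls (\<psi> n), gtest (\<psi> n))" by metis
  have "(\<lambda>n. cls (\<psi> n)) \<longlonglongrightarrow> x" "(\<lambda>n. gtest (\<psi> n)) \<longlonglongrightarrow> y"
    using tendsto_fst[OF p(2)] tendsto_snd[OF p(2)] by (simp_all add: \<psi>(2))
  then show ?R using \<psi>(1) by blast
next
  assume ?R
  then obtain \<psi> where \<psi>: "\<And>n. \<psi> n \<in> test_functions \<Omega>" "(\<lambda>n. cls (\<psi> n)) \<longlonglongrightarrow> x" "(\<lambda>n. gtest (\<psi> n)) \<longlonglongrightarrow> y"
    by blast
  have "(\<lambda>n. (cls (\<psi> n), gtest (\<psi> n))) \<longlonglongrightarrow> (x, y)" by (intro tendsto_Pair \<psi>)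
  then show ?L unfolding graph_def closure_sequential
    by (intro exI[of _ "\<lambda>n. (cls (\<psi> n), gtest (\<psi> n))"] conjI allI imageI \<psi>(1))
qed

lemma test_graph: "\<psi> \<in> test_functions \<Omega> \<Longrightarrow> (cls \<psi>, gtest \<psi>) \<in> graph"
  unfolding graph_def by (rule subsetD[OF closure_subset]) (rule imageI)

lemma test_Supp: "\<psi> \<in> test_functions \<Omega> \<Longrightarrow> cls \<psi> \<in> Supp"
  using emb_Supp[OF test_L2] by (simp add: test_emb)

lemma test_wd: assumes \<psi>: "\<psi> \<in> test_functions \<Omega>" shows "wd i (cls \<psi>) (cls (pd i \<psi>))"
  unfolding wd_def
proof
  fix \<eta> assume \<eta>: "\<eta> \<in> test_functions \<Omega>"
  note c = test_functions_cnj[OF \<eta>]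
  note s = test_sq_integrable[OF \<psi>] test_sq_integrable[OF pd_test[OF \<psi>, of i]]
    test_sq_integrable[OF \<eta>] test_sq_integrable[OF pd_test[OF \<eta>, of i]]
  have "(LINT x|lebesgue. \<psi> x * cnj (pd i \<eta> x)) = - (LINT x|lebesgue. pd i \<psi> x * cnj (\<eta> x))"
    using test_functions_integration_by_parts[OF \<psi> c, of "axis i 1"]
    by (simp add: pd_def[symmetric] pd_cnj[OF \<eta>])
  then have "Re (LINT x|lebesgue. \<psi> x * cnj (pd i \<eta> x)) = Re (- (LINT x|lebesgue. pd i \<psi> x * cnj (\<eta> x)))" by simp
  then show "inner (cls \<psi>) (cls (pd i \<eta>)) = - inner (cls (pd i \<psi>)) (cls \<eta>)"
    unfolding inner_cls[OF s(1) s(4)] inner_cls[OF s(2) s(3)] inner_complex_Re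
      integral_Re[OF sq_integrable_mult[OF s(1) sq_integrable_cnj[OF s(4)]]]
      integral_Re[OF sq_integrable_mult[OF s(2) sq_integrable_cnj[OF s(3)]]]
    by simp
qed

text \<open>Integration by parts survives the limit, so the second component is the weak gradient.
  Uniqueness of weak derivatives therefore makes the gradient closable.\<close>

lemma graph_props:
  assumes "(x, y) \<in> graph" shows "x \<in> Supp" "y $ i \<in> Supp" "wd i x (y $ i)"
proof -
  obtain \<psi> where \<psi>: "\<And>n. \<psi> n \<in> test_functions \<Omega>" "(\<lambda>n. cls (\<psi> n)) \<longlonglongrightarrow> x" "(\<lambda>n. gtest (\<psi> n)) \<longlonglongrightarrow> y"
    using assms unfolding graph_iff by blast
  have y: "(\<lambda>n. cls (pd i (\<psi> n))) \<longlonglongrightarrow> y $ i" using tendsto_vec_nth[OF \<psi>(3), of i] by (simp add: gtest_def)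
  show "x \<in> Supp" by (rule Supp_closed[OF test_Supp[OF \<psi>(1)] \<psi>(2)])
  show "y $ i \<in> Supp" by (rule Supp_closed[OF test_Supp[OF pd_test[OF \<psi>(1)]] y])
  show "wd i x (y $ i)"
    unfolding wd_def
  proof
    fix \<eta> assume \<eta>: "\<eta> \<in> test_functions \<Omega>"
    have "(\<lambda>n. inner (cls (\<psi> n)) (cls (pd i \<eta>))) \<longlonglongrightarrow> inner x (cls (pd i \<eta>))" by (intro tendsto_intros \<psi>)
    moreover have "(\<lambda>n. inner (cls (\<psi> n)) (cls (pd i \<eta>))) \<longlonglongrightarrow> - inner (y $ i) (cls \<eta>)"
    proof -
      have "(\<lambda>n. - inner (cls (pd i (\<psi> n))) (cls \<eta>)) \<longlonglongrightarrow> - inner (y $ i) (cls \<eta>)" by (intro tendsto_intros y)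
      moreover have "inner (cls (\<psi> n)) (cls (pd i \<eta>)) = - inner (cls (pd i (\<psi> n))) (cls \<eta>)" for n
        using test_wd[OF \<psi>(1)] \<eta> by (simp add: wd_def)
      ultimately show ?thesis by simp
    qed
    ultimately show "inner x (cls (pd i \<eta>)) = - inner (y $ i) (cls \<eta>)" by (rule LIMSEQ_unique)
  qed
qed

lemma graph_unique: assumes a: "(x, y) \<in> graph" and b: "(x, z) \<in> graph" shows "y = z"
proof -
  have "y $ i = z $ i" for i
    by (rule wd_unique[OF graph_props(2)[OF a] graph_props(2)[OF b] graph_props(3)[OF a] graph_props(3)[OF b]])
  then show ?thesis by (simp add: vec_eq_iff)
qed

lemma gr_eqI: "(x, y) \<in> graph \<Longrightarrow> gr x = y"
  unfolding gr_def by (rule the_equality) (auto intro: graph_unique)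

lemma D_graph: "x \<in> D \<longleftrightarrow> (x, gr x) \<in> graph"
proof
  assume "x \<in> D"
  then obtain y where "(x, y) \<in> graph" by (auto simp: D_def)
  then show "(x, gr x) \<in> graph" using gr_eqI by simp
qed (auto simp: D_def image_iff intro!: bexI[of _ "(x, gr x)"])

lemma graph_D: "(x, y) \<in> graph \<Longrightarrow> x \<in> D" by (auto simp: D_def image_iff intro!: bexI[of _ "(x, y)"])

lemma D_approx_test:
  assumes "x \<in> D" obtains \<psi> where "\<And>n. \<psi> n \<in> test_functions \<Omega>" "(\<lambda>n. cls (\<psi> n)) \<longlonglongrightarrow> x" "(\<lambda>n. gtest (\<psi> n)) \<longlonglongrightarrow> gr x"
  using assms unfolding D_graph graph_iff by blast

lemma graph_add: assumes "(x, y) \<in> graph" "(x', y') \<in> graph" shows "(x + x', y + y') \<in> graph"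
proof -
  obtain \<psi> where \<psi>: "\<And>n. \<psi> n \<in> test_functions \<Omega>" "(\<lambda>n. cls (\<psi> n)) \<longlonglongrightarrow> x" "(\<lambda>n. gtest (\<psi> n)) \<longlonglongrightarrow> y"
    using assms(1) unfolding graph_iff by blast
  obtain \<eta> where \<eta>: "\<And>n. \<eta> n \<in> test_functions \<Omega>" "(\<lambda>n. cls (\<eta> n)) \<longlonglongrightarrow> x'" "(\<lambda>n. gtest (\<eta> n)) \<longlonglongrightarrow> y'"
    using assms(2) unfolding graph_iff by blast
  note s = test_sq_integrable[OF \<psi>(1)] test_sq_integrable[OF \<eta>(1)]
    test_sq_integrable[OF pd_test[OF \<psi>(1)]] test_sq_integrable[OF pd_test[OF \<eta>(1)]]
  have "cls (\<lambda>x. \<psi> n x + \<eta> n x) = cls (\<psi> n) + cls (\<eta> n)" "gtest (\<lambda>x. \<psi> n x + \<eta> n x) = gtest (\<psi> n) + gtest (\<eta> n)" for n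
    using s by (simp_all add: cls_add gtest_def pd_add \<psi>(1) \<eta>(1) vec_eq_iff)
  then show ?thesis
    unfolding graph_iff using tendsto_add[OF \<psi>(2) \<eta>(2)] tendsto_add[OF \<psi>(3) \<eta>(3)]
    by (intro exI[of _ "\<lambda>n x. \<psi> n x + \<eta> n x"]) (simp add: test_functions_add \<psi>(1) \<eta>(1))
qed

lemma graph_scaleR: assumes "(x, y) \<in> graph" shows "(c *\<^sub>R x, c *\<^sub>R y) \<in> graph"
proof -
  obtain \<psi> where \<psi>: "\<And>n. \<psi> n \<in> test_functions \<Omega>" "(\<lambda>n. cls (\<psi> n)) \<longlonglongrightarrow> x" "(\<lambda>n. gtest (\<psi> n)) \<longlonglongrightarrow> y"
    using assms(1) unfolding graph_iff by blast
  note s = test_sq_integrable[OF \<psi>(1)] test_sq_integrable[OF pd_test[OF \<psi>(1)]]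
  have "cls (\<lambda>x. of_real c * \<psi> n x) = c *\<^sub>R cls (\<psi> n)" "gtest (\<lambda>x. of_real c * \<psi> n x) = c *\<^sub>R gtest (\<psi> n)" for n
    using cls_scaleR[OF s(1) s(1), of c] cls_scaleR[OF s(2) s(2), of c]
    by (simp_all add: gtest_def pd_cmult \<psi>(1) vec_eq_iff scaleR_conv_of_real)
  then show ?thesis
    unfolding graph_iff using tendsto_scaleR[OF tendsto_const \<psi>(2), of c] tendsto_scaleR[OF tendsto_const \<psi>(3), of c]
    by (intro exI[of _ "\<lambda>n x. of_real c * \<psi> n x"]) (simp add: test_functions_cmult \<psi>(1))
qed

lemma graph_map:
  assumes "(x, y) \<in> graph" and T: "bounded_linear T"
    and t: "\<And>\<psi>. \<psi> \<in> test_functions \<Omega> \<Longrightarrow> t \<psi> \<in> test_functions \<Omega> \<and> cls (t \<psi>) = T (cls \<psi>) \<and> (\<forall>i. cls (pd i (t \<psi>)) = T (cls (pd i \<psi>)))"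
  shows "(T x, \<chi> i. T (y $ i)) \<in> graph"
proof -
  obtain \<psi> where \<psi>: "\<And>n. \<psi> n \<in> test_functions \<Omega>" "(\<lambda>n. cls (\<psi> n)) \<longlonglongrightarrow> x" "(\<lambda>n. gtest (\<psi> n)) \<longlonglongrightarrow> y"
    using assms(1) unfolding graph_iff by blast
  have "(\<lambda>n. T (cls (\<psi> n))) \<longlonglongrightarrow> T x" by (rule bounded_linear.tendsto[OF T \<psi>(2)])
  moreover have "(\<lambda>n. gtest (t (\<psi> n))) \<longlonglongrightarrow> (\<chi> i. T (y $ i))"
    unfolding gtest_def
  proof (rule tendsto_vec_lambda)
    fix i
    have "(\<lambda>n. T (gtest (\<psi> n) $ i)) \<longlonglongrightarrow> T (y $ i)" by (rule bounded_linear.tendsto[OF T tendsto_vec_nth[OF \<psi>(3)]])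
    then show "(\<lambda>n. cls (pd i (t (\<psi> n)))) \<longlonglongrightarrow> T (y $ i)" using t[OF \<psi>(1)] by (simp add: gtest_def)
  qed
  ultimately show ?thesis unfolding graph_iff using t[OF \<psi>(1)] by (intro exI[of _ "\<lambda>n. t (\<psi> n)"]) simp
qed

lemma graph_Ii: "(x, y) \<in> graph \<Longrightarrow> (Ii x, \<chi> i. Ii (y $ i)) \<in> graph"
  by (rule graph_map[OF _ bounded_linear_Ii, of _ _ "\<lambda>\<psi> x. \<i> * \<psi> x"])
    (auto simp: Ii_cls pd_cmult test_functions_cmult test_sq_integrable test_sq_integrable[OF pd_test])

lemma graph_cj: "(x, y) \<in> graph \<Longrightarrow> (cj x, \<chi> i. cj (y $ i)) \<in> graph"
  by (rule graph_map[OF _ bounded_linear_cj, of _ _ "\<lambda>\<psi> x. cnj (\<psi> x)"])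
    (auto simp: cj_cls pd_cnj test_functions_cnj test_sq_integrable test_sq_integrable[OF pd_test])

lemma Ii_skew: "inner (Ii x) y = - inner x (Ii y)"
  using Ii_inner[of "Ii x" y] by (simp add: Ii_Ii)

lemma inner_vec: "inner x y = (\<Sum>i\<in>UNIV. inner (x $ i) (y $ i))"
  by (simp add: inner_vec_def)

sublocale closed_skew_form D gr Ii
proof
  show "subspace D"
    unfolding subspace_def
  proof (intro conjI ballI allI)
    show "0 \<in> D"
      using graph_D[OF test_graph[OF test_functions_zero]] by (simp add: cls_zero)
    show "x + y \<in> D" if "x \<in> D" "y \<in> D" for x y
      using graph_D[OF graph_add[OF D_graph[THEN iffD1, OF that(1)] D_graph[THEN iffD1, OF that(2)]]] .
    show "c *\<^sub>R x \<in> D" if "x \<in> D" for c x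
      using graph_D[OF graph_scaleR[OF D_graph[THEN iffD1, OF that]]] .
  qed
  fix x y :: "(real ^ 'n) l2"
  assume x: "x \<in> D"
  then show "gr (c *\<^sub>R x) = c *\<^sub>R gr x" for c by (intro gr_eqI graph_scaleR) (simp add: D_graph)
  show "Ii x \<in> D" using x graph_D[OF graph_Ii] by (simp add: D_graph)
  assume y: "y \<in> D"
  show "gr (x + y) = gr x + gr y" using x y by (intro gr_eqI graph_add) (simp_all add: D_graph)
  have "gr (Ii x) = (\<chi> i. Ii (gr x $ i))" "gr (Ii y) = (\<chi> i. Ii (gr y $ i))"
    using x y by (auto intro!: gr_eqI graph_Ii simp: D_graph)
  then show "inner (gr (Ii x)) (gr y) = - inner (gr x) (gr (Ii y))"
    by (simp add: inner_vec Ii_skew sum_negf)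
next
  fix x :: "nat \<Rightarrow> (real ^ 'n) l2" and y z
  assume x: "\<And>n. x n \<in> D" "x \<longlonglongrightarrow> y" "(\<lambda>n. gr (x n)) \<longlonglongrightarrow> z"
  have "(\<lambda>n. (x n, gr (x n))) \<longlonglongrightarrow> (y, z)" by (intro tendsto_Pair x)
  moreover have "closed graph" by (simp add: graph_def)
  moreover have "(x n, gr (x n)) \<in> graph" for n using x(1) by (simp add: D_graph)
  ultimately have "(y, z) \<in> graph" using closed_sequentially[of graph "\<lambda>n. (x n, gr (x n))"] by blast
  then show "y \<in> D \<and> gr y = z" using graph_D gr_eqI by blast
qed (auto simp: linear_add[OF Ii_linear] linear_scale[OF Ii_linear] Ii_inner Ii_Ii)

end

section \<open>Sub-Markov property of the resolvent\<close>

lemma cls_norm_le: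
  assumes a: "sq_integrable lebesgue a" and b: "sq_integrable lebesgue b" and C: "C \<ge> 0"
    and le: "AE t in lebesgue. cmod (a t) \<le> C * cmod (b t)"
  shows "norm (cls a) \<le> C * norm (cls b)"
proof -
  have "(LINT t|lebesgue. (cmod (a t))\<^sup>2) \<le> (LINT t|lebesgue. C\<^sup>2 * (cmod (b t))\<^sup>2)"
  proof (rule integral_mono_AE)
    show "AE t in lebesgue. (cmod (a t))\<^sup>2 \<le> C\<^sup>2 * (cmod (b t))\<^sup>2"
      using le by eventually_elim (metis norm_ge_zero power_mono power_mult_distrib)
  qed (use a b in \<open>auto simp: sq_integrable_def\<close>)
  then have "(norm (cls a))\<^sup>2 \<le> (C * norm (cls b))\<^sup>2"
    by (simp add: norm_cls_sq[OF a] norm_cls_sq[OF b] power_mult_distrib)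
  then show ?thesis using C by (intro power2_le_imp_le[of "norm (cls a)"]) auto
qed

text \<open>The discrete form of the Beurling-Deny argument: symmetry of \<open>k\<close> allows
  replacing \<open>c z w\<close> by its symmetrization, \<open>mon\<close> replaces that by diagonal
  values, and the row sums are at most \<open>m\<close>. Later \<open>k\<close> holds the matrix
  entries of the resolvent on indicator functions.\<close>

lemma symmetric_kernel_sum_le:
  fixes c :: "'z \<Rightarrow> 'z \<Rightarrow> real"
  assumes k: "\<And>z w. z \<in> Z \<Longrightarrow> w \<in> Z \<Longrightarrow> k z w \<ge> 0"
    and sym: "\<And>z w. z \<in> Z \<Longrightarrow> w \<in> Z \<Longrightarrow> k z w = k w z"
    and row: "\<And>z. z \<in> Z \<Longrightarrow> (\<Sum>w\<in>Z. k z w) \<le> m z"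
    and pos: "\<And>z. c z z \<ge> 0" and mon: "\<And>z w. c z w + c w z \<le> c z z + c w w"
  shows "(\<Sum>z\<in>Z. \<Sum>w\<in>Z. k z w * c z w) \<le> (\<Sum>z\<in>Z. m z * c z z)"
proof -
  let ?S = "\<Sum>z\<in>Z. \<Sum>w\<in>Z. k z w * c z w"
  have sw: "?S = (\<Sum>z\<in>Z. \<Sum>w\<in>Z. k z w * c w z)"
    by (subst sum.swap) (intro sum.cong refl, simp add: sym)
  have sw2: "(\<Sum>z\<in>Z. \<Sum>w\<in>Z. k z w * c w w) = (\<Sum>z\<in>Z. \<Sum>w\<in>Z. k z w * c z z)"
    by (subst sum.swap) (intro sum.cong refl, simp add: sym)
  have "2 * ?S = (\<Sum>z\<in>Z. \<Sum>w\<in>Z. k z w * (c z w + c w z))"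
    using sw by (simp add: distrib_left sum.distrib)
  also have "\<dots> \<le> (\<Sum>z\<in>Z. \<Sum>w\<in>Z. k z w * (c z z + c w w))"
    by (intro sum_mono mult_left_mono mon k)
  also have "\<dots> = 2 * (\<Sum>z\<in>Z. \<Sum>w\<in>Z. k z w * c z z)"
    by (simp add: distrib_left sum.distrib sw2)
  also have "(\<Sum>z\<in>Z. \<Sum>w\<in>Z. k z w * c z z) = (\<Sum>z\<in>Z. (\<Sum>w\<in>Z. k z w) * c z z)"
    by (simp add: sum_distrib_right)
  also have "2 * \<dots> \<le> 2 * (\<Sum>z\<in>Z. m z * c z z)"
    by (intro mult_left_mono sum_mono mult_right_mono row pos) auto
  finally show ?thesis by simp
qed

text \<open>Lipschitz up to an arbitrarily small additive error, in squared form. The power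
  nonlinearity satisfies this although it is not Lipschitz, and on a domain of finite measure it can
  be integrated at once to give continuity of the superposition operator in L2.\<close>

definition quasi_lipschitz :: "(complex \<Rightarrow> complex) \<Rightarrow> bool" where
  "quasi_lipschitz a \<longleftrightarrow> a 0 = 0 \<and> (\<forall>\<delta>>0. \<exists>M\<ge>0. \<forall>z w. (cmod (a z - a w))\<^sup>2 \<le> \<delta> + M * (cmod (z - w))\<^sup>2)"

lemma quasi_lipschitz_continuous: assumes "quasi_lipschitz a" shows "continuous_on UNIV a"
  unfolding continuous_on_iff
proof (intro ballI allI impI)
  fix z e :: "_" assume e: "(e::real) > 0"
  obtain M where M: "M \<ge> 0" "\<And>z w. (cmod (a z - a w))\<^sup>2 \<le> e\<^sup>2 / 4 + M * (cmod (z - w))\<^sup>2"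
    using assms e unfolding quasi_lipschitz_def by (metis divide_pos_pos zero_less_numeral zero_less_power)
  \<comment> \<open>As (M + 1)^2 dominates M, this radius keeps the quadratic term at most a quarter
    of the squared tolerance.\<close>
  define d where "d = (e / 2) / (M + 1)"
  have d: "d > 0" using e M by (simp add: d_def)
  show "\<exists>d>0. \<forall>w\<in>UNIV. dist w z < d \<longrightarrow> dist (a w) (a z) < e"
  proof (intro exI[of _ d] conjI d ballI impI)
    fix w assume w: "dist w z < d"
    have "(cmod (w - z))\<^sup>2 \<le> d\<^sup>2" using w by (intro power_mono) (auto simp: dist_norm)
    then have "M * (cmod (w - z))\<^sup>2 \<le> (M + 1)\<^sup>2 * d\<^sup>2"
      using M(1) by (intro mult_mono) (auto simp: power2_eq_square algebra_simps)
    also have "\<dots> = ((M + 1) * d)\<^sup>2" by (rule power_mult_distrib[symmetric])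
    also have "(M + 1) * d = e / 2" 
    proof -
      have "M + 1 \<noteq> 0" using M(1) by linarith
      from nonzero_eq_divide_eq[OF this, THEN iffD1, OF d_def] show ?thesis by (simp only: mult.commute)
    qed
    also have "(e / 2)\<^sup>2 = e\<^sup>2 / 4" by (simp add: power_divide)
    finally have "(cmod (a w - a z))\<^sup>2 \<le> e\<^sup>2 / 2" using M(2)[of w z] by simp
    also have "\<dots> < e\<^sup>2" using e by simp
    finally show "dist (a w) (a z) < e" using e by (simp add: dist_norm power_less_imp_less_base)
  qed
qed

section \<open>Positivity and upper bound for the resolvent by truncation\<close>

context sobolev_domain begin

lemma D_Supp: "x \<in> D \<Longrightarrow> x \<in> Supp" by (auto simp: D_graph intro: graph_props(1))

lemma test_D: "\<psi> \<in> test_functions \<Omega> \<Longrightarrow> cls \<psi> \<in> D" "\<psi> \<in> test_functions \<Omega> \<Longrightarrow> gr (cls \<psi>) = gtest \<psi>"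
  using test_graph graph_D gr_eqI by blast+

text \<open>Formally the resolvent equation tested with H(Re w) gives \<open>e\<close> times an
  integral of H' times a square. Since \<open>w\<close> is only in \<open>D\<close>, the test
  vectors are H(Re \<psi>) for test functions \<psi> tending to \<open>w\<close>; these are again
  test functions, so no chain rule in the Sobolev space is required.\<close>

lemma cutoff_monotone_nonneg:
  fixes f :: "(real ^ 'n) l2"
  assumes e: "e > 0" and H: "smooth_chain H" "H 0 0 = 0" and H1: "\<And>x. 0 \<le> H (Suc 0) x" "\<And>x. H (Suc 0) x \<le> L"
  defines "w \<equiv> J e f"
  shows "sq_integrable lebesgue (\<lambda>t. of_real (H 0 (Re (repr w t))))"
    "0 \<le> inner (f - w) (cls (\<lambda>t. of_real (H 0 (Re (repr w t)))))"
proof -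
  have L: "L \<ge> 0" using H1[of 0] by linarith
  have lip: "\<bar>H 0 x - H 0 y\<bar> \<le> L * \<bar>x - y\<bar>" for x y
  proof -
    have "norm (H 0 x - H 0 y) \<le> L * norm (x - y)"
      by (rule field_differentiable_bound[of UNIV "H 0" "H (Suc 0)"])
        (use H(1) H1 in \<open>auto simp: smooth_chain_def\<close>)
    then show ?thesis by simp
  qed
  have H0m: "H 0 \<in> borel_measurable borel"
    using H(1) by (intro borel_measurable_continuous_onI DERIV_continuous_on[where D="H (Suc 0)"]) (auto simp: smooth_chain_def)
  let ?h = "\<lambda>g t. of_real (H 0 (Re (g t))) :: complex"
  have hs: "sq_integrable lebesgue (?h g)" if g: "sq_integrable lebesgue g" for g
  proof (rule sq_integrableI_bound)
    have "g \<in> borel_measurable lebesgue" using g by (simp add: sq_integrable_def)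
    then have "(\<lambda>t. H 0 (Re (g t))) \<in> borel_measurable lebesgue"
      by (intro measurable_compose[OF _ H0m]) measurable
    then show "?h g \<in> borel_measurable lebesgue" by measurable
    show "integrable lebesgue (\<lambda>t. L\<^sup>2 * (cmod (g t))\<^sup>2)" using g by (auto simp: sq_integrable_def)
    have "(cmod (?h g t))\<^sup>2 \<le> L\<^sup>2 * (cmod (g t))\<^sup>2" for t
    proof -
      have "cmod (?h g t) \<le> L * \<bar>Re (g t)\<bar>" using lip[of "Re (g t)" 0] H(2) by simp
      also have "\<dots> \<le> L * cmod (g t)" using L abs_Re_le_cmod by (intro mult_left_mono) auto
      finally have "(cmod (?h g t))\<^sup>2 \<le> (L * cmod (g t))\<^sup>2" by (rule power_mono) simp
      then show ?thesis by (simp only: power_mult_distrib)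
    qed
    then show "AE t in lebesgue. (cmod (?h g t))\<^sup>2 \<le> L\<^sup>2 * (cmod (g t))\<^sup>2" by simp
  qed
  show "sq_integrable lebesgue (?h (repr w))" by (rule hs) simp
  have wD: "w \<in> D" unfolding w_def by (rule J_D[OF e])
  obtain \<psi> where \<psi>: "\<And>n. \<psi> n \<in> test_functions \<Omega>" "(\<lambda>n. cls (\<psi> n)) \<longlonglongrightarrow> w" "(\<lambda>n. gtest (\<psi> n)) \<longlonglongrightarrow> gr w"
    using D_approx_test[OF wD] by metis
  have v: "?h (\<psi> n) \<in> test_functions \<Omega>" for n by (rule test_functions_chain[OF \<psi>(1) H])
  have pdv: "pd i (?h (\<psi> n)) = (\<lambda>t. of_real (H (Suc 0) (Re (\<psi> n t)) * Re (pd i (\<psi> n) t)))" for i n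
  proof
    fix t
    show "pd i (?h (\<psi> n)) t = of_real (H (Suc 0) (Re (\<psi> n t)) * Re (pd i (\<psi> n) t))"
      unfolding pd_def[of i "\<psi> n"]
      by (rule pd_eqI, rule smooth_chain_derivative[OF H(1) test_functions_has_derivative[OF \<psi>(1)]])
  qed
  have vlim: "(\<lambda>n. cls (?h (\<psi> n))) \<longlonglongrightarrow> cls (?h (repr w))"
  proof (rule LIM_zero_cancel, rule Lim_null_comparison)
    have "norm (cls (?h (\<psi> n)) - cls (?h (repr w))) \<le> L * norm (cls (\<psi> n) - w)" for n
    proof -
      have "norm (cls (\<lambda>t. ?h (\<psi> n) t - ?h (repr w) t)) \<le> L * norm (cls (\<lambda>t. \<psi> n t - repr w t))"
      proof (rule cls_norm_le[OF _ _ L])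
        have "cmod (?h (\<psi> n) t - ?h (repr w) t) \<le> L * cmod (\<psi> n t - repr w t)" for t
        proof -
          have "cmod (?h (\<psi> n) t - ?h (repr w) t) = \<bar>H 0 (Re (\<psi> n t)) - H 0 (Re (repr w t))\<bar>"
            by (simp flip: of_real_diff)
          also have "\<dots> \<le> L * \<bar>Re (\<psi> n t) - Re (repr w t)\<bar>" by (rule lip)
          also have "\<dots> \<le> L * cmod (\<psi> n t - repr w t)"
            using L abs_Re_le_cmod[of "\<psi> n t - repr w t"] by (intro mult_left_mono) auto
          finally show ?thesis .
        qed
        then show "AE t in lebesgue. cmod (?h (\<psi> n) t - ?h (repr w) t) \<le> L * cmod (\<psi> n t - repr w t)" by simp
      qed (intro sq_integrable_diff hs test_sq_integrable[OF \<psi>(1)] sq_integrable_repr)+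
      then show ?thesis
        by (simp add: cls_diff hs test_sq_integrable[OF \<psi>(1)])
    qed
    then show "\<forall>\<^sub>F n in sequentially. norm (cls (?h (\<psi> n)) - cls (?h (repr w))) \<le> L * norm (cls (\<psi> n) - w)" by simp
    have "(\<lambda>n. L * norm (cls (\<psi> n) - w)) \<longlonglongrightarrow> L * 0" by (intro tendsto_intros tendsto_norm_zero LIM_zero \<psi>)
    then show "(\<lambda>n. L * norm (cls (\<psi> n) - w)) \<longlonglongrightarrow> 0" by simp
  qed
  have bound: "norm (gtest (?h (\<psi> n))) \<le> L * norm (gtest (\<psi> n))" for n
  proof -
    have "norm (gtest (?h (\<psi> n)) $ i) \<le> L * norm (gtest (\<psi> n) $ i)" for i
      unfolding gtest_def vec_lambda_beta pdv
    proof (rule cls_norm_le[OF _ _ L])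
      show "sq_integrable lebesgue (\<lambda>t. of_real (H (Suc 0) (Re (\<psi> n t)) * Re (pd i (\<psi> n) t)))"
        using test_sq_integrable[OF pd_test[OF v], of i n] by (simp add: pdv)
      have "cmod (of_real (H (Suc 0) (Re (\<psi> n t)) * Re (pd i (\<psi> n) t))) \<le> L * cmod (pd i (\<psi> n) t)" for t
        using mult_mono[OF H1(2) abs_Re_le_cmod L abs_ge_zero, of "Re (\<psi> n t)" "pd i (\<psi> n) t"] H1(1)[of "Re (\<psi> n t)"]
        by (simp only: norm_of_real abs_mult abs_of_nonneg)
      then show "AE t in lebesgue. cmod (of_real (H (Suc 0) (Re (\<psi> n t)) * Re (pd i (\<psi> n) t))) \<le> L * cmod (pd i (\<psi> n) t)" by simp
    qed (rule test_sq_integrable[OF pd_test[OF \<psi>(1)]])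
    then have "norm (gtest (?h (\<psi> n))) \<le> norm (L *\<^sub>R gtest (\<psi> n))"
      using L by (intro norm_le_componentwise_cart) simp
    then show ?thesis using L by simp
  qed
  have mono: "0 \<le> inner (gtest (\<psi> n)) (gtest (?h (\<psi> n)))" for n
    unfolding inner_vec
  proof (rule sum_nonneg)
    fix i
    have "inner (gtest (\<psi> n) $ i) (gtest (?h (\<psi> n)) $ i) =
      (LINT t|lebesgue. inner (pd i (\<psi> n) t) (pd i (?h (\<psi> n)) t))"
      unfolding gtest_def vec_lambda_beta
      by (rule inner_cls[OF test_sq_integrable[OF pd_test[OF \<psi>(1)]] test_sq_integrable[OF pd_test[OF v]]])
    also have "\<dots> \<ge> 0"
    proof (intro integral_nonneg_AE always_eventually allI)
      fix t
      show "0 \<le> inner (pd i (\<psi> n) t) (pd i (?h (\<psi> n)) t)"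
        unfolding pdv inner_complex_def using H1(1)[of "Re (\<psi> n t)"] by (simp add: mult.left_commute[of _ "H (Suc 0) _"])
    qed
    finally show "0 \<le> inner (gtest (\<psi> n) $ i) (gtest (?h (\<psi> n)) $ i)" .
  qed
  \<comment> \<open>The gradients of the composed test functions are bounded but not shown to
    converge. Hence \<open>gr w\<close> is replaced by \<open>gtest (\<psi> n)\<close>, for which
    the sign is exact, and the error is the product of a null sequence with a bounded one.\<close>
  have key: "- (e * (norm (gr w - gtest (\<psi> n)) * (L * norm (gtest (\<psi> n))))) \<le> inner (f - w) (cls (?h (\<psi> n)))" for n
  proof -
    have eq: "inner (f - w) (cls (?h (\<psi> n))) = e * inner (gr w) (gtest (?h (\<psi> n)))"
      using J_eq[OF e test_D(1)[OF v], of f n] by (simp add: w_def test_D(2)[OF v] inner_diff_left)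
    have ge: "- (norm (gr w - gtest (\<psi> n)) * (L * norm (gtest (\<psi> n)))) \<le> inner (gr w) (gtest (?h (\<psi> n)))"
    proof -
      have "\<bar>inner (gr w - gtest (\<psi> n)) (gtest (?h (\<psi> n)))\<bar> \<le> norm (gr w - gtest (\<psi> n)) * (L * norm (gtest (\<psi> n)))"
        by (rule order_trans[OF Cauchy_Schwarz_ineq2 mult_left_mono[OF bound]]) simp
      then show ?thesis using mono[of n] unfolding inner_diff_left by linarith
    qed
    show ?thesis using mult_left_mono[OF ge less_imp_le[OF e]] unfolding eq by simp
  qed
  show "0 \<le> inner (f - w) (cls (?h (repr w)))"
  proof (rule LIMSEQ_le)
    show "(\<lambda>n. inner (f - w) (cls (?h (\<psi> n)))) \<longlonglongrightarrow> inner (f - w) (cls (?h (repr w)))" by (intro tendsto_intros vlim)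
    have "(\<lambda>n. - (e * (norm (gr w - gtest (\<psi> n)) * (L * norm (gtest (\<psi> n)))))) \<longlonglongrightarrow>
        - (e * (norm (gr w - gr w) * (L * norm (gr w))))"
      by (intro tendsto_intros \<psi>)
    then show "(\<lambda>n. - (e * (norm (gr w - gtest (\<psi> n)) * (L * norm (gtest (\<psi> n)))))) \<longlonglongrightarrow> 0" by simp
    show "\<exists>N. \<forall>n\<ge>N. - (e * (norm (gr w - gtest (\<psi> n)) * (L * norm (gtest (\<psi> n))))) \<le> inner (f - w) (cls (?h (\<psi> n)))"
      using key by blast
  qed
qed

text \<open>The integrand is nonpositive by hypothesis, while its integral is nonnegative by
  \<open>cutoff_monotone_nonneg\<close>.\<close>

lemma cutoff_AE_zero:
  assumes e: "e > 0" and H: "smooth_chain H" "H 0 0 = 0" and H1: "\<And>x. 0 \<le> H (Suc 0) x" "\<And>x. H (Suc 0) x \<le> L"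
    and le: "AE t in lebesgue. (Re (repr f t) - Re (repr (J e f) t)) * H 0 (Re (repr (J e f) t)) \<le> 0"
  shows "AE t in lebesgue. (Re (repr f t) - Re (repr (J e f) t)) * H 0 (Re (repr (J e f) t)) = 0"
proof -
  let ?w = "repr (J e f)" and ?h = "\<lambda>t. of_real (H 0 (Re (repr (J e f) t))) :: complex"
  let ?F = "\<lambda>t. (Re (repr f t) - Re (?w t)) * H 0 (Re (?w t))"
  note c = cutoff_monotone_nonneg[OF e H H1, of f]
  have s: "sq_integrable lebesgue (\<lambda>t. repr f t - ?w t)" by (intro sq_integrable_diff) auto
  have F: "inner (repr f t - ?w t) (?h t) = ?F t" for t by (simp add: inner_complex_def)
  have i: "integrable lebesgue ?F" using sq_integrable_inner[OF s c(1)] by (simp add: F)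
  have "inner (f - J e f) (cls ?h) = (LINT t|lebesgue. ?F t)"
    using inner_cls[OF s c(1)] by (simp add: F cls_diff)
  then have "(LINT t|lebesgue. - ?F t) \<le> 0" using c(2) by simp
  moreover have "(LINT t|lebesgue. - ?F t) \<ge> 0" using le by (intro integral_nonneg_AE) auto
  ultimately have "(LINT t|lebesgue. - ?F t) = 0" by simp
  then have "AE t in lebesgue. - ?F t = 0"
    using integral_nonneg_eq_0_iff_AE[of lebesgue "\<lambda>t. - ?F t"] i le by simp
  then show ?thesis by eventually_elim simp
qed

lemma J_nonneg:
  assumes e: "e > 0" and f: "AE t in lebesgue. 0 \<le> Re (repr f t)"
  shows "AE t in lebesgue. 0 \<le> Re (repr (J e f) t)"
proof -
  \<comment> \<open>Here \<open>H 0\<close> is nondecreasing and negative exactly for negative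
    arguments. Where the datum is nonnegative and the resolvent negative, the product would be
    strictly negative instead of zero.\<close>
  define H where "H = (\<lambda>k x. (-1) * (-1) ^ k * cutoff k ((-1) * x + 0))"
  have H: "smooth_chain H" unfolding H_def by (rule smooth_chain_affine[OF cutoff_chain])
  have H0: "H 0 x = - cutoff 0 (- x)" and H1: "H (Suc 0) x = cutoff (Suc 0) (- x)" for x by (simp_all add: H_def)
  have *: "H 0 x \<le> 0" "H 0 x = 0 \<longleftrightarrow> x \<ge> 0" for x using cutoff_0_bounds(1,3)[of "- x"] cutoff_0_bounds(4)[of "- x"]
    by (auto simp: H0 not_le)
  have "AE t in lebesgue. (Re (repr f t) - Re (repr (J e f) t)) * H 0 (Re (repr (J e f) t)) = 0"
  proof (rule cutoff_AE_zero[OF e H])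
    show "AE t in lebesgue. (Re (repr f t) - Re (repr (J e f) t)) * H 0 (Re (repr (J e f) t)) \<le> 0"
      using f
    proof eventually_elim
      case (elim t)
      then show ?case using *[of "Re (repr (J e f) t)"]
        by (cases "Re (repr (J e f) t) \<ge> 0") (auto intro: mult_nonneg_nonpos)
    qed
  qed (use cutoff_1_bounds * in \<open>auto simp: H1\<close>)
  then show ?thesis using f
  proof eventually_elim
    case (elim t)
    then show ?case using *[of "Re (repr (J e f) t)"] by auto
  qed
qed

lemma J_le_1:
  assumes e: "e > 0" and f: "AE t in lebesgue. Re (repr f t) \<le> 1"
  shows "AE t in lebesgue. Re (repr (J e f) t) \<le> 1"
proof -
  \<comment> \<open>Here \<open>H 0\<close> is positive exactly for arguments greater than
    1.\<close>
  define H where "H = (\<lambda>k x. 1 * 1 ^ k * cutoff k (1 * x + (-1)))"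
  have H: "smooth_chain H" unfolding H_def by (rule smooth_chain_affine[OF cutoff_chain])
  have H0: "H 0 x = cutoff 0 (x - 1)" and H1: "H (Suc 0) x = cutoff (Suc 0) (x - 1)" for x by (simp_all add: H_def)
  have *: "H 0 x \<ge> 0" "H 0 x = 0 \<longleftrightarrow> x \<le> 1" for x using cutoff_0_bounds(1,3)[of "x - 1"] cutoff_0_bounds(4)[of "x - 1"]
    by (auto simp: H0 not_le)
  have "AE t in lebesgue. (Re (repr f t) - Re (repr (J e f) t)) * H 0 (Re (repr (J e f) t)) = 0"
  proof (rule cutoff_AE_zero[OF e H])
    show "AE t in lebesgue. (Re (repr f t) - Re (repr (J e f) t)) * H 0 (Re (repr (J e f) t)) \<le> 0"
      using f
    proof eventually_elim
      case (elim t)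
      then show ?case using *[of "Re (repr (J e f) t)"]
        by (cases "Re (repr (J e f) t) \<le> 1") (auto intro: mult_nonpos_nonneg)
    qed
  qed (use cutoff_1_bounds * in \<open>auto simp: H1\<close>)
  then show ?thesis using f
  proof eventually_elim
    case (elim t)
    then show ?case using *[of "Re (repr (J e f) t)"] by auto
  qed
qed

end

lemma cls_sum:
  assumes "finite Z" "\<And>z. z \<in> Z \<Longrightarrow> sq_integrable lebesgue (f z)"
  shows "sq_integrable lebesgue (\<lambda>t. \<Sum>z\<in>Z. f z t)" "cls (\<lambda>t. \<Sum>z\<in>Z. f z t) = (\<Sum>z\<in>Z. cls (f z))"
proof -
  have "sq_integrable lebesgue (\<lambda>t. \<Sum>z\<in>Z. f z t) \<and> cls (\<lambda>t. \<Sum>z\<in>Z. f z t) = (\<Sum>z\<in>Z. cls (f z))"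
    using assms
  proof (induction Z rule: finite_induct)
    case empty then show ?case by (simp add: cls_zero)
  next
    case (insert z Z)
    then show ?case by (simp add: sq_integrable_add cls_add)
  qed
  then show "sq_integrable lebesgue (\<lambda>t. \<Sum>z\<in>Z. f z t)" "cls (\<lambda>t. \<Sum>z\<in>Z. f z t) = (\<Sum>z\<in>Z. cls (f z))" by auto
qed

context closed_skew_form begin

lemma J_0: "e > 0 \<Longrightarrow> J e 0 = 0"
  using J_scaleR[of e 0 0] by simp

lemma J_sum: assumes "e > 0" "finite Z" shows "J e (\<Sum>z\<in>Z. f z) = (\<Sum>z\<in>Z. J e (f z))"
  using assms(2) by (induction Z rule: finite_induct) (simp_all add: J_0 J_add assms(1))

end

section \<open>Matrix entries of the resolvent on indicator functions\<close>

context sobolev_domain begin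

lemma dom_lmeasurable: "\<Omega> \<in> lmeasurable" by (rule lmeasurable_open[OF bounded_dom open_dom])

definition chi :: "complex \<Rightarrow> (real ^ 'n) set \<Rightarrow> (real ^ 'n) l2" where
  "chi z B = cls (\<lambda>t. z * indicator B t)"

lemma chi_sq: assumes "B \<in> lmeasurable" shows "sq_integrable lebesgue (\<lambda>t. z * indicator B t)"
proof (rule sq_integrableI_bound)
  have "B \<in> sets lebesgue" using assms by auto
  then show "(\<lambda>t. z * indicator B t) \<in> borel_measurable lebesgue"
    by (intro borel_measurable_times borel_measurable_const borel_measurable_indicator)
  show "integrable lebesgue (\<lambda>t. (cmod z)\<^sup>2 * indicat_real B t)"
    using assms by (intro integrable_mult_right integrable_real_indicator) (auto simp: fmeasurable_def)
qed (auto simp: indicator_def)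

lemma inner_chi_1:
  assumes B: "B \<in> lmeasurable"
  shows "integrable lebesgue (\<lambda>t. Re (repr x t) * indicat_real B t)"
    "inner x (chi 1 B) = (LINT t|lebesgue. Re (repr x t) * indicat_real B t)"
proof -
  have *: "inner (repr x t) (1 * indicator B t) = Re (repr x t) * indicat_real B t" for t
    by (simp add: inner_complex_def indicator_def)
  show "integrable lebesgue (\<lambda>t. Re (repr x t) * indicat_real B t)"
    using sq_integrable_inner[OF sq_integrable_repr chi_sq[OF B, of 1], of x] unfolding * .
  show "inner x (chi 1 B) = (LINT t|lebesgue. Re (repr x t) * indicat_real B t)"
    using inner_cls[OF sq_integrable_repr chi_sq[OF B, of 1], of x] unfolding * by (simp add: chi_def)
qed

lemma inner_chi:
  assumes "B \<in> lmeasurable" "C \<in> lmeasurable"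
  shows "inner (chi z B) (chi w C) = inner z w * measure lebesgue (B \<inter> C)"
proof -
  have *: "inner (z * indicator B t) (w * indicator C t) = inner z w * indicat_real (B \<inter> C) t" for t
    by (simp add: indicator_def)
  show ?thesis
    using inner_cls[OF chi_sq[OF assms(1), of z] chi_sq[OF assms(2), of w]] unfolding * by (simp add: chi_def)
qed

lemma chi_eq: assumes B: "B \<in> lmeasurable" shows "chi z B = Re z *\<^sub>R chi 1 B + Im z *\<^sub>R Ii (chi 1 B)"
proof -
  have "Re z *\<^sub>R chi 1 B + Im z *\<^sub>R Ii (chi 1 B) = cls (\<lambda>t. Re z *\<^sub>R (1 * indicator B t) + Im z *\<^sub>R (\<i> * (1 * indicator B t)))"
    unfolding chi_def Ii_cls[OF chi_sq[OF B]] using chi_sq[OF B, of 1] sq_integrable_cmult[OF chi_sq[OF B, of 1], of \<i>]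
    by (simp only: cls_add sq_integrable_scaleR cls_scaleR[of _ "\<lambda>t. 1 * indicator B t"] cls_scaleR[of _ "\<lambda>t. \<i> * (1 * indicator B t)"])
  also have "(\<lambda>t. Re z *\<^sub>R (1 * indicator B t) + Im z *\<^sub>R (\<i> * (1 * indicator B t))) = (\<lambda>t. z * indicator B t)"
    by (auto simp: indicator_def complex_eq_iff)
  finally show ?thesis by (simp add: chi_def)
qed

context
  fixes e :: real assumes e: "e > 0"
begin

lemma J_chi_nonneg:
  assumes f: "sq_integrable lebesgue f" "\<And>t. 0 \<le> Re (f t)" and C: "C \<in> lmeasurable"
  shows "0 \<le> inner (J e (cls f)) (chi 1 C)"
proof -
  have "AE t in lebesgue. 0 \<le> Re (repr (cls f) t)"
    using repr_cls[OF f(1)] by eventually_elim (simp add: f(2))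
  from J_nonneg[OF e this] have "AE t in lebesgue. 0 \<le> Re (repr (J e (cls f)) t) * indicat_real C t"
    by eventually_elim simp
  then show ?thesis unfolding inner_chi_1[OF C] by (rule integral_nonneg_AE)
qed

definition ker :: "(real ^ 'n) set \<Rightarrow> (real ^ 'n) set \<Rightarrow> real" where
  "ker B C = inner (J e (chi 1 B)) (chi 1 C)"

lemma ker_nonneg: "B \<in> lmeasurable \<Longrightarrow> C \<in> lmeasurable \<Longrightarrow> 0 \<le> ker B C"
  unfolding ker_def chi_def[of 1 B] by (rule J_chi_nonneg[OF chi_sq]) (auto simp: indicator_def)

lemma ker_sym: "ker B C = ker C B"
  unfolding ker_def J_sym[OF e, of "chi 1 B"] by (rule inner_commute)

text \<open>The resolvent maps real functions to real ones: \<open>J_nonneg\<close> applies to both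
  signs of \<i> times the indicator, since the real part is zero in either case.\<close>

lemma ker_imag:
  assumes B: "B \<in> lmeasurable" and C: "C \<in> lmeasurable"
  shows "inner (Ii (J e (chi 1 B))) (chi 1 C) = 0"
proof -
  note s = sq_integrable_cmult[OF chi_sq[OF B, of 1], of \<i>]
  have I: "Ii (chi 1 B) = cls (\<lambda>t. \<i> * (1 * indicator B t))" by (simp only: chi_def Ii_cls[OF chi_sq[OF B]])
  have 1: "0 \<le> inner (J e (Ii (chi 1 B))) (chi 1 C)"
    unfolding I by (rule J_chi_nonneg[OF s _ C]) (simp add: indicator_def)
  have "0 \<le> inner (J e (cls (\<lambda>t. - (\<i> * (1 * indicator B t))))) (chi 1 C)"
    by (rule J_chi_nonneg[OF sq_integrable_uminus[OF s] _ C]) (simp add: indicator_def)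
  also have "cls (\<lambda>t. - (\<i> * (1 * indicator B t))) = (-1) *\<^sub>R Ii (chi 1 B)"
    unfolding I using cls_uminus[OF s s] by simp
  finally have "0 \<le> - inner (J e (Ii (chi 1 B))) (chi 1 C)" unfolding J_scaleR[OF e] by simp
  with 1 show ?thesis by (simp add: J_I[OF e])
qed

text \<open>The row sums up to the resolvent of the indicator of \<open>B z\<close> paired with the
  indicator of the union; by symmetry this is the resolvent of the latter, at most 1, integrated
  over \<open>B z\<close>.\<close>

lemma ker_row:
  assumes fin: "finite Z" and B: "\<And>z. z \<in> Z \<Longrightarrow> B z \<in> lmeasurable" and dis: "disjoint_family_on B Z" and z: "z \<in> Z"
  shows "(\<Sum>w\<in>Z. ker (B z) (B w)) \<le> measure lebesgue (B z)"
proof -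
  have UZ: "(\<Union>w\<in>Z. B w) \<in> lmeasurable" using fin B by (rule fmeasurable.finite_UN)
  have "(\<Sum>w\<in>Z. chi 1 (B w)) = chi 1 (\<Union>w\<in>Z. B w)"
  proof -
    have "indicator (\<Union>w\<in>Z. B w) t = (\<Sum>w\<in>Z. indicator (B w) t :: complex)" for t
      by (rule indicator_UN_disjoint[OF fin dis])
    moreover have "sq_integrable lebesgue (\<lambda>t. 1 * indicator (B w) t)" if "w \<in> Z" for w
      by (rule chi_sq[OF B[OF that]])
    ultimately show ?thesis unfolding chi_def using cls_sum(2)[OF fin, of "\<lambda>w t. 1 * indicator (B w) t"] by simp
  qed
  then have "(\<Sum>w\<in>Z. ker (B z) (B w)) = inner (J e (chi 1 (B z))) (chi 1 (\<Union>w\<in>Z. B w))"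
    unfolding ker_def inner_sum_right[symmetric] by simp
  also have "\<dots> = inner (J e (chi 1 (\<Union>w\<in>Z. B w))) (chi 1 (B z))"
    unfolding J_sym[OF e, of "chi 1 (B z)"] by (rule inner_commute)
  also have "\<dots> = (LINT t|lebesgue. Re (repr (J e (chi 1 (\<Union>w\<in>Z. B w))) t) * indicat_real (B z) t)"
    by (rule inner_chi_1(2)[OF B[OF z]])
  also have "\<dots> \<le> (LINT t|lebesgue. indicat_real (B z) t)"
  proof (rule integral_mono_AE[OF inner_chi_1(1)[OF B[OF z]]])
    show "integrable lebesgue (indicat_real (B z))"
      using B[OF z] by (intro integrable_real_indicator) (auto simp: fmeasurable_def)
    have "AE t in lebesgue. Re (repr (chi 1 (\<Union>w\<in>Z. B w)) t) \<le> 1"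
      unfolding chi_def using repr_cls[OF chi_sq[OF UZ, of 1]] by eventually_elim (simp add: indicator_def)
    from J_le_1[OF e this]
    show "AE t in lebesgue. Re (repr (J e (chi 1 (\<Union>w\<in>Z. B w))) t) * indicat_real (B z) t \<le> indicat_real (B z) t"
      by eventually_elim (simp add: indicator_def)
  qed
  also have "\<dots> = measure lebesgue (B z)" using B[OF z] by simp
  finally show ?thesis .
qed

lemma inner_J_chi:
  assumes B: "B \<in> lmeasurable" and C: "C \<in> lmeasurable"
  shows "inner (J e (chi z B)) (chi w C) = inner z w * ker B C"
proof -
  let ?X = "J e (chi 1 B)" and ?Y = "chi 1 C"
  have 1: "inner (Ii ?X) ?Y = 0" by (rule ker_imag[OF B C])
  have 2: "inner ?X (Ii ?Y) = 0" using 1 by (simp add: Ii_skew)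
  have "J e (chi z B) = Re z *\<^sub>R ?X + Im z *\<^sub>R Ii ?X"
    unfolding chi_eq[OF B, of z] by (simp only: J_add[OF e] J_scaleR[OF e] J_I[OF e])
  then show ?thesis
    unfolding chi_eq[OF C, of w]
    by (simp add: inner_add_left inner_add_right 1 2 Ii_inner ker_def inner_complex_def algebra_simps)
qed

end

section \<open>Superposition operators and the resolvent\<close>

text \<open>The superposition operator, cut off outside \<open>\<Omega>\<close>. Its argument is a
  function rather than a class so that simple functions can be inserted with their level
  sets.\<close>

definition nemf :: "(complex \<Rightarrow> complex) \<Rightarrow> (real ^ 'n \<Rightarrow> complex) \<Rightarrow> (real ^ 'n) l2" where
  "nemf a f = cls (ext (\<lambda>t. a (f t)))"

text \<open>On simple functions the resolvent acts as a symmetric matrix with the real entries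
  \<open>ker\<close>, so the discrete inequality applies. Two pairs are treated together because
  comparing the dissipation with the energy of \<open>G\<close> needs monotonicity of a sum whose
  second part alone may be negative.\<close>

lemma markov_simple:
  assumes e: "e > 0" and s: "simple_function lebesgue s"
    and pos: "\<And>z. 0 \<le> inner (a1 z) (b1 z) + inner (a2 z) (b2 z)"
    and mon: "\<And>z w. 0 \<le> inner (a1 z - a1 w) (b1 z - b1 w) + inner (a2 z - a2 w) (b2 z - b2 w)"
  shows "inner (J e (nemf a1 s)) (nemf b1 s) + inner (J e (nemf a2 s)) (nemf b2 s)
    \<le> inner (nemf a1 s) (nemf b1 s) + inner (nemf a2 s) (nemf b2 s)"
proof -
  define Z where "Z = range s"
  define B where "B z = {t \<in> \<Omega>. s t = z}" for z
  have fin: "finite Z" using s by (simp add: Z_def simple_function_def)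
  have Bm: "B z \<in> lmeasurable" if "z \<in> Z" for z
  proof (rule fmeasurableI2[OF dom_lmeasurable])
    have "s -` {z} \<inter> space lebesgue \<in> sets lebesgue" using s by (rule simple_functionD(2))
    then have "(s -` {z} \<inter> space lebesgue) \<inter> \<Omega> \<in> sets lebesgue" using dom_sets by (rule sets.Int)
    moreover have "(s -` {z} \<inter> space lebesgue) \<inter> \<Omega> = B z" by (auto simp: B_def)
    ultimately show "B z \<in> sets lebesgue" by simp
  qed (auto simp: B_def)
  have dis: "disjoint_family_on B Z" by (auto simp: disjoint_family_on_def B_def)
  have nem: "nemf a s = (\<Sum>z\<in>Z. chi (a z) (B z))" for a
  proof -
    have "ext (\<lambda>t. a (s t)) t = (\<Sum>z\<in>Z. a z * indicator (B z) t)" for t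
    proof (cases "t \<in> \<Omega>")
      case True
      have "(\<Sum>z\<in>Z. a z * indicator (B z) t) = (\<Sum>z\<in>Z. if z = s t then a z else 0)"
        using True by (intro sum.cong) (auto simp: B_def indicator_def)
      also have "\<dots> = a (s t)" using fin by (simp add: Z_def)
      finally show ?thesis using True by (simp add: ext_def)
    next
      case False then show ?thesis by (simp add: ext_def B_def indicator_def)
    qed
    then have "ext (\<lambda>t. a (s t)) = (\<lambda>t. \<Sum>z\<in>Z. a z * indicator (B z) t)" by blast
    moreover have "sq_integrable lebesgue (\<lambda>t. a z * indicator (B z) t)" if "z \<in> Z" for z
      by (rule chi_sq[OF Bm[OF that]])
    ultimately show ?thesis
      unfolding nemf_def chi_def using cls_sum(2)[OF fin, of "\<lambda>z t. a z * indicator (B z) t"] by simp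
  qed
  have J: "inner (J e (nemf a s)) (nemf b s) = (\<Sum>z\<in>Z. \<Sum>w\<in>Z. ker e (B z) (B w) * inner (a z) (b w))" for a b
  proof -
    have "inner (J e (nemf a s)) (nemf b s) = (\<Sum>z\<in>Z. inner (J e (chi (a z) (B z))) (nemf b s))"
      unfolding nem[of a] J_sum[OF e fin] by (rule inner_sum_left)
    also have "\<dots> = (\<Sum>z\<in>Z. \<Sum>w\<in>Z. inner (J e (chi (a z) (B z))) (chi (b w) (B w)))"
      unfolding nem[of b] inner_sum_right ..
    also have "\<dots> = (\<Sum>z\<in>Z. \<Sum>w\<in>Z. ker e (B z) (B w) * inner (a z) (b w))"
      by (intro sum.cong refl) (simp add: inner_J_chi[OF e Bm Bm] mult.commute)
    finally show ?thesis .
  qed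
  have N: "inner (nemf a s) (nemf b s) = (\<Sum>z\<in>Z. measure lebesgue (B z) * inner (a z) (b z))" for a b
  proof -
    have "inner (nemf a s) (nemf b s) = (\<Sum>z\<in>Z. inner (chi (a z) (B z)) (nemf b s))"
      unfolding nem[of a] by (rule inner_sum_left)
    also have "\<dots> = (\<Sum>z\<in>Z. \<Sum>w\<in>Z. inner (chi (a z) (B z)) (chi (b w) (B w)))"
      unfolding nem[of b] inner_sum_right ..
    also have "\<dots> = (\<Sum>z\<in>Z. \<Sum>w\<in>Z. if w = z then measure lebesgue (B z) * inner (a z) (b z) else 0)"
    proof (intro sum.cong refl)
      fix z w assume "z \<in> Z" "w \<in> Z"
      then show "inner (chi (a z) (B z)) (chi (b w) (B w)) = (if w = z then measure lebesgue (B z) * inner (a z) (b z) else 0)"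
        using dis by (auto simp: inner_chi Bm disjoint_family_on_def)
    qed
    finally show ?thesis using fin by simp
  qed
  have "(\<Sum>z\<in>Z. \<Sum>w\<in>Z. ker e (B z) (B w) * (inner (a1 z) (b1 w) + inner (a2 z) (b2 w)))
    \<le> (\<Sum>z\<in>Z. measure lebesgue (B z) * (inner (a1 z) (b1 z) + inner (a2 z) (b2 z)))"
  proof (rule symmetric_kernel_sum_le)
    show "ker e (B z) (B w) \<ge> 0" if "z \<in> Z" "w \<in> Z" for z w using ker_nonneg[OF e Bm Bm] that by simp
    show "ker e (B z) (B w) = ker e (B w) (B z)" for z w by (rule ker_sym[OF e])
    show "(\<Sum>w\<in>Z. ker e (B z) (B w)) \<le> measure lebesgue (B z)" if "z \<in> Z" for z by (rule ker_row[OF e fin Bm dis that])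
    show "inner (a1 z) (b1 w) + inner (a2 z) (b2 w) + (inner (a1 w) (b1 z) + inner (a2 w) (b2 z))
        \<le> inner (a1 z) (b1 z) + inner (a2 z) (b2 z) + (inner (a1 w) (b1 w) + inner (a2 w) (b2 w))" for z w
      using mon[of z w] by (simp add: inner_diff_left inner_diff_right)
  qed (rule pos)
  then show ?thesis unfolding J N by (simp add: distrib_left sum.distrib)
qed

lemma quasi_lipschitz_bound:
  assumes "quasi_lipschitz a" "\<delta> > 0"
  obtains M where "M \<ge> 0" "\<And>z w. (cmod (a z - a w))\<^sup>2 \<le> \<delta> + M * (cmod (z - w))\<^sup>2" "\<And>z. (cmod (a z))\<^sup>2 \<le> \<delta> + M * (cmod z)\<^sup>2"
proof -
  obtain M where M: "M \<ge> 0" "\<And>z w. (cmod (a z - a w))\<^sup>2 \<le> \<delta> + M * (cmod (z - w))\<^sup>2"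
    using assms unfolding quasi_lipschitz_def by metis
  have "a 0 = 0" using assms by (simp add: quasi_lipschitz_def)
  then show ?thesis using that[OF M] M(2)[of _ 0] by simp
qed

lemma indicator_dom_integrable: "integrable lebesgue (\<lambda>t. \<delta> * indicat_real \<Omega> t)"
  using dom_lmeasurable by (intro integrable_mult_right integrable_real_indicator) (auto simp: fmeasurable_def)

lemma nemf_sq:
  assumes a: "quasi_lipschitz a" and f: "sq_integrable lebesgue f"
  shows "sq_integrable lebesgue (ext (\<lambda>t. a (f t)))"
proof -
  obtain M where M: "M \<ge> 0" "\<And>z. (cmod (a z))\<^sup>2 \<le> 1 + M * (cmod z)\<^sup>2"
    using quasi_lipschitz_bound[OF a zero_less_one] by metis
  have am: "a \<in> borel_measurable borel" by (rule borel_measurable_continuous_onI[OF quasi_lipschitz_continuous[OF a]])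
  have fm: "f \<in> borel_measurable lebesgue" using f by (simp add: sq_integrable_def)
  show ?thesis
  proof (rule sq_integrableI_bound)
    have "(\<lambda>t. indicator \<Omega> t * a (f t)) \<in> borel_measurable lebesgue"
      using dom_sets by (intro borel_measurable_times borel_measurable_indicator measurable_compose[OF fm am])
    moreover have "(\<lambda>t. indicator \<Omega> t * a (f t)) = ext (\<lambda>t. a (f t))" by (auto simp: ext_def)
    ultimately show "ext (\<lambda>t. a (f t)) \<in> borel_measurable lebesgue" by simp
    show "integrable lebesgue (\<lambda>t. 1 * indicat_real \<Omega> t + M * (cmod (f t))\<^sup>2)"
      using f by (intro Bochner_Integration.integrable_add indicator_dom_integrable integrable_mult_right) (simp add: sq_integrable_def)
    show "AE t in lebesgue. (cmod (ext (\<lambda>t. a (f t)) t))\<^sup>2 \<le> 1 * indicat_real \<Omega> t + M * (cmod (f t))\<^sup>2"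
      using M by (auto simp: ext_def)
  qed
qed

text \<open>Allowing two different functions \<open>a\<close> and \<open>b\<close> covers both
  continuity in the argument and the distance between truncated and exact nonlinearity.\<close>

lemma nemf_diff:
  assumes a: "quasi_lipschitz a" and b: "quasi_lipschitz b" and f: "sq_integrable lebesgue f" and g: "sq_integrable lebesgue g"
    and M: "M \<ge> 0" and d: "\<delta> \<ge> 0" and ab: "\<And>z w. (cmod (a z - b w))\<^sup>2 \<le> \<delta> + M * (cmod (z - w))\<^sup>2"
  shows "(norm (nemf a f - nemf b g))\<^sup>2 \<le> \<delta> * measure lebesgue \<Omega> + M * (norm (cls f - cls g))\<^sup>2"
proof -
  note sf = nemf_sq[OF a f] and sg = nemf_sq[OF b g]
  have i: "integrable lebesgue (\<lambda>t. M * (cmod (f t - g t))\<^sup>2)"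
    using sq_integrable_diff[OF f g] by (simp add: sq_integrable_def)
  have "(norm (nemf a f - nemf b g))\<^sup>2 = (LINT t|lebesgue. (cmod (ext (\<lambda>t. a (f t)) t - ext (\<lambda>t. b (g t)) t))\<^sup>2)"
    unfolding nemf_def cls_diff[OF sf sg, symmetric] by (rule norm_cls_sq[OF sq_integrable_diff[OF sf sg]])
  also have "\<dots> \<le> (LINT t|lebesgue. \<delta> * indicat_real \<Omega> t + M * (cmod (f t - g t))\<^sup>2)"
  proof (rule integral_mono)
    show "integrable lebesgue (\<lambda>t. (cmod (ext (\<lambda>t. a (f t)) t - ext (\<lambda>t. b (g t)) t))\<^sup>2)"
      using sq_integrable_diff[OF sf sg] by (simp add: sq_integrable_def)
    show "integrable lebesgue (\<lambda>t. \<delta> * indicat_real \<Omega> t + M * (cmod (f t - g t))\<^sup>2)"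
      by (intro Bochner_Integration.integrable_add indicator_dom_integrable i)
    show "(cmod (ext (\<lambda>t. a (f t)) t - ext (\<lambda>t. b (g t)) t))\<^sup>2 \<le> \<delta> * indicat_real \<Omega> t + M * (cmod (f t - g t))\<^sup>2" for t
      using ab M d by (auto simp: ext_def)
  qed
  also have "\<dots> = \<delta> * measure lebesgue \<Omega> + M * (LINT t|lebesgue. (cmod (f t - g t))\<^sup>2)"
    using Bochner_Integration.integral_add[OF indicator_dom_integrable i] by simp
  also have "(LINT t|lebesgue. (cmod (f t - g t))\<^sup>2) = (norm (cls f - cls g))\<^sup>2"
    unfolding cls_diff[OF f g, symmetric] by (rule norm_cls_sq[OF sq_integrable_diff[OF f g], symmetric])
  finally show ?thesis .
qed

lemma nemf_tendsto:
  assumes a: "quasi_lipschitz a" and F: "\<And>i. sq_integrable lebesgue (F i)" and f: "sq_integrable lebesgue f"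
    and lim: "(\<lambda>i. cls (F i)) \<longlonglongrightarrow> cls f"
  shows "(\<lambda>i. nemf a (F i)) \<longlonglongrightarrow> nemf a f"
proof (rule metric_LIMSEQ_I)
  fix r :: real assume r: "r > 0"
  \<comment> \<open>The constant error integrates to
    \<open>\<delta> * measure lebesgue \<Omega>\<close>, at most half of the squared tolerance; the
    summand 1 avoids division by zero for an empty domain.\<close>
  define \<delta> where "\<delta> = (r\<^sup>2 / 2) / (measure lebesgue \<Omega> + 1)"
  have m0: "0 \<le> measure lebesgue \<Omega>" by simp
  have \<delta>: "\<delta> > 0" using r m0 by (simp add: \<delta>_def add_nonneg_pos)
  obtain M where M: "M \<ge> 0" "\<And>z w. (cmod (a z - a w))\<^sup>2 \<le> \<delta> + M * (cmod (z - w))\<^sup>2"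
    using quasi_lipschitz_bound[OF a \<delta>] by metis
  have "\<delta> * measure lebesgue \<Omega> \<le> \<delta> * (measure lebesgue \<Omega> + 1)" using \<delta> by simp
  also have "\<dots> = r\<^sup>2 / 2"
  proof -
    have "measure lebesgue \<Omega> + 1 \<noteq> 0" using m0 by linarith
    from nonzero_eq_divide_eq[OF this, THEN iffD1, OF \<delta>_def] show ?thesis .
  qed
  finally have 1: "\<delta> * measure lebesgue \<Omega> \<le> r\<^sup>2 / 2" .
  have "(\<lambda>i. M * (norm (cls (F i) - cls f))\<^sup>2) \<longlonglongrightarrow> M * 0\<^sup>2"
    by (intro tendsto_intros tendsto_norm_zero LIM_zero lim)
  then have "\<forall>\<^sub>F i in sequentially. M * (norm (cls (F i) - cls f))\<^sup>2 < r\<^sup>2 / 2"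
    using r by (intro order_tendstoD(2)) auto
  then obtain N where N: "\<And>i. i \<ge> N \<Longrightarrow> M * (norm (cls (F i) - cls f))\<^sup>2 < r\<^sup>2 / 2" by (auto simp: eventually_sequentially)
  show "\<exists>N. \<forall>i\<ge>N. dist (nemf a (F i)) (nemf a f) < r"
  proof (intro exI allI impI)
    fix i assume i: "N \<le> i"
    have "(norm (nemf a (F i) - nemf a f))\<^sup>2 \<le> \<delta> * measure lebesgue \<Omega> + M * (norm (cls (F i) - cls f))\<^sup>2"
      by (rule nemf_diff[OF a a F f M(1) less_imp_le[OF \<delta>] M(2)])
    also have "\<dots> < r\<^sup>2" using 1 N[OF i] by linarith
    finally show "dist (nemf a (F i)) (nemf a f) < r" using r by (simp add: dist_norm power_less_imp_less_base)
  qed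
qed

lemma simple_approximation:
  fixes f :: "real ^ 'n \<Rightarrow> complex"
  assumes f: "sq_integrable lebesgue f"
  obtains F where "\<And>i. simple_function lebesgue (F i)" "\<And>i. sq_integrable lebesgue (F i)" "(\<lambda>i. cls (F i)) \<longlonglongrightarrow> cls f"
proof -
  have fm: "f \<in> borel_measurable lebesgue" using f by (simp add: sq_integrable_def)
  obtain F where F: "\<And>i. simple_function lebesgue (F i)" "\<And>x. (\<lambda>i. F i x) \<longlonglongrightarrow> f x" "\<And>i x. dist (F i x) 0 \<le> 2 * dist (f x) 0"
    using borel_measurable_implies_sequence_metric[OF fm, of 0] by auto
  have Fm: "F i \<in> borel_measurable lebesgue" for i by (rule borel_measurable_simple_function[OF F(1)])
  have i4: "integrable lebesgue (\<lambda>t. 9 * (cmod (f t))\<^sup>2)" using f by (simp add: sq_integrable_def)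
  have Fb: "(cmod (F i t))\<^sup>2 \<le> 9 * (cmod (f t))\<^sup>2" "(cmod (F i t - f t))\<^sup>2 \<le> 9 * (cmod (f t))\<^sup>2" for i t
  proof -
    have 1: "cmod (F i t) \<le> 2 * cmod (f t)" using F(3)[of i t] by simp
    then have 2: "cmod (F i t) \<le> 3 * cmod (f t)" "cmod (F i t - f t) \<le> 3 * cmod (f t)"
      using norm_triangle_ineq4[of "F i t" "f t"] norm_ge_zero[of "f t"] by linarith+
    show "(cmod (F i t))\<^sup>2 \<le> 9 * (cmod (f t))\<^sup>2" "(cmod (F i t - f t))\<^sup>2 \<le> 9 * (cmod (f t))\<^sup>2"
      using power_mono[OF 2(1) norm_ge_zero, of 2] power_mono[OF 2(2) norm_ge_zero, of 2]
      by (simp_all add: power_mult_distrib)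
  qed
  have Fs: "sq_integrable lebesgue (F i)" for i
    by (rule sq_integrableI_bound[OF Fm i4]) (use Fb in auto)
  have "(\<lambda>i. LINT t|lebesgue. (cmod (F i t - f t))\<^sup>2) \<longlonglongrightarrow> (LINT t|(lebesgue :: (real ^ 'n) measure). 0)"
  proof (rule integral_dominated_convergence[where w="\<lambda>t. 9 * (cmod (f t))\<^sup>2" and s="\<lambda>i t. (cmod (F i t - f t))\<^sup>2" and f="\<lambda>t. 0"])
    show "(\<lambda>t. (cmod (F i t - f t))\<^sup>2) \<in> borel_measurable lebesgue" for i using Fm[of i] fm by measurable
    have "(\<lambda>i. (cmod (F i t - f t))\<^sup>2) \<longlonglongrightarrow> 0\<^sup>2" for t
      by (intro tendsto_power tendsto_norm_zero LIM_zero F)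
    then show "AE t in lebesgue. (\<lambda>i. (cmod (F i t - f t))\<^sup>2) \<longlonglongrightarrow> 0" by simp
    show "AE t in lebesgue. norm ((cmod (F i t - f t))\<^sup>2) \<le> 9 * (cmod (f t))\<^sup>2" for i using Fb by simp
  qed (use i4 in simp_all)
  then have "(\<lambda>i. (norm (cls (F i) - cls f))\<^sup>2) \<longlonglongrightarrow> 0"
    by (simp add: cls_diff[OF Fs f, symmetric] norm_cls_sq[OF sq_integrable_diff[OF Fs f]])
  then have "(\<lambda>i. sqrt ((norm (cls (F i) - cls f))\<^sup>2)) \<longlonglongrightarrow> sqrt 0" by (rule tendsto_real_sqrt)
  then have "(\<lambda>i. cls (F i) - cls f) \<longlonglongrightarrow> 0" by (simp add: tendsto_norm_zero_iff)
  then have "(\<lambda>i. cls (F i)) \<longlonglongrightarrow> cls f" by (rule LIM_zero_cancel)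
  with F(1) Fs that show ?thesis by blast
qed

definition nem :: "(complex \<Rightarrow> complex) \<Rightarrow> (real ^ 'n) l2 \<Rightarrow> (real ^ 'n) l2" where
  "nem a x = nemf a (repr x)"

lemma nem_cls:
  assumes a: "quasi_lipschitz a" and f: "sq_integrable lebesgue f" shows "nem a (cls f) = nemf a f"
  unfolding nem_def nemf_def
proof (subst cls_eq_iff)
  show "AE t in lebesgue. ext (\<lambda>t. a (repr (cls f) t)) t = ext (\<lambda>t. a (f t)) t"
    using repr_cls[OF f] by eventually_elim (simp add: ext_def)
qed (simp_all add: nemf_sq a f)

lemma nem_continuous: assumes a: "quasi_lipschitz a" shows "continuous_on UNIV (nem a)"
  unfolding continuous_on_sequentially
proof (intro allI ballI impI, elim conjE)
  fix x :: "nat \<Rightarrow> (real ^ 'n) l2" and l assume "x \<longlonglongrightarrow> l"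
  then show "(nem a \<circ> x) \<longlonglongrightarrow> nem a l"
    unfolding nem_def[abs_def] comp_def by (intro nemf_tendsto[OF a]) auto
qed

lemma nem_Supp: "quasi_lipschitz a \<Longrightarrow> nem a x \<in> Supp"
proof -
  assume a: "quasi_lipschitz a"
  have "ext (ext (\<lambda>t. a (repr x t))) = ext (\<lambda>t. a (repr x t))" by (auto simp: ext_def)
  then have "nem a x = emb (ext (\<lambda>t. a (repr x t)))" by (simp add: nem_def nemf_def emb_def)
  moreover have "ext (\<lambda>t. a (repr x t)) \<in> L2 \<Omega>" using nemf_sq[OF a sq_integrable_repr] by (simp add: L2_iff sq_integrable_ext)
  ultimately show ?thesis using emb_Supp by simp
qed

lemma inner_emb_repr: assumes "v \<in> Supp" shows "inner (emb (repr x)) v = inner x v"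
proof -
  have v: "v = cls (ext (repr v))" using assms by (simp add: Supp_def emb_def)
  have "inner (cls (ext (repr x))) (cls (ext (repr v))) = inner (cls (repr x)) (cls (ext (repr v)))"
    unfolding inner_cls[OF sq_integrable_ext[OF sq_integrable_repr] sq_integrable_ext[OF sq_integrable_repr]]
      inner_cls[OF sq_integrable_repr sq_integrable_ext[OF sq_integrable_repr]]
    by (rule Bochner_Integration.integral_cong) (auto simp: ext_def)
  then show ?thesis using v by (simp add: emb_def)
qed

text \<open>The resolvent equation tests the datum only against \<open>D\<close>, whose elements
  vanish off \<open>\<Omega>\<close>, so values of \<open>x\<close> outside do not matter.\<close>

lemma J_emb_repr: assumes e: "e > 0" shows "J e (emb (repr x)) = J e x"
proof (rule J_eqI[OF e])
  show "is_resolvent e (emb (repr x)) (J e x)"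
    using J_resolvent[OF e, of x] inner_emb_repr[OF D_Supp] by (simp add: is_resolvent_def)
qed

text \<open>The passage from simple functions to L2 by continuity of the superposition operators and
  of \<open>A e\<close>. It yields \<open>markov\<close>, \<open>lower\<close> and
  \<open>upper\<close> of the abstract setting, for suitable choices of the two pairs.\<close>

lemma markov_inequality:
  assumes e: "e > 0" and q: "quasi_lipschitz a1" "quasi_lipschitz b1" "quasi_lipschitz a2" "quasi_lipschitz b2"
    and pos: "\<And>z. 0 \<le> inner (a1 z) (b1 z) + inner (a2 z) (b2 z)"
    and mon: "\<And>z w. 0 \<le> inner (a1 z - a1 w) (b1 z - b1 w) + inner (a2 z - a2 w) (b2 z - b2 w)"
  shows "0 \<le> inner (A e (nem a1 x)) (nem b1 x) + inner (A e (nem a2 x)) (nem b2 x)"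
proof -
  obtain F where F: "\<And>i. simple_function lebesgue (F i)" "\<And>i. sq_integrable lebesgue (F i)" "(\<lambda>i. cls (F i)) \<longlonglongrightarrow> cls (repr x)"
    using simple_approximation[OF sq_integrable_repr] by metis
  have lim: "(\<lambda>i. nemf a (F i)) \<longlonglongrightarrow> nem a x" if "quasi_lipschitz a" for a
    unfolding nem_def by (rule nemf_tendsto[OF that F(2) sq_integrable_repr F(3)])
  have "0 \<le> inner (A e (nemf a1 (F i))) (nemf b1 (F i)) + inner (A e (nemf a2 (F i))) (nemf b2 (F i))" for i
  proof -
    have "0 \<le> (1 / e) * (inner (nemf a1 (F i)) (nemf b1 (F i)) + inner (nemf a2 (F i)) (nemf b2 (F i))
        - (inner (J e (nemf a1 (F i))) (nemf b1 (F i)) + inner (J e (nemf a2 (F i))) (nemf b2 (F i))))"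
      using markov_simple[OF e F(1)[of i] pos mon] e by (intro mult_nonneg_nonneg) auto
    also have "\<dots> = inner (A e (nemf a1 (F i))) (nemf b1 (F i)) + inner (A e (nemf a2 (F i))) (nemf b2 (F i))"
      by (simp add: A_def inner_diff_left add_divide_distrib diff_divide_distrib)
    finally show ?thesis .
  qed
  moreover have "(\<lambda>i. inner (A e (nemf a1 (F i))) (nemf b1 (F i)) + inner (A e (nemf a2 (F i))) (nemf b2 (F i)))
     \<longlonglongrightarrow> inner (A e (nem a1 x)) (nem b1 x) + inner (A e (nem a2 x)) (nem b2 x)"
    by (intro tendsto_add tendsto_inner A_tendsto e lim q)
  ultimately show ?thesis using LIMSEQ_le_const by blast
qed

end

section \<open>The damping nonlinearity\<close>

definition radial :: "(real \<Rightarrow> real) \<Rightarrow> complex \<Rightarrow> complex" where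
  "radial k z = of_real (k (cmod z)) * z"

lemma inner_of_real_mult: "inner (of_real a * z) (of_real b * w) = a * b * inner z w" for z w :: complex
  by (simp add: inner_complex_def algebra_simps)

lemma inner_complex_bounds: "inner z w \<le> cmod z * cmod w" "- (cmod z * cmod w) \<le> inner z w"
  using Cauchy_Schwarz_ineq2[of z w] by auto

context
  fixes k :: "real \<Rightarrow> real"
  assumes k0: "\<And>r. r \<ge> 0 \<Longrightarrow> k r \<ge> 0" and mono: "\<And>r s. 0 \<le> s \<Longrightarrow> s \<le> r \<Longrightarrow> s * k s \<le> r * k r"
begin

text \<open>Estimating \<open>inner z w\<close> by the product of the moduli reduces the expression
  to (r - s)(r k(r) - s k(s)), with r and s the moduli.\<close>

lemma radial_monotone: "0 \<le> inner (radial k z - radial k w) (z - w)"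
proof -
  let ?r = "cmod z" and ?s = "cmod w"
  have "(k ?r + k ?s) * inner z w \<le> (k ?r + k ?s) * (?r * ?s)"
    using k0[of ?r] k0[of ?s] by (intro mult_left_mono inner_complex_bounds) auto
  moreover have "inner (radial k z - radial k w) (z - w) = k ?r * ?r\<^sup>2 + k ?s * ?s\<^sup>2 - (k ?r + k ?s) * inner z w"
    using inner_of_real_mult[of "k ?r" z 1 z] inner_of_real_mult[of "k ?r" z 1 w]
      inner_of_real_mult[of "k ?s" w 1 z] inner_of_real_mult[of "k ?s" w 1 w]
    by (simp add: radial_def inner_diff_left inner_diff_right power2_norm_eq_inner inner_commute[of w z] algebra_simps)
  moreover have "0 \<le> (?r - ?s) * (?r * k ?r - ?s * k ?s)"
    using mono[of ?r ?s] mono[of ?s ?r] by (cases "?s \<le> ?r") (auto intro: mult_nonneg_nonneg mult_nonpos_nonpos)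
  ultimately show ?thesis by (simp add: algebra_simps power2_eq_square)
qed

text \<open>For |w| at most |z|, split off k(|z|)(z - w). The change of the coefficient multiplies
  \<open>w\<close>, and since r k(r) is nondecreasing it costs no more than (|z| - |w|) k(|z|);
  hence the factor 2.\<close>

lemma radial_lipschitz:
  assumes dec: "\<And>r s. 0 \<le> s \<Longrightarrow> s \<le> r \<Longrightarrow> k r \<le> k s" and K: "\<And>r. r \<ge> 0 \<Longrightarrow> k r \<le> K"
  shows "cmod (radial k z - radial k w) \<le> 2 * K * cmod (z - w)"
proof -
  have *: "cmod (radial k z - radial k w) \<le> 2 * K * cmod (z - w)" if le: "cmod w \<le> cmod z" for z w
  proof -
    let ?r = "cmod z" and ?s = "cmod w"
    have "radial k z - radial k w = of_real (k ?r) * (z - w) - of_real (k ?s - k ?r) * w"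
      by (simp add: radial_def algebra_simps)
    then have "cmod (radial k z - radial k w) \<le> cmod (of_real (k ?r) * (z - w)) + cmod (of_real (k ?s - k ?r) * w)"
      using norm_triangle_ineq4 by metis
    also have "\<dots> = k ?r * cmod (z - w) + (k ?s - k ?r) * ?s"
      using k0[of ?r] dec[OF norm_ge_zero le] unfolding norm_mult norm_of_real by simp
    also have "(k ?s - k ?r) * ?s = (?s * k ?s - ?r * k ?r) + (?r - ?s) * k ?r" by (simp add: algebra_simps)
    also have "\<dots> \<le> (?r - ?s) * k ?r" using mono[OF norm_ge_zero le] by simp
    also have "\<dots> \<le> cmod (z - w) * k ?r"
      using norm_triangle_ineq2[of z w] k0[of ?r] by (intro mult_right_mono) auto
    finally have "cmod (radial k z - radial k w) \<le> 2 * k ?r * cmod (z - w)" by (simp add: algebra_simps)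
    also have "\<dots> \<le> 2 * K * cmod (z - w)" using K[of ?r] by (intro mult_right_mono) auto
    finally show ?thesis .
  qed
  show ?thesis using *[of z w] *[of w z] by (cases "cmod w \<le> cmod z") (auto simp: norm_minus_commute)
qed

end

lemma radial_0: "radial k 0 = 0" by (simp add: radial_def)

lemma damping_radial: "damping \<alpha> = radial (\<lambda>r. r powr (- \<alpha>))"
  by (auto simp: fun_eq_iff damping_def radial_def powr_minus divide_inverse)

text \<open>The singular coefficient is frozen below radius \<open>d\<close>. It stays nonincreasing
  while its product with the radius stays nondecreasing, which gives both the Lipschitz bound and
  monotonicity.\<close>

definition trunc_power :: "real \<Rightarrow> real \<Rightarrow> real \<Rightarrow> real" where
  "trunc_power \<alpha> d r = max r d powr (- \<alpha>)"

lemma powr_times_mono: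
  fixes r s \<alpha> :: real assumes "0 \<le> s" "s \<le> r" "\<alpha> < 1" shows "s * s powr (- \<alpha>) \<le> r * r powr (- \<alpha>)"
proof (cases "s = 0")
  case False
  then have "s * s powr (- \<alpha>) = s powr (1 - \<alpha>)" "r * r powr (- \<alpha>) = r powr (1 - \<alpha>)"
    using assms powr_mult_base[of s "- \<alpha>"] powr_mult_base[of r "- \<alpha>"] by simp_all
  then show ?thesis using assms by (simp add: powr_mono2)
qed (use assms in auto)

context
  fixes \<alpha> d :: real assumes \<alpha>: "0 < \<alpha>" "\<alpha> < 1" and d: "0 < d"
begin

lemma trunc_power_nonneg: "0 \<le> trunc_power \<alpha> d r" by (simp add: trunc_power_def)

lemma trunc_power_antimono: "s \<le> r \<Longrightarrow> trunc_power \<alpha> d r \<le> trunc_power \<alpha> d s"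
  using \<alpha> d by (auto simp: trunc_power_def intro!: powr_mono2')

lemma trunc_power_le: "trunc_power \<alpha> d r \<le> d powr (- \<alpha>)"
  using \<alpha> d by (auto simp: trunc_power_def intro!: powr_mono2')

lemma trunc_power_mono:
  assumes "0 \<le> s" "s \<le> r" shows "s * trunc_power \<alpha> d s \<le> r * trunc_power \<alpha> d r"
proof (cases "r \<le> d")
  case True
  then show ?thesis using assms by (simp add: trunc_power_def mult_right_mono max_def)
next
  case False
  show ?thesis
  proof (cases "s \<le> d")
    case True
    have "s * trunc_power \<alpha> d s \<le> d * d powr (- \<alpha>)" using True assms by (simp add: trunc_power_def mult_right_mono max_def)
    also have "\<dots> \<le> r * r powr (- \<alpha>)" by (rule powr_times_mono) (use d False \<alpha> in auto)
    finally show ?thesis using False by (simp add: trunc_power_def max_def)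
  next
    case s: False
    then show ?thesis using powr_times_mono[OF assms \<alpha>(2)] False by (simp add: trunc_power_def max_def)
  qed
qed

lemma trunc_monotone: "0 \<le> inner (radial (trunc_power \<alpha> d) z - radial (trunc_power \<alpha> d) w) (z - w)"
  by (rule radial_monotone[OF trunc_power_nonneg trunc_power_mono])

lemma trunc_lipschitz:
  "cmod (radial (trunc_power \<alpha> d) z - radial (trunc_power \<alpha> d) w) \<le> 2 * d powr (- \<alpha>) * cmod (z - w)"
  by (rule radial_lipschitz[OF trunc_power_nonneg trunc_power_mono trunc_power_antimono trunc_power_le])

lemma trunc_close: "cmod (radial (trunc_power \<alpha> d) z - damping \<alpha> z) \<le> d powr (1 - \<alpha>)"
proof (cases "cmod z \<ge> d")
  case True
  then show ?thesis by (simp add: damping_radial radial_def trunc_power_def max_def)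
next
  case False
  show ?thesis
  proof (cases "z = 0")
    case True then show ?thesis by (simp add: radial_def damping_def)
  next
    case z: False
    have le: "d powr (- \<alpha>) \<le> cmod z powr (- \<alpha>)" using False z \<alpha> by (intro powr_mono2') auto
    have "radial (trunc_power \<alpha> d) z - damping \<alpha> z = - (of_real (cmod z powr (- \<alpha>) - d powr (- \<alpha>)) * z)"
      using False by (simp add: damping_radial radial_def trunc_power_def max_def algebra_simps)
    then have "cmod (radial (trunc_power \<alpha> d) z - damping \<alpha> z) = (cmod z powr (- \<alpha>) - d powr (- \<alpha>)) * cmod z"
      using le by (simp only: norm_minus_cancel norm_mult norm_of_real)
    also have "\<dots> \<le> cmod z powr (- \<alpha>) * cmod z" by (intro mult_right_mono) auto
    also have "\<dots> \<le> d * d powr (- \<alpha>)"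
      using powr_times_mono[OF norm_ge_zero, of z d \<alpha>] False \<alpha> by (simp add: mult.commute)
    also have "\<dots> = d powr (1 - \<alpha>)" using powr_mult_base[of d "- \<alpha>"] d by simp
    finally show ?thesis .
  qed
qed

text \<open>The two values are taken at different points so that one estimate serves
  \<open>nemf_diff\<close> and the proof of \<open>quasi_lipschitz_damping\<close>.\<close>

lemma damping_trunc_diff:
  "(cmod (radial (trunc_power \<alpha> d) z - damping \<alpha> w))\<^sup>2
    \<le> 2 * (d powr (1 - \<alpha>))\<^sup>2 + 2 * (2 * d powr (- \<alpha>))\<^sup>2 * (cmod (z - w))\<^sup>2"
proof -
  let ?g = "radial (trunc_power \<alpha> d)" and ?e = "d powr (1 - \<alpha>)" and ?L = "2 * d powr (- \<alpha>)"
  have "cmod (?g z - damping \<alpha> w) \<le> cmod (?g w - damping \<alpha> w) + cmod (?g z - ?g w)"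
    using norm_triangle_ineq[of "?g w - damping \<alpha> w" "?g z - ?g w"] by simp
  also have "\<dots> \<le> ?e + ?L * cmod (z - w)" by (intro add_mono trunc_close trunc_lipschitz)
  finally have "(cmod (?g z - damping \<alpha> w))\<^sup>2 \<le> (?e + ?L * cmod (z - w))\<^sup>2" by (intro power_mono) auto
  also have "\<dots> \<le> 2 * ?e\<^sup>2 + 2 * (?L * cmod (z - w))\<^sup>2"
    using sum_squares_bound[of ?e "?L * cmod (z - w)"] by (simp add: power2_sum)
  finally show ?thesis by (simp add: power_mult_distrib)
qed

end

lemma quasi_lipschitzI_lipschitz:
  assumes "a 0 = 0" "\<And>z w. cmod (a z - a w) \<le> L * cmod (z - w)" shows "quasi_lipschitz a"
  unfolding quasi_lipschitz_def
proof (intro conjI allI impI assms(1))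
  fix \<delta> :: real assume \<delta>: "\<delta> > 0"
  have "(cmod (a z - a w))\<^sup>2 \<le> \<delta> + L\<^sup>2 * (cmod (z - w))\<^sup>2" for z w
    using power_mono[OF assms(2)[of z w] norm_ge_zero, of 2] \<delta> by (simp add: power_mult_distrib)
  then show "\<exists>M\<ge>0. \<forall>z w. (cmod (a z - a w))\<^sup>2 \<le> \<delta> + M * (cmod (z - w))\<^sup>2"
    by (intro exI[of _ "L\<^sup>2"]) auto
qed

lemma quasi_lipschitz_trunc:
  assumes "0 < \<alpha>" "\<alpha> < 1" "0 < d" shows "quasi_lipschitz (radial (trunc_power \<alpha> d))"
  by (rule quasi_lipschitzI_lipschitz[OF radial_0 trunc_lipschitz[OF assms]])

lemma quasi_lipschitz_damping:
  assumes \<alpha>: "0 < \<alpha>" "\<alpha> < 1" shows "quasi_lipschitz (damping \<alpha>)"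
  unfolding quasi_lipschitz_def
proof (intro conjI allI impI)
  show "damping \<alpha> 0 = 0" by (simp add: damping_def)
  fix \<delta> :: real assume \<delta>: "\<delta> > 0"
  \<comment> \<open>The additive errors below sum up to six times the square of
    \<open>\<eta>\<close>, which is less than \<open>\<delta>\<close>. The truncation radius
    \<open>d\<close> is then chosen so that the truncation error is \<open>\<eta>\<close>.\<close>
  define \<eta> where "\<eta> = sqrt (\<delta> / 8)"
  have \<eta>: "\<eta> > 0" "\<eta>\<^sup>2 = \<delta> / 8" using \<delta> by (auto simp: \<eta>_def)
  define d where "d = \<eta> powr (1 / (1 - \<alpha>))"
  have d: "d > 0" using \<eta> by (simp add: d_def)
  have d1: "d powr (1 - \<alpha>) = \<eta>" using \<eta> \<alpha> by (simp add: d_def powr_powr)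
  let ?g = "radial (trunc_power \<alpha> d)" and ?L = "2 * d powr (- \<alpha>)"
  have "(cmod (damping \<alpha> z - damping \<alpha> w))\<^sup>2 \<le> \<delta> + 4 * ?L\<^sup>2 * (cmod (z - w))\<^sup>2" for z w
  proof -
    have 1: "(cmod (?g z - damping \<alpha> z))\<^sup>2 \<le> \<eta>\<^sup>2"
      using power_mono[OF trunc_close[OF \<alpha> d, of z] norm_ge_zero, of 2] by (simp add: d1)
    have 2: "(cmod (?g z - damping \<alpha> w))\<^sup>2 \<le> 2 * \<eta>\<^sup>2 + 2 * ?L\<^sup>2 * (cmod (z - w))\<^sup>2"
      using damping_trunc_diff[OF \<alpha> d, of z w] by (simp only: d1)
    have "cmod (damping \<alpha> z - damping \<alpha> w) \<le> cmod (?g z - damping \<alpha> z) + cmod (?g z - damping \<alpha> w)"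
      using norm_triangle_ineq4[of "?g z - damping \<alpha> w" "?g z - damping \<alpha> z"] by simp
    then have "(cmod (damping \<alpha> z - damping \<alpha> w))\<^sup>2 \<le> (cmod (?g z - damping \<alpha> z) + cmod (?g z - damping \<alpha> w))\<^sup>2"
      by (intro power_mono) auto
    also have "\<dots> \<le> 2 * (cmod (?g z - damping \<alpha> z))\<^sup>2 + 2 * (cmod (?g z - damping \<alpha> w))\<^sup>2"
      using sum_squares_bound[of "cmod (?g z - damping \<alpha> z)" "cmod (?g z - damping \<alpha> w)"] by (simp add: power2_sum)
    also have "\<dots> \<le> 2 * \<eta>\<^sup>2 + 2 * (2 * \<eta>\<^sup>2 + 2 * ?L\<^sup>2 * (cmod (z - w))\<^sup>2)"
      by (intro add_mono mult_left_mono 1 2) simp_all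
    also have "\<dots> \<le> \<delta> + 4 * ?L\<^sup>2 * (cmod (z - w))\<^sup>2" using \<eta>(2) \<delta> by (simp add: algebra_simps)
    finally show ?thesis .
  qed
  then show "\<exists>M\<ge>0. \<forall>z w. (cmod (damping \<alpha> z - damping \<alpha> w))\<^sup>2 \<le> \<delta> + M * (cmod (z - w))\<^sup>2"
    by (intro exI[of _ "4 * ?L\<^sup>2"]) auto
qed

section \<open>Pointwise comparison of dissipation and half-power energy\<close>

text \<open>As s is at most 1, s^p is at least (s^q)^k, and Bernoulli's inequality bounds this k-th
  power from below.\<close>

lemma one_minus_powr_le:
  fixes s p q :: real assumes s: "0 \<le> s" "s \<le> 1" and k: "0 < q" "p \<le> real k * q" and p: "0 < p"
  shows "1 - s powr p \<le> real k * (1 - s powr q)"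
proof (cases "s = 0")
  case True
  have "k \<noteq> 0" using k p by (cases k) auto
  then show ?thesis using True p k by simp
next
  case False
  then have s0: "s > 0" using s by simp
  have "s powr (real k * q) \<le> s powr p" using s s0 k(2) by (intro powr_mono') auto
  moreover have "s powr (real k * q) = (s powr q) ^ k" using s0 by (simp add: powr_powr[symmetric] mult.commute powr_realpow)
  moreover have "1 + real k * (s powr q - 1) \<le> (s powr q) ^ k"
    using Bernoulli_inequality[of "s powr q - 1" k] powr_ge_zero[of s q] by simp
  ultimately show ?thesis by (simp add: algebra_simps)
qed

text \<open>The comparison reduces to \<open>r = 1\<close> by homogeneity; since both sides are affine in the inner
  product of the two complex numbers, only the cases of equal and of opposite directions matter.\<close>

lemma power_comparison:
  fixes r s \<alpha> :: real
  assumes \<alpha>: "0 < \<alpha>" "\<alpha> < 1" and rs: "0 < s" "s \<le> r" and k: "1 \<le> real k * (1 - \<alpha>)"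
  shows "(r powr (1 - \<alpha>/2) - s powr (1 - \<alpha>/2))\<^sup>2 \<le> real k * ((r - s) * (r powr (1 - \<alpha>) - s powr (1 - \<alpha>)))"
    and "(r - s) * (r powr (1 - \<alpha>) - s powr (1 - \<alpha>)) \<le> 2 * (r powr (1 - \<alpha>/2) - s powr (1 - \<alpha>/2))\<^sup>2"
proof -
  define x where "x = s / r"
  have r: "r > 0" using rs by simp
  have x: "0 < x" "x \<le> 1" using rs r by (auto simp: x_def)
  define p where "p = 1 - \<alpha>/2"
  define q where "q = 1 - \<alpha>"
  have pq: "0 < q" "q < p" "p < 1" "1/2 \<le> p" "1 + q = 2 * p" using \<alpha> by (auto simp: p_def q_def)
  have sc: "r powr c - s powr c = r powr c * (1 - x powr c)" for c
    using r rs by (simp add: x_def powr_divide right_diff_distrib)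
  have sr: "r - s = r * (1 - x)" using r by (simp add: x_def right_diff_distrib)
  have R: "(r powr p)\<^sup>2 = r * r powr q"
    using powr_mult_base[of r q] r pq(5) by (simp add: power2_eq_square powr_add[symmetric])
  have xp: "x \<le> x powr p" using powr_mono'[of p 1 x] x pq by simp
  have p1: "0 \<le> 1 - x powr p" using powr_le1[of p x] x pq by simp
  have pq1: "x powr p \<le> x powr q" using powr_mono'[of q p x] x pq by simp
  \<comment> \<open>Applicable because p < 1 and 1 is at most k q.\<close>
  have a: "1 - x powr p \<le> real k * (1 - x powr q)"
    by (rule one_minus_powr_le) (use x pq k in \<open>auto simp: q_def\<close>)
  \<comment> \<open>Since p is at least 1/2, x^p is at most the square root of x, and 2 sqrt x is at
    most 1 + x.\<close>
  have b: "1 - x \<le> 2 * (1 - x powr p)"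
  proof -
    have "x powr p \<le> x powr (1/2)" using powr_mono'[of "1/2" p x] x pq by simp
    then have "x powr p \<le> sqrt x" using x by (simp add: powr_half_sqrt)
    moreover have "sqrt x * 2 \<le> 1 + x"
      using sum_squares_bound[of 1 "sqrt x"] x by simp
    ultimately show ?thesis by simp
  qed
  have "(1 - x powr p) * (1 - x powr p) \<le> (1 - x) * (real k * (1 - x powr q))"
    using xp a p1 x by (intro mult_mono) auto
  then have "r * r powr q * ((1 - x powr p) * (1 - x powr p)) \<le> r * r powr q * ((1 - x) * (real k * (1 - x powr q)))"
    using r by (intro mult_left_mono) auto
  then show "(r powr (1 - \<alpha>/2) - s powr (1 - \<alpha>/2))\<^sup>2 \<le> real k * ((r - s) * (r powr (1 - \<alpha>) - s powr (1 - \<alpha>)))"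
    unfolding p_def[symmetric] q_def[symmetric] sc sr power_mult_distrib R by (simp add: power2_eq_square mult_ac)
  have "(1 - x) * (1 - x powr q) \<le> (2 * (1 - x powr p)) * (1 - x powr p)"
    using b pq1 p1 powr_le1[of q x] x pq by (intro mult_mono) auto
  then have "r * r powr q * ((1 - x) * (1 - x powr q)) \<le> r * r powr q * ((2 * (1 - x powr p)) * (1 - x powr p))"
    using r by (intro mult_left_mono) auto
  then show "(r - s) * (r powr (1 - \<alpha>) - s powr (1 - \<alpha>)) \<le> 2 * (r powr (1 - \<alpha>/2) - s powr (1 - \<alpha>/2))\<^sup>2"
    unfolding p_def[symmetric] q_def[symmetric] sc sr power_mult_distrib R by (simp only: power2_eq_square mult_ac)
qed

lemma affine_nonneg: "\<bar>t\<bar> \<le> m \<Longrightarrow> 0 \<le> a - b * m \<Longrightarrow> 0 \<le> a + b * m \<Longrightarrow> 0 \<le> a - b * t" for a b t m :: real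
proof -
  assume h: "\<bar>t\<bar> \<le> m" "0 \<le> a - b * m" "0 \<le> a + b * m"
  have "b * t \<le> \<bar>b\<bar> * m" using mult_mono[of "\<bar>b\<bar>" "\<bar>b\<bar>" "\<bar>t\<bar>" m] h(1) abs_ge_self[of "b * t"] by (simp add: abs_mult)
  moreover have "\<bar>b\<bar> * m \<le> a" using h(2,3) by (cases "b \<ge> 0") auto
  ultimately show ?thesis by linarith
qed

text \<open>The pointwise source of \<open>lower\<close> and \<open>upper\<close>. Because
  \<open>markov_inequality\<close> carries pointwise monotonicity over to every \<open>A e\<close>,
  the constants do not depend on the Yosida parameter.\<close>

lemma damping_comparison:
  assumes \<alpha>: "0 < \<alpha>" "\<alpha> < 1" and k: "1 \<le> real k * (1 - \<alpha>)" "2 \<le> k"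
  shows "(cmod (damping (\<alpha>/2) z - damping (\<alpha>/2) w))\<^sup>2 \<le> real k * inner (z - w) (damping \<alpha> z - damping \<alpha> w)"
    and "inner (z - w) (damping \<alpha> z - damping \<alpha> w) \<le> 2 * (cmod (damping (\<alpha>/2) z - damping (\<alpha>/2) w))\<^sup>2"
proof -
  let ?g = "damping \<alpha>" and ?G = "damping (\<alpha>/2)"
  let ?L = "\<lambda>z w. inner (z - w) (?g z - ?g w)" and ?R = "\<lambda>z w. (cmod (?G z - ?G w))\<^sup>2"
  have zero: "?R z 0 \<le> real k * ?L z 0 \<and> ?L z 0 \<le> 2 * ?R z 0" for z
  proof (cases "z = 0")
    case True then show ?thesis by (simp add: damping_def)
  next
    case False
    then have r: "cmod z > 0" by simp
    have "?L z 0 = cmod z powr (- \<alpha>) * (cmod z)\<^sup>2"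
      using inner_of_real_mult[of 1 z "cmod z powr (- \<alpha>)" z] by (simp add: damping_radial radial_def power2_norm_eq_inner)
    moreover have "?R z 0 = (cmod z powr (- (\<alpha>/2)))\<^sup>2 * (cmod z)\<^sup>2"
      by (simp add: damping_radial radial_def norm_mult power_mult_distrib)
    moreover have "(cmod z powr (- (\<alpha>/2)))\<^sup>2 = cmod z powr (- \<alpha>)"
      by (simp add: power2_eq_square powr_add[symmetric])
    ultimately have "?R z 0 = ?L z 0" "0 \<le> ?L z 0" by auto
    then show ?thesis using k(2) mult_right_mono[of 1 "real k" "?L z 0"] by simp
  qed
  have ord: "?R z w \<le> real k * ?L z w \<and> ?L z w \<le> 2 * ?R z w" if zw: "0 < cmod w" "cmod w \<le> cmod z" for z w
  proof -
    define r s t where "r = cmod z" and "s = cmod w" and "t = inner z w"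
    have r: "0 < s" "s \<le> r" "0 < r" using zw by (auto simp: r_def s_def)
    define P where "P = r powr (1 - \<alpha>/2)"
    define Q where "Q = s powr (1 - \<alpha>/2)"
    define A where "A = r powr (1 - \<alpha>)"
    define B where "B = s powr (1 - \<alpha>)"
    define a where "a = r powr (- \<alpha>)"
    define b where "b = s powr (- \<alpha>)"
    define c where "c = r powr (- (\<alpha>/2)) * s powr (- (\<alpha>/2))"
    have pos: "0 < P" "0 < Q" "0 < A" "0 < B" using r by (auto simp: P_def Q_def A_def B_def)
    have Aa: "A = r * a" "B = s * b" using powr_mult_base[of r "- \<alpha>"] powr_mult_base[of s "- \<alpha>"] r
      by (auto simp: A_def B_def a_def b_def)
    have PA: "P\<^sup>2 = r * A" "Q\<^sup>2 = s * B"
      using powr_mult_base[of r "1 - \<alpha>"] powr_mult_base[of s "1 - \<alpha>"] r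
      by (simp_all add: P_def Q_def A_def B_def power2_eq_square powr_add[symmetric])
    have PQ: "r * s * c = P * Q"
    proof -
      have "r * s * c = (r * r powr (- (\<alpha>/2))) * (s * s powr (- (\<alpha>/2)))" by (simp add: c_def mult_ac)
      also have "r * r powr (- (\<alpha>/2)) = P" using powr_mult_base[of r "- (\<alpha>/2)"] r by (simp add: P_def)
      also have "s * s powr (- (\<alpha>/2)) = Q" using powr_mult_base[of s "- (\<alpha>/2)"] r by (simp add: Q_def)
      finally show ?thesis .
    qed
    have L: "?L z w = (r * A + s * B) - (a + b) * t"
      using inner_of_real_mult[of 1 z a z] inner_of_real_mult[of 1 z b w] inner_of_real_mult[of 1 w a z] inner_of_real_mult[of 1 w b w]
      by (simp add: damping_radial radial_def r_def[symmetric] s_def[symmetric] a_def[symmetric] b_def[symmetric]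
          inner_diff_left inner_diff_right inner_commute[of w z] t_def[symmetric] Aa)
        (simp add: r_def s_def power2_norm_eq_inner[symmetric] power2_eq_square algebra_simps)
    have R: "?R z w = (r * A + s * B) - (2 * c) * t"
    proof -
      let ?u = "r powr (- (\<alpha>/2))" and ?v = "s powr (- (\<alpha>/2))"
      have uv: "?u * ?u = a" "?v * ?v = b" by (simp_all add: a_def b_def powr_add[symmetric])
      have "?R z w = inner (of_real ?u * z - of_real ?v * w) (of_real ?u * z - of_real ?v * w)"
        by (simp add: power2_norm_eq_inner damping_radial radial_def r_def s_def)
      also have "\<dots> = (?u * ?u) * r\<^sup>2 + (?v * ?v) * s\<^sup>2 - 2 * (?u * ?v) * t"
        by (simp only: inner_diff_left inner_diff_right inner_of_real_mult r_def s_def t_def power2_norm_eq_inner inner_commute[of w z])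
          (simp add: algebra_simps)
      finally show ?thesis unfolding uv by (simp add: Aa c_def power2_eq_square algebra_simps)
    qed
    have t: "\<bar>t\<bar> \<le> r * s" using Cauchy_Schwarz_ineq2[of z w] by (simp add: t_def r_def s_def)
    have same: "(r * A + s * B) - (a + b) * (r * s) = (r - s) * (A - B)" by (simp add: Aa algebra_simps)
    have opp: "(r * A + s * B) + (a + b) * (r * s) = (r + s) * (A + B)" by (simp add: Aa algebra_simps)
    have cPQ: "2 * c * (r * s) = 2 * (P * Q)" unfolding PQ[symmetric] by (simp only: mult_ac)
    have sameR: "(r * A + s * B) - (2 * c) * (r * s) = (P - Q)\<^sup>2"
      unfolding cPQ by (simp add: PA[symmetric] power2_diff)
    have oppR: "(r * A + s * B) + (2 * c) * (r * s) = (P + Q)\<^sup>2"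
      unfolding cPQ by (simp add: PA[symmetric] power2_sum)
    note pc = power_comparison[OF \<alpha> r(1,2) k(1), folded P_def Q_def A_def B_def]
    have AB: "0 \<le> (r - s) * (A - B)"
      using r \<alpha> by (intro mult_nonneg_nonneg) (auto simp: A_def B_def intro!: powr_mono2)
    have o1: "(P + Q)\<^sup>2 \<le> 2 * ((r + s) * (A + B))"
    proof -
      have "(P + Q)\<^sup>2 \<le> 2 * (r * A + s * B)" using sum_squares_bound[of P Q] by (simp add: PA[symmetric] power2_sum)
      also have "\<dots> \<le> 2 * ((r + s) * (A + B))" using r pos by (simp add: algebra_simps)
      finally show ?thesis .
    qed
    have o2: "(r + s) * (A + B) \<le> 2 * (P + Q)\<^sup>2"
    proof -
      have "(r + s) * (A + B) \<le> 2 * (r * A + s * B)" using AB by (simp add: algebra_simps)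
      also have "\<dots> \<le> 2 * (P + Q)\<^sup>2" using pos by (simp add: PA[symmetric] power2_sum)
      finally show ?thesis .
    qed
    \<comment> \<open>For opposite directions a factor 2 suffices, which is why
      \<open>2 \<le> k\<close> is demanded besides the condition involving \<alpha>.\<close>
    have o3: "(P + Q)\<^sup>2 \<le> real k * ((r + s) * (A + B))"
    proof -
      have "2 * ((r + s) * (A + B)) \<le> real k * ((r + s) * (A + B))"
        using k(2) r pos by (intro mult_right_mono mult_nonneg_nonneg) auto
      then show ?thesis using o1 by linarith
    qed
    \<comment> \<open>This is \<open>k\<close> times the dissipation increment minus the squared
      increment of \<open>G\<close>, written as an affine function of \<open>t = inner z w\<close>.
      Its values at \<open>t = r * s\<close> and \<open>t = - (r * s)\<close> are the cases of equal
      and opposite directions; the second inequality below is handled alike.\<close>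
    have "0 \<le> (real k - 1) * (r * A + s * B) - (real k * (a + b) - 2 * c) * t"
    proof (rule affine_nonneg[OF t])
      show "0 \<le> (real k - 1) * (r * A + s * B) - (real k * (a + b) - 2 * c) * (r * s)"
        using pc(1) unfolding same[symmetric] sameR[symmetric] by (simp add: algebra_simps)
      show "0 \<le> (real k - 1) * (r * A + s * B) + (real k * (a + b) - 2 * c) * (r * s)"
        using o3 unfolding opp[symmetric] oppR[symmetric] by (simp add: algebra_simps)
    qed
    moreover have "0 \<le> (r * A + s * B) - (4 * c - (a + b)) * t"
    proof (rule affine_nonneg[OF t])
      show "0 \<le> (r * A + s * B) - (4 * c - (a + b)) * (r * s)"
        using pc(2) unfolding same[symmetric] sameR[symmetric] by (simp add: algebra_simps)
      show "0 \<le> (r * A + s * B) + (4 * c - (a + b)) * (r * s)"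
        using o2 unfolding opp[symmetric] oppR[symmetric] by (simp add: algebra_simps)
    qed
    ultimately show ?thesis unfolding L R by (simp add: algebra_simps)
  qed
  have sym: "?L z w = ?L w z" "?R z w = ?R w z" for z w
    by (simp_all add: inner_diff_left inner_diff_right norm_minus_commute)
  have "?R z w \<le> real k * ?L z w \<and> ?L z w \<le> 2 * ?R z w"
  proof (cases "z = 0 \<or> w = 0")
    case True
    then show ?thesis using zero[of z] zero[of w] sym[of 0 w] by auto
  next
    case False
    then show ?thesis using ord[of w z] ord[of z w] sym[of z w] by (cases "cmod w \<le> cmod z") auto
  qed
  then show "?R z w \<le> real k * ?L z w" "?L z w \<le> 2 * ?R z w" by auto
qed

lemma quasi_lipschitz_scale:
  assumes a: "quasi_lipschitz a" shows "quasi_lipschitz (\<lambda>z. of_real c * a z)"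
  unfolding quasi_lipschitz_def
proof (intro conjI allI impI)
  show "of_real c * a 0 = 0" using a by (simp add: quasi_lipschitz_def)
  fix \<delta> :: real assume \<delta>: "\<delta> > 0"
  have c: "c\<^sup>2 + 1 > 0" by (simp add: add_nonneg_pos)
  then have "\<delta> / (c\<^sup>2 + 1) > 0" using \<delta> by simp
  then obtain M where M: "M \<ge> 0" "\<And>z w. (cmod (a z - a w))\<^sup>2 \<le> \<delta> / (c\<^sup>2 + 1) + M * (cmod (z - w))\<^sup>2"
    using a unfolding quasi_lipschitz_def by metis
  have "(cmod (of_real c * a z - of_real c * a w))\<^sup>2 \<le> \<delta> + (c\<^sup>2 * M) * (cmod (z - w))\<^sup>2" for z w
  proof -
    have "(cmod (of_real c * a z - of_real c * a w))\<^sup>2 = c\<^sup>2 * (cmod (a z - a w))\<^sup>2"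
      by (simp add: right_diff_distrib[symmetric] norm_mult power_mult_distrib)
    also have "\<dots> \<le> c\<^sup>2 * (\<delta> / (c\<^sup>2 + 1) + M * (cmod (z - w))\<^sup>2)" by (intro mult_left_mono M) simp
    also have "\<dots> = c\<^sup>2 * (\<delta> / (c\<^sup>2 + 1)) + (c\<^sup>2 * M) * (cmod (z - w))\<^sup>2" by (simp add: distrib_left)
    also have "c\<^sup>2 * (\<delta> / (c\<^sup>2 + 1)) \<le> (c\<^sup>2 + 1) * (\<delta> / (c\<^sup>2 + 1))"
      using \<delta> c by (intro mult_right_mono) auto
    also have "\<dots> = \<delta>" using c by simp
    finally show ?thesis by simp
  qed
  then show "\<exists>M\<ge>0. \<forall>z w. (cmod (of_real c * a z - of_real c * a w))\<^sup>2 \<le> \<delta> + M * (cmod (z - w))\<^sup>2"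
    using M(1) by (intro exI[of _ "c\<^sup>2 * M"]) auto
qed

lemma quasi_lipschitz_id: "quasi_lipschitz (\<lambda>z. z)"
  by (rule quasi_lipschitzI_lipschitz[of _ 1]) auto

lemma quasi_lipschitz_zero: "quasi_lipschitz (\<lambda>z. 0)"
  by (rule quasi_lipschitzI_lipschitz[of _ 0]) auto

lemma inner_mult_of_real: "inner z (of_real c * w) = c * inner z w" for z w :: complex
  using inner_of_real_mult[of 1 z c w] by simp

section \<open>The damping nonlinearity satisfies the abstract hypotheses\<close>

context sobolev_domain begin

lemma nem_scale: assumes a: "quasi_lipschitz a" shows "nem (\<lambda>z. of_real c * a z) x = c *\<^sub>R nem a x"
proof -
  have "ext (\<lambda>t. of_real c * a (repr x t)) = (\<lambda>t. c *\<^sub>R ext (\<lambda>t. a (repr x t)) t)"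
    by (auto simp: ext_def scaleR_conv_of_real)
  then show ?thesis
    unfolding nem_def nemf_def
    by (simp only: cls_scaleR[OF nemf_sq[OF a sq_integrable_repr] nemf_sq[OF a sq_integrable_repr]])
qed

lemma nem_zero: "nem (\<lambda>z. 0) x = 0"
proof -
  have "ext (\<lambda>t. 0 :: complex) = (\<lambda>t. 0)" by (auto simp: ext_def)
  then show ?thesis by (simp add: nem_def nemf_def cls_zero)
qed

lemma nem_at_0: assumes a: "quasi_lipschitz a" shows "nem a 0 = 0"
proof -
  have "nem a (cls (\<lambda>t. 0)) = nemf a (\<lambda>t. 0)" by (rule nem_cls[OF a sq_integrable_zero])
  moreover have "ext (\<lambda>t. a 0) = (\<lambda>t. 0)" using a by (auto simp: ext_def quasi_lipschitz_def)
  ultimately show ?thesis by (simp add: cls_zero nemf_def)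
qed

text \<open>Superposition with the identity is restriction to \<open>\<Omega>\<close>, which neither
  the resolvent nor the pairing with \<open>y\<close> can detect.\<close>

lemma A_nem_id:
  assumes e: "e > 0" and y: "y \<in> Supp" shows "inner (A e (nem (\<lambda>z. z) x)) y = inner (A e x) y"
proof -
  have "nem (\<lambda>z. z) x = emb (repr x)" by (simp add: nem_def nemf_def emb_def)
  then show ?thesis by (simp add: A_def inner_diff_left J_emb_repr[OF e] inner_emb_repr[OF y])
qed

lemma nem_monotone:
  assumes a: "quasi_lipschitz a" and mon: "\<And>z w. 0 \<le> inner (a z - a w) (z - w)"
  shows "0 \<le> inner (nem a x - nem a y) (x - y)"
proof -
  let ?f = "repr x" and ?g = "repr y"
  note s = nemf_sq[OF a sq_integrable_repr]
  have "inner (nem a x - nem a y) (x - y) = inner (cls (\<lambda>t. ext (\<lambda>t. a (?f t)) t - ext (\<lambda>t. a (?g t)) t)) (cls (\<lambda>t. ?f t - ?g t))"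
    by (simp add: nem_def nemf_def cls_diff s)
  also have "\<dots> = (LINT t|lebesgue. inner (ext (\<lambda>t. a (?f t)) t - ext (\<lambda>t. a (?g t)) t) (?f t - ?g t))"
    by (intro inner_cls sq_integrable_diff s sq_integrable_repr)
  also have "\<dots> \<ge> 0" by (intro integral_nonneg_AE always_eventually allI) (simp add: ext_def mon)
  finally show ?thesis .
qed

lemma damped_form_damping:
  assumes \<alpha>: "0 < \<alpha>" "\<alpha> < 1"
  shows "\<exists>gn c cb c1 c2. damped_form D gr Ii (nem (damping \<alpha>)) (nem (damping (\<alpha>/2))) gn c cb c1 c2"
proof -
  have \<alpha>2: "0 < \<alpha>/2" "\<alpha>/2 < 1" using \<alpha> by auto
  \<comment> \<open>Chosen so that the truncation error \<open>d n powr (1 - \<alpha>)\<close> is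
    the rate 4^-n demanded by \<open>gn_g\<close>.\<close>
  define d where "d n = ((1/4)^n) powr (1 / (1 - \<alpha>))" for n :: nat
  have d: "d n > 0" for n by (simp add: d_def)
  have dp: "d n powr (1 - \<alpha>) = (1/4)^n" for n using \<alpha> by (simp add: d_def powr_powr)
  define a where "a n = radial (trunc_power \<alpha> (d n))" for n
  have qa: "quasi_lipschitz (a n)" for n unfolding a_def by (rule quasi_lipschitz_trunc[OF \<alpha> d])
  have qg: "quasi_lipschitz (damping \<alpha>)" by (rule quasi_lipschitz_damping[OF \<alpha>])
  have qG: "quasi_lipschitz (damping (\<alpha>/2))" by (rule quasi_lipschitz_damping[OF \<alpha>2])
  define L where "L n = 2 * d n powr (- \<alpha>)" for n
  have L0: "L n \<ge> 0" for n by (simp add: L_def)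
  have lip: "norm (nem (a n) x - nem (a n) y) \<le> L n * norm (x - y)" for n x y
  proof -
    have "(cmod (a n z - a n w))\<^sup>2 \<le> 0 + (L n)\<^sup>2 * (cmod (z - w))\<^sup>2" for z w
      using power_mono[OF trunc_lipschitz[OF \<alpha> d[of n], of z w] norm_ge_zero, of 2]
      by (simp add: a_def L_def power_mult_distrib)
    from nemf_diff[OF qa qa sq_integrable_repr sq_integrable_repr zero_le_power2 order_refl this, of x y]
    have "(norm (nem (a n) x - nem (a n) y))\<^sup>2 \<le> (L n * norm (x - y))\<^sup>2"
      by (simp add: nem_def power_mult_distrib)
    then show ?thesis using L0 by (intro power2_le_imp_le[of "norm (nem (a n) x - nem (a n) y)"]) auto
  qed
  \<comment> \<open>Both nonlinearities are applied to the same \<open>x\<close>, so only the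
    additive error of \<open>damping_trunc_diff\<close>, integrated over \<open>\<Omega>\<close>,
    remains.\<close>
  define c where "c = sqrt (2 * measure lebesgue \<Omega>)"
  have c0: "c \<ge> 0" by (simp add: c_def)
  have close: "norm (nem (a n) x - nem (damping \<alpha>) x) \<le> c * (1/4)^n" for n x
  proof -
    have ab: "(cmod (a n z - damping \<alpha> w))\<^sup>2 \<le> 2 * ((1/4)^n)\<^sup>2 + 2 * (L n)\<^sup>2 * (cmod (z - w))\<^sup>2" for z w
      using damping_trunc_diff[OF \<alpha> d[of n], of z w] unfolding dp a_def L_def .
    have "(norm (nem (a n) x - nem (damping \<alpha>) x))\<^sup>2 \<le> 2 * ((1/4)^n)\<^sup>2 * measure lebesgue \<Omega> + 2 * (L n)\<^sup>2 * (norm (x - x))\<^sup>2"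
      using nemf_diff[OF qa qg sq_integrable_repr sq_integrable_repr _ _ ab, of x x] by (simp add: nem_def)
    also have "\<dots> = (c * (1/4)^n)\<^sup>2" by (simp add: c_def power_mult_distrib)
    finally show ?thesis using c0 by (intro power2_le_imp_le[of "norm (nem (a n) x - nem (damping \<alpha>) x)"]) auto
  qed
  have gb: "norm (nem (damping \<alpha>) x) \<le> (c + L 0) * (1 + norm x)" for x
  proof -
    have "norm (nem (damping \<alpha>) x) \<le> norm (nem (a 0) x) + norm (nem (a 0) x - nem (damping \<alpha>) x)"
      using norm_triangle_sub[of "nem (damping \<alpha>) x" "nem (a 0) x"] by (simp add: norm_minus_commute)
    also have "\<dots> \<le> L 0 * norm x + c"
      using lip[of 0 x 0] close[of 0 x] by (simp add: nem_at_0[OF qa])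
    also have "\<dots> \<le> (c + L 0) * (1 + norm x)" using c0 L0[of 0] by (simp add: algebra_simps)
    finally show ?thesis .
  qed
  obtain k0 :: nat where k0: "1 / (1 - \<alpha>) < real k0" using reals_Archimedean2 by blast
  define k where "k = max 2 k0"
  have k: "2 \<le> k" "1 \<le> real k * (1 - \<alpha>)"
  proof -
    have "1 / (1 - \<alpha>) \<le> real k" using k0 by (simp add: k_def)
    then show "1 \<le> real k * (1 - \<alpha>)" using \<alpha> by (simp add: pos_divide_le_eq)
  qed (simp add: k_def)
  note cmp = damping_comparison[OF \<alpha> k(2,1)]
  have g0: "damping \<beta> 0 = 0" for \<beta> by (simp add: damping_def)
  have "damped_form D gr Ii (nem (damping \<alpha>)) (nem (damping (\<alpha>/2))) (\<lambda>n. nem (a n)) c (c + L 0) (1 / real k) 2"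
  proof
    show "\<exists>L. \<forall>x y. norm (nem (a n) x - nem (a n) y) \<le> L * norm (x - y)" for n using lip by blast
    show "0 \<le> inner (nem (a n) x - nem (a n) y) (x - y)" for n x y
      by (rule nem_monotone[OF qa]) (unfold a_def, rule trunc_monotone[OF \<alpha> d])
    show "nem (a n) 0 = 0" for n by (rule nem_at_0[OF qa])
    show "norm (nem (a n) x - nem (damping \<alpha>) x) \<le> c * (1/4)^n" for n x by (rule close)
    show "continuous_on UNIV (nem (damping \<alpha>))" by (rule nem_continuous[OF qg])
    show "continuous_on UNIV (nem (damping (\<alpha>/2)))" by (rule nem_continuous[OF qG])
    show "norm (nem (damping \<alpha>) x) \<le> (c + L 0) * (1 + norm x)" for x by (rule gb)
    show "0 \<le> inner (A e x) (nem (a n) x)" if e: "e > 0" for e n x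
    proof -
      have mon: "0 \<le> inner (z - w) (a n z - a n w)" for z w
        using trunc_monotone[OF \<alpha> d, of n z w] by (simp add: a_def inner_commute)
      \<comment> \<open>For a single monotone function the second pair is zero.\<close>
      have "0 \<le> inner (A e (nem (\<lambda>z. z) x)) (nem (a n) x) + inner (A e (nem (\<lambda>z. 0) x)) (nem (\<lambda>z. 0) x)"
        by (rule markov_inequality[OF e quasi_lipschitz_id qa quasi_lipschitz_zero quasi_lipschitz_zero])
          (use mon mon[of _ 0] in \<open>auto simp: a_def radial_0\<close>)
      then show ?thesis by (simp add: nem_zero A_nem_id[OF e nem_Supp[OF qa]])
    qed
    show "1 / real k * En e (nem (damping (\<alpha>/2)) x) \<le> inner (A e x) (nem (damping \<alpha>) x)" if e: "e > 0" for e x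
    proof -
      \<comment> \<open>The second pair consists of \<open>G\<close> and a negative multiple of
        \<open>G\<close>, so it subtracts \<open>1 / k\<close> times the energy of \<open>G\<close>.
        The sum is still monotone by the pointwise comparison.\<close>
      let ?b = "\<lambda>z. of_real (- (1 / real k)) * damping (\<alpha>/2) z"
      have mon: "0 \<le> inner (z - w) (damping \<alpha> z - damping \<alpha> w) + inner (damping (\<alpha>/2) z - damping (\<alpha>/2) w) (?b z - ?b w)" for z w
      proof -
        have "inner (damping (\<alpha>/2) z - damping (\<alpha>/2) w) (?b z - ?b w) = - (1 / real k) * (cmod (damping (\<alpha>/2) z - damping (\<alpha>/2) w))\<^sup>2"
          by (simp only: right_diff_distrib[symmetric] inner_mult_of_real power2_norm_eq_inner)
        then show ?thesis using cmp(1)[of z w] k by (simp add: pos_divide_le_eq mult.commute)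
      qed
      have "0 \<le> inner (A e (nem (\<lambda>z. z) x)) (nem (damping \<alpha>) x) + inner (A e (nem (damping (\<alpha>/2)) x)) (nem ?b x)"
        by (rule markov_inequality[OF e quasi_lipschitz_id qg qG quasi_lipschitz_scale[OF qG]])
          (use mon mon[of _ 0] in \<open>auto simp: g0\<close>)
      then show ?thesis
        by (simp only: nem_scale[OF qG] inner_scaleR_right A_nem_id[OF e nem_Supp[OF qg]] En_def)
    qed
    show "inner (A e x) (nem (damping \<alpha>) x) \<le> 2 * En e (nem (damping (\<alpha>/2)) x)" if e: "e > 0" for e x
    proof -
      \<comment> \<open>For the upper bound the roles are exchanged: now the dissipation is
        subtracted and twice the energy of \<open>G\<close> is added.\<close>
      let ?b = "\<lambda>z. of_real (-1) * damping \<alpha> z" and ?c = "\<lambda>z. of_real 2 * damping (\<alpha>/2) z"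
      have mon: "0 \<le> inner (z - w) (?b z - ?b w) + inner (damping (\<alpha>/2) z - damping (\<alpha>/2) w) (?c z - ?c w)" for z w
      proof -
        have "inner (damping (\<alpha>/2) z - damping (\<alpha>/2) w) (?c z - ?c w) = 2 * (cmod (damping (\<alpha>/2) z - damping (\<alpha>/2) w))\<^sup>2"
          "inner (z - w) (?b z - ?b w) = - inner (z - w) (damping \<alpha> z - damping \<alpha> w)"
          by (simp_all only: right_diff_distrib[symmetric] inner_mult_of_real power2_norm_eq_inner mult_minus_left mult_1)
        then show ?thesis using cmp(2)[of z w] by simp
      qed
      have "0 \<le> inner (A e (nem (\<lambda>z. z) x)) (nem ?b x) + inner (A e (nem (damping (\<alpha>/2)) x)) (nem ?c x)"
        by (rule markov_inequality[OF e quasi_lipschitz_id quasi_lipschitz_scale[OF qg] qG quasi_lipschitz_scale[OF qG]])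
          (use mon mon[of _ 0] in \<open>auto simp: g0\<close>)
      then show ?thesis
        by (simp only: nem_scale[OF qG] nem_scale[OF qg] inner_scaleR_right A_nem_id[OF e nem_Supp[OF qg]] En_def)
    qed
  qed (use k in auto)
  then show ?thesis by blast
qed

end

section \<open>Translation to the Sobolev spaces\<close>

lemma Basis_axis: "(Basis :: (real ^ 'n) set) = range (\<lambda>i. axis i 1)"
  by (auto simp: Basis_vec_def)

lemma sum_Basis_axis: "(\<Sum>b\<in>(Basis :: (real ^ 'n) set). f b) = (\<Sum>i\<in>UNIV. f (axis i 1))"
proof -
  have "inj (\<lambda>i::'n. axis i (1::real))" by (auto simp: inj_on_def axis_eq_axis)
  then show ?thesis unfolding Basis_axis by (simp add: sum.reindex)
qed

text \<open>A complex-linear functional is determined by its real part; \<open>cx \<Phi>\<close> is the functional with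
  \<open>Re (cx \<Phi> V) = \<Phi> (cj V)\<close>. The conjugation mediates between the real inner product of \<open>L\<^sup>2\<close> and the
  bilinear pairing of \<open>Hm1\<close>.\<close>

definition cx :: "('a::euclidean_space l2 \<Rightarrow> real) \<Rightarrow> 'a l2 \<Rightarrow> complex" where
  "cx \<Phi> V = Complex (\<Phi> (cj V)) (\<Phi> (Ii (cj V)))"

section \<open>The space \<open>H10\<close> and the form domain\<close>

context sobolev_domain begin

definition wdr :: "'n \<Rightarrow> (real ^ 'n \<Rightarrow> complex) \<Rightarrow> real ^ 'n \<Rightarrow> complex" where
  "wdr i u = weak_deriv \<Omega> (axis i 1) u"

definition GR :: "(real ^ 'n \<Rightarrow> complex) \<Rightarrow> (real ^ 'n) l2 ^ 'n" where "GR u = (\<chi> i. emb (wdr i u))"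

definition Vn :: "(real ^ 'n) l2 \<Rightarrow> real" where "Vn x = sqrt ((norm x)\<^sup>2 + (norm (gr x))\<^sup>2)"

lemma H1_L2: "u \<in> H1 \<Omega> \<Longrightarrow> u \<in> L2 \<Omega>" by (simp add: H1_def)

lemma H1_wdr:
  assumes "u \<in> H1 \<Omega>" shows "wdr i u \<in> L2 \<Omega>" "wd i (emb u) (emb (wdr i u))"
proof -
  have "axis i 1 \<in> (Basis :: (real ^ 'n) set)" by (simp add: Basis_axis)
  then have "\<exists>g. has_weak_deriv \<Omega> (axis i 1) u g" using assms by (auto simp: H1_def)
  then have w: "has_weak_deriv \<Omega> (axis i 1) u (wdr i u)" unfolding wdr_def weak_deriv_def by (rule someI_ex)
  then show L: "wdr i u \<in> L2 \<Omega>" by (simp add: has_weak_deriv_def)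
  show "wd i (emb u) (emb (wdr i u))" using has_weak_deriv_iff[OF H1_L2[OF assms] L] w by simp
qed

text \<open>\<open>weak_deriv\<close> selects an unspecified representative; uniqueness of weak
  derivatives in \<open>Supp\<close> fixes its class, so any candidate gradient may be used to
  compute \<open>GR\<close>.\<close>

lemma GR_unique:
  assumes u: "u \<in> L2 \<Omega>" and y: "\<And>i. wd i (emb u) (y $ i)" "\<And>i. y $ i \<in> Supp"
  shows "u \<in> H1 \<Omega>" "GR u = y"
proof -
  have "has_weak_deriv \<Omega> (axis i 1) u (repr (y $ i))" for i
    using has_weak_deriv_iff[OF u repr_L2] y by (simp add: Supp_def)
  then show H: "u \<in> H1 \<Omega>" using u by (auto simp: H1_def Basis_axis)
  have "emb (wdr i u) = y $ i" for i
    by (rule wd_unique[OF emb_Supp[OF H1_wdr(1)[OF H]] y(2) H1_wdr(2)[OF H] y(1)])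
  then show "GR u = y" by (simp add: GR_def vec_eq_iff)
qed

lemma H1_norm_eq: assumes "u \<in> H1 \<Omega>" shows "H1_norm \<Omega> u = sqrt ((norm (emb u))\<^sup>2 + (norm (GR u))\<^sup>2)"
proof -
  have "(norm (GR u))\<^sup>2 = (\<Sum>i\<in>UNIV. (L2_norm \<Omega> (wdr i u))\<^sup>2)"
    by (simp add: power2_norm_eq_inner inner_vec GR_def L2_norm_emb[OF H1_wdr(1)[OF assms]])
  then show ?thesis
    by (simp add: H1_norm_def L2_norm_emb[OF H1_L2[OF assms]] sum_Basis_axis wdr_def)
qed

lemma H1_diff:
  assumes "u \<in> H1 \<Omega>" "v \<in> H1 \<Omega>" shows "(\<lambda>x. u x - v x) \<in> H1 \<Omega>" "GR (\<lambda>x. u x - v x) = GR u - GR v"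
proof -
  note L = H1_L2[OF assms(1)] H1_L2[OF assms(2)]
  have w: "wd i (emb (\<lambda>x. u x - v x)) ((GR u - GR v) $ i)" for i
    using H1_wdr(2)[OF assms(1), of i] H1_wdr(2)[OF assms(2), of i]
    by (simp add: emb_diff[OF L] GR_def wd_def inner_diff_left)
  have s: "(GR u - GR v) $ i \<in> Supp" for i
    using emb_Supp[OF H1_wdr(1)[OF assms(1)]] emb_Supp[OF H1_wdr(1)[OF assms(2)]] by (simp add: GR_def Supp_diff)
  show "(\<lambda>x. u x - v x) \<in> H1 \<Omega>" "GR (\<lambda>x. u x - v x) = GR u - GR v"
    using GR_unique[OF L2_diff[OF L] w s] by auto
qed

lemma test_H1: assumes \<psi>: "\<psi> \<in> test_functions \<Omega>" shows "\<psi> \<in> H1 \<Omega>" "GR \<psi> = gtest \<psi>"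
proof -
  have w: "wd i (emb \<psi>) (gtest \<psi> $ i)" for i
    using test_wd[OF \<psi>, of i] by (simp add: test_emb[OF \<psi>] gtest_def)
  have s: "gtest \<psi> $ i \<in> Supp" for i by (simp add: gtest_def test_Supp[OF pd_test[OF \<psi>]])
  show "\<psi> \<in> H1 \<Omega>" "GR \<psi> = gtest \<psi>" using GR_unique[OF test_L2[OF \<psi>] w s] by auto
qed

lemma norms_le_sqrt: "norm x \<le> sqrt ((norm x)\<^sup>2 + (norm y)\<^sup>2)" "norm y \<le> sqrt ((norm x)\<^sup>2 + (norm y)\<^sup>2)"
  by (rule real_le_rsqrt, simp)+

text \<open>Approximation by test functions in the \<open>H1\<close> norm is convergence in the
  graph of the gradient, so the closure defining \<open>H10\<close> is the one defining
  \<open>graph\<close>. \<open>H10_intro\<close> is the converse.\<close>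

lemma H10_imp: assumes u: "u \<in> H10 \<Omega>" shows "u \<in> H1 \<Omega>" "emb u \<in> D" "GR u = gr (emb u)"
proof -
  show H: "u \<in> H1 \<Omega>" using u by (simp add: H10_def)
  have "\<exists>\<psi>\<in>test_functions \<Omega>. H1_norm \<Omega> (\<lambda>x. u x - \<psi> x) < 1 / real (Suc n)" for n
    using u by (auto simp: H10_def)
  then obtain \<psi> where \<psi>: "\<And>n. \<psi> n \<in> test_functions \<Omega>" "\<And>n. H1_norm \<Omega> (\<lambda>x. u x - \<psi> n x) < 1 / real (Suc n)" by metis
  have N: "H1_norm \<Omega> (\<lambda>x. u x - \<psi> n x) = sqrt ((norm (emb u - cls (\<psi> n)))\<^sup>2 + (norm (GR u - gtest (\<psi> n)))\<^sup>2)" for n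
    using H1_norm_eq[OF H1_diff(1)[OF H test_H1(1)[OF \<psi>(1)]], of n]
    by (simp add: H1_diff(2)[OF H test_H1(1)[OF \<psi>(1)]] test_H1(2)[OF \<psi>(1)] emb_diff[OF H1_L2[OF H] test_L2[OF \<psi>(1)]] test_emb[OF \<psi>(1)])
  have lim: "(\<lambda>n. 1 / real (Suc n)) \<longlonglongrightarrow> 0" by (rule LIMSEQ_Suc[OF lim_1_over_n])
  have "(\<lambda>n. cls (\<psi> n) - emb u) \<longlonglongrightarrow> 0"
  proof (rule Lim_null_comparison[OF always_eventually lim], rule allI)
    show "norm (cls (\<psi> n) - emb u) \<le> 1 / real (Suc n)" for n
      using \<psi>(2)[of n] norms_le_sqrt(1)[of "emb u - cls (\<psi> n)" "GR u - gtest (\<psi> n)"] unfolding N norm_minus_commute[of "cls (\<psi> n)"] by linarith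
  qed
  moreover have "(\<lambda>n. gtest (\<psi> n) - GR u) \<longlonglongrightarrow> 0"
  proof (rule Lim_null_comparison[OF always_eventually lim], rule allI)
    show "norm (gtest (\<psi> n) - GR u) \<le> 1 / real (Suc n)" for n
      using \<psi>(2)[of n] norms_le_sqrt(2)[where x="emb u - cls (\<psi> n)" and y="GR u - gtest (\<psi> n)"] unfolding N norm_minus_commute[of "gtest (\<psi> n)"] by linarith
  qed
  ultimately have g: "(\<lambda>n. cls (\<psi> n)) \<longlonglongrightarrow> emb u \<and> (\<lambda>n. gtest (\<psi> n)) \<longlonglongrightarrow> GR u"
    using LIM_zero_cancel[of "\<lambda>n. cls (\<psi> n)" "emb u"] LIM_zero_cancel[of "\<lambda>n. gtest (\<psi> n)" "GR u"] by simp
  have "\<forall>n. \<psi> n \<in> test_functions \<Omega>" using \<psi>(1) by simp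
  then have "(emb u, GR u) \<in> graph" using g by (intro iffD2[OF graph_iff] exI[of _ \<psi>]) simp
  then show "emb u \<in> D" "GR u = gr (emb u)" by (rule graph_D, rule gr_eqI[symmetric])
qed

lemma H10_intro: assumes u: "u \<in> L2 \<Omega>" and D: "emb u \<in> D" shows "u \<in> H10 \<Omega>"
proof -
  have g: "(emb u, gr (emb u)) \<in> graph" using D by (simp add: D_graph)
  note H = GR_unique[OF u graph_props(3)[OF g] graph_props(2)[OF g]]
  obtain \<psi> where \<psi>: "\<And>n. \<psi> n \<in> test_functions \<Omega>" "(\<lambda>n. cls (\<psi> n)) \<longlonglongrightarrow> emb u" "(\<lambda>n. gtest (\<psi> n)) \<longlonglongrightarrow> gr (emb u)"
    using D_approx_test[OF D] by metis
  have N: "H1_norm \<Omega> (\<lambda>x. u x - \<psi> n x) = sqrt ((norm (emb u - cls (\<psi> n)))\<^sup>2 + (norm (gr (emb u) - gtest (\<psi> n)))\<^sup>2)" for n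
    using H1_norm_eq[OF H1_diff(1)[OF H(1) test_H1(1)[OF \<psi>(1)]], of n]
    by (simp add: H1_diff(2)[OF H(1) test_H1(1)[OF \<psi>(1)]] H(2) test_H1(2)[OF \<psi>(1)] emb_diff[OF u test_L2[OF \<psi>(1)]] test_emb[OF \<psi>(1)])
  have "(\<lambda>n. sqrt ((norm (emb u - cls (\<psi> n)))\<^sup>2 + (norm (gr (emb u) - gtest (\<psi> n)))\<^sup>2)) \<longlonglongrightarrow>
      sqrt ((norm (emb u - emb u))\<^sup>2 + (norm (gr (emb u) - gr (emb u)))\<^sup>2)"
    by (intro tendsto_intros \<psi>)
  then have lim: "(\<lambda>n. H1_norm \<Omega> (\<lambda>x. u x - \<psi> n x)) \<longlonglongrightarrow> 0" by (simp add: N)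
  have "\<exists>\<psi>\<in>test_functions \<Omega>. H1_norm \<Omega> (\<lambda>x. u x - \<psi> x) < \<epsilon>" if "\<epsilon> > 0" for \<epsilon>
  proof -
    from order_tendstoD(2)[OF lim that] obtain n where "H1_norm \<Omega> (\<lambda>x. u x - \<psi> n x) < \<epsilon>"
      by (auto simp: eventually_sequentially)
    then show ?thesis using \<psi>(1) by blast
  qed
  then show ?thesis using H(1) by (simp add: H10_def)
qed

lemma H10_L2: "u \<in> H10 \<Omega> \<Longrightarrow> u \<in> L2 \<Omega>" using H10_imp(1) H1_L2 by blast

lemma H10_norm: "u \<in> H10 \<Omega> \<Longrightarrow> H1_norm \<Omega> u = Vn (emb u)"
  using H1_norm_eq[OF H10_imp(1)] H10_imp(3) by (simp add: Vn_def)

lemma emb_repr: "x \<in> D \<Longrightarrow> emb (repr x) = x" using D_Supp by (auto simp: Supp_def)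

lemma repr_H10: "x \<in> D \<Longrightarrow> repr x \<in> H10 \<Omega>" by (rule H10_intro[OF repr_L2]) (simp add: emb_repr)

lemma emb_cmult: assumes u: "u \<in> L2 \<Omega>" shows "emb (\<lambda>x. c * u x) = Re c *\<^sub>R emb u + Im c *\<^sub>R Ii (emb u)"
proof -
  note s = L2_ext[OF u] and si = sq_integrable_cmult[OF L2_ext[OF u], of \<i>]
  have "Re c *\<^sub>R emb u + Im c *\<^sub>R Ii (emb u) = cls (\<lambda>t. Re c *\<^sub>R ext u t + Im c *\<^sub>R (\<i> * ext u t))"
    unfolding emb_def Ii_cls[OF s]
    by (simp only: cls_add[OF sq_integrable_scaleR[OF s] sq_integrable_scaleR[OF si]] cls_scaleR[OF s s] cls_scaleR[OF si si])
  also have "(\<lambda>t. Re c *\<^sub>R ext u t + Im c *\<^sub>R (\<i> * ext u t)) = ext (\<lambda>x. c * u x)"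
    by (auto simp: ext_def complex_eq_iff)
  finally show ?thesis by (simp add: emb_def)
qed

lemma cj_D: "x \<in> D \<Longrightarrow> cj x \<in> D" "x \<in> D \<Longrightarrow> gr (cj x) = (\<chi> i. cj (gr x $ i))"
  using graph_D[OF graph_cj] gr_eqI[OF graph_cj] D_graph[THEN iffD1] by blast+

lemma Ii_D: "x \<in> D \<Longrightarrow> gr (Ii x) = (\<chi> i. Ii (gr x $ i))"
  by (rule gr_eqI[OF graph_Ii[OF D_graph[THEN iffD1]]])

lemma norm_vec_map: assumes "\<And>x y. inner (T x) (T y) = inner x y" shows "norm (\<chi> i. T (y $ i)) = norm y"
  by (simp add: norm_eq_sqrt_inner inner_vec assms)

lemma Vn_isometries: assumes "x \<in> D" shows "Vn (cj x) = Vn x" "Vn (Ii x) = Vn x"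
  using assms by (simp_all add: Vn_def cj_D Ii_D norm_vec_map cj_inner Ii_inner norm_cj norm_I)

lemma norm_le_Vn: "norm x \<le> Vn x" "norm (gr x) \<le> Vn x"
  unfolding Vn_def by (rule norms_le_sqrt)+

section \<open>Functionals in \<open>Hm1\<close>\<close>

definition bounded_form :: "real \<Rightarrow> ((real ^ 'n) l2 \<Rightarrow> real) \<Rightarrow> bool" where
  "bounded_form C \<Phi> \<longleftrightarrow> (\<forall>x\<in>D. \<forall>y\<in>D. \<Phi> (x + y) = \<Phi> x + \<Phi> y) \<and> (\<forall>c. \<forall>x\<in>D. \<Phi> (c *\<^sub>R x) = c * \<Phi> x) \<and>
     (\<forall>x\<in>D. \<bar>\<Phi> x\<bar> \<le> C * Vn x)"

text \<open>Real and imaginary parts are bounded separately, hence the factor 2; conjugation and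
  multiplication by \<i> preserve \<open>Vn\<close>.\<close>

lemma cx_bound: assumes "bounded_form C \<Phi>" "v \<in> H10 \<Omega>" shows "cmod (cx \<Phi> (emb v)) \<le> 2 * C * H1_norm \<Omega> v"
proof -
  note D = H10_imp(2)[OF assms(2)]
  have "cmod (cx \<Phi> (emb v)) \<le> \<bar>\<Phi> (cj (emb v))\<bar> + \<bar>\<Phi> (Ii (cj (emb v)))\<bar>"
    using cmod_le[of "cx \<Phi> (emb v)"] by (simp add: cx_def)
  also have "\<dots> \<le> C * Vn (cj (emb v)) + C * Vn (Ii (cj (emb v)))"
    using assms(1) cj_D(1)[OF D] I_D[OF cj_D(1)[OF D]] by (intro add_mono) (auto simp: bounded_form_def)
  also have "\<dots> = 2 * C * H1_norm \<Omega> v"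
    by (simp add: Vn_isometries[OF D] Vn_isometries[OF cj_D(1)[OF D]] H10_norm[OF assms(2)])
  finally show ?thesis .
qed

lemma zero_H10: "(\<lambda>x. 0) \<in> H10 \<Omega>"
proof -
  have "emb (\<lambda>x. 0) = 0" using test_emb[OF test_functions_zero] by (simp add: cls_zero)
  then show ?thesis using H10_intro[OF test_L2[OF test_functions_zero]] D_0 by simp
qed

lemma Vn_0: "Vn 0 = 0" by (simp add: Vn_def grad_0)

lemma H1_norm_zero: "H1_norm \<Omega> (\<lambda>x. 0) = 0"
  using H10_norm[OF zero_H10] test_emb[OF test_functions_zero] by (simp add: cls_zero Vn_0)

lemma cx_Hm1: assumes b: "bounded_form C \<Phi>" and F: "\<And>v. v \<in> H10 \<Omega> \<Longrightarrow> F v = cx \<Phi> (emb v)" shows "F \<in> Hm1 \<Omega>"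
  unfolding Hm1_def mem_Collect_eq
proof (intro conjI ballI allI)
  note lin = linear_add[OF cj_linear] linear_scale[OF cj_linear] I_add I_scaleR
  fix v assume v: "v \<in> H10 \<Omega>"
  note vD = H10_imp(2)[OF v] and vL = H10_L2[OF v]
  let ?W = "cj (emb v)"
  have W: "?W \<in> D" "Ii ?W \<in> D" using cj_D(1)[OF vD] I_D by auto
  {
    fix w assume w: "w \<in> H10 \<Omega>"
    have e: "emb (\<lambda>x. v x + w x) = emb v + emb w" by (rule emb_add[OF vL H10_L2[OF w]])
    have "(\<lambda>x. v x + w x) \<in> H10 \<Omega>"
      by (rule H10_intro[OF L2_add[OF vL H10_L2[OF w]]]) (simp add: e D_add vD H10_imp(2)[OF w])
    then show "F (\<lambda>x. v x + w x) = F v + F w"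
      using b W cj_D(1)[OF H10_imp(2)[OF w]] I_D
      by (simp add: F v w e cx_def lin bounded_form_def complex_eq_iff)
  }
  fix c
  have e: "emb (\<lambda>x. c * v x) = Re c *\<^sub>R emb v + Im c *\<^sub>R Ii (emb v)" by (rule emb_cmult[OF vL])
  have H: "(\<lambda>x. c * v x) \<in> H10 \<Omega>"
    by (rule H10_intro[OF L2_cmult[OF vL]]) (simp add: e D_add D_scaleR vD I_D)
  \<comment> \<open>Conjugation turns \<open>c\<close> into its conjugate; with this sign
    \<open>cx \<Phi>\<close> becomes complex linear and not antilinear.\<close>
  have 1: "cj (emb (\<lambda>x. c * v x)) = Re c *\<^sub>R ?W + (- Im c) *\<^sub>R Ii ?W" by (simp add: e lin cj_Ii)
  have 2: "Ii (cj (emb (\<lambda>x. c * v x))) = Re c *\<^sub>R Ii ?W + Im c *\<^sub>R ?W" 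
    unfolding 1 by (simp only: lin I_I) simp
  have "\<Phi> (Re c *\<^sub>R ?W + (- Im c) *\<^sub>R Ii ?W) = Re c * \<Phi> ?W + (- Im c) * \<Phi> (Ii ?W)"
    "\<Phi> (Re c *\<^sub>R Ii ?W + Im c *\<^sub>R ?W) = Re c * \<Phi> (Ii ?W) + Im c * \<Phi> ?W"
    using b W D_scaleR by (simp_all only: bounded_form_def)
  then show "F (\<lambda>x. c * v x) = c * F v"
    unfolding F[OF H] F[OF v] cx_def 1[symmetric] 2[symmetric] by (simp add: complex_eq_iff)
next
  show "\<exists>C. \<forall>v\<in>H10 \<Omega>. cmod (F v) \<le> C * H1_norm \<Omega> v"
    using cx_bound[OF b] F by (intro exI[of _ "2 * C"]) simp
qed

lemma Hm1_norm_le: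
  assumes C: "C \<ge> 0" and "\<And>v. v \<in> H10 \<Omega> \<Longrightarrow> cmod (F v) \<le> C * H1_norm \<Omega> v" shows "Hm1_norm \<Omega> F \<le> C"
  unfolding Hm1_norm_def
proof (rule cSUP_least)
  show "{v \<in> H10 \<Omega>. H1_norm \<Omega> v \<le> 1} \<noteq> {}" using zero_H10 H1_norm_zero by auto
  fix v assume v: "v \<in> {v \<in> H10 \<Omega>. H1_norm \<Omega> v \<le> 1}"
  then have "cmod (F v) \<le> C * H1_norm \<Omega> v" using assms(2) by simp
  also have "\<dots> \<le> C * 1" using v C by (intro mult_left_mono) auto
  finally show "cmod (F v) \<le> C" by simp
qed

lemma Hm1_bdd: assumes "F \<in> Hm1 \<Omega>" shows "bdd_above ((\<lambda>v. cmod (F v)) ` {v \<in> H10 \<Omega>. H1_norm \<Omega> v \<le> 1})"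
proof -
  obtain C where C: "\<And>v. v \<in> H10 \<Omega> \<Longrightarrow> cmod (F v) \<le> C * H1_norm \<Omega> v" using assms unfolding Hm1_def by clarsimp meson
  show ?thesis
  proof (rule bdd_aboveI2)
    fix v assume v: "v \<in> {v \<in> H10 \<Omega>. H1_norm \<Omega> v \<le> 1}"
    have n0: "0 \<le> H1_norm \<Omega> v" using v by (simp add: H10_norm Vn_def)
    have "cmod (F v) \<le> C * H1_norm \<Omega> v" using C v by simp
    also have "\<dots> \<le> \<bar>C\<bar> * 1" using v n0 by (intro mult_mono) auto
    finally show "cmod (F v) \<le> \<bar>C\<bar>" by simp
  qed
qed

lemma Hm1_norm_nonneg: assumes "F \<in> Hm1 \<Omega>" shows "0 \<le> Hm1_norm \<Omega> F"
proof -
  have "cmod (F (\<lambda>x. 0)) \<le> Hm1_norm \<Omega> F"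
    unfolding Hm1_norm_def by (rule cSUP_upper[OF _ Hm1_bdd[OF assms]]) (simp add: zero_H10 H1_norm_zero)
  then show ?thesis by (rule order_trans[OF norm_ge_zero])
qed

lemma Hm1_apply: assumes F: "F \<in> Hm1 \<Omega>" and v: "v \<in> H10 \<Omega>" shows "cmod (F v) \<le> Hm1_norm \<Omega> F * H1_norm \<Omega> v"
proof (cases "H1_norm \<Omega> v = 0")
  case True
  obtain C where "cmod (F v) \<le> C * H1_norm \<Omega> v" using F v by (auto simp: Hm1_def)
  then show ?thesis by (simp add: True)
next
  case False
  define n where "n = H1_norm \<Omega> v"
  have n: "n > 0" using False v by (simp add: n_def H10_norm Vn_def less_le)
  let ?w = "\<lambda>x. of_real (1 / n) * v x"
  note vD = H10_imp(2)[OF v] and vL = H10_L2[OF v]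
  have e: "emb ?w = (1 / n) *\<^sub>R emb v" using emb_cmult[OF vL, of "of_real (1 / n)"] by simp
  have H: "?w \<in> H10 \<Omega>" by (rule H10_intro[OF L2_cmult[OF vL]]) (simp only: e D_scaleR vD)
  have "Vn ((1 / n) *\<^sub>R emb v) = sqrt ((1 / n)\<^sup>2 * ((norm (emb v))\<^sup>2 + (norm (gr (emb v)))\<^sup>2))"
    unfolding Vn_def grad_scaleR[OF vD] by (simp add: power_divide add_divide_distrib)
  also have "\<dots> = (1 / n) * Vn (emb v)" using n by (simp add: real_sqrt_mult Vn_def)
  also have "\<dots> = 1" using n by (simp add: n_def H10_norm[OF v, symmetric])
  finally have "H1_norm \<Omega> ?w \<le> 1" using H10_norm[OF H] unfolding e by simp
  then have "cmod (F ?w) \<le> Hm1_norm \<Omega> F"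
    unfolding Hm1_norm_def by (intro cSUP_upper[OF _ Hm1_bdd[OF F]]) (use H in blast)
  moreover have "F ?w = of_real (1 / n) * F v" using F v by (simp only: Hm1_def mem_Collect_eq)
  ultimately have "(1 / n) * cmod (F v) \<le> Hm1_norm \<Omega> F" using n by (simp add: norm_mult norm_divide)
  then show ?thesis using n by (simp add: n_def[symmetric] pos_divide_le_eq)
qed

lemma Hm1_combination:
  assumes "F \<in> Hm1 \<Omega>" "G \<in> Hm1 \<Omega>" "K \<in> Hm1 \<Omega>" shows "(\<lambda>v. (F v - G v) / c - K v) \<in> Hm1 \<Omega>"
proof -
  obtain CF CG CK where C: "\<And>v. v \<in> H10 \<Omega> \<Longrightarrow> cmod (F v) \<le> CF * H1_norm \<Omega> v"
    "\<And>v. v \<in> H10 \<Omega> \<Longrightarrow> cmod (G v) \<le> CG * H1_norm \<Omega> v" "\<And>v. v \<in> H10 \<Omega> \<Longrightarrow> cmod (K v) \<le> CK * H1_norm \<Omega> v"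
    using assms unfolding Hm1_def by clarsimp meson
  have "cmod ((F v - G v) / c - K v) \<le> ((CF + CG) / cmod c + CK) * H1_norm \<Omega> v" if v: "v \<in> H10 \<Omega>" for v
  proof -
    have "cmod ((F v - G v) / c - K v) \<le> cmod (F v - G v) / cmod c + cmod (K v)"
      using norm_triangle_ineq4[of "(F v - G v) / c" "K v"] by (simp add: norm_divide)
    also have "\<dots> \<le> (CF * H1_norm \<Omega> v + CG * H1_norm \<Omega> v) / cmod c + CK * H1_norm \<Omega> v"
      using norm_triangle_ineq4[of "F v" "G v"] C(1)[OF v] C(2)[OF v] C(3)[OF v] by (intro add_mono divide_right_mono) auto
    finally show ?thesis by (simp add: algebra_simps add_divide_distrib)
  qed
  moreover have "(F (\<lambda>x. v x + w x) - G (\<lambda>x. v x + w x)) / c - K (\<lambda>x. v x + w x) = ((F v - G v) / c - K v) + ((F w - G w) / c - K w)"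
    if "v \<in> H10 \<Omega>" "w \<in> H10 \<Omega>" for v w
    using assms that by (simp add: Hm1_def add_divide_distrib diff_divide_distrib)
  moreover have "(F (\<lambda>x. d * v x) - G (\<lambda>x. d * v x)) / c - K (\<lambda>x. d * v x) = d * ((F v - G v) / c - K v)" if "v \<in> H10 \<Omega>" for v d
    using assms that by (simp add: Hm1_def right_diff_distrib diff_divide_distrib)
  ultimately show ?thesis unfolding Hm1_def by blast
qed

lemma integral_mult_cx:
  assumes f: "f \<in> L2 \<Omega>" and g: "g \<in> L2 \<Omega>"
  shows "(LINT x|lebesgue_on \<Omega>. f x * g x) = cx (inner (emb f)) (emb g)"
proof (rule complex_eq_by_Re)
  show "Re (LINT x|lebesgue_on \<Omega>. f x * g x) = Re (cx (inner (emb f)) (emb g))"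
    by (simp add: Re_integral_mult[OF f g] cx_def)
  have "\<i> * (LINT x|lebesgue_on \<Omega>. f x * g x) = (LINT x|lebesgue_on \<Omega>. f x * (\<i> * g x))" by (simp add: mult.left_commute)
  then have "Re (\<i> * (LINT x|lebesgue_on \<Omega>. f x * g x)) = inner (emb f) (cj (Ii (emb g)))"
    by (simp only: Re_integral_mult[OF f L2_cmult[OF g]] emb_i[OF g])
  then show "Re (\<i> * (LINT x|lebesgue_on \<Omega>. f x * g x)) = Re (\<i> * cx (inner (emb f)) (emb g))"
    by (simp add: cx_def cj_Ii)
qed

lemma Hm1_of_cx: "f \<in> L2 \<Omega> \<Longrightarrow> v \<in> H10 \<Omega> \<Longrightarrow> Hm1_of \<Omega> f v = cx (inner (emb f)) (emb v)"
  unfolding Hm1_of_def by (rule integral_mult_cx[OF _ H10_L2])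

lemma laplacian_cx:
  assumes u: "u \<in> H10 \<Omega>" and v: "v \<in> H10 \<Omega>"
  shows "laplacian \<Omega> u v = cx (\<lambda>W. - inner (gr (emb u)) (gr W)) (emb v)"
proof -
  note u' = H10_imp[OF u] and v' = H10_imp[OF v]
  have e: "emb (wdr i u) = gr (emb u) $ i" "emb (wdr i v) = gr (emb v) $ i" for i
    by (simp_all add: u'(3)[symmetric] v'(3)[symmetric] GR_def)
  have "laplacian \<Omega> u v = - (\<Sum>i\<in>UNIV. cx (inner (gr (emb u) $ i)) (gr (emb v) $ i))"
    unfolding laplacian_def sum_Basis_axis wdr_def[symmetric] integral_mult_cx[OF H1_wdr(1)[OF u'(1)] H1_wdr(1)[OF v'(1)]] e ..
  also have "\<dots> = cx (\<lambda>W. - inner (gr (emb u)) (gr W)) (emb v)"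
    by (simp add: complex_eq_iff cx_def inner_vec cj_D[OF v'(2)] Ii_D[OF cj_D(1)[OF v'(2)]])
  finally show ?thesis .
qed

end

section \<open>Equivalence of the weak and the \<open>Hm1\<close> formulation\<close>

context sobolev_domain begin

lemma emb_compose:
  assumes a: "quasi_lipschitz a" and u: "u \<in> L2 \<Omega>"
  shows "(\<lambda>x. a (u x)) \<in> L2 \<Omega>" "emb (\<lambda>x. a (u x)) = nem a (emb u)"
proof -
  have e: "ext (\<lambda>x. a (ext u x)) = ext (\<lambda>x. a (u x))" by (auto simp: ext_def)
  show "(\<lambda>x. a (u x)) \<in> L2 \<Omega>" using nemf_sq[OF a L2_ext[OF u]] by (simp add: L2_iff e)
  show "emb (\<lambda>x. a (u x)) = nem a (emb u)" using nem_cls[OF a L2_ext[OF u]] by (simp add: emb_def nemf_def e)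
qed

lemma bounded_form_inner: "bounded_form (norm x) (inner x)"
  unfolding bounded_form_def
proof (intro conjI ballI allI)
  fix W
  have "\<bar>inner x W\<bar> \<le> norm x * norm W" by (rule Cauchy_Schwarz_ineq2)
  also have "\<dots> \<le> norm x * Vn W" by (intro mult_left_mono norm_le_Vn) simp
  finally show "\<bar>inner x W\<bar> \<le> norm x * Vn W" .
qed (simp_all add: inner_add_right)

text \<open>The functional i Laplacian u - g(u) in real form, with \<open>p\<close> in place of the
  gradient of u and \<open>y\<close> in place of g(u). Keeping them as free arguments makes
  differences of velocities again of this form.\<close>

definition vel :: "(real ^ 'n) l2 ^ 'n \<Rightarrow> (real ^ 'n) l2 \<Rightarrow> (real ^ 'n) l2 \<Rightarrow> real" where
  "vel p y W = inner p (gr (Ii W)) - inner y W"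

lemma bounded_form_vel: "bounded_form (norm p + norm y) (vel p y)"
  unfolding bounded_form_def
proof (intro conjI ballI allI)
  fix W assume W: "W \<in> D"
  have "\<bar>inner p (gr (Ii W))\<bar> \<le> norm p * norm (gr (Ii W))" by (rule Cauchy_Schwarz_ineq2)
  also have "\<dots> \<le> norm p * Vn (Ii W)" by (intro mult_left_mono norm_le_Vn) simp
  finally have 1: "\<bar>inner p (gr (Ii W))\<bar> \<le> norm p * Vn W" by (simp add: Vn_isometries[OF W])
  have "\<bar>inner y W\<bar> \<le> norm y * norm W" by (rule Cauchy_Schwarz_ineq2)
  also have "\<dots> \<le> norm y * Vn W" by (intro mult_left_mono norm_le_Vn) simp
  finally show "\<bar>vel p y W\<bar> \<le> (norm p + norm y) * Vn W" using 1 by (simp add: vel_def distrib_right)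
  show "vel p y (c *\<^sub>R W) = c * vel p y W" for c
    by (simp add: vel_def I_scaleR grad_scaleR I_D W right_diff_distrib)
  show "vel p y (W + W') = vel p y W + vel p y W'" if "W' \<in> D" for W'
    by (simp add: vel_def I_add grad_add I_D W that inner_add_right)
qed

lemma cx_diff: "cx \<Phi> V - cx \<Psi> V = cx (\<lambda>W. \<Phi> W - \<Psi> W) V"
  by (simp add: cx_def complex_eq_iff)

lemma vel_diff: "vel p y W - vel p' y' W = vel (p - p') (y - y') W"
  by (simp add: vel_def inner_diff_left)

lemma cx_norm:
  assumes b: "bounded_form C \<Phi>" and C: "C \<ge> 0" and F: "\<And>v. v \<in> H10 \<Omega> \<Longrightarrow> F v = cx \<Phi> (emb v)"
  shows "0 \<le> Hm1_norm \<Omega> F" "Hm1_norm \<Omega> F \<le> 2 * C"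
proof -
  show "0 \<le> Hm1_norm \<Omega> F" by (rule Hm1_norm_nonneg[OF cx_Hm1[OF b F]])
  show "Hm1_norm \<Omega> F \<le> 2 * C" by (rule Hm1_norm_le) (use C cx_bound[OF b] F in auto)
qed

text \<open>\<open>weak_solution\<close> for the concrete nonlinearity, stated apart from
  \<open>damped_form\<close>: that locale carries approximations and constants which
  \<open>damped_form_damping\<close> provides only existentially.\<close>

definition wsol :: "real \<Rightarrow> (real \<Rightarrow> (real ^ 'n) l2) \<Rightarrow> bool" where
  "wsol \<alpha> u \<longleftrightarrow> (\<forall>t\<ge>0. u t \<in> D) \<and> continuous_on {0..} u \<and> continuous_on {0..} (\<lambda>t. gr (u t)) \<and>
    (\<forall>v\<in>D. \<forall>s\<ge>0. \<forall>t\<ge>s. inner (u t - u s) v =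
       integral {s..t} (\<lambda>r. inner (gr (u r)) (gr (Ii v)) - inner (nem (damping \<alpha>) (u r)) v))"

lemma eventually_nonneg: "\<forall>\<^sub>F s in at t within {0..}. (0::real) \<le> s"
  by (simp add: eventually_at_filter)

lemma H10_repr_diff:
  assumes "x \<in> D" "y \<in> D"
  shows "H1_norm \<Omega> (\<lambda>t. repr x t - repr y t) = Vn (x - y)"
proof -
  have e: "emb (\<lambda>t. repr x t - repr y t) = x - y"
    by (simp add: emb_diff[OF repr_L2 repr_L2] emb_repr assms)
  have "(\<lambda>t. repr x t - repr y t) \<in> H10 \<Omega>"
    by (rule H10_intro[OF L2_diff[OF repr_L2 repr_L2]]) (simp add: e D_diff assms)
  from H10_norm[OF this] show ?thesis by (simp add: e)
qed

text \<open>The increment is the time integral of \<open>vel\<close>, and its deviation from the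
  value at \<open>t0\<close> is controlled by \<open>\<eta>\<close>. The bound is proportional to
  \<open>Vn W\<close>, so it is uniform over the unit ball and amounts to an estimate in the dual
  norm.\<close>

lemma difference_quotient_bound:
  assumes u: "wsol \<alpha> u" and q: "quasi_lipschitz (damping \<alpha>)" and W: "W \<in> D" and s: "0 \<le> s" "s < t"
    and t0: "p = gr (u t0)" "y = nem (damping \<alpha>) (u t0)"
    and near: "\<And>r. s \<le> r \<Longrightarrow> r \<le> t \<Longrightarrow> norm (gr (u r) - p) + norm (nem (damping \<alpha>) (u r) - y) \<le> \<eta>"
  shows "\<bar>(inner (u t) W - inner (u s) W) / (t - s) - vel p y W\<bar> \<le> \<eta> * Vn W"
proof -
  let ?f = "\<lambda>r. vel (gr (u r)) (nem (damping \<alpha>) (u r)) W"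
  have sub: "{s..t} \<subseteq> {0..}" using s by auto
  have cu: "continuous_on {s..t} u" "continuous_on {s..t} (\<lambda>r. gr (u r))"
    using u continuous_on_subset[OF _ sub] unfolding wsol_def by blast+
  have cg: "continuous_on {s..t} (\<lambda>r. nem (damping \<alpha>) (u r))"
    by (rule continuous_on_compose2[OF nem_continuous[OF q] cu(1)]) simp
  have i: "?f integrable_on {s..t}"
    unfolding vel_def by (intro integrable_continuous_interval continuous_intros cu cg)
  have "inner (u t) W - inner (u s) W = integral {s..t} ?f"
    using u W s unfolding wsol_def vel_def by (simp add: inner_diff_left)
  moreover have "integral {s..t} (\<lambda>r. vel p y W) = (t - s) * vel p y W" using s by simp
  ultimately have eq: "inner (u t) W - inner (u s) W - (t - s) * vel p y W = integral {s..t} (\<lambda>r. ?f r - vel p y W)"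
    using integral_diff[OF i integrable_const_ivl[of "vel p y W" s t]] s by simp
  have "norm (integral {s..t} (\<lambda>r. ?f r - vel p y W)) \<le> integral {s..t} (\<lambda>r. \<eta> * Vn W)"
  proof (rule integral_norm_bound_integral)
    show "(\<lambda>r. ?f r - vel p y W) integrable_on {s..t}" by (intro integrable_diff i integrable_const_ivl)
    show "(\<lambda>r. \<eta> * Vn W) integrable_on {s..t}" by (rule integrable_const_ivl)
    fix r assume r: "r \<in> {s..t}"
    have "\<bar>?f r - vel p y W\<bar> \<le> (norm (gr (u r) - p) + norm (nem (damping \<alpha>) (u r) - y)) * Vn W"
      unfolding vel_diff using bounded_form_vel W by (simp add: bounded_form_def)
    also have "\<dots> \<le> \<eta> * Vn W" using near r by (intro mult_right_mono) (auto simp: Vn_def)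
    finally show "norm (?f r - vel p y W) \<le> \<eta> * Vn W" by simp
  qed
  also have "\<dots> = (t - s) * (\<eta> * Vn W)" using s by simp
  finally have "\<bar>inner (u t) W - inner (u s) W - (t - s) * vel p y W\<bar> \<le> (t - s) * (\<eta> * Vn W)" by (simp add: eq)
  moreover have "(inner (u t) W - inner (u s) W) / (t - s) - vel p y W = (inner (u t) W - inner (u s) W - (t - s) * vel p y W) / (t - s)"
    using s by (simp add: diff_divide_distrib)
  ultimately show ?thesis using s by (simp add: abs_divide pos_divide_le_eq mult.commute)
qed

lemma wsol_global_solution:
  assumes q: "quasi_lipschitz (damping \<alpha>)" and u: "wsol \<alpha> u" and phi: "\<phi> \<in> L2 \<Omega>" "u 0 = emb \<phi>"
  shows "global_solution \<Omega> \<alpha> \<phi> (\<lambda>t. repr (u t))"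
proof -
  let ?g = "\<lambda>t. nem (damping \<alpha>) (u t)" and ?v = "\<lambda>t. repr (u t)"
  have D: "u t \<in> D" if "t \<ge> 0" for t using u that by (simp add: wsol_def)
  have er: "emb (?v t) = u t" if "t \<ge> 0" for t by (rule emb_repr[OF D[OF that]])
  have tu: "(u \<longlongrightarrow> u t) (at t within {0..})" "((\<lambda>s. gr (u s)) \<longlongrightarrow> gr (u t)) (at t within {0..})" if "t \<ge> 0" for t
    using u that by (auto simp: wsol_def continuous_on_def)
  have tg: "(?g \<longlongrightarrow> ?g t) (at t within {0..})" if "t \<ge> 0" for t
    using continuous_on_tendsto_compose[OF nem_continuous[OF q] tu(1)[OF that]] by simp
  have CH: "C_H10 \<Omega> ?v"
    unfolding C_H10_def
  proof (intro conjI allI impI)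
    show "?v t \<in> H10 \<Omega>" if "t \<ge> 0" for t by (rule repr_H10[OF D[OF that]])
    fix t :: real assume t: "0 \<le> t"
    have "((\<lambda>s. sqrt ((norm (u s - u t))\<^sup>2 + (norm (gr (u s) - gr (u t)))\<^sup>2)) \<longlongrightarrow>
        sqrt ((norm (u t - u t))\<^sup>2 + (norm (gr (u t) - gr (u t)))\<^sup>2)) (at t within {0..})"
      by (intro tendsto_intros tu t)
    then have "((\<lambda>s. sqrt ((norm (u s - u t))\<^sup>2 + (norm (gr (u s) - gr (u t)))\<^sup>2)) \<longlongrightarrow> 0) (at t within {0..})" by simp
    then show "((\<lambda>s. H1_norm \<Omega> (\<lambda>x. ?v s x - ?v t x)) \<longlongrightarrow> 0) (at t within {0..})"
    proof (rule Lim_transform_eventually)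
      show "\<forall>\<^sub>F s in at t within {0..}. sqrt ((norm (u s - u t))\<^sup>2 + (norm (gr (u s) - gr (u t)))\<^sup>2) = H1_norm \<Omega> (\<lambda>x. ?v s x - ?v t x)"
        using eventually_nonneg by eventually_elim (simp add: H10_repr_diff D t Vn_def grad_diff)
    qed
  qed
  \<comment> \<open>The time derivative dictated by the equation; its continuity in
    \<open>Hm1\<close> follows from that of the gradient and of the nonlinearity along
    \<open>u\<close>.\<close>
  define U' where "U' t v = cx (vel (gr (u t)) (?g t)) (emb v)" for t v
  have U0: "Hm1_of \<Omega> (?v t) v = cx (inner (u t)) (emb v)" if "t \<ge> 0" "v \<in> H10 \<Omega>" for t v
    using Hm1_of_cx[OF repr_L2 that(2)] er[OF that(1)] by simp
  have C0: "C_Hm1 \<Omega> (\<lambda>t. Hm1_of \<Omega> (?v t))"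
    unfolding C_Hm1_def
  proof (intro conjI allI impI)
    show "Hm1_of \<Omega> (?v t) \<in> Hm1 \<Omega>" if "t \<ge> 0" for t by (rule cx_Hm1[OF bounded_form_inner U0[OF that]])
    fix t :: real assume t: "0 \<le> t"
    have *: "0 \<le> Hm1_norm \<Omega> (\<lambda>v. Hm1_of \<Omega> (?v s) v - Hm1_of \<Omega> (?v t) v) \<and>
      Hm1_norm \<Omega> (\<lambda>v. Hm1_of \<Omega> (?v s) v - Hm1_of \<Omega> (?v t) v) \<le> 2 * norm (u s - u t)" if s: "s \<ge> 0" for s
    proof -
      have "(\<lambda>W. inner (u s) W - inner (u t) W) = inner (u s - u t)" by (simp add: fun_eq_iff inner_diff_left)
      then have "Hm1_of \<Omega> (?v s) v - Hm1_of \<Omega> (?v t) v = cx (inner (u s - u t)) (emb v)" if "v \<in> H10 \<Omega>" for v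
        by (simp add: U0 s t that cx_diff)
      from cx_norm[OF bounded_form_inner norm_ge_zero this] show ?thesis by simp
    qed
    show "((\<lambda>s. Hm1_norm \<Omega> (\<lambda>v. Hm1_of \<Omega> (?v s) v - Hm1_of \<Omega> (?v t) v)) \<longlongrightarrow> 0) (at t within {0..})"
    proof (rule tendsto_sandwich[OF _ _ tendsto_const])
      show "\<forall>\<^sub>F s in at t within {0..}. 0 \<le> Hm1_norm \<Omega> (\<lambda>v. Hm1_of \<Omega> (?v s) v - Hm1_of \<Omega> (?v t) v)"
        using eventually_nonneg by eventually_elim (use * in auto)
      show "\<forall>\<^sub>F s in at t within {0..}. Hm1_norm \<Omega> (\<lambda>v. Hm1_of \<Omega> (?v s) v - Hm1_of \<Omega> (?v t) v) \<le> 2 * norm (u s - u t)"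
        using eventually_nonneg by eventually_elim (use * in auto)
      have "((\<lambda>s. 2 * norm (u s - u t)) \<longlongrightarrow> 2 * norm (u t - u t)) (at t within {0..})" by (intro tendsto_intros tu t)
      then show "((\<lambda>s. 2 * norm (u s - u t)) \<longlongrightarrow> 0) (at t within {0..})" by simp
    qed
  qed
  have C1: "C_Hm1 \<Omega> U'"
    unfolding C_Hm1_def
  proof (intro conjI allI impI)
    show "U' t \<in> Hm1 \<Omega>" for t by (rule cx_Hm1[OF bounded_form_vel]) (simp add: U'_def)
    fix t :: real assume t: "0 \<le> t"
    have *: "0 \<le> Hm1_norm \<Omega> (\<lambda>v. U' s v - U' t v) \<and>
      Hm1_norm \<Omega> (\<lambda>v. U' s v - U' t v) \<le> 2 * (norm (gr (u s) - gr (u t)) + norm (?g s - ?g t))" for s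
    proof -
      have "(\<lambda>W. vel (gr (u s)) (?g s) W - vel (gr (u t)) (?g t) W) = vel (gr (u s) - gr (u t)) (?g s - ?g t)"
        by (simp only: vel_diff)
      then have "U' s v - U' t v = cx (vel (gr (u s) - gr (u t)) (?g s - ?g t)) (emb v)" for v
        by (simp add: U'_def cx_diff)
      from cx_norm[OF bounded_form_vel _ this] show ?thesis by simp
    qed
    show "((\<lambda>s. Hm1_norm \<Omega> (\<lambda>v. U' s v - U' t v)) \<longlongrightarrow> 0) (at t within {0..})"
    proof (rule tendsto_sandwich[OF _ _ tendsto_const])
      show "\<forall>\<^sub>F s in at t within {0..}. 0 \<le> Hm1_norm \<Omega> (\<lambda>v. U' s v - U' t v)" using * by simp
      show "\<forall>\<^sub>F s in at t within {0..}. Hm1_norm \<Omega> (\<lambda>v. U' s v - U' t v) \<le> 2 * (norm (gr (u s) - gr (u t)) + norm (?g s - ?g t))"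
        using * by simp
      have "((\<lambda>s. 2 * (norm (gr (u s) - gr (u t)) + norm (?g s - ?g t))) \<longlongrightarrow> 2 * (norm (gr (u t) - gr (u t)) + norm (?g t - ?g t))) (at t within {0..})"
        by (intro tendsto_intros tu tg t)
      then show "((\<lambda>s. 2 * (norm (gr (u s) - gr (u t)) + norm (?g s - ?g t))) \<longlongrightarrow> 0) (at t within {0..})" by simp
    qed
  qed
  have deriv: "((\<lambda>s. Hm1_norm \<Omega> (\<lambda>v. (Hm1_of \<Omega> (?v s) v - Hm1_of \<Omega> (?v t) v) / of_real (s - t) - U' t v)) \<longlongrightarrow> 0) (at t within {0..})"
    if t: "t \<ge> 0" for t
  proof (rule tendstoI)
    fix \<epsilon> :: real assume \<epsilon>: "\<epsilon> > 0"
    \<comment> \<open>A quarter of the tolerance is taken: \<open>cx_norm\<close> doubles it, and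
      the final inequality is strict.\<close>
    let ?k = "\<lambda>r. norm (gr (u r) - gr (u t)) + norm (?g r - ?g t)"
    have "(?k \<longlongrightarrow> norm (gr (u t) - gr (u t)) + norm (?g t - ?g t)) (at t within {0..})"
      by (intro tendsto_intros tu tg t)
    then have "\<forall>\<^sub>F r in at t within {0..}. ?k r < \<epsilon> / 4" using \<epsilon> by (intro order_tendstoD(2)) auto
    then obtain d where d: "d > 0" "\<And>r. r \<in> {0..} \<Longrightarrow> r \<noteq> t \<Longrightarrow> dist r t < d \<Longrightarrow> ?k r < \<epsilon> / 4"
      unfolding eventually_at by blast
    have near: "?k r \<le> \<epsilon> / 4" if "0 \<le> r" "\<bar>r - t\<bar> < d" for r
      using d(2)[of r] that \<epsilon> by (cases "r = t") (auto simp: dist_real_def)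
    show "\<forall>\<^sub>F s in at t within {0..}. dist (Hm1_norm \<Omega> (\<lambda>v. (Hm1_of \<Omega> (?v s) v - Hm1_of \<Omega> (?v t) v) / of_real (s - t) - U' t v)) 0 < \<epsilon>"
      unfolding eventually_at
    proof (intro exI[of _ d] conjI d(1) ballI impI, elim conjE)
      fix s assume s: "s \<in> {0..}" "s \<noteq> t" "dist s t < d"
      define \<Phi> where "\<Phi> W = (inner (u s) W - inner (u t) W) / (s - t) - vel (gr (u t)) (?g t) W" for W
      have bd: "\<bar>\<Phi> W\<bar> \<le> \<epsilon> / 4 * Vn W" if W: "W \<in> D" for W
      \<comment> \<open>The quotient bound is stated for ordered times; for \<open>s < t\<close>
        numerator and denominator both change sign.\<close>
      proof (cases "s < t")
        case True
        have "\<bar>(inner (u t) W - inner (u s) W) / (t - s) - vel (gr (u t)) (?g t) W\<bar> \<le> \<epsilon> / 4 * Vn W"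
          by (rule difference_quotient_bound[OF u q W _ True refl refl])
            (use s True near in \<open>auto simp: dist_real_def\<close>)
        moreover have "(inner (u t) W - inner (u s) W) / (t - s) = (inner (u s) W - inner (u t) W) / (s - t)"
          by (metis minus_diff_eq minus_divide_divide)
        ultimately show ?thesis by (simp add: \<Phi>_def)
      next
        case False
        then have ts: "t < s" using s by simp
        show ?thesis unfolding \<Phi>_def
          by (rule difference_quotient_bound[OF u q W t ts refl refl])
            (use s ts t near in \<open>auto simp: dist_real_def\<close>)
      qed
      have bf: "bounded_form (\<epsilon> / 4) \<Phi>"
        unfolding bounded_form_def
      proof (intro conjI ballI allI bd)
        fix x y assume xy: "x \<in> D" "y \<in> D"
        have "vel (gr (u t)) (?g t) (x + y) = vel (gr (u t)) (?g t) x + vel (gr (u t)) (?g t) y"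
          using bounded_form_vel xy by (simp add: bounded_form_def)
        then show "\<Phi> (x + y) = \<Phi> x + \<Phi> y"
          by (simp add: \<Phi>_def inner_add_right add_divide_distrib diff_divide_distrib)
      next
        fix c x assume x: "x \<in> D"
        have "vel (gr (u t)) (?g t) (c *\<^sub>R x) = c * vel (gr (u t)) (?g t) x"
          using bounded_form_vel x by (simp add: bounded_form_def)
        then show "\<Phi> (c *\<^sub>R x) = c * \<Phi> x"
          by (simp add: \<Phi>_def right_diff_distrib diff_divide_distrib)
      qed
      have "(Hm1_of \<Omega> (?v s) v - Hm1_of \<Omega> (?v t) v) / of_real (s - t) - U' t v = cx \<Phi> (emb v)" if "v \<in> H10 \<Omega>" for v
        using s t that by (simp add: U0 U'_def cx_def \<Phi>_def complex_eq_iff Re_divide_of_real Im_divide_of_real del: of_real_diff)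
      from cx_norm[OF bf _ this] \<epsilon>
      show "dist (Hm1_norm \<Omega> (\<lambda>v. (Hm1_of \<Omega> (?v s) v - Hm1_of \<Omega> (?v t) v) / of_real (s - t) - U' t v)) 0 < \<epsilon>"
        by (simp add: dist_real_def)
    qed
  qed
  have eqn: "\<i> * U' t v + laplacian \<Omega> (?v t) v + \<i> * Hm1_of \<Omega> (\<lambda>x. damping \<alpha> (?v t x)) v = 0"
    if t: "t \<ge> 0" and v: "v \<in> H10 \<Omega>" for t v
  proof -
    let ?W = "cj (emb v)"
    have W: "?W \<in> D" by (rule cj_D(1)[OF H10_imp(2)[OF v]])
    have "Hm1_of \<Omega> (\<lambda>x. damping \<alpha> (?v t x)) v = cx (inner (?g t)) (emb v)"
      using Hm1_of_cx[OF emb_compose(1)[OF q repr_L2] v] emb_compose(2)[OF q repr_L2, of "u t"] er[OF t] by simp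
    then show ?thesis
      using laplacian_cx[OF repr_H10[OF D[OF t]] v] er[OF t]
      by (simp add: U'_def cx_def vel_def complex_eq_iff I_I grad_minus[OF W])
  qed
  have "AE x in lebesgue_on \<Omega>. ?v 0 x = \<phi> x"
    using emb_eq_iff[OF repr_L2 phi(1), of "u 0"] er[of 0] phi(2) by simp
  with CH C0 C1 deriv eqn show ?thesis
    unfolding global_solution_def C1_Hm1_def by (intro conjI exI[of _ U']) auto
qed

text \<open>The \<open>Hm1\<close> derivative is tested with a fixed element of \<open>H10\<close>,
  which leaves a differentiable real function of time; the fundamental theorem of calculus turns the
  equation into its integrated form.\<close>

lemma global_solution_wsol:
  assumes q: "quasi_lipschitz (damping \<alpha>)" and phi: "\<phi> \<in> L2 \<Omega>" and v: "global_solution \<Omega> \<alpha> \<phi> v"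
  shows "wsol \<alpha> (\<lambda>t. emb (v t))" "emb (v 0) = emb \<phi>" "\<And>t. t \<ge> 0 \<Longrightarrow> v t \<in> H10 \<Omega>"
proof -
  obtain U' where C1: "C1_Hm1 \<Omega> (\<lambda>t. Hm1_of \<Omega> (v t)) U'"
    and eqn: "\<And>t w. t \<ge> 0 \<Longrightarrow> w \<in> H10 \<Omega> \<Longrightarrow>
      \<i> * U' t w + laplacian \<Omega> (v t) w + \<i> * Hm1_of \<Omega> (\<lambda>x. damping \<alpha> (v t x)) w = 0"
    using v unfolding global_solution_def by blast
  have CH: "C_H10 \<Omega> v" and AE0: "AE x in lebesgue_on \<Omega>. v 0 x = \<phi> x" using v by (auto simp: global_solution_def)
  show H: "v t \<in> H10 \<Omega>" if "t \<ge> 0" for t using CH that by (simp add: C_H10_def)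
  show "emb (v 0) = emb \<phi>" using emb_eq_iff[OF H10_L2[OF H[OF order_refl]] phi] AE0 by simp
  let ?V = "\<lambda>t. emb (v t)"
  have D: "?V t \<in> D" if "t \<ge> 0" for t by (rule H10_imp(2)[OF H[OF that]])
  have nd: "norm (?V s - ?V t) \<le> H1_norm \<Omega> (\<lambda>x. v s x - v t x)" "norm (gr (?V s) - gr (?V t)) \<le> H1_norm \<Omega> (\<lambda>x. v s x - v t x)"
    if st: "s \<ge> 0" "t \<ge> 0" for s t
  proof -
    have e: "emb (\<lambda>x. v s x - v t x) = ?V s - ?V t" by (rule emb_diff[OF H10_L2[OF H[OF st(1)]] H10_L2[OF H[OF st(2)]]])
    have "(\<lambda>x. v s x - v t x) \<in> H10 \<Omega>"
      by (rule H10_intro[OF L2_diff[OF H10_L2[OF H[OF st(1)]] H10_L2[OF H[OF st(2)]]]]) (simp add: e D_diff D st)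
    from H10_norm[OF this] have "H1_norm \<Omega> (\<lambda>x. v s x - v t x) = Vn (?V s - ?V t)" by (simp add: e)
    then show "norm (?V s - ?V t) \<le> H1_norm \<Omega> (\<lambda>x. v s x - v t x)" "norm (gr (?V s) - gr (?V t)) \<le> H1_norm \<Omega> (\<lambda>x. v s x - v t x)"
      using norm_le_Vn[of "?V s - ?V t"] grad_diff[OF D[OF st(1)] D[OF st(2)]] by auto
  qed
  have lim: "((\<lambda>s. H1_norm \<Omega> (\<lambda>x. v s x - v t x)) \<longlongrightarrow> 0) (at t within {0..})" if "t \<ge> 0" for t
    using CH that by (simp add: C_H10_def)
  have cV: "continuous_on {0..} ?V"
    unfolding continuous_on_def
  proof
    fix t :: real assume "t \<in> {0..}"
    then have t: "t \<ge> 0" by simp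
    show "(?V \<longlongrightarrow> ?V t) (at t within {0..})"
      by (rule LIM_zero_cancel, rule Lim_null_comparison[OF _ lim[OF t]])
        (use eventually_nonneg in eventually_elim, rule nd(1)[OF _ t])
  qed
  have cG: "continuous_on {0..} (\<lambda>t. gr (?V t))"
    unfolding continuous_on_def
  proof
    fix t :: real assume "t \<in> {0..}"
    then have t: "t \<ge> 0" by simp
    show "((\<lambda>t. gr (?V t)) \<longlongrightarrow> gr (?V t)) (at t within {0..})"
      by (rule LIM_zero_cancel, rule Lim_null_comparison[OF _ lim[OF t]])
        (use eventually_nonneg in eventually_elim, rule nd(2)[OF _ t])
  qed
  have weak: "inner (?V t - ?V s) W = integral {s..t} (\<lambda>r. inner (gr (?V r)) (gr (Ii W)) - inner (nem (damping \<alpha>) (?V r)) W)"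
    if W: "W \<in> D" and st: "0 \<le> s" "s \<le> t" for W s t
  proof -
    \<comment> \<open>The conjugate is used because the real part of \<open>cx \<Phi>\<close> at
      \<open>emb w\<close> is \<open>\<Phi>\<close> at \<open>cj (emb w)\<close>, which is then
      \<open>W\<close>.\<close>
    define w where "w = repr (cj W)"
    have w: "w \<in> H10 \<Omega>" unfolding w_def by (rule repr_H10[OF cj_D(1)[OF W]])
    have ew: "cj (emb w) = W" by (simp add: w_def emb_repr[OF cj_D(1)[OF W]] cj_cj)
    have Re0: "Re (Hm1_of \<Omega> (v r) w) = inner (?V r) W" if "r \<ge> 0" for r
      by (simp add: Hm1_of_cx[OF H10_L2[OF H[OF that]] w] cx_def ew)
    have Re1: "Re (U' r w) = inner (gr (?V r)) (gr (Ii W)) - inner (nem (damping \<alpha>) (?V r)) W" if r: "r \<ge> 0" for r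
    proof -
      have "Hm1_of \<Omega> (\<lambda>x. damping \<alpha> (v r x)) w = cx (inner (nem (damping \<alpha>) (?V r))) (emb w)"
        using Hm1_of_cx[OF emb_compose(1)[OF q H10_L2[OF H[OF r]]] w] emb_compose(2)[OF q H10_L2[OF H[OF r]]] by simp
      then show ?thesis using eqn[OF r w] laplacian_cx[OF H[OF r] w] by (simp add: complex_eq_iff cx_def ew)
    qed
    have der: "((\<lambda>r. Re (Hm1_of \<Omega> (v r) w)) has_real_derivative Re (U' r w)) (at r within {0..})" if r: "r \<ge> 0" for r
    proof -
      let ?Q = "\<lambda>y z. (Hm1_of \<Omega> (v y) z - Hm1_of \<Omega> (v r) z) / of_real (y - r) - U' r z"
      have M: "?Q y \<in> Hm1 \<Omega>" if "y \<ge> 0" for y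
        using C1 r that by (intro Hm1_combination) (auto simp: C1_Hm1_def C_Hm1_def)
      have "((\<lambda>y. Hm1_norm \<Omega> (?Q y) * H1_norm \<Omega> w) \<longlongrightarrow> 0 * H1_norm \<Omega> w) (at r within {0..})"
        using C1 r by (intro tendsto_mult tendsto_const) (simp add: C1_Hm1_def)
      then have z: "((\<lambda>y. Hm1_norm \<Omega> (?Q y) * H1_norm \<Omega> w) \<longlongrightarrow> 0) (at r within {0..})" by simp
      have "((\<lambda>y. ?Q y w) \<longlongrightarrow> 0) (at r within {0..})"
        by (rule Lim_null_comparison[OF _ z]) (use eventually_nonneg in eventually_elim, rule Hm1_apply[OF M w])
      then have "((\<lambda>y. Re (?Q y w)) \<longlongrightarrow> Re 0) (at r within {0..})" by (rule tendsto_Re)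
      then have "((\<lambda>y. (Re (Hm1_of \<Omega> (v y) w) - Re (Hm1_of \<Omega> (v r) w)) / (y - r) - Re (U' r w)) \<longlongrightarrow> 0) (at r within {0..})"
        by (simp add: Re_divide_of_real del: of_real_diff)
      then show ?thesis unfolding has_field_derivative_iff by (rule LIM_zero_cancel)
    qed
    have "((\<lambda>r. Re (U' r w)) has_integral (Re (Hm1_of \<Omega> (v t) w) - Re (Hm1_of \<Omega> (v s) w))) {s..t}"
    proof (rule fundamental_theorem_of_calculus[OF st(2)])
      fix r assume r: "r \<in> {s..t}"
      then have "((\<lambda>r. Re (Hm1_of \<Omega> (v r) w)) has_vector_derivative Re (U' r w)) (at r within {0..})"
        using der st by (simp flip: has_real_derivative_iff_has_vector_derivative)
      then show "((\<lambda>r. Re (Hm1_of \<Omega> (v r) w)) has_vector_derivative Re (U' r w)) (at r within {s..t})"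
        by (rule has_vector_derivative_within_subset) (use st in auto)
    qed
    then have "((\<lambda>r. inner (gr (?V r)) (gr (Ii W)) - inner (nem (damping \<alpha>) (?V r)) W) has_integral
        (Re (Hm1_of \<Omega> (v t) w) - Re (Hm1_of \<Omega> (v s) w))) {s..t}"
      by (rule has_integral_eq[rotated]) (use st Re1 in auto)
    then show ?thesis using st by (simp add: integral_unique Re0 inner_diff_left)
  qed
  show "wsol \<alpha> ?V" unfolding wsol_def using D cV cG weak by auto
qed

end

theorem theorem4p1:
  fixes \<Omega> :: "(real ^ 'n) set" and \<alpha> :: real and \<phi> :: "real ^ 'n \<Rightarrow> complex"
  assumes "0 < \<alpha>" and "\<alpha> < 1"
    and "open \<Omega>" and "bounded \<Omega>"
    and "\<phi> \<in> H10 \<Omega>"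
  shows "\<exists>u. global_solution \<Omega> \<alpha> \<phi> u \<and>
    (\<forall>v. global_solution \<Omega> \<alpha> \<phi> v \<longrightarrow> (\<forall>t\<ge>0. AE x in lebesgue_on \<Omega>. v t x = u t x)) \<and>
    (SUP t\<in>{0..}. ereal (H1_norm \<Omega> (u t))) \<le> ereal (H1_norm \<Omega> \<phi>)"
proof -
  interpret sobolev_domain \<Omega> using assms(3,4) by unfold_locales
  note q = quasi_lipschitz_damping[OF assms(1,2)]
  note phi = H10_imp(2)[OF assms(5)] and phiL = H10_L2[OF assms(5)]
  obtain gn c cb c1 c2 where "damped_form D gr Ii (nem (damping \<alpha>)) (nem (damping (\<alpha>/2))) gn c cb c1 c2"
    using damped_form_damping[OF assms(1,2)] by blast
  then interpret F: damped_form D gr Ii "nem (damping \<alpha>)" "nem (damping (\<alpha>/2))" gn c cb c1 c2 .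
  \<comment> \<open>With the concrete \<open>grad\<close>, \<open>I\<close> and \<open>g\<close> the
    two notions coincide literally.\<close>
  have ws: "F.weak_solution u \<longleftrightarrow> wsol \<alpha> u" for u by (simp add: F.weak_solution_def wsol_def)
  obtain u where u: "F.weak_solution u" "u 0 = emb \<phi>"
    "\<And>t. t \<ge> 0 \<Longrightarrow> norm (u t) \<le> norm (emb \<phi>)" "\<And>t. t \<ge> 0 \<Longrightarrow> norm (gr (u t)) \<le> norm (gr (emb \<phi>))"
    using F.weak_solution_exists[OF phi] by metis
  have uw: "wsol \<alpha> u" using u(1) ws by simp
  have uD: "u t \<in> D" if "t \<ge> 0" for t using uw that by (simp add: wsol_def)
  show ?thesis
  proof (intro exI[of _ "\<lambda>t. repr (u t)"] conjI allI impI)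
    show "global_solution \<Omega> \<alpha> \<phi> (\<lambda>t. repr (u t))" by (rule wsol_global_solution[OF q uw phiL u(2)])
    fix v t assume v: "global_solution \<Omega> \<alpha> \<phi> v" and t: "(0::real) \<le> t"
    note V = global_solution_wsol[OF q phiL v]
    have "emb (v t) = u t"
      \<comment> \<open>Any competing solution is turned into an abstract weak solution first;
        equality of classes then means equality almost everywhere on
        \<open>\<Omega>\<close>.\<close>
      by (rule F.weak_solution_unique[of "\<lambda>t. emb (v t)" u]) (use V u ws t in auto)
    then have "emb (v t) = emb (repr (u t))" by (simp add: emb_repr[OF uD[OF t]])
    then show "AE x in lebesgue_on \<Omega>. v t x = repr (u t) x"
      using emb_eq_iff[OF H10_L2[OF V(3)[OF t]] repr_L2] by simp
  next
    show "(SUP t\<in>{0..}. ereal (H1_norm \<Omega> (repr (u t)))) \<le> ereal (H1_norm \<Omega> \<phi>)"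
    proof (rule SUP_least)
      fix t :: real assume "t \<in> {0..}"
      then have t: "t \<ge> 0" by simp
      \<comment> \<open>The L2 norm and the gradient norm are each bounded by their initial values,
        so the full \<open>H1\<close> norm is as well.\<close>
      have "Vn (u t) \<le> Vn (emb \<phi>)"
        unfolding Vn_def using u(3,4)[OF t] by (intro real_sqrt_le_mono add_mono power_mono) auto
      then show "ereal (H1_norm \<Omega> (repr (u t))) \<le> ereal (H1_norm \<Omega> \<phi>)"
        using H10_norm[OF repr_H10[OF uD[OF t]]] H10_norm[OF assms(5)] by (simp add: emb_repr[OF uD[OF t]])
    qed
  qed
qed

end
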